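(* Let $H$ be a finite group, let $\tau\in\mathrm{Aut}(H)$ with $\tau^2=1$, and let $n\ge 1$. Suppose $\{\lambda_i: H_i\to\mathbb{C}\}_{i=1}^m$ is a generalized involution model for $H$ with respect to $\tau$, so that there exists a set $\{\varepsilon_i\}_{i=1}^m$ of orbit representatives in $\mathcal{I}_{H,\tau}$ with $H_i=C_{H,\tau}(\varepsilon_i)$. For each $x=(x_0,x_1,\dots,x_m)\in\mathscr{U}_m(n)$ define $$\varepsilon_x=\Bigl((\underbrace{1,\dots,1}_{2x_0\text{ times}},\underbrace{\varepsilon_1,\dots,\varepsilon_1}_{x_1\text{ times}},\dots,\underbrace{\varepsilon_m,\dots,\varepsilon_m}_{x_m\text{ times}}),\ \omega_{x_0}\Bigr)\in G_n = H\wr S_n .$$ If $\tau$ is extended to an automorphism of $G_n$ by ${}^\tau(h,\pi)=({}^\tau h,\pi)$, where ${}^\tau(h_1,\dots,h_n)=({}^\tau h_1,\dots,{}^\tau h_n)$, then the linear characters $\{\phi_x^\tau:G_x^\tau\to\mathbb{C}\}_{x\in\mathscr{U}_m(n)}$ form a generalized involution model for $G_n=H\wr S_n$ with respect to $\tau$. (In particular, if a finite group $H$ has a generalized involution model, then so does $H\wr S_n$ for all $n\ge1$.)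
   Context: All groups are finite; a linear character is a complex character of degree one. A model for a group $G$ is a set $\{\lambda_i:H_i\to\mathbb{C}\}$ of linear characters of subgroups $H_i\subset G$ such that $\sum_i\mathrm{Ind}_{H_i}^G(\lambda_i)$ is the multiplicity-free sum of all irreducible characters of $G$. For $\tau\in\mathrm{Aut}(G)$ with $\tau^2=1$ write ${}^\tau g=\tau(g)$, ${}^\tau g^{-1}=\tau(g)^{-1}$ and $\mathcal{I}_{G,\tau}=\{\omega\in G:\omega\cdot{}^\tau\omega=1\}$. The group $G$ acts on $\mathcal{I}_{G,\tau}$ by twisted conjugation $g:\omega\mapsto g\cdot\omega\cdot{}^\tau g^{-1}$; orbits in $\mathcal{I}_{G,\tau}$ refer to this action, and $C_{G,\tau}(\omega)=\{g\in G:g\cdot\omega\cdot{}^\tau g^{-1}=\omega\}$ is the twisted centralizer. A generalized involution model for $G$ with respect to $\tau$ is a model $\mathcal{M}$ for which there is an injective map $\iota:\mathcal{M}\to\mathcal{I}_{G,\tau}$ such that (a) each $\lambda\in\mathcal{M}$ is a linear character of $C_{G,\tau}(\iota(\lambda))$, and (b) the image of $\iota$ contains exactly one element of each orbit in $\mathcal{I}_{G,\tau}$. A group has a generalized involution model if it has one with respect to some $\tau$ with $\tau^2=1$. Wreath products. $G_n=H\wr S_n$ is the set of pairs $(h,\pi)$, $h\in H^n$, $\pi\in S_n$, with product $(h,\pi)(k,\sigma)=(\sigma^{-1}(h)\cdot k,\pi\sigma)$, where $\pi(h)=(h_{\pi^{-1}(1)},\dots,h_{\pi^{-1}(n)})$.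 $G_a\times G_b\times\cdots$ is embedded in $G_{a+b+\cdots}$ blockwise on consecutive coordinates; $G_0$ is trivial. $\omega_k=(1\ 2)(3\ 4)\cdots(2k-1\ 2k)\in S_{2k}$, with $\omega_0=1$ (also viewed in $S_n$ for $n\ge 2k$). $W_k=C_{S_{2k}}(\omega_k)$, and $$V_k^\tau=\{(h,\pi)\in G_{2k}: \pi\in W_k,\ h=(h_1,{}^\tau h_1,h_2,{}^\tau h_2,\dots,h_k,{}^\tau h_k),\ h_i\in H\}.$$ $\sigma_k^\tau:V_k^\tau\to\{\pm1\}$ is the linear character $\sigma_k^\tau(h,\pi)=\mathrm{sgn}(\pi)$. $\mathscr{U}_m(n)$ is the set of vectors $x=(x_0,x_1,\dots,x_m)$ of nonnegative integers with $2x_0+\sum_{i=1}^m x_i=n$. For $x\in\mathscr{U}_m(n)$, $$G_x^\tau=V_{x_0}^\tau\times\prod_{i=1}^m(H_i\wr S_{x_i})\subset G_n,\qquad \phi_x^\tau=\sigma_{x_0}^\tau\odot\bigodot_{i=1}^m\lambda_i\wr(x_i),$$ where $\odot$ is the external tensor product, $\lambda_i\wr(x_i)$ is the linear character of $H_i\wr S_{x_i}$ given by $(h,\pi)\mapsto\prod_{j=1}^{x_i}\lambda_i(h_j)$, and factors with $x_i=0$ are ignored. *)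

theory Defs
  imports
    "HOL-Algebra.Group_Action"
    "HOL-Algebra.Sym_Groups"
    "HOL-Algebra.Product_Groups"
    "Jordan_Normal_Form.VS_Connect"
begin

section \<open>Complex characters of finite groups\<close>

definition representation :: "('a, 'b) monoid_scheme \<Rightarrow> nat \<Rightarrow> ('a \<Rightarrow> complex mat) \<Rightarrow> bool" where
  "representation G d \<rho> \<longleftrightarrow>
     (\<forall>g\<in>carrier G. \<rho> g \<in> carrier_mat d d) \<and>
     \<rho> \<one>\<^bsub>G\<^esub> = 1\<^sub>m d \<and>
     (\<forall>g\<in>carrier G. \<forall>h\<in>carrier G. \<rho> (g \<otimes>\<^bsub>G\<^esub> h) = \<rho> g * \<rho> h)"

definition irreducible_representation ::
  "('a, 'b) monoid_scheme \<Rightarrow> nat \<Rightarrow> ('a \<Rightarrow> complex mat) \<Rightarrow> bool" where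
  "irreducible_representation G d \<rho> \<longleftrightarrow>
     representation G d \<rho> \<and> d > 0 \<and>
     (\<forall>W. VectorSpace.subspace class_ring W (module_vec TYPE(complex) d) \<and>
          (\<forall>g\<in>carrier G. \<forall>v\<in>W. \<rho> g *\<^sub>v v \<in> W)
        \<longrightarrow> W = {0\<^sub>v d} \<or> W = carrier_vec d)"

definition mat_trace :: "complex mat \<Rightarrow> complex" where
  "mat_trace A = (\<Sum>i<dim_row A. A $$ (i, i))"

text \<open>Functions on a group are taken to be \<^const>\<open>undefined\<close> off the carrier
  (\<^const>\<open>extensional\<close>), so that two characters of \<open>G\<close> are equal in HOL iff they agree on \<open>G\<close>.\<close>

definition character_of :: "('a, 'b) monoid_scheme \<Rightarrow> ('a \<Rightarrow> complex mat) \<Rightarrow> 'a \<Rightarrow> complex" where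
  "character_of G \<rho> = (\<lambda>g\<in>carrier G. mat_trace (\<rho> g))"

definition irreducible_characters :: "('a, 'b) monoid_scheme \<Rightarrow> ('a \<Rightarrow> complex) set" where
  "irreducible_characters G =
     {character_of G \<rho> | \<rho>. \<exists>d. irreducible_representation G d \<rho>}"

definition linear_character :: "('a, 'b) monoid_scheme \<Rightarrow> ('a \<Rightarrow> complex) \<Rightarrow> bool" where
  "linear_character G lam \<longleftrightarrow> (\<exists>\<rho>. representation G 1 \<rho> \<and> lam = character_of G \<rho>)"

definition induced_character ::
  "('a, 'b) monoid_scheme \<Rightarrow> 'a set \<Rightarrow> ('a \<Rightarrow> complex) \<Rightarrow> 'a \<Rightarrow> complex" where
  "induced_character G K lam = (\<lambda>g\<in>carrier G.
     (\<Sum>x\<in>carrier G.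
        if x \<otimes>\<^bsub>G\<^esub> g \<otimes>\<^bsub>G\<^esub> inv\<^bsub>G\<^esub> x \<in> K then lam (x \<otimes>\<^bsub>G\<^esub> g \<otimes>\<^bsub>G\<^esub> inv\<^bsub>G\<^esub> x) else 0)
     / of_nat (card K))"


section \<open>Models and generalized involution models\<close>

text \<open>A linear character \<open>\<lambda> : K \<rightarrow> \<complex>\<close> of a subgroup \<open>K\<close> is encoded as the pair \<open>(K, \<lambda>)\<close>.\<close>

definition model :: "('a, 'b) monoid_scheme \<Rightarrow> ('a set \<times> ('a \<Rightarrow> complex)) set \<Rightarrow> bool" where
  "model G M \<longleftrightarrow>
     finite M \<and>
     (\<forall>(K, lam)\<in>M. subgroup K G \<and> linear_character (G\<lparr>carrier := K\<rparr>) lam) \<and>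
     (\<forall>g\<in>carrier G.
        (\<Sum>(K, lam)\<in>M. induced_character G K lam g) = (\<Sum>\<chi>\<in>irreducible_characters G. \<chi> g))"

definition involutive_automorphism :: "('a, 'b) monoid_scheme \<Rightarrow> ('a \<Rightarrow> 'a) \<Rightarrow> bool" where
  "involutive_automorphism G \<tau> \<longleftrightarrow> \<tau> \<in> iso G G \<and> (\<forall>g\<in>carrier G. \<tau> (\<tau> g) = g)"

definition twisted_involutions :: "('a, 'b) monoid_scheme \<Rightarrow> ('a \<Rightarrow> 'a) \<Rightarrow> 'a set" where
  "twisted_involutions G \<tau> = {\<omega> \<in> carrier G. \<omega> \<otimes>\<^bsub>G\<^esub> \<tau> \<omega> = \<one>\<^bsub>G\<^esub>}"

definition twisted_conj :: "('a, 'b) monoid_scheme \<Rightarrow> ('a \<Rightarrow> 'a) \<Rightarrow> 'a \<Rightarrow> 'a \<Rightarrow> 'a" where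
  "twisted_conj G \<tau> g \<omega> = g \<otimes>\<^bsub>G\<^esub> \<omega> \<otimes>\<^bsub>G\<^esub> inv\<^bsub>G\<^esub> (\<tau> g)"

abbreviation twisted_centralizer ::
  "('a, 'b) monoid_scheme \<Rightarrow> ('a \<Rightarrow> 'a) \<Rightarrow> 'a \<Rightarrow> 'a set" where
  "twisted_centralizer G \<tau> \<omega> \<equiv> stabilizer G (twisted_conj G \<tau>) \<omega>"

definition orbit_representatives ::
  "('a, 'b) monoid_scheme \<Rightarrow> ('a \<Rightarrow> 'a) \<Rightarrow> 'a set \<Rightarrow> bool" where
  "orbit_representatives G \<tau> R \<longleftrightarrow>
     R \<subseteq> twisted_involutions G \<tau> \<and>
     (\<forall>Orb\<in>orbits G (twisted_involutions G \<tau>) (twisted_conj G \<tau>). \<exists>!\<omega>. \<omega> \<in> R \<inter> Orb)"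

definition generalized_involution_model ::
  "('a, 'b) monoid_scheme \<Rightarrow> ('a \<Rightarrow> 'a) \<Rightarrow> ('a set \<times> ('a \<Rightarrow> complex)) set \<Rightarrow> bool" where
  "generalized_involution_model G \<tau> M \<longleftrightarrow>
     involutive_automorphism G \<tau> \<and> model G M \<and>
     (\<exists>\<iota>. inj_on \<iota> M \<and>
          (\<forall>(K, lam)\<in>M. K = twisted_centralizer G \<tau> (\<iota> (K, lam))) \<and>
          orbit_representatives G \<tau> (\<iota> ` M))"

definition has_generalized_involution_model :: "('a, 'b) monoid_scheme \<Rightarrow> bool" where
  "has_generalized_involution_model G \<longleftrightarrow> (\<exists>\<tau> M. generalized_involution_model G \<tau> M)"


section \<open>Wreath products\<close>

text \<open>An element of \<open>H \<wr> S\<^sub>n\<close> is a pair \<open>(h, \<pi>)\<close> with \<open>h\<close> an (extensional) function on \<open>{1..n}\<close>.\<close>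

type_synonym 'a wr = "(nat \<Rightarrow> 'a) \<times> (nat \<Rightarrow> nat)"

definition perm_act :: "nat \<Rightarrow> (nat \<Rightarrow> nat) \<Rightarrow> (nat \<Rightarrow> 'a) \<Rightarrow> nat \<Rightarrow> 'a" where
  "perm_act n \<pi> h = (\<lambda>i\<in>{1..n}. h (inv_into UNIV \<pi> i))"

definition wreath :: "('a, 'b) monoid_scheme \<Rightarrow> nat \<Rightarrow> 'a wr monoid" where
  "wreath H n =
     \<lparr>carrier = carrier (product_group {1..n} (\<lambda>_. H)) \<times> carrier (sym_group n),
      monoid.mult = (\<lambda>(h, \<pi>) (k, \<sigma>).
        (perm_act n (inv_into UNIV \<sigma>) h \<otimes>\<^bsub>product_group {1..n} (\<lambda>_. H)\<^esub> k,
         \<pi> \<otimes>\<^bsub>sym_group n\<^esub> \<sigma>)),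
      one = (\<one>\<^bsub>product_group {1..n} (\<lambda>_. H)\<^esub>, \<one>\<^bsub>sym_group n\<^esub>)\<rparr>"

definition wreath_aut :: "('a \<Rightarrow> 'a) \<Rightarrow> nat \<Rightarrow> 'a wr \<Rightarrow> 'a wr" where
  "wreath_aut \<tau> n = (\<lambda>(h, \<pi>). (\<lambda>i\<in>{1..n}. \<tau> (h i), \<pi>))"

text \<open>Blocks of sizes \<open>a 0, a 1, a 2, \<dots>\<close> are laid out consecutively on \<open>{1, 2, \<dots>}\<close>; block \<open>i\<close>
  occupies the positions \<open>block_offset a i + j\<close> with \<open>1 \<le> j \<le> a i\<close>.  The block containing a
  position \<open>p\<close> is the least \<open>i\<close> for which \<open>p\<close> does not exceed the right end of block \<open>i\<close>; empty
  blocks are thereby skipped.\<close>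

definition block_offset :: "(nat \<Rightarrow> nat) \<Rightarrow> nat \<Rightarrow> nat" where
  "block_offset a i = (\<Sum>j<i. a j)"

definition block_index :: "(nat \<Rightarrow> nat) \<Rightarrow> nat \<Rightarrow> nat" where
  "block_index a p = (LEAST i. p \<le> block_offset a (Suc i))"

text \<open>The embedding \<open>G\<^bsub>a 0\<^esub> \<times> \<dots> \<times> G\<^bsub>a m\<^esub> \<rightarrow> G\<^sub>n\<close> with \<open>n = a 0 + \<dots> + a m\<close>, where tuples
  \<open>(u 0, \<dots>, u m)\<close> are functions on \<open>{0..m}\<close>.\<close>

definition block_embed :: "nat \<Rightarrow> (nat \<Rightarrow> nat) \<Rightarrow> (nat \<Rightarrow> 'a wr) \<Rightarrow> 'a wr" where
  "block_embed n a u =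
     (\<lambda>p\<in>{1..n}. fst (u (block_index a p)) (p - block_offset a (block_index a p)),
      \<lambda>p. if p \<in> {1..n}
          then block_offset a (block_index a p)
               + snd (u (block_index a p)) (p - block_offset a (block_index a p))
          else p)"


section \<open>The subgroups \<open>G\<^sub>x\<close>, the characters \<open>\<phi>\<^sub>x\<close> and the elements \<open>\<epsilon>\<^sub>x\<close>\<close>

primrec omega :: "nat \<Rightarrow> nat \<Rightarrow> nat" where
  "omega 0 = id"
| "omega (Suc k) = omega k \<circ> transpose (2 * k + 1) (2 * k + 2)"

definition W_grp :: "nat \<Rightarrow> (nat \<Rightarrow> nat) set" where
  "W_grp k = {\<pi> \<in> carrier (sym_group (2 * k)).
     \<pi> \<otimes>\<^bsub>sym_group (2 * k)\<^esub> omega k = omega k \<otimes>\<^bsub>sym_group (2 * k)\<^esub> \<pi>}"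

definition V_grp :: "('a, 'b) monoid_scheme \<Rightarrow> ('a \<Rightarrow> 'a) \<Rightarrow> nat \<Rightarrow> 'a wr set" where
  "V_grp H \<tau> k = {(h, \<pi>) \<in> carrier (wreath H (2 * k)).
     \<pi> \<in> W_grp k \<and> (\<forall>i\<in>{1..k}. h (2 * i) = \<tau> (h (2 * i - 1)))}"

definition sigma_char :: "'a wr \<Rightarrow> complex" where
  "sigma_char = (\<lambda>(h, \<pi>). of_int (sign \<pi>))"

definition wreath_char :: "nat \<Rightarrow> ('a \<Rightarrow> complex) \<Rightarrow> 'a wr \<Rightarrow> complex" where
  "wreath_char k lam = (\<lambda>(h, \<pi>). \<Prod>j=1..k. lam (h j))"

definition U_set :: "nat \<Rightarrow> nat \<Rightarrow> (nat \<Rightarrow> nat) set" where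
  "U_set m n = {x \<in> {0..m} \<rightarrow>\<^sub>E UNIV. 2 * x 0 + (\<Sum>i=1..m. x i) = n}"

definition block_sizes :: "(nat \<Rightarrow> nat) \<Rightarrow> nat \<Rightarrow> nat" where
  "block_sizes x i = (if i = 0 then 2 * x 0 else x i)"

definition G_x_tuples ::
  "('a, 'b) monoid_scheme \<Rightarrow> ('a \<Rightarrow> 'a) \<Rightarrow> nat \<Rightarrow> (nat \<Rightarrow> 'a set) \<Rightarrow> (nat \<Rightarrow> nat)
    \<Rightarrow> (nat \<Rightarrow> 'a wr) set" where
  "G_x_tuples H \<tau> m K x =
     (\<Pi>\<^sub>E i\<in>{0..m}. if i = 0 then V_grp H \<tau> (x 0)
                  else carrier (wreath (H\<lparr>carrier := K i\<rparr>) (x i)))"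

definition G_x ::
  "('a, 'b) monoid_scheme \<Rightarrow> ('a \<Rightarrow> 'a) \<Rightarrow> nat \<Rightarrow> nat \<Rightarrow> (nat \<Rightarrow> 'a set) \<Rightarrow> (nat \<Rightarrow> nat)
    \<Rightarrow> 'a wr set" where
  "G_x H \<tau> n m K x = block_embed n (block_sizes x) ` G_x_tuples H \<tau> m K x"

text \<open>The external tensor product: \<open>\<phi>\<^sub>x\<close> evaluates each factor on the corresponding component of
  the unique tuple whose block embedding is the given element.\<close>

definition phi_x ::
  "('a, 'b) monoid_scheme \<Rightarrow> ('a \<Rightarrow> 'a) \<Rightarrow> nat \<Rightarrow> nat \<Rightarrow> (nat \<Rightarrow> 'a set) \<Rightarrow> (nat \<Rightarrow> 'a \<Rightarrow> complex)
    \<Rightarrow> (nat \<Rightarrow> nat) \<Rightarrow> 'a wr \<Rightarrow> complex" where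
  "phi_x H \<tau> n m K lam x = (\<lambda>g\<in>G_x H \<tau> n m K x.
     let u = inv_into (G_x_tuples H \<tau> m K x) (block_embed n (block_sizes x)) g
     in sigma_char (u 0) * (\<Prod>i=1..m. wreath_char (x i) (lam i) (u i)))"

definition eps_x ::
  "('a, 'b) monoid_scheme \<Rightarrow> nat \<Rightarrow> (nat \<Rightarrow> 'a) \<Rightarrow> (nat \<Rightarrow> nat) \<Rightarrow> 'a wr" where
  "eps_x H n \<epsilon> x =
     (\<lambda>p\<in>{1..n}. let i = block_index (block_sizes x) p in if i = 0 then \<one>\<^bsub>H\<^esub> else \<epsilon> i,
      omega (x 0))"

end

theory Submission
  imports Defs "Jordan_Normal_Form.Spectral_Radius"
begin

text \<open>
The proof replaces the comparison of two decompositions into irreducibles by a count.  For a finite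
  group \<open>G\<close> with an automorphism \<open>\<tau>\<close> of order at most two put
  \<open>r g = card {y. y \<otimes> \<tau> y = g}\<close>.  By Fourier expansion \<open>r = (\<Sum>\<chi>. c \<chi> * \<chi>)\<close>, where \<open>c \<chi>\<close> is the twisted
  Frobenius-Schur indicator; it is \<open>1\<close> or \<open>-1\<close> if \<open>\<chi>\<close> is invariant under \<open>g \<mapsto> inv (\<tau> g)\<close>, and \<open>0\<close>
  otherwise (lemma \<open>frobenius_schur_value\<close>).

  For a generalized involution model the induced degrees add up to the number of twisted
  involutions, which is \<open>r \<one>\<close>.  As irreducible degrees are positive, every \<open>c \<chi>\<close> must then be \<open>1\<close>.  So the model of
  \<open>H\<close> says that its induced characters sum to \<open>r\<close>, and moreover that every \<open>g\<close> is conjugate to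
  \<open>inv (\<tau> g)\<close>, because no irreducible character separates the two (\<open>square_roots_if_model\<close>).  Conversely, if every
  \<open>g\<close> is conjugate to \<open>inv (\<tau> g)\<close>, then all indicators are signs; if furthermore \<open>r\<close> is a sum of
  induced linear characters, the signs are multiplicities, hence all equal to \<open>1\<close>, and these linear
  characters form a model (\<open>model_if_induced_sum_counts_square_roots\<close>).

  Both conditions pass from \<open>H\<close> to the wreath product.  Conjugacy of \<open>g\<close> with \<open>inv (\<tau> g)\<close> is seen
  from the cycle products of \<open>g\<close> (\<open>twisted_inverse_conjugate\<close>).  For the count, the linear characters of
  the model of \<open>H\<close> are spread out to a function \<open>L w' h w\<close> of all \<open>h\<close> that carry a twisted involution \<open>w\<close>
  to \<open>w'\<close> (\<open>twisted_cocycle\<close>).  The characters of the wreath product are then the restrictions of a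
  single weight: the weight of \<open>g\<close> at a twisted involution \<open>\<omega>\<close> fixed by \<open>g\<close> is the sign of \<open>g\<close> on the
  positions moved by \<open>\<omega>\<close>, times the product of the values of \<open>L\<close> over the positions fixed by \<open>\<omega>\<close>.
  Summing induced characters over the orbit representatives amounts to summing this weight over all \<open>\<omega>\<close> fixed by
  \<open>g\<close> (\<open>sum_induced_eq_sum_fixed\<close>), and it remains to see that the sum is the number of twisted square roots of \<open>g\<close>
  (\<open>sum_weight_fixing\<close>).

  That identity is proved cycle by cycle.  A twisted involution fixed by \<open>g\<close>, or a square root of \<open>g\<close>, commutes with \<open>g\<close> on
  positions, so it preserves a given cycle of \<open>g\<close> or exchanges it with another one.  Two exchanged
  cycles have equal length, so the sign is \<open>1\<close>, and multiplication by one half of \<open>g\<close> matches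
  involutions with square roots (\<open>swapped_halves\<close>).  On a single cycle with cycle product \<open>c\<close>
  (\<open>single_cycle\<close>) the diagonal involutions contribute the number of square roots of \<open>c\<close> in \<open>H\<close>.  If the length
  is odd there are no others, and the square roots of \<open>g\<close> correspond to those of \<open>c\<close>.  If the length is even
  there are no square roots at all; the involutions that rotate the cycle by half its length have
  weight \<open>-1\<close>, and as many of them exist as there are square roots of \<open>c\<close>, so they cancel the diagonal ones.

  What is left is to recognize \<open>G_x\<close> as the twisted centralizer of \<open>eps_x\<close> and \<open>phi_x\<close> as the weight
  there (\<open>G_x_eq\<close>, \<open>phi_x_eq\<close>), and to see that the \<open>eps_x\<close> represent the orbits: the block sizes
  count the positions of each kind (\<open>eps_x_unique\<close>, \<open>eps_x_exists\<close>).
\<close>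

section \<open>Frames of subspaces\<close>

lemma mat_trace_mult_comm:
  assumes "A \<in> carrier_mat n m" "B \<in> carrier_mat m n"
  shows "mat_trace (A * B) = mat_trace (B * A)"
proof -
  have "mat_trace (A * B) = (\<Sum>i<n. \<Sum>j<m. A $$ (i,j) * B $$ (j,i))"
    using assms by (auto simp: mat_trace_def scalar_prod_def lessThan_atLeast0 intro!: sum.cong)
  also have "\<dots> = (\<Sum>j<m. \<Sum>i<n. A $$ (i,j) * B $$ (j,i))"
    by (rule sum.swap)
  also have "\<dots> = mat_trace (B * A)"
    using assms by (auto simp: mat_trace_def scalar_prod_def lessThan_atLeast0 mult.commute intro!: sum.cong)
  finally show ?thesis .
qed

lemma mat_trace_add:
  assumes "A \<in> carrier_mat n n" "B \<in> carrier_mat n n"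
  shows "mat_trace (A + B) = mat_trace A + mat_trace B"
  using assms by (simp add: mat_trace_def sum.distrib)

lemma mat_trace_one [simp]: "mat_trace (1\<^sub>m n) = of_nat n"
  by (simp add: mat_trace_def)

lemma subspace_vec_iff:
  "VectorSpace.subspace class_ring W (module_vec TYPE(complex) d) \<longleftrightarrow>
     W \<subseteq> carrier_vec d \<and> 0\<^sub>v d \<in> W \<and> (\<forall>v\<in>W. \<forall>w\<in>W. v + w \<in> W) \<and> (\<forall>c. \<forall>v\<in>W. c \<cdot>\<^sub>v v \<in> W)"
  (is "?L \<longleftrightarrow> ?R")
proof
  assume ?L
  then have "LinearCombinations.submodule class_ring W (module_vec TYPE(complex) d)"
    by (simp add: VectorSpace.subspace_def LinearCombinations.submodule_def)
  then show ?R
    by (auto simp: LinearCombinations.submodule_def module_vec_simps class_ring_simps)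
next
  assume ?R
  then show ?L
    by (auto simp: VectorSpace.subspace_def LinearCombinations.submodule_def module_vec_simps class_ring_simps vec_vs vec_module)
qed

text \<open>The rows of \<open>B\<close> show that the \<open>k\<close> columns of \<open>A\<close> are independent vectors in a space of dimension \<open>d\<close>.\<close>
lemma left_inverse_dim_le:
  assumes A: "A \<in> carrier_mat d k" and B: "(B :: complex mat) \<in> carrier_mat k d" and BA: "B * A = 1\<^sub>m k"
  shows "k \<le> d"
proof (rule ccontr)
  assume "\<not> k \<le> d"
  then have dk: "d < k" by simp
  define A' where "A' = mat k k (\<lambda>(i,j). if i < d then A $$ (i,j) else 0)"
  define B' where "B' = mat k k (\<lambda>(i,j). if j < d then B $$ (i,j) else 0)"
  have "B' * A' = B * A"
  proof (rule eq_matI)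
    fix i j assume "i < dim_row (B * A)" "j < dim_col (B * A)"
    then have ij: "i < k" "j < k" using A B by auto
    have "{0..<k} = {0..<d} \<union> {d..<k}" using dk by auto
    then have "(B' * A') $$ (i,j) = (\<Sum>l\<in>{0..<d} \<union> {d..<k}. B' $$ (i,l) * A' $$ (l,j))"
      using ij dk by (auto simp: scalar_prod_def A'_def B'_def intro!: sum.cong)
    also have "\<dots> = (\<Sum>l=0..<d. B' $$ (i,l) * A' $$ (l,j)) + (\<Sum>l=d..<k. B' $$ (i,l) * A' $$ (l,j))"
      by (rule sum.union_disjoint) auto
    also have "\<dots> = (\<Sum>l=0..<d. B $$ (i,l) * A $$ (l,j))"
      using ij dk by (simp add: A'_def B'_def)
    also have "\<dots> = (B * A) $$ (i,j)"
      using ij A B by (simp add: scalar_prod_def)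
    finally show "(B' * A') $$ (i,j) = (B * A) $$ (i,j)" .
  qed (use A B in \<open>auto simp: A'_def B'_def\<close>)
  then have "B' * A' = 1\<^sub>m k" using BA by simp
  then have "A' * B' = 1\<^sub>m k"
    by (rule mat_mult_left_right_inverse[rotated 2]) (auto simp: A'_def B'_def)
  then have "(A' * B') $$ (d,d) = 1" using dk by simp
  moreover have "(A' * B') $$ (d,d) = 0"
    using dk by (simp add: A'_def B'_def scalar_prod_def)
  ultimately show False by simp
qed

text \<open>A frame of \<open>W\<close> is a matrix \<open>A\<close> whose columns lie in \<open>W\<close>, together with a left inverse \<open>B\<close>; then \<open>A * B\<close> is a projection
  onto the column space. If it does not reproduce some \<open>w\<close> in \<open>W\<close>, then the defect \<open>w - A *\<^sub>v (B *\<^sub>v w)\<close> is killed by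
  \<open>B\<close> and can be added as a further column.\<close>
lemma subspace_frame_extend:
  fixes A B :: "complex mat"
  assumes A: "A \<in> carrier_mat d k" and B: "B \<in> carrier_mat k d" and BA: "B * A = 1\<^sub>m k"
    and W: "VectorSpace.subspace class_ring W (module_vec TYPE(complex) d)"
    and AW: "\<And>v. v \<in> carrier_vec k \<Longrightarrow> A *\<^sub>v v \<in> W"
    and w: "w \<in> W" "A *\<^sub>v (B *\<^sub>v w) \<noteq> w"
  shows "\<exists>A B. A \<in> carrier_mat d (Suc k) \<and> B \<in> carrier_mat (Suc k) d \<and> B * A = 1\<^sub>m (Suc k)
           \<and> (\<forall>v\<in>carrier_vec (Suc k). A *\<^sub>v v \<in> W)"
proof -
  note W' = W[unfolded subspace_vec_iff]
  have wc: "w \<in> carrier_vec d" using w W' by auto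
  define u where "u = w - A *\<^sub>v (B *\<^sub>v w)"
  have uc: "u \<in> carrier_vec d" using wc A B by (simp add: u_def)
  have uW: "u \<in> W"
  proof -
    have "A *\<^sub>v (B *\<^sub>v w) \<in> W" using AW B wc by simp
    moreover have "u = w + (-1) \<cdot>\<^sub>v (A *\<^sub>v (B *\<^sub>v w))"
      unfolding u_def using wc A B by (intro eq_vecI) auto
    ultimately show ?thesis using W' w by simp
  qed
  have Bu: "B *\<^sub>v u = 0\<^sub>v k"
  proof -
    have "B *\<^sub>v u = B *\<^sub>v w - B *\<^sub>v (A *\<^sub>v (B *\<^sub>v w))"
      unfolding u_def using wc A B by (subst mult_minus_distrib_mat_vec[of _ k d]) auto
    also have "B *\<^sub>v (A *\<^sub>v (B *\<^sub>v w)) = (B * A) *\<^sub>v (B *\<^sub>v w)"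
      using wc A B by (subst assoc_mult_mat_vec[of _ k d _ k]) auto
    finally show ?thesis using wc B BA by simp
  qed
  have "u \<noteq> 0\<^sub>v d"
  proof
    assume u0: "u = 0\<^sub>v d"
    have "A *\<^sub>v (B *\<^sub>v w) = w"
    proof (rule eq_vecI)
      fix i assume "i < dim_vec w"
      then have "i < d" using wc by simp
      then have "u $ i = 0" using u0 by simp
      then show "(A *\<^sub>v (B *\<^sub>v w)) $ i = w $ i" using \<open>i < d\<close> wc A B unfolding u_def by simp
    qed (use A wc in auto)
    then show False using w by simp
  qed
  then obtain p where p: "p < d" "u $ p \<noteq> 0"
    using uc by (metis carrier_vecD eq_vecI index_zero_vec)
  \<comment> \<open>\<open>b\<close> is the new row of the left inverse: it kills the old columns and sends \<open>u\<close> to \<open>1\<close>.\<close>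
  define b where "b j = ((1\<^sub>m d - A * B) $$ (p, j)) / u $ p" for j
  have bA: "(\<Sum>l<d. b l * A $$ (l, j)) = 0" if j: "j < k" for j
  proof -
    have "(\<Sum>l<d. b l * A $$ (l, j)) = ((1\<^sub>m d - A * B) * A) $$ (p, j) / u $ p"
      using j p A B by (simp add: b_def scalar_prod_def sum_divide_distrib lessThan_atLeast0 algebra_simps)
    also have "(1\<^sub>m d - A * B) * A = A - A * (B * A)"
      using A B by (subst minus_mult_distrib_mat[of _ d d]) (auto simp: assoc_mult_mat[of _ d k _ d _ k])
    also have "\<dots> = 0\<^sub>m d k" using A BA by simp
    finally show ?thesis using j p by simp
  qed
  have bu: "(\<Sum>l<d. b l * u $ l) = 1"
  proof -
    have "(\<Sum>l<d. b l * u $ l) = ((1\<^sub>m d - A * B) *\<^sub>v u) $ p / u $ p"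
      using p A B uc by (simp add: b_def scalar_prod_def sum_divide_distrib lessThan_atLeast0 algebra_simps)
    also have "(1\<^sub>m d - A * B) *\<^sub>v u = u - A *\<^sub>v (B *\<^sub>v u)"
      using A B uc by (subst minus_mult_distrib_mat_vec[of _ d d]) (auto simp: assoc_mult_mat_vec[of _ d k _ d])
    also have "\<dots> = u" unfolding Bu using A uc by (intro eq_vecI) (auto simp: scalar_prod_def)
    finally show ?thesis using p by simp
  qed
  define A' where "A' = mat d (Suc k) (\<lambda>(i,j). if j < k then A $$ (i,j) else u $ i)"
  define B' where "B' = mat (Suc k) d (\<lambda>(i,j). if i < k then B $$ (i,j) else b j)"
  have BAe: "(\<Sum>l<d. B $$ (i,l) * A $$ (l,j)) = (if i = j then 1 else 0)" if "i < k" "j < k" for i j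
  proof -
    have "(\<Sum>l<d. B $$ (i,l) * A $$ (l,j)) = (B * A) $$ (i,j)"
      using A B that by (simp add: scalar_prod_def lessThan_atLeast0)
    then show ?thesis using BA that by simp
  qed
  have Bue: "(\<Sum>l<d. B $$ (i,l) * u $ l) = 0" if "i < k" for i
  proof -
    have "(\<Sum>l<d. B $$ (i,l) * u $ l) = (B *\<^sub>v u) $ i"
      using B uc that by (simp add: scalar_prod_def lessThan_atLeast0)
    then show ?thesis using Bu that by simp
  qed
  have "B' * A' = 1\<^sub>m (Suc k)"
  proof (rule eq_matI)
    fix i j assume ij: "i < dim_row (1\<^sub>m (Suc k) :: complex mat)" "j < dim_col (1\<^sub>m (Suc k) :: complex mat)"
    then have "(B' * A') $$ (i,j) = (\<Sum>l<d. (if i < k then B $$ (i,l) else b l) * (if j < k then A $$ (l,j) else u $ l))"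
      by (simp add: A'_def B'_def scalar_prod_def lessThan_atLeast0)
    then show "(B' * A') $$ (i,j) = 1\<^sub>m (Suc k) $$ (i,j)"
      using ij by (cases "i < k"; cases "j < k") (auto simp: BAe Bue bA bu less_Suc_eq)
  qed (auto simp: A'_def B'_def)
  moreover have "A' *\<^sub>v v \<in> W" if v: "v \<in> carrier_vec (Suc k)" for v
  proof -
    define v' where "v' = vec k (\<lambda>i. v $ i)"
    have "A' *\<^sub>v v = A *\<^sub>v v' + v $ k \<cdot>\<^sub>v u"
    proof (rule eq_vecI)
      fix i assume "i < dim_vec (A *\<^sub>v v' + v $ k \<cdot>\<^sub>v u)"
      then have i: "i < d" using A uc by simp
      then show "(A' *\<^sub>v v) $ i = (A *\<^sub>v v' + v $ k \<cdot>\<^sub>v u) $ i"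
        using A uc v by (simp add: A'_def v'_def scalar_prod_def)
    qed (use A uc in \<open>auto simp: A'_def\<close>)
    moreover have "A *\<^sub>v v' \<in> W" by (rule AW) (simp add: v'_def)
    ultimately show ?thesis using W' uW by simp
  qed
  ultimately show ?thesis by (intro exI[of _ A'] exI[of _ B']) (auto simp: A'_def B'_def)
qed

text \<open>Extension of frames stops because their size is bounded by \<open>d\<close>; a maximal frame is a basis of \<open>W\<close> with dual rows.\<close>
lemma subspace_frame:
  assumes W: "VectorSpace.subspace class_ring W (module_vec TYPE(complex) d)"
  obtains A k B where "A \<in> carrier_mat d k" "B \<in> carrier_mat k d" "B * A = 1\<^sub>m k"
    "\<And>v. v \<in> carrier_vec k \<Longrightarrow> A *\<^sub>v v \<in> W" "\<And>w. w \<in> W \<Longrightarrow> A *\<^sub>v (B *\<^sub>v w) = w"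
proof -
  define P where "P k \<longleftrightarrow> (\<exists>A B. A \<in> carrier_mat d k \<and> B \<in> carrier_mat k d \<and> B * A = 1\<^sub>m k
           \<and> (\<forall>v\<in>carrier_vec k. A *\<^sub>v v \<in> W))" for k
  have W': "0\<^sub>v d \<in> W" using W[unfolded subspace_vec_iff] by simp
  have "P 0"
    unfolding P_def
  proof (intro exI conjI ballI)
    show "(0\<^sub>m d 0) *\<^sub>v v \<in> W" if "v \<in> carrier_vec 0" for v
    proof -
      have "(0\<^sub>m d 0) *\<^sub>v v = 0\<^sub>v d" using that by (intro eq_vecI) (auto simp: scalar_prod_def)
      then show ?thesis using W' by simp
    qed
  qed (auto intro!: eq_matI)
  moreover have bound: "\<forall>k. P k \<longrightarrow> k \<le> d"
    unfolding P_def using left_inverse_dim_le by blast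
  ultimately have max: "P (Greatest P)" "\<not> P (Suc (Greatest P))"
    using GreatestI_nat[of P 0 d] Greatest_le_nat[of P "Suc (Greatest P)" d] by auto
  define k where "k = Greatest P"
  obtain A B where AB: "A \<in> carrier_mat d k" "B \<in> carrier_mat k d" "B * A = 1\<^sub>m k"
     "\<forall>v\<in>carrier_vec k. A *\<^sub>v v \<in> W"
    using max(1) unfolding P_def k_def by blast
  have "A *\<^sub>v (B *\<^sub>v w) = w" if "w \<in> W" for w
  proof (rule ccontr)
    assume "A *\<^sub>v (B *\<^sub>v w) \<noteq> w"
    then have "P (Suc k)" unfolding P_def
      using subspace_frame_extend[OF AB(1-3) W] AB(4) that by blast
    then show False using max(2) by (simp add: k_def)
  qed
  then show thesis using that AB by blast
qed

lemma mat_assoc_dim: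
  fixes A B C :: "complex mat"
  assumes "dim_col A = dim_row B" "dim_col B = dim_row C"
  shows "A * B * C = A * (B * C)"
  using assms by (intro assoc_mult_mat[of _ "dim_row A" "dim_col A" _ "dim_col B" _ "dim_col C"]) auto

lemma mat_vec_assoc_dim:
  fixes A B :: "complex mat"
  assumes "dim_col A = dim_row B" "dim_col B = dim_vec v"
  shows "A * B *\<^sub>v v = A *\<^sub>v (B *\<^sub>v v)"
  using assms by (intro assoc_mult_mat_vec[of _ "dim_row A" "dim_col A" _ "dim_col B"]) (auto intro: carrier_vecI)

lemma mat_eqI_vec:
  fixes A B :: "complex mat"
  assumes "A \<in> carrier_mat n m" "B \<in> carrier_mat n m"
    and "\<And>v. v \<in> carrier_vec m \<Longrightarrow> A *\<^sub>v v = B *\<^sub>v v"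
  shows "A = B"
proof (rule eq_matI)
  fix i j assume ij: "i < dim_row B" "j < dim_col B"
  have e: "(X *\<^sub>v unit_vec m j) $ i = X $$ (i,j)" if "X \<in> carrier_mat n m" for X :: "complex mat"
    using that ij assms(2) by (simp add: scalar_prod_right_unit)
  show "A $$ (i,j) = B $$ (i,j)"
    using assms(3)[of "unit_vec m j"] e[OF assms(1)] e[OF assms(2)] by simp
qed (use assms in auto)

lemma range_subspace:
  assumes "A \<in> carrier_mat d e"
  shows "VectorSpace.subspace class_ring {A *\<^sub>v v | v. v \<in> carrier_vec e} (module_vec TYPE(complex) d)"
  unfolding subspace_vec_iff
proof (intro conjI ballI allI)
  show "0\<^sub>v d \<in> {A *\<^sub>v v | v. v \<in> carrier_vec e}"
    using assms by (intro CollectI exI[of _ "0\<^sub>v e"]) auto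
  show "v + w \<in> {A *\<^sub>v v | v. v \<in> carrier_vec e}"
    if vw: "v \<in> {A *\<^sub>v v | v. v \<in> carrier_vec e}" "w \<in> {A *\<^sub>v v | v. v \<in> carrier_vec e}" for v w
  proof -
    obtain a b where ab: "v = A *\<^sub>v a" "w = A *\<^sub>v b" "a \<in> carrier_vec e" "b \<in> carrier_vec e" using vw by blast
    then have "v + w = A *\<^sub>v (a + b)" using assms by (simp add: mult_add_distrib_mat_vec)
    then show ?thesis using ab by (intro CollectI exI[of _ "a + b"]) simp
  qed
  show "c \<cdot>\<^sub>v v \<in> {A *\<^sub>v v | v. v \<in> carrier_vec e}"
    if v: "v \<in> {A *\<^sub>v v | v. v \<in> carrier_vec e}" for c v
  proof -
    obtain a where a: "v = A *\<^sub>v a" "a \<in> carrier_vec e" using v by blast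
    then have "c \<cdot>\<^sub>v v = A *\<^sub>v (c \<cdot>\<^sub>v a)" using assms by (simp add: mult_mat_vec)
    then show ?thesis using a by (intro CollectI exI[of _ "c \<cdot>\<^sub>v a"]) simp
  qed
qed (use assms in auto)

lemma kernel_subspace:
  assumes "A \<in> carrier_mat d e"
  shows "VectorSpace.subspace class_ring {v \<in> carrier_vec e. A *\<^sub>v v = 0\<^sub>v d} (module_vec TYPE(complex) e)"
  unfolding subspace_vec_iff
  using assms by (auto simp: mult_add_distrib_mat_vec mult_mat_vec)

text \<open>A frame \<open>A\<close> of \<open>W\<close> and a frame \<open>C\<close> of the kernel of \<open>B\<close>, the complement of \<open>W\<close> cut out by the projection \<open>A * B\<close>; so \<open>(A, C)\<close> is
  an invertible matrix with inverse \<open>(B, D)\<close>.\<close>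
lemma frame_pair:
  assumes W: "VectorSpace.subspace class_ring W (module_vec TYPE(complex) d)"
  obtains A k B C l D where "A \<in> carrier_mat d k" "B \<in> carrier_mat k d" "C \<in> carrier_mat d l" "D \<in> carrier_mat l d"
    "B * A = 1\<^sub>m k" "D * C = 1\<^sub>m l" "D * A = 0\<^sub>m l k" "B * C = 0\<^sub>m k l" "A * B + C * D = 1\<^sub>m d"
    "\<And>v. v \<in> carrier_vec k \<Longrightarrow> A *\<^sub>v v \<in> W" "\<And>w. w \<in> W \<Longrightarrow> A *\<^sub>v (B *\<^sub>v w) = w"
proof -
  obtain k A B where A: "A \<in> carrier_mat d k" and B: "B \<in> carrier_mat k d" and BA: "B * A = 1\<^sub>m k"
    and AW: "\<And>v. v \<in> carrier_vec k \<Longrightarrow> A *\<^sub>v v \<in> W" and ABw: "\<And>w. w \<in> W \<Longrightarrow> A *\<^sub>v (B *\<^sub>v w) = w"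
    by (rule subspace_frame[OF W]) (rule that)
  define Q where "Q = 1\<^sub>m d - A * B"
  have Q: "Q \<in> carrier_mat d d" unfolding Q_def using A B by (intro minus_carrier_mat) auto
  define W2 where "W2 = {Q *\<^sub>v v | v. v \<in> carrier_vec d}"
  obtain l C D' where C: "C \<in> carrier_mat d l" and D': "D' \<in> carrier_mat l d" and DC': "D' * C = 1\<^sub>m l"
    and CW: "\<And>v. v \<in> carrier_vec l \<Longrightarrow> C *\<^sub>v v \<in> W2" and CDw: "\<And>w. w \<in> W2 \<Longrightarrow> C *\<^sub>v (D' *\<^sub>v w) = w"
    by (rule subspace_frame[OF range_subspace[OF Q], folded W2_def]) (rule that)
  define D where "D = D' * Q"
  have D: "D \<in> carrier_mat l d" using D' Q by (simp add: D_def)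
  note dims = A[THEN carrier_matD(1)] A[THEN carrier_matD(2)] B[THEN carrier_matD(1)] B[THEN carrier_matD(2)]
    C[THEN carrier_matD(1)] C[THEN carrier_matD(2)] D[THEN carrier_matD(1)] D[THEN carrier_matD(2)]
    D'[THEN carrier_matD(1)] D'[THEN carrier_matD(2)] Q[THEN carrier_matD(1)] Q[THEN carrier_matD(2)]
  have QA: "Q * A = 0\<^sub>m d k"
  proof -
    have "Q * A = A - A * (B * A)" unfolding Q_def using A B
      by (subst minus_mult_distrib_mat[of _ d d]) (auto simp: mat_assoc_dim)
    then show ?thesis using A BA by simp
  qed
  have BQ: "B * Q = 0\<^sub>m k d"
  proof -
    have "B * Q = B - B * A * B" unfolding Q_def using A B
      by (subst mult_minus_distrib_mat[of _ k d]) (auto simp: mat_assoc_dim)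
    then show ?thesis using B BA by simp
  qed
  have QQ: "Q * Q = Q"
  proof -
    have "Q * Q = Q * (1\<^sub>m d - A * B)" by (simp only: Q_def)
    also have "\<dots> = Q - Q * A * B" using A B Q
      by (subst mult_minus_distrib_mat[of _ d d]) (auto simp: mat_assoc_dim)
    finally have "Q * Q = Q - Q * A * B" .
    moreover have "Q - 0\<^sub>m d d = Q" using Q by (intro eq_matI) auto
    ultimately show ?thesis using B QA by simp
  qed
  have QC: "Q * C = C"
  proof (rule mat_eqI_vec)
    fix v :: "complex vec" assume v: "v \<in> carrier_vec l"
    obtain a where a: "a \<in> carrier_vec d" "C *\<^sub>v v = Q *\<^sub>v a" using CW[OF v] unfolding W2_def by blast
    have "Q * C *\<^sub>v v = Q *\<^sub>v (Q *\<^sub>v a)" using a v dims by (simp add: mat_vec_assoc_dim)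
    also have "\<dots> = Q * Q *\<^sub>v a" using a dims by (simp add: mat_vec_assoc_dim)
    finally show "Q * C *\<^sub>v v = C *\<^sub>v v" using a QQ by simp
  qed (use Q C in auto)
  have CD: "C * D = Q"
  proof (rule mat_eqI_vec)
    fix v :: "complex vec" assume v: "v \<in> carrier_vec d"
    have "Q *\<^sub>v v \<in> W2" using v by (auto simp: W2_def)
    then show "C * D *\<^sub>v v = Q *\<^sub>v v" using v dims CDw by (simp add: mat_vec_assoc_dim D_def)
  qed (use Q C D in auto)
  have 1: "D * C = 1\<^sub>m l" using dims QC DC' by (simp add: D_def mat_assoc_dim)
  have 2: "D * A = 0\<^sub>m l k" using dims QA D' by (simp add: D_def mat_assoc_dim)
  have 3: "B * C = 0\<^sub>m k l"
  proof -
    have "B * C = B * Q * C" using dims QC by (simp add: mat_assoc_dim)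
    then show ?thesis using BQ C by simp
  qed
  have 4: "A * B + C * D = 1\<^sub>m d" unfolding CD Q_def using A B by (intro eq_matI) auto
  show thesis by (rule that[OF A B C D BA 1 2 3 4 AW ABw])
qed

section \<open>Characters as sums of irreducible characters\<close>

lemma representationD:
  assumes "representation G d \<rho>"
  shows "\<And>g. g \<in> carrier G \<Longrightarrow> \<rho> g \<in> carrier_mat d d"
    "\<rho> \<one>\<^bsub>G\<^esub> = 1\<^sub>m d"
    "\<And>g h. g \<in> carrier G \<Longrightarrow> h \<in> carrier G \<Longrightarrow> \<rho> (g \<otimes>\<^bsub>G\<^esub> h) = \<rho> g * \<rho> h"
    "\<And>g. g \<in> carrier G \<Longrightarrow> dim_row (\<rho> g) = d" "\<And>g. g \<in> carrier G \<Longrightarrow> dim_col (\<rho> g) = d"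
  using assms unfolding representation_def by auto

text \<open>In a basis adapted to an invariant subspace the matrices are block triangular. The two diagonal blocks
  are representations, on the subspace and on the quotient, and the trace is the sum of
  their traces.\<close>
lemma representation_split:
  fixes G (structure)
  assumes rep: "representation G d \<rho>" and G: "group G"
    and W: "VectorSpace.subspace class_ring W (module_vec TYPE(complex) d)"
    and inv: "\<And>g v. g \<in> carrier G \<Longrightarrow> v \<in> W \<Longrightarrow> \<rho> g *\<^sub>v v \<in> W"
    and nontriv: "W \<noteq> {0\<^sub>v d}" "W \<noteq> carrier_vec d"
  obtains k l \<sigma> \<sigma>' where "k < d" "l < d" "representation G k \<sigma>" "representation G l \<sigma>'"
    "\<And>g. g \<in> carrier G \<Longrightarrow> mat_trace (\<rho> g) = mat_trace (\<sigma> g) + mat_trace (\<sigma>' g)"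
proof -
  interpret group G by fact
  note W' = W[unfolded subspace_vec_iff]
  obtain k l A B C D where A: "A \<in> carrier_mat d k" and B: "B \<in> carrier_mat k d"
    and C: "C \<in> carrier_mat d l" and D: "D \<in> carrier_mat l d"
    and BA: "B * A = 1\<^sub>m k" and DC: "D * C = 1\<^sub>m l" and DA: "D * A = 0\<^sub>m l k" and BC: "B * C = 0\<^sub>m k l"
    and one: "A * B + C * D = 1\<^sub>m d"
    and AW: "\<And>v. v \<in> carrier_vec k \<Longrightarrow> A *\<^sub>v v \<in> W" and ABw: "\<And>w. w \<in> W \<Longrightarrow> A *\<^sub>v (B *\<^sub>v w) = w"
    by (rule frame_pair[OF W]) (rule that)
  note r = representationD[OF rep]
  note dims = A[THEN carrier_matD(1)] A[THEN carrier_matD(2)] B[THEN carrier_matD(1)] B[THEN carrier_matD(2)]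
    C[THEN carrier_matD(1)] C[THEN carrier_matD(2)] D[THEN carrier_matD(1)] D[THEN carrier_matD(2)]
  define \<sigma> where "\<sigma> g = B * (\<rho> g * A)" for g
  define \<sigma>' where "\<sigma>' g = D * (\<rho> g * C)" for g
  have ABr: "A * (B * (\<rho> g * A)) = \<rho> g * A" if g: "g \<in> carrier G" for g
  proof (rule mat_eqI_vec)
    fix v :: "complex vec" assume v: "v \<in> carrier_vec k"
    have "\<rho> g *\<^sub>v (A *\<^sub>v v) \<in> W" using inv AW v g by blast
    then show "A * (B * (\<rho> g * A)) *\<^sub>v v = \<rho> g * A *\<^sub>v v"
      using v dims r(4,5)[OF g] ABw by (simp add: mat_vec_assoc_dim)
  qed (use A B r(1)[OF g] in auto)
  have DrA: "D * (\<rho> g * A) = 0\<^sub>m l k" if g: "g \<in> carrier G" for g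
  proof -
    have "D * (\<rho> g * A) = D * A * (B * (\<rho> g * A))"
      using dims r(4,5)[OF g] ABr[OF g] by (simp add: mat_assoc_dim)
    then show ?thesis using DA B A r(1)[OF g] by (simp add: left_mult_zero_mat[of _ k k])
  qed
  have split: "X = A * (B * X) + C * (D * X)" if "X \<in> carrier_mat d n" for X :: "complex mat" and n
  proof -
    have "X = (A * B + C * D) * X" using that one by simp
    also have "\<dots> = A * B * X + C * D * X" using A B C D that by (intro add_mult_distrib_mat[of _ d d]) auto
    finally show ?thesis using that dims by (simp add: mat_assoc_dim)
  qed
  have s1: "representation G k \<sigma>"
    unfolding representation_def
  proof (intro conjI ballI)
    show "\<sigma> \<one> = 1\<^sub>m k" using r(2) A BA by (simp add: \<sigma>_def)
    show "\<sigma> (g \<otimes> h) = \<sigma> g * \<sigma> h" if gh: "g \<in> carrier G" "h \<in> carrier G" for g h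
      using dims r(3)[OF gh] r(4,5)[OF gh(1)] r(4,5)[OF gh(2)] ABr[OF gh(2)] by (simp add: \<sigma>_def mat_assoc_dim)
  qed (use A B r(1) in \<open>auto simp: \<sigma>_def\<close>)
  have s2: "representation G l \<sigma>'"
    unfolding representation_def
  proof (intro conjI ballI)
    show "\<sigma>' \<one> = 1\<^sub>m l" using r(2) C DC by (simp add: \<sigma>'_def)
    show "\<sigma>' (g \<otimes> h) = \<sigma>' g * \<sigma>' h" if gh: "g \<in> carrier G" "h \<in> carrier G" for g h
    proof -
      have hC: "\<rho> h * C \<in> carrier_mat d l" using r(1)[OF gh(2)] C by simp
      have rg: "\<rho> g \<in> carrier_mat d d" using r(1) gh by simp
      have "\<sigma>' (g \<otimes> h) = D * \<rho> g * (\<rho> h * C)"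
        using dims r(3)[OF gh] r(4,5)[OF gh(1)] r(4,5)[OF gh(2)] by (simp add: \<sigma>'_def mat_assoc_dim)
      also have "\<dots> = D * \<rho> g * (A * (B * (\<rho> h * C)) + C * (D * (\<rho> h * C)))"
        by (rule arg_cong[OF split[OF hC]])
      also have "\<dots> = D * \<rho> g * (A * (B * (\<rho> h * C))) + D * \<rho> g * (C * (D * (\<rho> h * C)))"
        by (rule mult_add_distrib_mat[of _ l d _ l]; rule carrier_matI) (simp_all add: dims r(4,5) gh)
      also have "D * \<rho> g * (A * (B * (\<rho> h * C))) = (D * (\<rho> g * A)) * (B * (\<rho> h * C))"
        using dims r(4,5)[OF gh(1)] r(4,5)[OF gh(2)] by (simp add: mat_assoc_dim)
      also have "\<dots> = 0\<^sub>m l l" unfolding DrA[OF gh(1)] using B hC by (intro left_mult_zero_mat) auto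
      also have "0\<^sub>m l l + D * \<rho> g * (C * (D * (\<rho> h * C))) = \<sigma>' g * \<sigma>' h"
        using dims r(4,5)[OF gh(1)] r(4,5)[OF gh(2)] C D hC rg
        by (subst left_add_zero_mat[of _ l l]) (auto simp: \<sigma>'_def mat_assoc_dim)
      finally show ?thesis .
    qed
  qed (use C D r(1) in \<open>auto simp: \<sigma>'_def\<close>)
  have tr: "mat_trace X = mat_trace (B * (X * A)) + mat_trace (D * (X * C))" if X: "X \<in> carrier_mat d d" for X
  proof -
    have "mat_trace X = mat_trace (A * (B * X) + C * (D * X))"
      by (rule arg_cong[OF split[OF X]])
    also have "\<dots> = mat_trace (A * (B * X)) + mat_trace (C * (D * X))"
      by (rule mat_trace_add[of _ d]) (use A B C D X in auto)
    also have "mat_trace (A * (B * X)) = mat_trace (B * X * A)"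
      using A B X by (intro mat_trace_mult_comm) auto
    also have "mat_trace (C * (D * X)) = mat_trace (D * X * C)"
      using C D X by (intro mat_trace_mult_comm) auto
    finally show ?thesis using dims X by (simp add: mat_assoc_dim)
  qed
  have "mat_trace (1\<^sub>m d) = mat_trace (1\<^sub>m k) + mat_trace (1\<^sub>m l)"
    using tr[of "1\<^sub>m d"] A B C D BA DC by simp
  then have "(of_nat d :: complex) = of_nat (k + l)" by simp
  then have dkl: "d = k + l" by (simp only: of_nat_eq_iff)
  have "k \<noteq> 0"
  proof
    assume "k = 0"
    have "w = 0\<^sub>v d" if "w \<in> W" for w
    proof (rule eq_vecI)
      fix i assume "i < dim_vec (0\<^sub>v d :: complex vec)"
      then have i: "i < d" by simp
      have "w $ i = (A *\<^sub>v (B *\<^sub>v w)) $ i" by (simp only: ABw[OF that])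
      also have "\<dots> = 0" using i dims \<open>k = 0\<close> by (simp add: scalar_prod_def)
      finally show "w $ i = 0\<^sub>v d $ i" using i by simp
    qed (use conjunct1[OF W'] that in auto)
    then have "W = {0\<^sub>v d}" using conjunct1[OF conjunct2[OF W']] by blast
    then show False using nontriv by simp
  qed
  moreover have "l \<noteq> 0"
  proof
    assume "l = 0"
    have "v \<in> W" if v: "v \<in> carrier_vec d" for v
    proof -
      have "C * D = 0\<^sub>m d d"
        by (rule eq_matI) (use dims \<open>l = 0\<close> in \<open>simp_all add: scalar_prod_def\<close>)
      then have "A * B + 0\<^sub>m d d = 1\<^sub>m d" using one by simp
      moreover have "A * B + 0\<^sub>m d d = A * B" by (rule right_add_zero_mat[of _ d d]) (use A B in auto)
      ultimately have "A * B *\<^sub>v v = v" using v by simp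
      moreover have "A * B *\<^sub>v v = A *\<^sub>v (B *\<^sub>v v)" using v dims by (simp add: mat_vec_assoc_dim)
      moreover have "A *\<^sub>v (B *\<^sub>v v) \<in> W" by (rule AW) (use B v in auto)
      ultimately show ?thesis by simp
    qed
    then have "W = carrier_vec d" using conjunct1[OF W'] by blast
    then show False using nontriv by simp
  qed
  ultimately have kd: "k < d" and ld: "l < d" using dkl by auto
  have "mat_trace (\<rho> g) = mat_trace (\<sigma> g) + mat_trace (\<sigma>' g)" if "g \<in> carrier G" for g
    unfolding \<sigma>_def \<sigma>'_def by (rule tr[OF r(1)[OF that]])
  then show thesis by (rule that[OF kd ld s1 s2])
qed

text \<open>Induction on the dimension by \<open>representation_split\<close>. The list records multiplicities.\<close>
lemma trace_sum_irreducible: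
  assumes "group G" "representation G d \<rho>"
  shows "\<exists>xs. set xs \<subseteq> irreducible_characters G \<and> (\<forall>g\<in>carrier G. mat_trace (\<rho> g) = (\<Sum>f\<leftarrow>xs. f g))"
  using assms(2)
proof (induction d arbitrary: \<rho> rule: less_induct)
  case (less d)
  show ?case
  proof (cases "d = 0")
    case True
    then show ?thesis using representationD(4)[OF less.prems]
      by (intro exI[of _ "[]"]) (simp add: mat_trace_def)
  next
    case d: False
    show ?thesis
    proof (cases "irreducible_representation G d \<rho>")
      case True
      then have "character_of G \<rho> \<in> irreducible_characters G"
        unfolding irreducible_characters_def by blast
      then show ?thesis
        by (intro exI[of _ "[character_of G \<rho>]"]) (simp add: character_of_def)
    next
      case False
      then have "\<exists>W. VectorSpace.subspace class_ring W (module_vec TYPE(complex) d) \<and>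
          (\<forall>g\<in>carrier G. \<forall>v\<in>W. \<rho> g *\<^sub>v v \<in> W) \<and> W \<noteq> {0\<^sub>v d} \<and> W \<noteq> carrier_vec d"
        using d less.prems by (simp add: irreducible_representation_def)
      then obtain W where W: "VectorSpace.subspace class_ring W (module_vec TYPE(complex) d)"
          "\<forall>g\<in>carrier G. \<forall>v\<in>W. \<rho> g *\<^sub>v v \<in> W" "W \<noteq> {0\<^sub>v d}" "W \<noteq> carrier_vec d"
        by (elim exE conjE)
      have W2: "\<rho> g *\<^sub>v v \<in> W" if "g \<in> carrier G" "v \<in> W" for g v
        using W(2)[rule_format, OF that] .
      obtain k l \<sigma> \<sigma>' where s: "k < d" "l < d" "representation G k \<sigma>" "representation G l \<sigma>'"
        "\<And>g. g \<in> carrier G \<Longrightarrow> mat_trace (\<rho> g) = mat_trace (\<sigma> g) + mat_trace (\<sigma>' g)"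
        by (rule representation_split[OF less.prems assms(1) W(1) W2 W(3,4)]) (assumption | rule that)+
      from less.IH[OF s(1) s(3)] obtain xs
        where xs: "set xs \<subseteq> irreducible_characters G" "\<forall>g\<in>carrier G. mat_trace (\<sigma> g) = (\<Sum>f\<leftarrow>xs. f g)"
        by (elim exE conjE)
      from less.IH[OF s(2) s(4)] obtain ys
        where ys: "set ys \<subseteq> irreducible_characters G" "\<forall>g\<in>carrier G. mat_trace (\<sigma>' g) = (\<Sum>f\<leftarrow>ys. f g)"
        by (elim exE conjE)
      show ?thesis
      proof (intro exI conjI ballI)
        show "set (xs @ ys) \<subseteq> irreducible_characters G" using xs(1) ys(1) by simp
        show "mat_trace (\<rho> g) = (\<Sum>f\<leftarrow>xs @ ys. f g)" if "g \<in> carrier G" for g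
          using s(5)[OF that] xs(2) ys(2) that by simp
      qed
    qed
  qed
qed

section \<open>Schur orthogonality\<close>

lemma (in group) bij_left_mult: "h \<in> carrier G \<Longrightarrow> bij_betw (\<lambda>g. h \<otimes> g) (carrier G) (carrier G)"
  by (rule bij_betw_byWitness[where f' = "\<lambda>g. inv h \<otimes> g"]) (auto simp: m_assoc[symmetric])

lemma (in group) bij_right_mult: "h \<in> carrier G \<Longrightarrow> bij_betw (\<lambda>g. g \<otimes> h) (carrier G) (carrier G)"
  by (rule bij_betw_byWitness[where f' = "\<lambda>g. g \<otimes> inv h"]) (auto simp: m_assoc)

lemma (in group) bij_inv: "bij_betw (\<lambda>g. inv g) (carrier G) (carrier G)"
  by (rule bij_betw_byWitness[where f' = "\<lambda>g. inv g"]) auto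

lemma irreducibleD:
  assumes "irreducible_representation G d \<rho>"
  shows "representation G d \<rho>" "d > 0"
    "\<And>W. VectorSpace.subspace class_ring W (module_vec TYPE(complex) d) \<Longrightarrow>
       (\<And>g v. g \<in> carrier G \<Longrightarrow> v \<in> W \<Longrightarrow> \<rho> g *\<^sub>v v \<in> W) \<Longrightarrow> W = {0\<^sub>v d} \<or> W = carrier_vec d"
  using assms unfolding irreducible_representation_def by simp_all

text \<open>The range of an intertwiner is an invariant subspace.\<close>
lemma schur_right_inverse:
  fixes M :: "complex mat"
  assumes irr: "irreducible_representation G d \<rho>" and s: "representation G e \<sigma>"
    and M: "M \<in> carrier_mat d e" and comm: "\<And>g. g \<in> carrier G \<Longrightarrow> \<rho> g * M = M * \<sigma> g"
  shows "M = 0\<^sub>m d e \<or> (\<exists>N\<in>carrier_mat e d. M * N = 1\<^sub>m d)"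
proof -
  note r = representationD[OF irreducibleD(1)[OF irr]] and s = representationD[OF s]
  define W where "W = {M *\<^sub>v v | v. v \<in> carrier_vec e}"
  have "W = {0\<^sub>v d} \<or> W = carrier_vec d"
  proof (rule irreducibleD(3)[OF irr range_subspace[OF M, folded W_def]])
    fix g w assume g: "g \<in> carrier G" and "w \<in> W"
    then obtain v where v: "v \<in> carrier_vec e" "w = M *\<^sub>v v" unfolding W_def by blast
    have "\<rho> g *\<^sub>v w = \<rho> g * M *\<^sub>v v" using v M r(4,5)[OF g] by (simp add: mat_vec_assoc_dim)
    also have "\<dots> = M *\<^sub>v (\<sigma> g *\<^sub>v v)" unfolding comm[OF g] using v M s(4,5)[OF g] by (simp add: mat_vec_assoc_dim)
    finally show "\<rho> g *\<^sub>v w \<in> W" unfolding W_def using s(1)[OF g] v by auto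
  qed
  then show ?thesis
  proof
    assume W0: "W = {0\<^sub>v d}"
    have "M = 0\<^sub>m d e"
    proof (rule mat_eqI_vec)
      fix v :: "complex vec" assume v: "v \<in> carrier_vec e"
      then have "M *\<^sub>v v \<in> W" unfolding W_def by blast
      then show "M *\<^sub>v v = 0\<^sub>m d e *\<^sub>v v" using W0 v by (simp, intro eq_vecI) (auto simp: scalar_prod_def)
    qed (use M in auto)
    then show ?thesis ..
  next
    assume W1: "W = carrier_vec d"
    have "\<exists>c. c \<in> carrier_vec e \<and> M *\<^sub>v c = unit_vec d j" for j
    proof -
      have "unit_vec d j \<in> W" using W1 by simp
      then show ?thesis unfolding W_def by force
    qed
    then obtain c where c: "\<And>j. c j \<in> carrier_vec e" "\<And>j. M *\<^sub>v c j = unit_vec d j" by metis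
    define N where "N = mat e d (\<lambda>(i,j). c j $ i)"
    have "M * N = 1\<^sub>m d"
    proof (rule eq_matI)
      fix i j assume "i < dim_row (1\<^sub>m d :: complex mat)" "j < dim_col (1\<^sub>m d :: complex mat)"
      then have ij: "i < d" "j < d" by auto
      have "col N j = c j" using c(1)[of j] ij by (intro eq_vecI) (auto simp: N_def)
      then have "(M * N) $$ (i,j) = (M *\<^sub>v c j) $ i" using ij M by (simp add: N_def)
      then show "(M * N) $$ (i,j) = 1\<^sub>m d $$ (i,j)" using c(2) ij by simp
    qed (use M in \<open>auto simp: N_def\<close>)
    then show ?thesis by (intro disjI2 bexI[of _ N]) (simp_all add: N_def)
  qed
qed

text \<open>The kernel of an intertwiner is an invariant subspace.\<close>
lemma schur_left_inverse:
  fixes M :: "complex mat"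
  assumes irr: "irreducible_representation G d \<rho>" "irreducible_representation G e \<sigma>"
    and M: "M \<in> carrier_mat d e" and comm: "\<And>g. g \<in> carrier G \<Longrightarrow> \<rho> g * M = M * \<sigma> g"
    and N: "N \<in> carrier_mat e d" and MN: "M * N = 1\<^sub>m d"
  shows "N * M = 1\<^sub>m e"
proof -
  note r = representationD[OF irreducibleD(1)[OF irr(1)]] and s = representationD[OF irreducibleD(1)[OF irr(2)]]
  define W where "W = {v \<in> carrier_vec e. M *\<^sub>v v = 0\<^sub>v d}"
  have "W = {0\<^sub>v e} \<or> W = carrier_vec e"
  proof (rule irreducibleD(3)[OF irr(2) kernel_subspace[OF M, folded W_def]])
    fix g v assume g: "g \<in> carrier G" and "v \<in> W"
    then have v: "v \<in> carrier_vec e" "M *\<^sub>v v = 0\<^sub>v d" unfolding W_def by auto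
    have "M *\<^sub>v (\<sigma> g *\<^sub>v v) = M * \<sigma> g *\<^sub>v v" using v M s(4,5)[OF g] by (simp add: mat_vec_assoc_dim)
    also have "\<dots> = \<rho> g *\<^sub>v (M *\<^sub>v v)" unfolding comm[OF g, symmetric] using v(1) M r(4,5)[OF g]
      by (simp add: mat_vec_assoc_dim)
    also have "\<dots> = 0\<^sub>v d" unfolding v(2) using r(1)[OF g] by (intro eq_vecI) (auto simp: scalar_prod_def)
    finally show "\<sigma> g *\<^sub>v v \<in> W" unfolding W_def using s(1)[OF g] v(1) by auto
  qed
  moreover have "W \<noteq> carrier_vec e"
  proof
    assume W1: "W = carrier_vec e"
    have "N *\<^sub>v unit_vec d 0 \<in> W" using N W1 by auto
    then have "M *\<^sub>v (N *\<^sub>v unit_vec d 0) = 0\<^sub>v d" unfolding W_def by simp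
    moreover have "M *\<^sub>v (N *\<^sub>v unit_vec d 0) = M * N *\<^sub>v unit_vec d 0"
      using M N by (simp add: mat_vec_assoc_dim)
    ultimately have "unit_vec d 0 = (0\<^sub>v d :: complex vec)" using MN by simp
    then have "unit_vec d 0 $ 0 = (0\<^sub>v d :: complex vec) $ 0" by simp
    then show False using irreducibleD(2)[OF irr(1)] by simp
  qed
  ultimately have W0: "W = {0\<^sub>v e}" by simp
  show ?thesis
  proof (rule mat_eqI_vec)
    fix v :: "complex vec" assume v: "v \<in> carrier_vec e"
    have "M *\<^sub>v (N * M *\<^sub>v v - v) = M *\<^sub>v (N * M *\<^sub>v v) - M *\<^sub>v v"
      using M N v by (intro mult_minus_distrib_mat_vec[of _ d e]) auto
    also have "M *\<^sub>v (N * M *\<^sub>v v) = M * N *\<^sub>v (M *\<^sub>v v)"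
      using M N v by (simp add: mat_vec_assoc_dim mat_assoc_dim)
    finally have "M *\<^sub>v (N * M *\<^sub>v v - v) = 0\<^sub>v d" using MN M v by simp
    then have "N * M *\<^sub>v v - v \<in> W" using M N v unfolding W_def by auto
    then have z: "N * M *\<^sub>v v - v = 0\<^sub>v e" using W0 by simp
    show "N * M *\<^sub>v v = 1\<^sub>m e *\<^sub>v v"
    proof (rule eq_vecI)
      fix i assume "i < dim_vec (1\<^sub>m e *\<^sub>v v)"
      then have i: "i < e" by simp
      have "(N * M *\<^sub>v v - v) $ i = 0" using z i by simp
      then show "(N * M *\<^sub>v v) $ i = (1\<^sub>m e *\<^sub>v v) $ i" using i v N by simp
    qed (use N in auto)
  qed (use M N in auto)
qed

text \<open>Subtract an eigenvalue: the difference still commutes with the representation but is not invertible, so it vanishes.\<close>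
lemma schur_scalar:
  fixes M :: "complex mat"
  assumes irr: "irreducible_representation G d \<rho>"
    and M: "M \<in> carrier_mat d d" and comm: "\<And>g. g \<in> carrier G \<Longrightarrow> \<rho> g * M = M * \<rho> g"
  shows "\<exists>c. M = c \<cdot>\<^sub>m 1\<^sub>m d"
proof -
  note r = representationD[OF irreducibleD(1)[OF irr]]
  obtain c where "eigenvalue M c"
    using spectrum_non_empty[OF M irreducibleD(2)[OF irr]] unfolding spectrum_def by auto
  then obtain v where v: "v \<in> carrier_vec d" "v \<noteq> 0\<^sub>v d" "M *\<^sub>v v = c \<cdot>\<^sub>v v"
    using M unfolding eigenvalue_def eigenvector_def by auto
  define M' where "M' = M - c \<cdot>\<^sub>m 1\<^sub>m d"
  have M': "M' \<in> carrier_mat d d" unfolding M'_def by (intro minus_carrier_mat) auto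
  have "\<rho> g * M' = M' * \<rho> g" if g: "g \<in> carrier G" for g
  proof -
    have "\<rho> g * M' = \<rho> g * M - \<rho> g * (c \<cdot>\<^sub>m 1\<^sub>m d)"
      unfolding M'_def using M r(1)[OF g] by (intro mult_minus_distrib_mat[of _ d d]) auto
    also have "\<rho> g * (c \<cdot>\<^sub>m 1\<^sub>m d) = c \<cdot>\<^sub>m 1\<^sub>m d * \<rho> g"
      using r(1)[OF g] by (subst mult_smult_distrib[of _ d d _ d], simp, simp, subst mult_smult_assoc_mat[of _ d d _ d]) simp_all
    also have "\<rho> g * M - c \<cdot>\<^sub>m 1\<^sub>m d * \<rho> g = M' * \<rho> g"
      unfolding M'_def comm[OF g] using M r(1)[OF g] by (intro minus_mult_distrib_mat[symmetric, of _ d d]) auto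
    finally show ?thesis .
  qed
  then consider "M' = 0\<^sub>m d d" | N where "N \<in> carrier_mat d d" "M' * N = 1\<^sub>m d"
    using schur_right_inverse[OF irr irreducibleD(1)[OF irr] M'] by blast
  then have "M' = 0\<^sub>m d d"
  proof cases
    case (2 N)
    then have NM: "N * M' = 1\<^sub>m d" using mat_mult_left_right_inverse[OF M'] by blast
    have "M' *\<^sub>v v = M *\<^sub>v v - c \<cdot>\<^sub>m 1\<^sub>m d *\<^sub>v v"
      unfolding M'_def using M v by (intro minus_mult_distrib_mat_vec[of _ d d]) auto
    also have "\<dots> = 0\<^sub>v d" using v by (intro eq_vecI) (auto simp: smult_scalar_prod_distrib[of _ d])
    finally have "N *\<^sub>v (M' *\<^sub>v v) = N *\<^sub>v 0\<^sub>v d" by simp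
    also have "\<dots> = 0\<^sub>v d" using 2 by (intro eq_vecI) (auto simp: scalar_prod_def)
    finally have "N * M' *\<^sub>v v = 0\<^sub>v d" using 2 M' v(1) by (simp add: mat_vec_assoc_dim)
    then show ?thesis using NM v by simp
  qed
  then have e: "M' $$ (i,j) = 0" if "i < d" "j < d" for i j using that by simp
  have "M = c \<cdot>\<^sub>m 1\<^sub>m d"
  proof (rule eq_matI)
    fix i j assume "i < dim_row (c \<cdot>\<^sub>m 1\<^sub>m d)" "j < dim_col (c \<cdot>\<^sub>m 1\<^sub>m d)"
    then show "M $$ (i,j) = (c \<cdot>\<^sub>m 1\<^sub>m d) $$ (i,j)" using e[of i j] M by (simp add: M'_def)
  qed (use M in auto)
  then show ?thesis ..
qed

lemma rep_mult_entry:
  assumes "representation G d \<rho>" "g \<in> carrier G" "h \<in> carrier G" "i < d" "j < d"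
  shows "\<rho> (g \<otimes>\<^bsub>G\<^esub> h) $$ (i,j) = (\<Sum>a<d. \<rho> g $$ (i,a) * \<rho> h $$ (a,j))"
  using representationD(3-5)[OF assms(1)] assms(2-) by (simp add: scalar_prod_def lessThan_atLeast0)

text \<open>The average of an elementary matrix over the group; its entries are the sums of products of matrix
  coefficients that orthogonality is about.\<close>
lemma average_intertwines:
  fixes G (structure)
  assumes G: "group G" and r: "representation G d \<rho>" and s: "representation G e \<sigma>" and jk: "j < d" "k < e"
    and h: "h \<in> carrier G"
  defines "M \<equiv> mat d e (\<lambda>(i,l). \<Sum>g\<in>carrier G. \<rho> g $$ (i,j) * \<sigma> (inv g) $$ (k,l))"
  shows "\<rho> h * M = M * \<sigma> h"
proof (rule eq_matI)
  interpret group G by fact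
  note rr = representationD[OF r] and ss = representationD[OF s]
  fix i l assume "i < dim_row (M * \<sigma> h)" "l < dim_col (M * \<sigma> h)"
  then have il: "i < d" "l < e" using ss(5)[OF h] by (auto simp: M_def)
  have "(\<rho> h * M) $$ (i,l) = (\<Sum>a<d. \<Sum>g\<in>carrier G. \<rho> h $$ (i,a) * (\<rho> g $$ (a,j) * \<sigma> (inv g) $$ (k,l)))"
    using il rr(4,5)[OF h] by (simp add: M_def scalar_prod_def lessThan_atLeast0 sum_distrib_left)
  also have "\<dots> = (\<Sum>g\<in>carrier G. (\<Sum>a<d. \<rho> h $$ (i,a) * \<rho> g $$ (a,j)) * \<sigma> (inv g) $$ (k,l))"
    by (subst sum.swap) (simp add: sum_distrib_right mult.assoc)
  also have "\<dots> = (\<Sum>g\<in>carrier G. \<rho> (h \<otimes> g) $$ (i,j) * \<sigma> (inv g) $$ (k,l))"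
    using il jk h by (simp add: rep_mult_entry[OF r])
  also have "\<dots> = (\<Sum>g\<in>carrier G. \<rho> (h \<otimes> g) $$ (i,j) * \<sigma> (inv (h \<otimes> g) \<otimes> h) $$ (k,l))"
  proof (rule sum.cong[OF refl])
    fix g assume g: "g \<in> carrier G"
    have "inv (h \<otimes> g) \<otimes> h = inv g" using g h by (simp add: inv_mult_group m_assoc)
    then show "\<rho> (h \<otimes> g) $$ (i,j) * \<sigma> (inv g) $$ (k,l) = \<rho> (h \<otimes> g) $$ (i,j) * \<sigma> (inv (h \<otimes> g) \<otimes> h) $$ (k,l)" by simp
  qed
  also have "\<dots> = (\<Sum>g\<in>carrier G. \<rho> g $$ (i,j) * \<sigma> (inv g \<otimes> h) $$ (k,l))"
    by (rule sum.reindex_bij_betw[OF bij_left_mult[OF h]])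
  also have "\<dots> = (\<Sum>g\<in>carrier G. \<Sum>b<e. \<rho> g $$ (i,j) * \<sigma> (inv g) $$ (k,b) * \<sigma> h $$ (b,l))"
    using il jk h by (simp add: rep_mult_entry[OF s] sum_distrib_left mult.assoc)
  also have "\<dots> = (\<Sum>b<e. \<Sum>g\<in>carrier G. \<rho> g $$ (i,j) * \<sigma> (inv g) $$ (k,b) * \<sigma> h $$ (b,l))"
    by (rule sum.swap)
  also have "\<dots> = (M * \<sigma> h) $$ (i,l)"
    using il ss(4,5)[OF h] by (simp add: M_def scalar_prod_def lessThan_atLeast0 sum_distrib_right)
  finally show "(\<rho> h * M) $$ (i,l) = (M * \<sigma> h) $$ (i,l)" .
qed (use representationD[OF r] representationD[OF s] h in \<open>auto simp: M_def\<close>)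

lemma coefficients_orthogonal:
  fixes G (structure)
  assumes G: "group G" and irr: "irreducible_representation G d \<rho>" and s: "representation G e \<sigma>"
    and no: "\<not> (\<exists>M\<in>carrier_mat d e. \<exists>N\<in>carrier_mat e d. M * N = 1\<^sub>m d \<and> (\<forall>g\<in>carrier G. \<rho> g * M = M * \<sigma> g))"
    and ij: "i < d" "j < d" "k < e" "l < e"
  shows "(\<Sum>g\<in>carrier G. \<rho> g $$ (i,j) * \<sigma> (inv g) $$ (k,l)) = 0"
proof -
  define M where "M = mat d e (\<lambda>(i,l). \<Sum>g\<in>carrier G. \<rho> g $$ (i,j) * \<sigma> (inv g) $$ (k,l))"
  have M: "M \<in> carrier_mat d e" by (simp add: M_def)
  have comm: "\<rho> h * M = M * \<sigma> h" if "h \<in> carrier G" for h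
    unfolding M_def by (rule average_intertwines[OF G irreducibleD(1)[OF irr] s ij(2,3) that])
  have "M = 0\<^sub>m d e"
    using schur_right_inverse[OF irr s M comm] no M comm by blast
  then have "M $$ (i,l) = 0" using ij by simp
  then show ?thesis using ij by (simp add: M_def)
qed

text \<open>The average of an elementary matrix is scalar by Schur; its trace determines the scalar.\<close>
lemma coefficients_self:
  fixes G (structure)
  assumes G: "group G" and irr: "irreducible_representation G d \<rho>"
    and ij: "i < d" "j < d" "k < d" "l < d"
  shows "(\<Sum>g\<in>carrier G. \<rho> g $$ (i,j) * \<rho> (inv g) $$ (k,l))
           = (if i = l \<and> j = k then of_nat (card (carrier G)) / of_nat d else 0)"
proof -
  interpret group G by fact
  note rep = irreducibleD(1)[OF irr]
  note r = representationD[OF rep]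
  define M where "M = mat d d (\<lambda>(i,l). \<Sum>g\<in>carrier G. \<rho> g $$ (i,j) * \<rho> (inv g) $$ (k,l))"
  have M: "M \<in> carrier_mat d d" by (simp add: M_def)
  have comm: "\<rho> h * M = M * \<rho> h" if "h \<in> carrier G" for h
    unfolding M_def by (rule average_intertwines[OF G rep rep ij(2,3) that])
  obtain c where c: "M = c \<cdot>\<^sub>m 1\<^sub>m d" using schur_scalar[OF irr M comm] by blast
  have "of_nat d * c = mat_trace M" unfolding c by (simp add: mat_trace_def)
  also have "\<dots> = (\<Sum>a<d. \<Sum>g\<in>carrier G. \<rho> g $$ (a,j) * \<rho> (inv g) $$ (k,a))"
    by (simp add: mat_trace_def M_def)
  also have "\<dots> = (\<Sum>g\<in>carrier G. \<Sum>a<d. \<rho> (inv g) $$ (k,a) * \<rho> g $$ (a,j))"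
    by (subst sum.swap) (simp add: mult.commute)
  also have "\<dots> = (\<Sum>g\<in>carrier G. \<rho> (inv g \<otimes> g) $$ (k,j))"
    by (intro sum.cong refl rep_mult_entry[OF rep, symmetric]) (use ij in auto)
  also have "\<dots> = (\<Sum>g\<in>carrier G. (if j = k then 1 else 0))"
    using r(2) ij by (intro sum.cong) auto
  finally have "of_nat d * c = (if j = k then of_nat (card (carrier G)) else 0)" by simp
  then have cc: "c = (if j = k then of_nat (card (carrier G)) / of_nat d else 0)"
    using irreducibleD(2)[OF irr] by (auto simp: field_simps)
  have "(\<Sum>g\<in>carrier G. \<rho> g $$ (i,j) * \<rho> (inv g) $$ (k,l)) = M $$ (i,l)"
    using ij by (simp add: M_def)
  also have "\<dots> = (if i = l then c else 0)" unfolding c using ij by simp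
  finally show ?thesis using cc by simp
qed

text \<open>The inverse takes the place of complex conjugation, which makes the form bilinear.\<close>
definition class_inner :: "('a, 'b) monoid_scheme \<Rightarrow> ('a \<Rightarrow> complex) \<Rightarrow> ('a \<Rightarrow> complex) \<Rightarrow> complex" where
  "class_inner G f f' = (\<Sum>g\<in>carrier G. f g * f' (inv\<^bsub>G\<^esub> g)) / of_nat (card (carrier G))"

lemma class_inner_cong:
  assumes "group G" "\<And>g. g \<in> carrier G \<Longrightarrow> f g = f1 g" "\<And>g. g \<in> carrier G \<Longrightarrow> f' g = f1' g"
  shows "class_inner G f f' = class_inner G f1 f1'"
  using assms by (simp add: class_inner_def group.inv_closed cong: sum.cong)

lemma class_inner_sum_left:
  "class_inner G (\<lambda>g. \<Sum>x\<in>X. f x g) f' = (\<Sum>x\<in>X. class_inner G (f x) f')"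
  by (simp add: class_inner_def sum_distrib_right sum_divide_distrib) (rule sum.swap)

lemma class_inner_sum_list_left:
  "class_inner G (\<lambda>g. \<Sum>f\<leftarrow>xs. f g) f' = (\<Sum>f\<leftarrow>xs. class_inner G f f')"
  by (induction xs) (simp_all add: class_inner_def distrib_right sum.distrib add_divide_distrib)

lemma class_inner_commute:
  assumes "group G"
  shows "class_inner G f f' = class_inner G f' f"
proof -
  interpret group G by fact
  have "(\<Sum>g\<in>carrier G. f' g * f (inv\<^bsub>G\<^esub> g)) = (\<Sum>g\<in>carrier G. f' (inv\<^bsub>G\<^esub> g) * f (inv\<^bsub>G\<^esub> (inv\<^bsub>G\<^esub> g)))"
    by (rule sum.reindex_bij_betw[OF bij_inv, symmetric])
  also have "\<dots> = (\<Sum>g\<in>carrier G. f g * f' (inv\<^bsub>G\<^esub> g))"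
    by (intro sum.cong) (auto simp: mult.commute)
  finally show ?thesis by (simp add: class_inner_def)
qed

lemma trace_conj:
  fixes G (structure)
  assumes r: "representation G d \<rho>" and s: "representation G e \<sigma>" and g: "g \<in> carrier G"
    and M: "M \<in> carrier_mat d e" and N: "N \<in> carrier_mat e d" and MN: "M * N = 1\<^sub>m d" "N * M = 1\<^sub>m e"
    and comm: "\<rho> g * M = M * \<sigma> g"
  shows "mat_trace (\<rho> g) = mat_trace (\<sigma> g)"
proof -
  note dims = representationD(4,5)[OF r g] representationD(4,5)[OF s g]
    M[THEN carrier_matD(1)] M[THEN carrier_matD(2)] N[THEN carrier_matD(1)] N[THEN carrier_matD(2)]
  have "\<rho> g = \<rho> g * (M * N)" using MN representationD(1)[OF r g] by simp
  also have "\<dots> = M * (\<sigma> g * N)" using dims comm by (simp add: mat_assoc_dim[symmetric])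
  also have "mat_trace \<dots> = mat_trace (\<sigma> g * N * M)"
    by (rule mat_trace_mult_comm[OF M]) (use N representationD(1)[OF s g] in auto)
  also have "\<sigma> g * N * M = \<sigma> g" using dims MN representationD(1)[OF s g] by (simp add: mat_assoc_dim)
  finally show ?thesis .
qed

lemma class_inner_traces:
  assumes "representation G d \<rho>" "representation G e \<sigma>" "group G"
  shows "class_inner G (\<lambda>g. mat_trace (\<rho> g)) (\<lambda>g. mat_trace (\<sigma> g)) =
    (\<Sum>i<d. \<Sum>k<e. \<Sum>g\<in>carrier G. \<rho> g $$ (i,i) * \<sigma> (inv\<^bsub>G\<^esub> g) $$ (k,k)) / of_nat (card (carrier G))"
proof -
  interpret group G by fact
  have "(\<Sum>g\<in>carrier G. mat_trace (\<rho> g) * mat_trace (\<sigma> (inv\<^bsub>G\<^esub> g))) =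
    (\<Sum>g\<in>carrier G. \<Sum>i<d. \<Sum>k<e. \<rho> g $$ (i,i) * \<sigma> (inv\<^bsub>G\<^esub> g) $$ (k,k))"
    using representationD(4)[OF assms(1)] representationD(4)[OF assms(2)]
    by (intro sum.cong) (auto simp: mat_trace_def sum_product)
  also have "\<dots> = (\<Sum>i<d. \<Sum>g\<in>carrier G. \<Sum>k<e. \<rho> g $$ (i,i) * \<sigma> (inv\<^bsub>G\<^esub> g) $$ (k,k))"
    by (rule sum.swap)
  also have "\<dots> = (\<Sum>i<d. \<Sum>k<e. \<Sum>g\<in>carrier G. \<rho> g $$ (i,i) * \<sigma> (inv\<^bsub>G\<^esub> g) $$ (k,k))"
    by (intro sum.cong refl sum.swap)
  finally show ?thesis by (simp add: class_inner_def)
qed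

lemma class_inner_self:
  assumes G: "group G" and fin: "finite (carrier G)" and irr: "irreducible_representation G d \<rho>"
  shows "class_inner G (\<lambda>g. mat_trace (\<rho> g)) (\<lambda>g. mat_trace (\<rho> g)) = 1"
proof -
  interpret group G by fact
  have "card (carrier G) \<noteq> 0" using fin one_closed by (metis card_eq_0_iff empty_iff)
  moreover have "(\<Sum>i<d. \<Sum>k<d. \<Sum>g\<in>carrier G. \<rho> g $$ (i,i) * \<rho> (inv\<^bsub>G\<^esub> g) $$ (k,k))
      = (\<Sum>i<d. \<Sum>k<d. if i = k then of_nat (card (carrier G)) / of_nat d else 0)"
    by (intro sum.cong refl) (simp add: coefficients_self[OF G irr])
  ultimately show ?thesis
    using irreducibleD(2)[OF irr] by (simp add: class_inner_traces[OF irreducibleD(1)[OF irr] irreducibleD(1)[OF irr] G])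
qed

lemma class_inner_inequivalent:
  assumes G: "group G" and irr: "irreducible_representation G d \<rho>" and s: "representation G e \<sigma>"
    and no: "\<not> (\<exists>M\<in>carrier_mat d e. \<exists>N\<in>carrier_mat e d. M * N = 1\<^sub>m d \<and> (\<forall>g\<in>carrier G. \<rho> g * M = M * \<sigma> g))"
  shows "class_inner G (\<lambda>g. mat_trace (\<rho> g)) (\<lambda>g. mat_trace (\<sigma> g)) = 0"
  unfolding class_inner_traces[OF irreducibleD(1)[OF irr] s G]
  by (simp add: coefficients_orthogonal[OF G irr s no])

text \<open>Two irreducible representations either admit an intertwiner with an inverse, and then have equal traces, or all
  sums of products of their coefficients vanish.\<close>
lemma irreducible_characters_orthonormal:
  assumes G: "group G" and fin: "finite (carrier G)"
    and \<chi>: "\<chi> \<in> irreducible_characters G" and \<psi>: "\<psi> \<in> irreducible_characters G"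
  shows "class_inner G \<chi> \<psi> = (if \<chi> = \<psi> then 1 else 0)"
proof -
  obtain d \<rho> where r: "irreducible_representation G d \<rho>" "\<chi> = character_of G \<rho>"
    using \<chi> unfolding irreducible_characters_def by blast
  obtain e \<sigma> where s: "irreducible_representation G e \<sigma>" "\<psi> = character_of G \<sigma>"
    using \<psi> unfolding irreducible_characters_def by blast
  have c: "class_inner G \<chi> \<psi> = class_inner G (\<lambda>g. mat_trace (\<rho> g)) (\<lambda>g. mat_trace (\<sigma> g))"
    using r(2) s(2) by (intro class_inner_cong[OF G]) (auto simp: character_of_def)
  show ?thesis
  proof (cases "\<exists>M\<in>carrier_mat d e. \<exists>N\<in>carrier_mat e d. M * N = 1\<^sub>m d \<and> (\<forall>g\<in>carrier G. \<rho> g * M = M * \<sigma> g)")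
    case True
    then obtain M N where M: "M \<in> carrier_mat d e" and N: "N \<in> carrier_mat e d" and MN: "M * N = 1\<^sub>m d"
      and comm: "\<And>g. g \<in> carrier G \<Longrightarrow> \<rho> g * M = M * \<sigma> g" by blast
    have NM: "N * M = 1\<^sub>m e" by (rule schur_left_inverse[OF r(1) s(1) M comm N MN])
    have t: "mat_trace (\<rho> g) = mat_trace (\<sigma> g)" if "g \<in> carrier G" for g
      by (rule trace_conj[OF irreducibleD(1)[OF r(1)] irreducibleD(1)[OF s(1)] that M N MN NM comm[OF that]])
    then have "\<chi> = \<psi>" using r(2) s(2) by (simp add: character_of_def restrict_def fun_eq_iff)
    moreover have "class_inner G \<chi> \<psi> = class_inner G (\<lambda>g. mat_trace (\<rho> g)) (\<lambda>g. mat_trace (\<rho> g))"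
      unfolding c using t by (intro class_inner_cong[OF G]) auto
    ultimately show ?thesis using class_inner_self[OF G fin r(1)] by simp
  next
    case False
    then have z: "class_inner G \<chi> \<psi> = 0"
      unfolding c by (intro class_inner_inequivalent[OF G r(1) irreducibleD(1)[OF s(1)]])
    moreover have "class_inner G \<chi> \<chi> = 1"
      using class_inner_self[OF G fin r(1)] r(2)
      by (subst class_inner_cong[OF G, of _ "\<lambda>g. mat_trace (\<rho> g)" _ "\<lambda>g. mat_trace (\<rho> g)"]) (auto simp: character_of_def)
    ultimately show ?thesis by auto
  qed
qed

section \<open>Completeness of the irreducible characters\<close>

text \<open>Permutation matrices of left multiplication, after numbering the group elements.\<close>
lemma regular_representation:
  assumes G: "group G" and fin: "finite (carrier G)"
  shows "\<exists>d \<rho>. representation G d \<rho> \<and>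
    (\<forall>g\<in>carrier G. mat_trace (\<rho> g) = (if g = \<one>\<^bsub>G\<^esub> then of_nat (card (carrier G)) else 0))"
proof -
  interpret group G by fact
  define N where "N = card (carrier G)"
  obtain f where f: "bij_betw f {..<N} (carrier G)"
    using ex_bij_betw_nat_finite[OF fin] unfolding N_def lessThan_atLeast0 by blast
  have fG: "f i \<in> carrier G" if "i < N" for i using f that by (auto simp: bij_betw_def)
  define \<rho> :: "'a \<Rightarrow> complex mat" where "\<rho> g = mat N N (\<lambda>(i,j). if g \<otimes>\<^bsub>G\<^esub> f j = f i then 1 else 0)" for g
  have "representation G N \<rho>"
    unfolding representation_def
  proof (intro conjI ballI)
    show "\<rho> \<one>\<^bsub>G\<^esub> = 1\<^sub>m N"
      using f fG by (intro eq_matI) (auto simp: \<rho>_def bij_betw_def inj_on_def)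
    fix g h assume gh: "g \<in> carrier G" "h \<in> carrier G"
    show "\<rho> (g \<otimes>\<^bsub>G\<^esub> h) = \<rho> g * \<rho> h"
    proof (rule eq_matI)
      fix i j assume "i < dim_row (\<rho> g * \<rho> h)" "j < dim_col (\<rho> g * \<rho> h)"
      then have ij: "i < N" "j < N" by (auto simp: \<rho>_def)
      have "h \<otimes>\<^bsub>G\<^esub> f j \<in> f ` {..<N}" using f gh ij fG by (simp add: bij_betw_def)
      then obtain b where b: "b < N" "h \<otimes>\<^bsub>G\<^esub> f j = f b" by auto
      have "(\<rho> g * \<rho> h) $$ (i,j) = (\<Sum>a<N. (if g \<otimes>\<^bsub>G\<^esub> f a = f i then 1 else 0) * (if f b = f a then 1 else 0))"
        using ij b by (simp add: \<rho>_def scalar_prod_def lessThan_atLeast0)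
      also have "\<dots> = (\<Sum>a<N. if a = b then (if g \<otimes>\<^bsub>G\<^esub> f b = f i then 1 else 0) else 0)"
        using f b by (intro sum.cong) (auto simp: bij_betw_def inj_on_def)
      also have "\<dots> = (if g \<otimes>\<^bsub>G\<^esub> f b = f i then 1 else 0)" using b by simp
      also have "\<dots> = \<rho> (g \<otimes>\<^bsub>G\<^esub> h) $$ (i,j)"
        using ij gh fG by (simp add: \<rho>_def m_assoc flip: b(2))
      finally show "\<rho> (g \<otimes>\<^bsub>G\<^esub> h) $$ (i,j) = (\<rho> g * \<rho> h) $$ (i,j)" by simp
    qed (auto simp: \<rho>_def)
  qed (auto simp: \<rho>_def)
  moreover have "mat_trace (\<rho> g) = (if g = \<one>\<^bsub>G\<^esub> then of_nat (card (carrier G)) else 0)" if g: "g \<in> carrier G" for g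
  proof -
    have "mat_trace (\<rho> g) = (\<Sum>i<N. if g = \<one>\<^bsub>G\<^esub> then 1 else 0)"
      unfolding mat_trace_def using g fG by (intro sum.cong) (auto simp: \<rho>_def)
    then show ?thesis by (simp add: N_def)
  qed
  ultimately show ?thesis by blast
qed

lemma regular_decomposition:
  assumes "group G" "finite (carrier G)"
  shows "\<exists>xs. set xs \<subseteq> irreducible_characters G \<and>
    (\<forall>g\<in>carrier G. (\<Sum>f\<leftarrow>xs. f g) = (if g = \<one>\<^bsub>G\<^esub> then of_nat (card (carrier G)) else 0))"
proof -
  obtain d \<rho> where r: "representation G d \<rho>"
    "\<forall>g\<in>carrier G. mat_trace (\<rho> g) = (if g = \<one>\<^bsub>G\<^esub> then of_nat (card (carrier G)) else 0)"
    using regular_representation[OF assms] by blast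
  obtain xs where "set xs \<subseteq> irreducible_characters G" "\<forall>g\<in>carrier G. mat_trace (\<rho> g) = (\<Sum>f\<leftarrow>xs. f g)"
    using trace_sum_irreducible[OF assms(1) r(1)] by blast
  then show ?thesis using r(2) by (intro exI[of _ xs]) simp
qed

lemma irreducible_character_degree:
  assumes G: "group G" and \<chi>: "\<chi> \<in> irreducible_characters G"
  shows "\<exists>d>0. \<chi> \<one>\<^bsub>G\<^esub> = of_nat d"
proof -
  interpret group G by fact
  obtain d \<rho> where r: "irreducible_representation G d \<rho>" "\<chi> = character_of G \<rho>"
    using \<chi> unfolding irreducible_characters_def by blast
  then show ?thesis using irreducibleD(2)[OF r(1)] representationD(2)[OF irreducibleD(1)[OF r(1)]]
    by (intro exI[of _ d]) (simp add: character_of_def)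
qed

text \<open>An irreducible character that does not occur in the regular character would have inner product \<open>0\<close> with it, while this inner product is the
  degree.\<close>
lemma finite_irreducible_characters:
  assumes G: "group G" and fin: "finite (carrier G)"
  shows "finite (irreducible_characters G)"
proof -
  interpret group G by fact
  obtain xs where xs: "set xs \<subseteq> irreducible_characters G"
    and reg: "\<forall>g\<in>carrier G. (\<Sum>f\<leftarrow>xs. f g) = (if g = \<one>\<^bsub>G\<^esub> then of_nat (card (carrier G)) else 0)"
    using regular_decomposition[OF assms] by blast
  have "\<chi> \<in> set xs" if \<chi>: "\<chi> \<in> irreducible_characters G" for \<chi>
  proof (rule ccontr)
    assume n: "\<chi> \<notin> set xs"
    have "class_inner G (\<lambda>g. \<Sum>f\<leftarrow>xs. f g) \<chi> = (\<Sum>f\<leftarrow>xs. class_inner G f \<chi>)"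
      by (rule class_inner_sum_list_left)
    also have "\<dots> = (\<Sum>f\<leftarrow>xs. 0)"
      using xs n \<chi> by (intro arg_cong[where f=sum_list] map_cong refl)
        (auto simp: irreducible_characters_orthonormal[OF assms])
    finally have "class_inner G (\<lambda>g. \<Sum>f\<leftarrow>xs. f g) \<chi> = 0" by simp
    moreover have "(\<Sum>g\<in>carrier G. (\<Sum>f\<leftarrow>xs. f g) * \<chi> (inv\<^bsub>G\<^esub> g))
        = (\<Sum>g\<in>carrier G. if g = \<one>\<^bsub>G\<^esub> then of_nat (card (carrier G)) * \<chi> \<one>\<^bsub>G\<^esub> else 0)"
      using reg by (intro sum.cong) auto
    moreover have "card (carrier G) \<noteq> 0" using fin one_closed by (metis card_eq_0_iff empty_iff)
    ultimately have "\<chi> \<one>\<^bsub>G\<^esub> = 0" using fin by (simp add: class_inner_def)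
    then show False using irreducible_character_degree[OF G \<chi>] by auto
  qed
  then show ?thesis by (intro finite_subset[OF _ finite_set[of xs]]) blast
qed

text \<open>The matrix \<open>\<Sum>g. f g * \<rho> (inv g)\<close> commutes with the irreducible \<open>\<rho>\<close>, so it is scalar, and its trace is a multiple of
  \<open>class_inner G f \<chi>\<close>. The sum in question is the trace of this matrix times \<open>\<rho> h\<close>.\<close>
lemma class_function_irreducible_sum:
  assumes G: "group G" and fin: "finite (carrier G)"
    and clf: "\<And>g h. g \<in> carrier G \<Longrightarrow> h \<in> carrier G \<Longrightarrow> f (g \<otimes>\<^bsub>G\<^esub> h) = f (h \<otimes>\<^bsub>G\<^esub> g)"
    and \<chi>: "\<chi> \<in> irreducible_characters G" and z: "class_inner G f \<chi> = 0" and h: "h \<in> carrier G"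
  shows "(\<Sum>g\<in>carrier G. f g * \<chi> (inv\<^bsub>G\<^esub> g \<otimes>\<^bsub>G\<^esub> h)) = 0"
proof -
  interpret group G by fact
  have card0: "card (carrier G) \<noteq> 0" using fin one_closed by (metis card_eq_0_iff empty_iff)
  obtain d \<rho> where irr: "irreducible_representation G d \<rho>" and \<chi>d: "\<chi> = character_of G \<rho>"
    using \<chi> unfolding irreducible_characters_def by blast
  note rep = irreducibleD(1)[OF irr]
  note r = representationD[OF rep]
  define T where "T = mat d d (\<lambda>(i,l). \<Sum>g\<in>carrier G. f g * \<rho> (inv\<^bsub>G\<^esub> g) $$ (i,l))"
  have T: "T \<in> carrier_mat d d" by (simp add: T_def)
  have Tk: "(T * \<rho> k) $$ (i,l) = (\<Sum>g\<in>carrier G. f g * \<rho> (inv\<^bsub>G\<^esub> g \<otimes>\<^bsub>G\<^esub> k) $$ (i,l))"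
    if k: "k \<in> carrier G" and il: "i < d" "l < d" for k i l
  proof -
    have "(T * \<rho> k) $$ (i,l) = (\<Sum>a<d. \<Sum>g\<in>carrier G. f g * \<rho> (inv\<^bsub>G\<^esub> g) $$ (i,a) * \<rho> k $$ (a,l))"
      using il r(4,5)[OF k] by (simp add: T_def scalar_prod_def lessThan_atLeast0 sum_distrib_right)
    also have "\<dots> = (\<Sum>g\<in>carrier G. \<Sum>a<d. f g * (\<rho> (inv\<^bsub>G\<^esub> g) $$ (i,a) * \<rho> k $$ (a,l)))"
      by (subst sum.swap) (simp add: mult.assoc)
    also have "\<dots> = (\<Sum>g\<in>carrier G. f g * \<rho> (inv\<^bsub>G\<^esub> g \<otimes>\<^bsub>G\<^esub> k) $$ (i,l))"
      using il k by (simp add: rep_mult_entry[OF rep] sum_distrib_left)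
    finally show ?thesis .
  qed
  have kT: "(\<rho> k * T) $$ (i,l) = (\<Sum>g\<in>carrier G. f g * \<rho> (k \<otimes>\<^bsub>G\<^esub> inv\<^bsub>G\<^esub> g) $$ (i,l))"
    if k: "k \<in> carrier G" and il: "i < d" "l < d" for k i l
  proof -
    have "(\<rho> k * T) $$ (i,l) = (\<Sum>a<d. \<Sum>g\<in>carrier G. \<rho> k $$ (i,a) * (f g * \<rho> (inv\<^bsub>G\<^esub> g) $$ (a,l)))"
      using il r(4,5)[OF k] by (simp add: T_def scalar_prod_def lessThan_atLeast0 sum_distrib_left)
    also have "\<dots> = (\<Sum>g\<in>carrier G. \<Sum>a<d. f g * (\<rho> k $$ (i,a) * \<rho> (inv\<^bsub>G\<^esub> g) $$ (a,l)))"
      by (subst sum.swap) (simp add: algebra_simps)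
    also have "\<dots> = (\<Sum>g\<in>carrier G. f g * \<rho> (k \<otimes>\<^bsub>G\<^esub> inv\<^bsub>G\<^esub> g) $$ (i,l))"
      using il k by (simp add: rep_mult_entry[OF rep] sum_distrib_left)
    finally show ?thesis .
  qed
  have "\<rho> k * T = T * \<rho> k" if k: "k \<in> carrier G" for k
  proof (rule eq_matI)
    fix i l assume "i < dim_row (T * \<rho> k)" "l < dim_col (T * \<rho> k)"
    then have il: "i < d" "l < d" using r(5)[OF k] T by auto
    have "(\<rho> k * T) $$ (i,l) = (\<Sum>g\<in>carrier G. f (g \<otimes>\<^bsub>G\<^esub> k) * \<rho> (k \<otimes>\<^bsub>G\<^esub> inv\<^bsub>G\<^esub> (g \<otimes>\<^bsub>G\<^esub> k)) $$ (i,l))"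
      unfolding kT[OF k il] by (rule sum.reindex_bij_betw[OF bij_right_mult[OF k], symmetric])
    also have "\<dots> = (\<Sum>g\<in>carrier G. f (k \<otimes>\<^bsub>G\<^esub> g) * \<rho> (inv\<^bsub>G\<^esub> (k \<otimes>\<^bsub>G\<^esub> g) \<otimes>\<^bsub>G\<^esub> k) $$ (i,l))"
    proof (rule sum.cong[OF refl])
      fix g assume g: "g \<in> carrier G"
      have "k \<otimes>\<^bsub>G\<^esub> inv\<^bsub>G\<^esub> (g \<otimes>\<^bsub>G\<^esub> k) = inv\<^bsub>G\<^esub> g" using g k by (simp add: inv_mult_group m_assoc[symmetric])
      moreover have "inv\<^bsub>G\<^esub> (k \<otimes>\<^bsub>G\<^esub> g) \<otimes>\<^bsub>G\<^esub> k = inv\<^bsub>G\<^esub> g" using g k by (simp add: inv_mult_group m_assoc)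
      ultimately show "f (g \<otimes>\<^bsub>G\<^esub> k) * \<rho> (k \<otimes>\<^bsub>G\<^esub> inv\<^bsub>G\<^esub> (g \<otimes>\<^bsub>G\<^esub> k)) $$ (i,l)
          = f (k \<otimes>\<^bsub>G\<^esub> g) * \<rho> (inv\<^bsub>G\<^esub> (k \<otimes>\<^bsub>G\<^esub> g) \<otimes>\<^bsub>G\<^esub> k) $$ (i,l)"
        using clf[OF g k] by simp
    qed
    also have "\<dots> = (T * \<rho> k) $$ (i,l)"
      unfolding Tk[OF k il] by (rule sum.reindex_bij_betw[OF bij_left_mult[OF k]])
    finally show "(\<rho> k * T) $$ (i,l) = (T * \<rho> k) $$ (i,l)" .
  qed (use T r(4,5)[OF k] in auto)
  then obtain c where c: "T = c \<cdot>\<^sub>m 1\<^sub>m d" using schur_scalar[OF irr T] by blast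
  have "of_nat d * c = mat_trace T" unfolding c by (simp add: mat_trace_def)
  also have "\<dots> = (\<Sum>a<d. \<Sum>g\<in>carrier G. f g * \<rho> (inv\<^bsub>G\<^esub> g) $$ (a,a))"
    by (simp add: mat_trace_def T_def)
  also have "\<dots> = (\<Sum>g\<in>carrier G. f g * mat_trace (\<rho> (inv\<^bsub>G\<^esub> g)))"
    using r(4) by (subst sum.swap) (simp add: mat_trace_def sum_distrib_left)
  also have "\<dots> = (\<Sum>g\<in>carrier G. f g * \<chi> (inv\<^bsub>G\<^esub> g))"
    by (intro sum.cong) (auto simp: \<chi>d character_of_def)
  also have "\<dots> = 0" using z card0 by (simp add: class_inner_def)
  finally have "c = 0" using irreducibleD(2)[OF irr] by simp
  then have T0: "(T * \<rho> h) $$ (i,i) = 0" if "i < d" for i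
    using that r(1)[OF h] unfolding c by (simp add: scalar_prod_def)
  have "(\<Sum>g\<in>carrier G. f g * \<chi> (inv\<^bsub>G\<^esub> g \<otimes>\<^bsub>G\<^esub> h)) = (\<Sum>g\<in>carrier G. \<Sum>a<d. f g * \<rho> (inv\<^bsub>G\<^esub> g \<otimes>\<^bsub>G\<^esub> h) $$ (a,a))"
    using r(4) h by (intro sum.cong) (auto simp: \<chi>d character_of_def mat_trace_def sum_distrib_left)
  also have "\<dots> = (\<Sum>a<d. (T * \<rho> h) $$ (a,a))"
    by (subst sum.swap) (simp add: Tk[OF h])
  also have "\<dots> = 0" using T0 by simp
  finally show ?thesis .
qed

text \<open>Adding up \<open>class_function_irreducible_sum\<close> over the constituents of the regular character turns
  \<open>\<chi> (inv g \<otimes> h)\<close> into a delta function at \<open>g = h\<close>.\<close>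
lemma class_function_eq_zero:
  assumes G: "group G" and fin: "finite (carrier G)"
    and clf: "\<And>g h. g \<in> carrier G \<Longrightarrow> h \<in> carrier G \<Longrightarrow> f (g \<otimes>\<^bsub>G\<^esub> h) = f (h \<otimes>\<^bsub>G\<^esub> g)"
    and z: "\<And>\<chi>. \<chi> \<in> irreducible_characters G \<Longrightarrow> class_inner G f \<chi> = 0" and h: "h \<in> carrier G"
  shows "f h = 0"
proof -
  interpret group G by fact
  have card0: "card (carrier G) \<noteq> 0" using fin one_closed by (metis card_eq_0_iff empty_iff)
  obtain xs where xs: "set xs \<subseteq> irreducible_characters G"
    and reg: "\<forall>g\<in>carrier G. (\<Sum>f\<leftarrow>xs. f g) = (if g = \<one>\<^bsub>G\<^esub> then of_nat (card (carrier G)) else 0)"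
    using regular_decomposition[OF assms(1,2)] by blast
  have "(\<Sum>g\<in>carrier G. f g * (\<Sum>\<chi>\<leftarrow>ys. \<chi> (inv\<^bsub>G\<^esub> g \<otimes>\<^bsub>G\<^esub> h))) = 0" if "set ys \<subseteq> irreducible_characters G" for ys
    using that by (induction ys) (auto simp: distrib_left sum.distrib class_function_irreducible_sum[OF G fin clf _ z h])
  from this[OF xs] have "0 = (\<Sum>g\<in>carrier G. f g * (\<Sum>\<chi>\<leftarrow>xs. \<chi> (inv\<^bsub>G\<^esub> g \<otimes>\<^bsub>G\<^esub> h)))" by simp
  also have "\<dots> = (\<Sum>g\<in>carrier G. if g = h then f h * of_nat (card (carrier G)) else 0)"
  proof (rule sum.cong[OF refl])
    fix g assume g: "g \<in> carrier G"
    have "inv\<^bsub>G\<^esub> g \<otimes>\<^bsub>G\<^esub> h = \<one>\<^bsub>G\<^esub> \<longleftrightarrow> g = h"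
    proof
      assume e: "inv\<^bsub>G\<^esub> g \<otimes>\<^bsub>G\<^esub> h = \<one>\<^bsub>G\<^esub>"
      have "h = g \<otimes>\<^bsub>G\<^esub> (inv\<^bsub>G\<^esub> g \<otimes>\<^bsub>G\<^esub> h)" using g h by (simp add: m_assoc[symmetric])
      then show "g = h" using e g by simp
    qed (use g in simp)
    then show "f g * (\<Sum>\<chi>\<leftarrow>xs. \<chi> (inv\<^bsub>G\<^esub> g \<otimes>\<^bsub>G\<^esub> h)) = (if g = h then f h * of_nat (card (carrier G)) else 0)"
      using reg g h by simp
  qed
  also have "\<dots> = f h * of_nat (card (carrier G))" using fin h by simp
  finally show ?thesis using card0 by simp
qed

section \<open>Twisted Frobenius-Schur indicators\<close>

definition twisted_square_roots :: "('a, 'b) monoid_scheme \<Rightarrow> ('a \<Rightarrow> 'a) \<Rightarrow> 'a \<Rightarrow> 'a set" where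
  "twisted_square_roots G \<tau> g = {y \<in> carrier G. y \<otimes>\<^bsub>G\<^esub> \<tau> y = g}"

definition frobenius_schur :: "('a, 'b) monoid_scheme \<Rightarrow> ('a \<Rightarrow> 'a) \<Rightarrow> ('a \<Rightarrow> complex) \<Rightarrow> complex" where
  "frobenius_schur G \<tau> f = (\<Sum>y\<in>carrier G. f (y \<otimes>\<^bsub>G\<^esub> \<tau> y)) / of_nat (card (carrier G))"

lemma involutive_automorphismD:
  assumes "involutive_automorphism G \<tau>" "group G"
  shows "\<And>g. g \<in> carrier G \<Longrightarrow> \<tau> g \<in> carrier G"
    "\<And>g h. g \<in> carrier G \<Longrightarrow> h \<in> carrier G \<Longrightarrow> \<tau> (g \<otimes>\<^bsub>G\<^esub> h) = \<tau> g \<otimes>\<^bsub>G\<^esub> \<tau> h"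
    "\<And>g. g \<in> carrier G \<Longrightarrow> \<tau> (\<tau> g) = g"
    "\<tau> \<one>\<^bsub>G\<^esub> = \<one>\<^bsub>G\<^esub>"
    "\<And>g. g \<in> carrier G \<Longrightarrow> \<tau> (inv\<^bsub>G\<^esub> g) = inv\<^bsub>G\<^esub> (\<tau> g)"
proof -
  have h: "\<tau> \<in> hom G G" using assms(1) by (simp add: involutive_automorphism_def iso_def)
  then interpret group_hom G G \<tau> using assms(2) by (simp add: group_hom_def group_hom_axioms_def)
  show "\<And>g. g \<in> carrier G \<Longrightarrow> \<tau> g \<in> carrier G" by simp
  show "\<And>g h. g \<in> carrier G \<Longrightarrow> h \<in> carrier G \<Longrightarrow> \<tau> (g \<otimes>\<^bsub>G\<^esub> h) = \<tau> g \<otimes>\<^bsub>G\<^esub> \<tau> h" by simp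
  show "\<And>g. g \<in> carrier G \<Longrightarrow> \<tau> (\<tau> g) = g" using assms(1) by (simp add: involutive_automorphism_def)
  show "\<tau> \<one>\<^bsub>G\<^esub> = \<one>\<^bsub>G\<^esub>" by simp
  show "\<And>g. g \<in> carrier G \<Longrightarrow> \<tau> (inv\<^bsub>G\<^esub> g) = inv\<^bsub>G\<^esub> (\<tau> g)" by simp
qed

lemma transpose_mult_dim:
  fixes A B :: "complex mat"
  assumes "dim_col A = dim_row B"
  shows "transpose_mat (A * B) = transpose_mat B * transpose_mat A"
  using assms by (intro transpose_mult[of _ "dim_row A" "dim_col A" _ "dim_col B"]) auto

text \<open>This representation has the character \<open>g \<mapsto> \<chi> (inv (\<tau> g))\<close>; the indicator detects whether it is equivalent to \<open>\<rho>\<close>.\<close>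
lemma twisted_dual_representation:
  assumes G: "group G" and \<tau>: "involutive_automorphism G \<tau>" and r: "representation G d \<rho>"
  shows "representation G d (\<lambda>g. transpose_mat (\<rho> (inv\<^bsub>G\<^esub> (\<tau> g))))"
proof -
  interpret group G by fact
  note t = involutive_automorphismD[OF \<tau> G]
  note rr = representationD[OF r]
  show ?thesis
    unfolding representation_def
    using t rr by (auto simp: inv_mult_group transpose_mult_dim)
qed

text \<open>The indicator is a sum of products of coefficients of \<open>\<rho>\<close> and of its twisted dual. It vanishes by
  orthogonality unless the two are equivalent. In that case the intertwiner is symmetric or
  antisymmetric, because its transpose intertwines as well, and the indicator is the corresponding sign.\<close>
lemma frobenius_schur_value:
  assumes G: "group G" and fin: "finite (carrier G)" and \<tau>: "involutive_automorphism G \<tau>"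
    and \<chi>: "\<chi> \<in> irreducible_characters G"
  shows "if \<forall>g\<in>carrier G. \<chi> (inv\<^bsub>G\<^esub> (\<tau> g)) = \<chi> g then frobenius_schur G \<tau> \<chi> \<in> {1, -1}
         else frobenius_schur G \<tau> \<chi> = 0"
proof -
  interpret group G by fact
  have card0: "card (carrier G) \<noteq> 0" using fin one_closed by (metis card_eq_0_iff empty_iff)
  note t = involutive_automorphismD[OF \<tau> G]
  obtain d \<rho> where irr: "irreducible_representation G d \<rho>" and \<chi>d: "\<chi> = character_of G \<rho>"
    using \<chi> unfolding irreducible_characters_def by blast
  note rep = irreducibleD(1)[OF irr]
  note r = representationD[OF rep]
  define \<rho>' where "\<rho>' g = transpose_mat (\<rho> (inv\<^bsub>G\<^esub> (\<tau> g)))" for g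
  have rep': "representation G d \<rho>'"
    unfolding \<rho>'_def by (rule twisted_dual_representation[OF G \<tau> rep])
  note r' = representationD[OF rep']
  have \<chi>': "mat_trace (\<rho>' g) = \<chi> (inv\<^bsub>G\<^esub> (\<tau> g))" if "g \<in> carrier G" for g
    using that t r(4,5) by (simp add: \<rho>'_def \<chi>d character_of_def mat_trace_def)
  have \<chi>r: "mat_trace (\<rho> g) = \<chi> g" if "g \<in> carrier G" for g
    using that by (simp add: \<chi>d character_of_def)
  have \<rho>'inv: "\<rho>' (inv\<^bsub>G\<^esub> g) $$ (i,j) = \<rho> (\<tau> g) $$ (j,i)" if "g \<in> carrier G" "i < d" "j < d" for g i j
    using that t r(4,5) by (simp add: \<rho>'_def)
  have fs: "frobenius_schur G \<tau> \<chi> =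
     (\<Sum>i<d. \<Sum>j<d. \<Sum>g\<in>carrier G. \<rho> g $$ (i,j) * \<rho>' (inv\<^bsub>G\<^esub> g) $$ (i,j)) / of_nat (card (carrier G))"
  proof -
    have "(\<Sum>y\<in>carrier G. \<chi> (y \<otimes>\<^bsub>G\<^esub> \<tau> y)) = (\<Sum>y\<in>carrier G. \<Sum>i<d. \<Sum>j<d. \<rho> y $$ (i,j) * \<rho>' (inv\<^bsub>G\<^esub> y) $$ (i,j))"
    proof (rule sum.cong[OF refl])
      fix y assume y: "y \<in> carrier G"
      have "\<chi> (y \<otimes>\<^bsub>G\<^esub> \<tau> y) = (\<Sum>i<d. \<rho> (y \<otimes>\<^bsub>G\<^esub> \<tau> y) $$ (i,i))"
        using y t r(4)[of "y \<otimes>\<^bsub>G\<^esub> \<tau> y"] by (simp add: \<chi>r[symmetric] mat_trace_def)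
      also have "\<dots> = (\<Sum>i<d. \<Sum>j<d. \<rho> y $$ (i,j) * \<rho>' (inv\<^bsub>G\<^esub> y) $$ (i,j))"
        using y t by (simp add: rep_mult_entry[OF rep] \<rho>'inv)
      finally show "\<chi> (y \<otimes>\<^bsub>G\<^esub> \<tau> y) = (\<Sum>i<d. \<Sum>j<d. \<rho> y $$ (i,j) * \<rho>' (inv\<^bsub>G\<^esub> y) $$ (i,j))" .
    qed
    also have "\<dots> = (\<Sum>i<d. \<Sum>y\<in>carrier G. \<Sum>j<d. \<rho> y $$ (i,j) * \<rho>' (inv\<^bsub>G\<^esub> y) $$ (i,j))"
      by (rule sum.swap)
    also have "\<dots> = (\<Sum>i<d. \<Sum>j<d. \<Sum>y\<in>carrier G. \<rho> y $$ (i,j) * \<rho>' (inv\<^bsub>G\<^esub> y) $$ (i,j))"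
      by (intro sum.cong refl sum.swap)
    finally show ?thesis by (simp add: frobenius_schur_def)
  qed
  show ?thesis
  proof (cases "\<exists>M\<in>carrier_mat d d. \<exists>N\<in>carrier_mat d d. M * N = 1\<^sub>m d \<and> (\<forall>g\<in>carrier G. \<rho> g * M = M * \<rho>' g)")
    case no: False
    have "frobenius_schur G \<tau> \<chi> = 0"
      unfolding fs by (simp add: coefficients_orthogonal[OF G irr rep' no])
    moreover have "\<not> (\<forall>g\<in>carrier G. \<chi> (inv\<^bsub>G\<^esub> (\<tau> g)) = \<chi> g)"
    proof
      assume eq: "\<forall>g\<in>carrier G. \<chi> (inv\<^bsub>G\<^esub> (\<tau> g)) = \<chi> g"
      have "class_inner G (\<lambda>g. mat_trace (\<rho> g)) (\<lambda>g. mat_trace (\<rho> g)) = class_inner G (\<lambda>g. mat_trace (\<rho> g)) (\<lambda>g. mat_trace (\<rho>' g))"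
        by (rule class_inner_cong[OF G]) (use eq in \<open>simp_all add: \<chi>' \<chi>r\<close>)
      then show False using class_inner_self[OF G fin irr] class_inner_inequivalent[OF G irr rep' no] by simp
    qed
    ultimately show ?thesis by simp
  next
    case True
    then obtain M A where M: "M \<in> carrier_mat d d" and A: "A \<in> carrier_mat d d" and MA: "M * A = 1\<^sub>m d"
      and comm: "\<And>g. g \<in> carrier G \<Longrightarrow> \<rho> g * M = M * \<rho>' g" by blast
    have AM: "A * M = 1\<^sub>m d" by (rule mat_mult_left_right_inverse[OF M A MA])
    note dims = M[THEN carrier_matD(1)] M[THEN carrier_matD(2)] A[THEN carrier_matD(1)] A[THEN carrier_matD(2)]
    have tr: "\<chi> (inv\<^bsub>G\<^esub> (\<tau> g)) = \<chi> g" if g: "g \<in> carrier G" for g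
      using trace_conj[OF rep rep' g M A MA AM comm[OF g]] \<chi>'[OF g] \<chi>r[OF g] by simp
    have conj: "\<rho>' g = A * (\<rho> g * M)" if g: "g \<in> carrier G" for g
    proof -
      have "\<rho>' g = A * M * \<rho>' g" using AM r'(1)[OF g] by simp
      then show ?thesis using dims r'(4,5)[OF g] comm[OF g] by (simp add: mat_assoc_dim)
    qed
    have comm': "A * \<rho> g = \<rho>' g * A" if g: "g \<in> carrier G" for g
      unfolding conj[OF g] using dims r(1,4,5)[OF g] MA by (simp add: mat_assoc_dim)
    have commT: "transpose_mat A * \<rho> g = \<rho>' g * transpose_mat A" if g: "g \<in> carrier G" for g
    proof -
      let ?g = "inv\<^bsub>G\<^esub> (\<tau> g)"
      have g': "?g \<in> carrier G" using t g by simp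
      have "inv\<^bsub>G\<^esub> (\<tau> ?g) = g" using t g by simp
      then have e: "\<rho>' ?g = transpose_mat (\<rho> g)" by (simp add: \<rho>'_def)
      have "transpose_mat (A * \<rho> ?g) = transpose_mat (transpose_mat (\<rho> g) * A)"
        using comm'[OF g'] e by simp
      then show ?thesis
        using dims r(4,5)[OF g] r(4,5)[OF g'] by (simp add: transpose_mult_dim \<rho>'_def)
    qed
    \<comment> \<open>\<open>A\<close> and its transpose intertwine the same two irreducible representations, so they are proportional, with a factor \<open>s\<close> of square \<open>1\<close>.\<close>
    define At where "At = transpose_mat A"
    have At: "At \<in> carrier_mat d d" using A by (simp add: At_def)
    have "\<rho> g * (M * At) = M * At * \<rho> g" if g: "g \<in> carrier G" for g
    proof -
      have "\<rho> g * (M * At) = M * (\<rho>' g * At)"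
        using dims At r(4,5)[OF g] r'(4,5)[OF g] comm[OF g] by (simp add: mat_assoc_dim[symmetric])
      also have "\<dots> = M * At * \<rho> g"
        using dims At r(4,5)[OF g] commT[OF g, folded At_def] by (simp add: mat_assoc_dim)
      finally show ?thesis .
    qed
    then obtain s where s: "M * At = s \<cdot>\<^sub>m 1\<^sub>m d"
      using schur_scalar[OF irr, of "M * At"] M At by auto
    have "At = A * M * At" using AM At by simp
    also have "\<dots> = A * (s \<cdot>\<^sub>m 1\<^sub>m d)" using dims At s by (simp add: mat_assoc_dim)
    also have "\<dots> = s \<cdot>\<^sub>m A" using A by (subst mult_smult_distrib[of _ d d _ d]) auto
    finally have Ats: "At = s \<cdot>\<^sub>m A" .
    have As: "A $$ (j,i) = s * A $$ (i,j)" if "i < d" "j < d" for i j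
    proof -
      have "At $$ (i,j) = s * A $$ (i,j)" unfolding Ats using that A by simp
      then show ?thesis using that A by (simp add: At_def)
    qed
    have "\<exists>i<d. \<exists>j<d. A $$ (i,j) \<noteq> 0"
    proof (rule ccontr)
      assume "\<not> (\<exists>i<d. \<exists>j<d. A $$ (i,j) \<noteq> 0)"
      then have "(M * A) $$ (0,0) = 0" using M A irreducibleD(2)[OF irr] by (simp add: scalar_prod_def)
      then show False using MA irreducibleD(2)[OF irr] by simp
    qed
    then obtain i0 j0 where ij0: "i0 < d" "j0 < d" "A $$ (i0,j0) \<noteq> 0" by blast
    have "s * s = 1" using As[OF ij0(1,2)] As[OF ij0(2,1)] ij0(3) by simp
    then have s1: "s \<in> {1,-1}" by (simp add: square_eq_1_iff)
    have AMs: "(\<Sum>i<d. \<Sum>j<d. A $$ (i,j) * M $$ (i,j)) = s * of_nat d"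
    proof -
      have "(\<Sum>i<d. \<Sum>j<d. A $$ (i,j) * M $$ (i,j)) = (\<Sum>i<d. \<Sum>j<d. s * (M $$ (i,j) * A $$ (j,i)))"
      proof (intro sum.cong refl)
        fix i j assume "i \<in> {..<d}" "j \<in> {..<d}"
        then have "A $$ (i,j) = s * A $$ (j,i)" using As[of j i] by simp
        then show "A $$ (i,j) * M $$ (i,j) = s * (M $$ (i,j) * A $$ (j,i))" by (simp only: mult_ac)
      qed
      also have "\<dots> = s * (\<Sum>i<d. (M * A) $$ (i,i))"
        using M A by (simp add: scalar_prod_def lessThan_atLeast0 sum_distrib_left)
      finally show ?thesis using MA by simp
    qed
    have "(\<Sum>g\<in>carrier G. \<rho> g $$ (i,j) * \<rho>' (inv\<^bsub>G\<^esub> g) $$ (i,j))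
         = A $$ (i,j) * M $$ (i,j) * (of_nat (card (carrier G)) / of_nat d)" if ij: "i < d" "j < d" for i j
    proof -
      have "(\<Sum>g\<in>carrier G. \<rho> g $$ (i,j) * \<rho>' (inv\<^bsub>G\<^esub> g) $$ (i,j))
         = (\<Sum>g\<in>carrier G. \<Sum>k<d. \<Sum>l<d. A $$ (i,k) * M $$ (l,j) * (\<rho> g $$ (i,j) * \<rho> (inv\<^bsub>G\<^esub> g) $$ (k,l)))"
      proof (rule sum.cong[OF refl])
        fix g assume g: "g \<in> carrier G"
        have "\<rho>' (inv\<^bsub>G\<^esub> g) $$ (i,j) = (\<Sum>k<d. \<Sum>l<d. A $$ (i,k) * (\<rho> (inv\<^bsub>G\<^esub> g) $$ (k,l) * M $$ (l,j)))"
          unfolding conj[OF inv_closed[OF g]] using M A r(4,5)[OF inv_closed[OF g]] ij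
          by (simp add: scalar_prod_def lessThan_atLeast0 sum_distrib_left)
        then show "\<rho> g $$ (i,j) * \<rho>' (inv\<^bsub>G\<^esub> g) $$ (i,j)
           = (\<Sum>k<d. \<Sum>l<d. A $$ (i,k) * M $$ (l,j) * (\<rho> g $$ (i,j) * \<rho> (inv\<^bsub>G\<^esub> g) $$ (k,l)))"
          by (simp add: sum_distrib_left mult_ac)
      qed
      also have "\<dots> = (\<Sum>k<d. \<Sum>g\<in>carrier G. \<Sum>l<d. A $$ (i,k) * M $$ (l,j) * (\<rho> g $$ (i,j) * \<rho> (inv\<^bsub>G\<^esub> g) $$ (k,l)))"
        by (rule sum.swap)
      also have "\<dots> = (\<Sum>k<d. \<Sum>l<d. \<Sum>g\<in>carrier G. A $$ (i,k) * M $$ (l,j) * (\<rho> g $$ (i,j) * \<rho> (inv\<^bsub>G\<^esub> g) $$ (k,l)))"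
        by (intro sum.cong refl sum.swap)
      also have "\<dots> = (\<Sum>k<d. \<Sum>l<d. A $$ (i,k) * M $$ (l,j) *
            (if i = l \<and> j = k then of_nat (card (carrier G)) / of_nat d else 0))"
        using ij by (intro sum.cong refl) (simp add: coefficients_self[OF G irr] flip: sum_distrib_left)
      also have "\<dots> = (\<Sum>k<d. \<Sum>l<d. if l = i then (if k = j then A $$ (i,j) * M $$ (i,j) * (of_nat (card (carrier G)) / of_nat d) else 0) else 0)"
        by (intro sum.cong refl) auto
      also have "\<dots> = A $$ (i,j) * M $$ (i,j) * (of_nat (card (carrier G)) / of_nat d)"
        using ij by simp
      finally show ?thesis .
    qed
    then have "frobenius_schur G \<tau> \<chi> =
        (\<Sum>i<d. \<Sum>j<d. A $$ (i,j) * M $$ (i,j)) * (of_nat (card (carrier G)) / of_nat d) / of_nat (card (carrier G))"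
      unfolding fs by (simp add: sum_distrib_right sum_divide_distrib)
    also have "\<dots> = s" using card0 irreducibleD(2)[OF irr] by (simp add: AMs)
    finally show ?thesis using s1 tr by simp
  qed
qed

text \<open>Sorting the group elements \<open>y\<close> by the value \<open>y \<otimes> \<tau> y\<close> turns the indicator into a class sum.\<close>
lemma frobenius_schur_class_inner:
  assumes G: "group G" and fin: "finite (carrier G)" and \<tau>: "involutive_automorphism G \<tau>"
  shows "class_inner G (\<lambda>g. of_nat (card (twisted_square_roots G \<tau> g))) f
     = frobenius_schur G \<tau> (\<lambda>g. f (inv\<^bsub>G\<^esub> g))"
proof -
  interpret group G by fact
  note t = involutive_automorphismD[OF \<tau> G]
  have "(\<Sum>g\<in>carrier G. of_nat (card (twisted_square_roots G \<tau> g)) * f (inv\<^bsub>G\<^esub> g))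
     = (\<Sum>g\<in>carrier G. \<Sum>y\<in>{y\<in>carrier G. y \<otimes>\<^bsub>G\<^esub> \<tau> y = g}. f (inv\<^bsub>G\<^esub> (y \<otimes>\<^bsub>G\<^esub> \<tau> y)))"
    by (simp add: twisted_square_roots_def)
  also have "\<dots> = (\<Sum>y\<in>carrier G. f (inv\<^bsub>G\<^esub> (y \<otimes>\<^bsub>G\<^esub> \<tau> y)))"
    using fin t by (intro sum.group) auto
  finally show ?thesis by (simp add: class_inner_def frobenius_schur_def)
qed

text \<open>The substitution of \<open>inv (\<tau> y)\<close> for \<open>y\<close> inverts the value \<open>y \<otimes> \<tau> y\<close>, since \<open>inv (\<tau> y) \<otimes> inv y = inv (y \<otimes> \<tau> y)\<close>.\<close>
lemma frobenius_schur_inv: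
  assumes G: "group G" and \<tau>: "involutive_automorphism G \<tau>"
  shows "frobenius_schur G \<tau> (\<lambda>g. f (inv\<^bsub>G\<^esub> g)) = frobenius_schur G \<tau> f"
proof -
  interpret group G by fact
  note t = involutive_automorphismD[OF \<tau> G]
  have b: "bij_betw (\<lambda>y. inv\<^bsub>G\<^esub> (\<tau> y)) (carrier G) (carrier G)"
    by (rule bij_betw_byWitness[where f' = "\<lambda>y. inv\<^bsub>G\<^esub> (\<tau> y)"]) (use t in auto)
  have "(\<Sum>y\<in>carrier G. f (inv\<^bsub>G\<^esub> (y \<otimes>\<^bsub>G\<^esub> \<tau> y)))
    = (\<Sum>y\<in>carrier G. f (inv\<^bsub>G\<^esub> (\<tau> y) \<otimes>\<^bsub>G\<^esub> \<tau> (inv\<^bsub>G\<^esub> (\<tau> y))))"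
    using t by (intro sum.cong) (auto simp: inv_mult_group)
  also have "\<dots> = (\<Sum>y\<in>carrier G. f (y \<otimes>\<^bsub>G\<^esub> \<tau> y))"
    by (rule sum.reindex_bij_betw[OF b])
  finally show ?thesis by (simp add: frobenius_schur_def)
qed

lemma square_roots_class_inner:
  assumes "group G" "finite (carrier G)" "involutive_automorphism G \<tau>"
  shows "class_inner G (\<lambda>g. of_nat (card (twisted_square_roots G \<tau> g))) f = frobenius_schur G \<tau> f"
  using frobenius_schur_class_inner[OF assms] frobenius_schur_inv[OF assms(1,3)] by metis

lemma character_commute:
  assumes G: "group G" and \<chi>: "\<chi> \<in> irreducible_characters G" and gh: "g \<in> carrier G" "h \<in> carrier G"
  shows "\<chi> (g \<otimes>\<^bsub>G\<^esub> h) = \<chi> (h \<otimes>\<^bsub>G\<^esub> g)"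
proof -
  interpret group G by fact
  obtain d \<rho> where irr: "irreducible_representation G d \<rho>" and \<chi>d: "\<chi> = character_of G \<rho>"
    using \<chi> unfolding irreducible_characters_def by blast
  note r = representationD[OF irreducibleD(1)[OF irr]]
  have "mat_trace (\<rho> g * \<rho> h) = mat_trace (\<rho> h * \<rho> g)"
    by (rule mat_trace_mult_comm[OF r(1)[OF gh(1)] r(1)[OF gh(2)]])
  then show ?thesis using gh r(3)[OF gh] r(3)[OF gh(2,1)] by (simp add: \<chi>d character_of_def)
qed

lemma (in group) translate_cancel:
  assumes "h \<in> carrier G" "k \<in> carrier G" "y \<in> carrier G"
  shows "inv h \<otimes> (h \<otimes> y \<otimes> inv k) \<otimes> k = y" "h \<otimes> (inv h \<otimes> y \<otimes> k) \<otimes> inv k = y"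
proof -
  have "inv h \<otimes> (h \<otimes> y \<otimes> inv k) = y \<otimes> inv k" "h \<otimes> (inv h \<otimes> y \<otimes> k) = y \<otimes> k"
    using assms by (simp_all add: m_assoc[symmetric])
  then show "inv h \<otimes> (h \<otimes> y \<otimes> inv k) \<otimes> k = y" "h \<otimes> (inv h \<otimes> y \<otimes> k) \<otimes> inv k = y"
    using assms by (simp_all add: m_assoc)
qed

text \<open>Twisted conjugation by \<open>h\<close> carries the square roots of \<open>g \<otimes> h\<close> to those of \<open>h \<otimes> g\<close>.\<close>
lemma square_roots_class_function:
  assumes G: "group G" and \<tau>: "involutive_automorphism G \<tau>" and gh: "g \<in> carrier G" "h \<in> carrier G"
  shows "card (twisted_square_roots G \<tau> (g \<otimes>\<^bsub>G\<^esub> h)) = card (twisted_square_roots G \<tau> (h \<otimes>\<^bsub>G\<^esub> g))"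
proof -
  interpret group G by fact
  note t = involutive_automorphismD[OF \<tau> G]
  have tr: "h \<otimes>\<^bsub>G\<^esub> y \<otimes>\<^bsub>G\<^esub> inv\<^bsub>G\<^esub> (\<tau> h) \<in> twisted_square_roots G \<tau> (h \<otimes>\<^bsub>G\<^esub> g)"
    if gh: "g \<in> carrier G" "h \<in> carrier G" and y: "y \<in> twisted_square_roots G \<tau> (g \<otimes>\<^bsub>G\<^esub> h)" for g h y
  proof -
    have yG: "y \<in> carrier G" and yy: "y \<otimes>\<^bsub>G\<^esub> \<tau> y = g \<otimes>\<^bsub>G\<^esub> h"
      using y by (auto simp: twisted_square_roots_def)
    have "h \<otimes>\<^bsub>G\<^esub> y \<otimes>\<^bsub>G\<^esub> inv\<^bsub>G\<^esub> (\<tau> h) \<otimes>\<^bsub>G\<^esub> \<tau> (h \<otimes>\<^bsub>G\<^esub> y \<otimes>\<^bsub>G\<^esub> inv\<^bsub>G\<^esub> (\<tau> h))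
       = h \<otimes>\<^bsub>G\<^esub> (y \<otimes>\<^bsub>G\<^esub> \<tau> y) \<otimes>\<^bsub>G\<^esub> inv\<^bsub>G\<^esub> h"
    proof -
      have "\<tau> (h \<otimes>\<^bsub>G\<^esub> y \<otimes>\<^bsub>G\<^esub> inv\<^bsub>G\<^esub> (\<tau> h)) = \<tau> h \<otimes>\<^bsub>G\<^esub> (\<tau> y \<otimes>\<^bsub>G\<^esub> inv\<^bsub>G\<^esub> h)"
        using yG gh t by (simp add: m_assoc)
      moreover have "inv\<^bsub>G\<^esub> (\<tau> h) \<otimes>\<^bsub>G\<^esub> (\<tau> h \<otimes>\<^bsub>G\<^esub> (\<tau> y \<otimes>\<^bsub>G\<^esub> inv\<^bsub>G\<^esub> h)) = \<tau> y \<otimes>\<^bsub>G\<^esub> inv\<^bsub>G\<^esub> h"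
        using yG gh t by (simp add: m_assoc[symmetric])
      ultimately show ?thesis using yG gh t by (simp add: m_assoc)
    qed
    also have "\<dots> = h \<otimes>\<^bsub>G\<^esub> g" unfolding yy using gh by (simp add: m_assoc)
    finally show ?thesis unfolding twisted_square_roots_def using yG gh t(1) by blast
  qed
  have "bij_betw (\<lambda>y. h \<otimes>\<^bsub>G\<^esub> y \<otimes>\<^bsub>G\<^esub> inv\<^bsub>G\<^esub> (\<tau> h)) (twisted_square_roots G \<tau> (g \<otimes>\<^bsub>G\<^esub> h)) (twisted_square_roots G \<tau> (h \<otimes>\<^bsub>G\<^esub> g))"
  proof (rule bij_betw_byWitness[where f' = "\<lambda>y. inv\<^bsub>G\<^esub> h \<otimes>\<^bsub>G\<^esub> y \<otimes>\<^bsub>G\<^esub> \<tau> h"])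
    show "\<forall>y\<in>twisted_square_roots G \<tau> (g \<otimes>\<^bsub>G\<^esub> h). inv\<^bsub>G\<^esub> h \<otimes>\<^bsub>G\<^esub> (h \<otimes>\<^bsub>G\<^esub> y \<otimes>\<^bsub>G\<^esub> inv\<^bsub>G\<^esub> (\<tau> h)) \<otimes>\<^bsub>G\<^esub> \<tau> h = y"
      by (intro ballI translate_cancel gh t(1)) (simp add: twisted_square_roots_def)
    show "\<forall>y\<in>twisted_square_roots G \<tau> (h \<otimes>\<^bsub>G\<^esub> g). h \<otimes>\<^bsub>G\<^esub> (inv\<^bsub>G\<^esub> h \<otimes>\<^bsub>G\<^esub> y \<otimes>\<^bsub>G\<^esub> \<tau> h) \<otimes>\<^bsub>G\<^esub> inv\<^bsub>G\<^esub> (\<tau> h) = y"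
      by (intro ballI translate_cancel gh t(1)) (simp add: twisted_square_roots_def)
    show "(\<lambda>y. h \<otimes>\<^bsub>G\<^esub> y \<otimes>\<^bsub>G\<^esub> inv\<^bsub>G\<^esub> (\<tau> h)) ` twisted_square_roots G \<tau> (g \<otimes>\<^bsub>G\<^esub> h) \<subseteq> twisted_square_roots G \<tau> (h \<otimes>\<^bsub>G\<^esub> g)"
      by (intro image_subsetI tr gh)
    show "(\<lambda>y. inv\<^bsub>G\<^esub> h \<otimes>\<^bsub>G\<^esub> y \<otimes>\<^bsub>G\<^esub> \<tau> h) ` twisted_square_roots G \<tau> (h \<otimes>\<^bsub>G\<^esub> g) \<subseteq> twisted_square_roots G \<tau> (g \<otimes>\<^bsub>G\<^esub> h)"
    proof (rule image_subsetI)
      fix y assume y: "y \<in> twisted_square_roots G \<tau> (h \<otimes>\<^bsub>G\<^esub> g)"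
      have e1: "(h \<otimes>\<^bsub>G\<^esub> g \<otimes>\<^bsub>G\<^esub> h) \<otimes>\<^bsub>G\<^esub> inv\<^bsub>G\<^esub> h = h \<otimes>\<^bsub>G\<^esub> g"
        using gh by (simp add: m_assoc)
      have e2: "inv\<^bsub>G\<^esub> h \<otimes>\<^bsub>G\<^esub> (h \<otimes>\<^bsub>G\<^esub> g \<otimes>\<^bsub>G\<^esub> h) = g \<otimes>\<^bsub>G\<^esub> h"
        using gh by (simp add: m_assoc[symmetric])
      have e3: "inv\<^bsub>G\<^esub> (\<tau> (inv\<^bsub>G\<^esub> h)) = \<tau> h" using gh t by simp
      have "inv\<^bsub>G\<^esub> h \<otimes>\<^bsub>G\<^esub> y \<otimes>\<^bsub>G\<^esub> inv\<^bsub>G\<^esub> (\<tau> (inv\<^bsub>G\<^esub> h))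
          \<in> twisted_square_roots G \<tau> (inv\<^bsub>G\<^esub> h \<otimes>\<^bsub>G\<^esub> (h \<otimes>\<^bsub>G\<^esub> g \<otimes>\<^bsub>G\<^esub> h))"
        by (rule tr) (use gh y in \<open>simp_all add: e1\<close>)
      then show "inv\<^bsub>G\<^esub> h \<otimes>\<^bsub>G\<^esub> y \<otimes>\<^bsub>G\<^esub> \<tau> h \<in> twisted_square_roots G \<tau> (g \<otimes>\<^bsub>G\<^esub> h)"
        unfolding e2 e3 .
    qed
  qed
  then show ?thesis by (rule bij_betw_same_card)
qed

lemma class_function_expansion:
  assumes G: "group G" and fin: "finite (carrier G)"
    and clf: "\<And>g h. g \<in> carrier G \<Longrightarrow> h \<in> carrier G \<Longrightarrow> f (g \<otimes>\<^bsub>G\<^esub> h) = f (h \<otimes>\<^bsub>G\<^esub> g)" and h: "h \<in> carrier G"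
  shows "f h = (\<Sum>\<chi>\<in>irreducible_characters G. class_inner G f \<chi> * \<chi> h)"
proof -
  let ?I = "irreducible_characters G"
  define f' where "f' g = f g - (\<Sum>\<chi>\<in>?I. class_inner G f \<chi> * \<chi> g)" for g
  have "f' h = 0"
  proof (rule class_function_eq_zero[OF G fin _ _ h])
    show "f' (g \<otimes>\<^bsub>G\<^esub> k) = f' (k \<otimes>\<^bsub>G\<^esub> g)" if "g \<in> carrier G" "k \<in> carrier G" for g k
      unfolding f'_def clf[OF that]
      by (intro arg_cong2[where f = "(-)"] sum.cong refl arg_cong2[where f = "(*)"] character_commute[OF G _ that])
    fix \<psi> assume \<psi>: "\<psi> \<in> ?I"
    have "class_inner G f' \<psi> = class_inner G f \<psi> - class_inner G (\<lambda>g. \<Sum>\<chi>\<in>?I. class_inner G f \<chi> * \<chi> g) \<psi>"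
      unfolding f'_def by (simp add: class_inner_def left_diff_distrib sum_subtractf diff_divide_distrib)
    also have "class_inner G (\<lambda>g. \<Sum>\<chi>\<in>?I. class_inner G f \<chi> * \<chi> g) \<psi>
       = (\<Sum>\<chi>\<in>?I. class_inner G (\<lambda>g. class_inner G f \<chi> * \<chi> g) \<psi>)"
      by (rule class_inner_sum_left)
    also have "\<dots> = (\<Sum>\<chi>\<in>?I. class_inner G f \<chi> * class_inner G \<chi> \<psi>)"
      by (simp add: class_inner_def sum_distrib_left sum_divide_distrib mult.assoc)
    also have "\<dots> = (\<Sum>\<chi>\<in>?I. if \<chi> = \<psi> then class_inner G f \<psi> else 0)"
      using \<psi> by (intro sum.cong refl) (simp add: irreducible_characters_orthonormal[OF G fin])
    also have "\<dots> = class_inner G f \<psi>"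
      using \<psi> finite_irreducible_characters[OF G fin] by simp
    finally show "class_inner G f' \<psi> = 0" by simp
  qed
  then show ?thesis by (simp add: f'_def)
qed

text \<open>The indicator function of the conjugacy class of \<open>g\<close> is a combination of irreducible characters.\<close>
lemma characters_separate_classes:
  assumes G: "group G" and fin: "finite (carrier G)" and gh: "g \<in> carrier G" "h \<in> carrier G"
    and eq: "\<And>\<chi>. \<chi> \<in> irreducible_characters G \<Longrightarrow> \<chi> g = \<chi> h"
  shows "\<exists>t\<in>carrier G. t \<otimes>\<^bsub>G\<^esub> g = h \<otimes>\<^bsub>G\<^esub> t"
proof -
  interpret group G by fact
  define f :: "'a \<Rightarrow> complex" where "f x = (if \<exists>t\<in>carrier G. t \<otimes>\<^bsub>G\<^esub> g = x \<otimes>\<^bsub>G\<^esub> t then 1 else 0)" for x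
  have tr: "\<exists>t\<in>carrier G. t \<otimes>\<^bsub>G\<^esub> g = y \<otimes>\<^bsub>G\<^esub> x \<otimes>\<^bsub>G\<^esub> t"
    if xy: "x \<in> carrier G" "y \<in> carrier G" and t: "t \<in> carrier G" "t \<otimes>\<^bsub>G\<^esub> g = x \<otimes>\<^bsub>G\<^esub> y \<otimes>\<^bsub>G\<^esub> t" for x y t
  proof (rule bexI[of _ "y \<otimes>\<^bsub>G\<^esub> t"])
    have "y \<otimes>\<^bsub>G\<^esub> t \<otimes>\<^bsub>G\<^esub> g = y \<otimes>\<^bsub>G\<^esub> (t \<otimes>\<^bsub>G\<^esub> g)" using xy t(1) gh by (simp only: m_assoc)
    also have "\<dots> = y \<otimes>\<^bsub>G\<^esub> x \<otimes>\<^bsub>G\<^esub> (y \<otimes>\<^bsub>G\<^esub> t)" unfolding t(2) using xy t(1) by (simp add: m_assoc)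
    finally show "y \<otimes>\<^bsub>G\<^esub> t \<otimes>\<^bsub>G\<^esub> g = y \<otimes>\<^bsub>G\<^esub> x \<otimes>\<^bsub>G\<^esub> (y \<otimes>\<^bsub>G\<^esub> t)" .
  qed (use xy t in simp)
  have clf: "f (x \<otimes>\<^bsub>G\<^esub> y) = f (y \<otimes>\<^bsub>G\<^esub> x)" if "x \<in> carrier G" "y \<in> carrier G" for x y
    unfolding f_def using tr[OF that] tr[OF that(2,1)] by auto
  have "f g = (\<Sum>\<chi>\<in>irreducible_characters G. class_inner G f \<chi> * \<chi> g)"
    by (rule class_function_expansion[OF G fin _ gh(1)]) (rule clf)
  also have "\<dots> = (\<Sum>\<chi>\<in>irreducible_characters G. class_inner G f \<chi> * \<chi> h)"
    using eq by (intro sum.cong refl) simp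
  also have "\<dots> = f h"
    by (rule class_function_expansion[OF G fin _ gh(2), symmetric]) (rule clf)
  finally have "f g = f h" .
  moreover have "\<exists>t\<in>carrier G. t \<otimes>\<^bsub>G\<^esub> g = g \<otimes>\<^bsub>G\<^esub> t" by (rule bexI[of _ "\<one>\<^bsub>G\<^esub>"]) (use gh in simp_all)
  ultimately show ?thesis unfolding f_def by (metis zero_neq_one)
qed

section \<open>Induced linear characters and counting square roots\<close>

lemma linear_character_irreducible:
  assumes "linear_character G f"
  shows "f \<in> irreducible_characters G"
proof -
  obtain \<rho> where r: "representation G 1 \<rho>" "f = character_of G \<rho>" using assms unfolding linear_character_def by blast
  have "W = {0\<^sub>v 1} \<or> W = carrier_vec 1" if W: "VectorSpace.subspace class_ring W (module_vec TYPE(complex) 1)" for W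
  proof (rule disjCI)
    note W' = W[unfolded subspace_vec_iff]
    assume n: "W \<noteq> carrier_vec 1"
    have "w = 0\<^sub>v 1" if w: "w \<in> W" for w
    proof (rule ccontr)
      assume w0: "w \<noteq> 0\<^sub>v 1"
      have wc: "w \<in> carrier_vec 1" using conjunct1[OF W'] w by blast
      have w1: "w $ 0 \<noteq> 0"
      proof
        assume "w $ 0 = 0"
        then have "w = 0\<^sub>v 1" using wc by (intro eq_vecI) auto
        then show False using w0 by simp
      qed
      have "v \<in> W" if v: "v \<in> carrier_vec 1" for v
      proof -
        have "v = (v $ 0 / w $ 0) \<cdot>\<^sub>v w" using v wc w1 by (intro eq_vecI) auto
        then show ?thesis using W' w by metis
      qed
      then show False using n conjunct1[OF W'] by blast
    qed
    then show "W = {0\<^sub>v 1}" using conjunct1[OF conjunct2[OF W']] by blast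
  qed
  then have "irreducible_representation G 1 \<rho>" using r(1) unfolding irreducible_representation_def by simp
  then show ?thesis using r(2) unfolding irreducible_characters_def by blast
qed

lemma linear_character_one:
  assumes "linear_character G f" "group G"
  shows "f \<one>\<^bsub>G\<^esub> = 1"
proof -
  interpret group G by fact
  obtain \<rho> where r: "representation G 1 \<rho>" "f = character_of G \<rho>" using assms unfolding linear_character_def by blast
  then show ?thesis using representationD(2)[OF r(1)] by (simp add: character_of_def)
qed

lemma induced_character_one:
  assumes G: "group G" and K: "subgroup K G" and f: "linear_character (G\<lparr>carrier := K\<rparr>) f"
  shows "induced_character G K f \<one>\<^bsub>G\<^esub> = of_nat (card (carrier G)) / of_nat (card K)"
proof -
  interpret group G by fact
  have "f \<one>\<^bsub>G\<^esub> = 1" using linear_character_one[OF f subgroup.subgroup_is_group[OF K G]] by simp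
  then show ?thesis using subgroup.one_closed[OF K]
    by (simp add: induced_character_def cong: sum.cong)
qed

lemma induced_class_function:
  assumes G: "group G" and gh: "g \<in> carrier G" "h \<in> carrier G"
  shows "induced_character G K f (g \<otimes>\<^bsub>G\<^esub> h) = induced_character G K f (h \<otimes>\<^bsub>G\<^esub> g)"
proof -
  interpret group G by fact
  define F where "F y = (if y \<in> K then f y else 0)" for y
  have "(\<Sum>x\<in>carrier G. F (x \<otimes>\<^bsub>G\<^esub> (h \<otimes>\<^bsub>G\<^esub> g) \<otimes>\<^bsub>G\<^esub> inv\<^bsub>G\<^esub> x))
     = (\<Sum>x\<in>carrier G. F ((x \<otimes>\<^bsub>G\<^esub> g) \<otimes>\<^bsub>G\<^esub> (h \<otimes>\<^bsub>G\<^esub> g) \<otimes>\<^bsub>G\<^esub> inv\<^bsub>G\<^esub> (x \<otimes>\<^bsub>G\<^esub> g)))"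
    by (rule sum.reindex_bij_betw[OF bij_right_mult[OF gh(1)], symmetric])
  also have "\<dots> = (\<Sum>x\<in>carrier G. F (x \<otimes>\<^bsub>G\<^esub> (g \<otimes>\<^bsub>G\<^esub> h) \<otimes>\<^bsub>G\<^esub> inv\<^bsub>G\<^esub> x))"
  proof (rule sum.cong[OF refl])
    fix x assume x: "x \<in> carrier G"
    have "g \<otimes>\<^bsub>G\<^esub> (inv\<^bsub>G\<^esub> g \<otimes>\<^bsub>G\<^esub> inv\<^bsub>G\<^esub> x) = inv\<^bsub>G\<^esub> x" using x gh by (simp add: m_assoc[symmetric])
    then have "(x \<otimes>\<^bsub>G\<^esub> g) \<otimes>\<^bsub>G\<^esub> (h \<otimes>\<^bsub>G\<^esub> g) \<otimes>\<^bsub>G\<^esub> inv\<^bsub>G\<^esub> (x \<otimes>\<^bsub>G\<^esub> g) = x \<otimes>\<^bsub>G\<^esub> (g \<otimes>\<^bsub>G\<^esub> h) \<otimes>\<^bsub>G\<^esub> inv\<^bsub>G\<^esub> x"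
      using x gh by (simp add: inv_mult_group m_assoc)
    then show "F ((x \<otimes>\<^bsub>G\<^esub> g) \<otimes>\<^bsub>G\<^esub> (h \<otimes>\<^bsub>G\<^esub> g) \<otimes>\<^bsub>G\<^esub> inv\<^bsub>G\<^esub> (x \<otimes>\<^bsub>G\<^esub> g)) = F (x \<otimes>\<^bsub>G\<^esub> (g \<otimes>\<^bsub>G\<^esub> h) \<otimes>\<^bsub>G\<^esub> inv\<^bsub>G\<^esub> x)" by simp
  qed
  finally show ?thesis using gh by (simp add: induced_character_def F_def)
qed

lemma frobenius_reciprocity:
  assumes G: "group G" and fin: "finite (carrier G)" and K: "subgroup K G" and \<chi>: "\<chi> \<in> irreducible_characters G"
  shows "class_inner G (induced_character G K f) \<chi> = class_inner (G\<lparr>carrier := K\<rparr>) f \<chi>"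
proof -
  interpret group G by fact
  have KG: "K \<subseteq> carrier G" by (rule subgroup.subset[OF K])
  have card0: "card (carrier G) \<noteq> 0" using fin one_closed by (metis card_eq_0_iff empty_iff)
  define F where "F y = (if y \<in> K then f y else 0)" for y
  have conj: "\<chi> (inv\<^bsub>G\<^esub> (x \<otimes>\<^bsub>G\<^esub> g \<otimes>\<^bsub>G\<^esub> inv\<^bsub>G\<^esub> x)) = \<chi> (inv\<^bsub>G\<^esub> g)" if x: "x \<in> carrier G" and g: "g \<in> carrier G" for x g
  proof -
    have "inv\<^bsub>G\<^esub> (x \<otimes>\<^bsub>G\<^esub> g \<otimes>\<^bsub>G\<^esub> inv\<^bsub>G\<^esub> x) = x \<otimes>\<^bsub>G\<^esub> (inv\<^bsub>G\<^esub> g \<otimes>\<^bsub>G\<^esub> inv\<^bsub>G\<^esub> x)" using x g by (simp add: inv_mult_group m_assoc)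
    then have "\<chi> (inv\<^bsub>G\<^esub> (x \<otimes>\<^bsub>G\<^esub> g \<otimes>\<^bsub>G\<^esub> inv\<^bsub>G\<^esub> x)) = \<chi> (inv\<^bsub>G\<^esub> g \<otimes>\<^bsub>G\<^esub> inv\<^bsub>G\<^esub> x \<otimes>\<^bsub>G\<^esub> x)"
      using character_commute[OF G \<chi>, of x "inv\<^bsub>G\<^esub> g \<otimes>\<^bsub>G\<^esub> inv\<^bsub>G\<^esub> x"] x g by simp
    then show ?thesis using x g by (simp add: m_assoc)
  qed
  have bij: "bij_betw (\<lambda>g. x \<otimes>\<^bsub>G\<^esub> g \<otimes>\<^bsub>G\<^esub> inv\<^bsub>G\<^esub> x) (carrier G) (carrier G)" if x: "x \<in> carrier G" for x
    using bij_betw_trans[OF bij_left_mult[OF x] bij_right_mult[OF inv_closed[OF x]]] by (simp add: comp_def)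
  have "(\<Sum>g\<in>carrier G. induced_character G K f g * \<chi> (inv\<^bsub>G\<^esub> g))
     = (\<Sum>g\<in>carrier G. \<Sum>x\<in>carrier G. F (x \<otimes>\<^bsub>G\<^esub> g \<otimes>\<^bsub>G\<^esub> inv\<^bsub>G\<^esub> x) * \<chi> (inv\<^bsub>G\<^esub> g)) / of_nat (card K)"
    unfolding sum_divide_distrib
    by (intro sum.cong refl) (simp add: induced_character_def F_def sum_distrib_right sum_divide_distrib)
  also have "(\<Sum>g\<in>carrier G. \<Sum>x\<in>carrier G. F (x \<otimes>\<^bsub>G\<^esub> g \<otimes>\<^bsub>G\<^esub> inv\<^bsub>G\<^esub> x) * \<chi> (inv\<^bsub>G\<^esub> g))
     = (\<Sum>x\<in>carrier G. \<Sum>g\<in>carrier G. F (x \<otimes>\<^bsub>G\<^esub> g \<otimes>\<^bsub>G\<^esub> inv\<^bsub>G\<^esub> x) * \<chi> (inv\<^bsub>G\<^esub> (x \<otimes>\<^bsub>G\<^esub> g \<otimes>\<^bsub>G\<^esub> inv\<^bsub>G\<^esub> x)))"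
    by (subst sum.swap) (simp add: conj)
  also have "\<dots> = (\<Sum>x\<in>carrier G. \<Sum>g\<in>carrier G. F g * \<chi> (inv\<^bsub>G\<^esub> g))"
    by (rule sum.cong[OF refl]) (rule sum.reindex_bij_betw[OF bij, where g = "\<lambda>y. F y * \<chi> (inv\<^bsub>G\<^esub> y)"])
  also have "\<dots> = of_nat (card (carrier G)) * (\<Sum>g\<in>carrier G. F g * \<chi> (inv\<^bsub>G\<^esub> g))" by simp
  also have "(\<Sum>g\<in>carrier G. F g * \<chi> (inv\<^bsub>G\<^esub> g)) = (\<Sum>g\<in>K. f g * \<chi> (inv\<^bsub>G\<^esub> g))"
    using KG fin by (intro sum.mono_neutral_cong_right) (auto simp: F_def)
  also have "\<dots> = (\<Sum>g\<in>K. f g * \<chi> (inv\<^bsub>G\<lparr>carrier := K\<rparr>\<^esub> g))"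
    by (intro sum.cong refl) (simp add: m_inv_consistent[OF K])
  finally show ?thesis using card0 by (simp add: class_inner_def)
qed

text \<open>By reciprocity the inner product is the multiplicity of the linear character in the restriction of \<open>\<chi>\<close>, which is a sum of irreducible
  characters of the subgroup.\<close>
lemma multiplicity_nat:
  assumes G: "group G" and fin: "finite (carrier G)" and K: "subgroup K G"
    and f: "linear_character (G\<lparr>carrier := K\<rparr>) f" and \<chi>: "\<chi> \<in> irreducible_characters G"
  shows "\<exists>n. class_inner G (induced_character G K f) \<chi> = of_nat n"
proof -
  let ?K = "G\<lparr>carrier := K\<rparr>"
  interpret group G by fact
  have KG: "K \<subseteq> carrier G" by (rule subgroup.subset[OF K])
  have gK: "group ?K" by (rule subgroup.subgroup_is_group[OF K G])
  have fK: "finite (carrier ?K)" using KG fin finite_subset by auto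
  obtain d \<rho> where irr: "irreducible_representation G d \<rho>" and \<chi>d: "\<chi> = character_of G \<rho>"
    using \<chi> unfolding irreducible_characters_def by blast
  have "representation ?K d \<rho>"
    using irreducibleD(1)[OF irr] KG unfolding representation_def by auto
  then obtain xs where xs: "set xs \<subseteq> irreducible_characters ?K" "\<forall>g\<in>carrier ?K. mat_trace (\<rho> g) = (\<Sum>f\<leftarrow>xs. f g)"
    using trace_sum_irreducible[OF gK] by blast
  have "class_inner G (induced_character G K f) \<chi> = class_inner ?K f \<chi>"
    by (rule frobenius_reciprocity[OF G fin K \<chi>])
  also have "\<dots> = class_inner ?K \<chi> f" by (rule class_inner_commute[OF gK])
  also have "\<dots> = class_inner ?K (\<lambda>g. \<Sum>f\<leftarrow>xs. f g) f"
    using xs(2) KG by (intro class_inner_cong[OF gK]) (auto simp: \<chi>d character_of_def)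
  also have "\<dots> = (\<Sum>f'\<leftarrow>xs. class_inner ?K f' f)" by (rule class_inner_sum_list_left)
  finally have e: "class_inner G (induced_character G K f) \<chi> = (\<Sum>f'\<leftarrow>xs. class_inner ?K f' f)" .
  have "\<exists>n. (\<Sum>f'\<leftarrow>ys. class_inner ?K f' f) = of_nat n" if "set ys \<subseteq> irreducible_characters ?K" for ys
    using that
  proof (induction ys)
    case Nil
    then show ?case by (intro exI[of _ 0]) simp
  next
    case (Cons y ys)
    then obtain n where n: "(\<Sum>f'\<leftarrow>ys. class_inner ?K f' f) = of_nat n" by auto
    have "class_inner ?K y f = (if y = f then 1 else 0)"
      using Cons.prems by (intro irreducible_characters_orthonormal[OF gK fK] linear_character_irreducible[OF f]) auto
    then show ?case using n by (intro exI[of _ "(if y = f then 1 else 0) + n"]) simp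
  qed
  from this[OF xs(1)] show ?thesis unfolding e .
qed

lemma square_roots_expansion:
  assumes G: "group G" and fin: "finite (carrier G)" and \<tau>: "involutive_automorphism G \<tau>" and g: "g \<in> carrier G"
  shows "of_nat (card (twisted_square_roots G \<tau> g)) = (\<Sum>\<chi>\<in>irreducible_characters G. frobenius_schur G \<tau> \<chi> * \<chi> g)"
  using class_function_expansion[OF G fin _ g, of "\<lambda>g. of_nat (card (twisted_square_roots G \<tau> g))"]
    square_roots_class_function[OF G \<tau>] square_roots_class_inner[OF G fin \<tau>] by simp

text \<open>The first direction of the criterion. As \<open>g\<close> and \<open>inv (\<tau> g)\<close> are conjugate, every indicator is \<open>1\<close> or \<open>-1\<close>; as the counting function is a sum of
  induced characters, it is also a natural number. Hence the counting function is the sum of all irreducible characters. Multiplicity one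
  moreover forces the pairs \<open>(K x, f x)\<close> to be distinct.\<close>
theorem model_if_induced_sum_counts_square_roots:
  assumes G: "group G" and fin: "finite (carrier G)" and \<tau>: "involutive_automorphism G \<tau>"
    and real: "\<And>g. g \<in> carrier G \<Longrightarrow> \<exists>t\<in>carrier G. t \<otimes>\<^bsub>G\<^esub> g = inv\<^bsub>G\<^esub> (\<tau> g) \<otimes>\<^bsub>G\<^esub> t"
    and X: "finite X" and K: "\<And>x. x \<in> X \<Longrightarrow> subgroup (K x) G"
    and f: "\<And>x. x \<in> X \<Longrightarrow> linear_character (G\<lparr>carrier := K x\<rparr>) (f x)"
    and sum: "\<And>g. g \<in> carrier G \<Longrightarrow>
       (\<Sum>x\<in>X. induced_character G (K x) (f x) g) = of_nat (card (twisted_square_roots G \<tau> g))"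
  shows "g \<in> carrier G \<Longrightarrow> (\<Sum>x\<in>X. induced_character G (K x) (f x) g) = (\<Sum>\<chi>\<in>irreducible_characters G. \<chi> g)"
    and "inj_on (\<lambda>x. (K x, f x)) X"
proof -
  interpret group G by fact
  note t = involutive_automorphismD[OF \<tau> G]
  have card0: "card (carrier G) \<noteq> 0" using fin one_closed by (metis card_eq_0_iff empty_iff)
  have "\<forall>x\<in>X. \<forall>\<chi>\<in>irreducible_characters G. \<exists>n. class_inner G (induced_character G (K x) (f x)) \<chi> = of_nat n"
    using multiplicity_nat[OF G fin K f] by blast
  then obtain n where n: "\<And>x \<chi>. x \<in> X \<Longrightarrow> \<chi> \<in> irreducible_characters G \<Longrightarrow>
      class_inner G (induced_character G (K x) (f x)) \<chi> = of_nat (n x \<chi>)" by metis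
  have fs: "frobenius_schur G \<tau> \<chi> = of_nat (\<Sum>x\<in>X. n x \<chi>)" if \<chi>: "\<chi> \<in> irreducible_characters G" for \<chi>
  proof -
    have "frobenius_schur G \<tau> \<chi> = class_inner G (\<lambda>g. \<Sum>x\<in>X. induced_character G (K x) (f x) g) \<chi>"
      unfolding square_roots_class_inner[OF G fin \<tau>, symmetric] using sum by (intro class_inner_cong[OF G]) auto
    also have "\<dots> = (\<Sum>x\<in>X. class_inner G (induced_character G (K x) (f x)) \<chi>)" by (rule class_inner_sum_left)
    finally show ?thesis using n \<chi> by simp
  qed
  have one: "(\<Sum>x\<in>X. n x \<chi>) = 1" if \<chi>: "\<chi> \<in> irreducible_characters G" for \<chi>
  proof -
    have "\<chi> (inv\<^bsub>G\<^esub> (\<tau> g)) = \<chi> g" if g: "g \<in> carrier G" for g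
    proof -
      obtain s where s: "s \<in> carrier G" "s \<otimes>\<^bsub>G\<^esub> g = inv\<^bsub>G\<^esub> (\<tau> g) \<otimes>\<^bsub>G\<^esub> s" using real[OF g] by blast
      have "inv\<^bsub>G\<^esub> (\<tau> g) = s \<otimes>\<^bsub>G\<^esub> (g \<otimes>\<^bsub>G\<^esub> inv\<^bsub>G\<^esub> s)" using s g t by (metis inv_closed inv_solve_right m_assoc m_closed)
      moreover have "\<chi> (s \<otimes>\<^bsub>G\<^esub> (g \<otimes>\<^bsub>G\<^esub> inv\<^bsub>G\<^esub> s)) = \<chi> (g \<otimes>\<^bsub>G\<^esub> inv\<^bsub>G\<^esub> s \<otimes>\<^bsub>G\<^esub> s)"
        by (rule character_commute[OF G \<chi>]) (use s g in auto)
      ultimately show ?thesis using s g by (simp add: m_assoc)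
    qed
    then have "frobenius_schur G \<tau> \<chi> \<in> {1,-1}" using frobenius_schur_value[OF G fin \<tau> \<chi>] by simp
    then consider "of_nat (\<Sum>x\<in>X. n x \<chi>) = (1::complex)" | "of_nat (\<Sum>x\<in>X. n x \<chi>) = (-1::complex)" unfolding fs[OF \<chi>] by blast
    then show ?thesis
    proof cases
      case 1
      then show ?thesis by (metis of_nat_1 of_nat_eq_iff)
    next
      case 2
      then have "Re (of_nat (\<Sum>x\<in>X. n x \<chi>)) = -1" by (simp only: uminus_complex.sel one_complex.sel)
      moreover have "Re (of_nat N) \<ge> 0" for N by simp
      ultimately have False by (metis neg_0_le_iff_le not_one_le_zero)
      then show ?thesis ..
    qed
  qed
  show "(\<Sum>x\<in>X. induced_character G (K x) (f x) g) = (\<Sum>\<chi>\<in>irreducible_characters G. \<chi> g)" if g: "g \<in> carrier G" for g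
    unfolding sum[OF g] square_roots_expansion[OF G fin \<tau> g] by (simp add: fs one)
  \<comment> \<open>Two equal pairs would have the same constituents, each of which would then occur at least twice.\<close>
  show "inj_on (\<lambda>x. (K x, f x)) X"
  proof (rule inj_onI, rule ccontr)
    fix x y assume xy: "x \<in> X" "y \<in> X" "(K x, f x) = (K y, f y)" "x \<noteq> y"
    have z: "class_inner G (induced_character G (K x) (f x)) \<chi> = 0" if \<chi>: "\<chi> \<in> irreducible_characters G" for \<chi>
    proof -
      have "of_nat (n x \<chi>) = (of_nat (n y \<chi>) :: complex)" using n[OF xy(1) \<chi>] n[OF xy(2) \<chi>] xy(3) by simp
      then have nxy: "n x \<chi> = n y \<chi>" by (simp only: of_nat_eq_iff)
      have "n x \<chi> + n y \<chi> = (\<Sum>z\<in>{x,y}. n z \<chi>)" using xy by simp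
      also have "\<dots> \<le> (\<Sum>z\<in>X. n z \<chi>)" using xy X by (intro sum_mono2) auto
      finally have "n x \<chi> = 0" using one[OF \<chi>] nxy by simp
      then show ?thesis using n[OF xy(1) \<chi>] by simp
    qed
    have "induced_character G (K x) (f x) \<one>\<^bsub>G\<^esub> = 0"
      by (rule class_function_eq_zero[OF G fin induced_class_function[OF G] z one_closed])
    then have "card (K x) = 0" using induced_character_one[OF G K[OF xy(1)] f[OF xy(1)]] card0 by simp
    moreover have "finite (K x)" using subgroup.subset[OF K[OF xy(1)]] fin finite_subset by blast
    ultimately show False using subgroup.one_closed[OF K[OF xy(1)]] by simp
  qed
qed

text \<open>The second direction. The premise \<open>count\<close> compares values at the identity: the sum of the degrees equals the sum of
  the degrees weighted by the indicators. All indicators are at most \<open>1\<close> and all degrees are positive, so every indicator is \<open>1\<close>.\<close>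
theorem square_roots_if_model:
  assumes G: "group G" and fin: "finite (carrier G)" and \<tau>: "involutive_automorphism G \<tau>"
    and K: "\<And>x. x \<in> X \<Longrightarrow> subgroup (K x) G"
    and f: "\<And>x. x \<in> X \<Longrightarrow> linear_character (G\<lparr>carrier := K x\<rparr>) (f x)"
    and model: "\<And>g. g \<in> carrier G \<Longrightarrow>
       (\<Sum>x\<in>X. induced_character G (K x) (f x) g) = (\<Sum>\<chi>\<in>irreducible_characters G. \<chi> g)"
    and count: "(\<Sum>x\<in>X. of_nat (card (carrier G)) / of_nat (card (K x))) = (of_nat (card (twisted_square_roots G \<tau> \<one>\<^bsub>G\<^esub>)) :: complex)"
    and g: "g \<in> carrier G"
  shows "(\<Sum>x\<in>X. induced_character G (K x) (f x) g) = of_nat (card (twisted_square_roots G \<tau> g))"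
    and "\<exists>t\<in>carrier G. t \<otimes>\<^bsub>G\<^esub> g = inv\<^bsub>G\<^esub> (\<tau> g) \<otimes>\<^bsub>G\<^esub> t"
proof -
  interpret group G by fact
  note t = involutive_automorphismD[OF \<tau> G]
  let ?I = "irreducible_characters G"
  have finI: "finite ?I" by (rule finite_irreducible_characters[OF G fin])
  have fs: "frobenius_schur G \<tau> \<chi> \<in> {0,1,-1}" if "\<chi> \<in> ?I" for \<chi>
    using frobenius_schur_value[OF G fin \<tau> that] by (auto split: if_splits)
  have "(\<Sum>\<chi>\<in>?I. \<chi> \<one>\<^bsub>G\<^esub>) = (\<Sum>\<chi>\<in>?I. frobenius_schur G \<tau> \<chi> * \<chi> \<one>\<^bsub>G\<^esub>)"
    unfolding square_roots_expansion[OF G fin \<tau> one_closed, symmetric] count[symmetric] model[OF one_closed, symmetric]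
    using induced_character_one[OF G K f] by simp
  then have "(\<Sum>\<chi>\<in>?I. (1 - frobenius_schur G \<tau> \<chi>) * \<chi> \<one>\<^bsub>G\<^esub>) = 0"
    by (simp add: left_diff_distrib sum_subtractf)
  then have "(\<Sum>\<chi>\<in>?I. Re ((1 - frobenius_schur G \<tau> \<chi>) * \<chi> \<one>\<^bsub>G\<^esub>)) = 0"
    by (simp only: Re_sum[symmetric] zero_complex.sel)
  moreover have nn: "Re ((1 - frobenius_schur G \<tau> \<chi>) * \<chi> \<one>\<^bsub>G\<^esub>) \<ge> 0" if "\<chi> \<in> ?I" for \<chi>
    using fs[OF that] irreducible_character_degree[OF G that] by auto
  ultimately have z: "Re ((1 - frobenius_schur G \<tau> \<chi>) * \<chi> \<one>\<^bsub>G\<^esub>) = 0" if "\<chi> \<in> ?I" for \<chi>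
    using sum_nonneg_eq_0_iff[OF finI, of "\<lambda>\<chi>. Re ((1 - frobenius_schur G \<tau> \<chi>) * \<chi> \<one>\<^bsub>G\<^esub>)"] that by blast
  have one: "frobenius_schur G \<tau> \<chi> = 1" if "\<chi> \<in> ?I" for \<chi>
    using z[OF that] fs[OF that] irreducible_character_degree[OF G that] by auto
  show "(\<Sum>x\<in>X. induced_character G (K x) (f x) g) = of_nat (card (twisted_square_roots G \<tau> g))"
    unfolding model[OF g] square_roots_expansion[OF G fin \<tau> g] using one by simp
  show "\<exists>t\<in>carrier G. t \<otimes>\<^bsub>G\<^esub> g = inv\<^bsub>G\<^esub> (\<tau> g) \<otimes>\<^bsub>G\<^esub> t"
  proof (rule characters_separate_classes[OF G fin g])
    show "\<chi> g = \<chi> (inv\<^bsub>G\<^esub> (\<tau> g))" if "\<chi> \<in> ?I" for \<chi>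
      using frobenius_schur_value[OF G fin \<tau> that] one[OF that] g by (auto split: if_splits)
  qed (use g t in auto)
qed

section \<open>Wreath products on a finite set of positions\<close>

text \<open>The wreath product with an arbitrary set of positions instead of \<open>{1..n}\<close>: the argument restricts to
  unions of cycles, and no renumbering is wanted then. The function part of an element is read at the source of the
  permutation: \<open>fst g i\<close> sits on the arrow from \<open>i\<close> to \<open>snd g i\<close>.\<close>
definition wr_grp :: "('a, 'b) monoid_scheme \<Rightarrow> nat set \<Rightarrow> 'a wr monoid" where
  "wr_grp H S = \<lparr>carrier = (S \<rightarrow>\<^sub>E carrier H) \<times> {\<pi>. \<pi> permutes S},
     monoid.mult = (\<lambda>g k. (\<lambda>i\<in>S. fst g (snd k i) \<otimes>\<^bsub>H\<^esub> fst k i, snd g \<circ> snd k)),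
     one = (\<lambda>i\<in>S. \<one>\<^bsub>H\<^esub>, id)\<rparr>"

definition wr_aut :: "('a \<Rightarrow> 'a) \<Rightarrow> nat set \<Rightarrow> 'a wr \<Rightarrow> 'a wr" where
  "wr_aut \<tau> S g = (\<lambda>i\<in>S. \<tau> (fst g i), snd g)"

definition wr_restrict :: "nat set \<Rightarrow> 'a wr \<Rightarrow> 'a wr" where
  "wr_restrict T g = (restrict (fst g) T, \<lambda>i. if i \<in> T then snd g i else i)"

lemma wr_carrier_iff: "g \<in> carrier (wr_grp H S) \<longleftrightarrow> fst g \<in> S \<rightarrow>\<^sub>E carrier H \<and> snd g permutes S"
  by (cases g) (simp add: wr_grp_def)

lemma wr_mult_simps:
  "snd (g \<otimes>\<^bsub>wr_grp H S\<^esub> k) = snd g \<circ> snd k"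
  "i \<in> S \<Longrightarrow> fst (g \<otimes>\<^bsub>wr_grp H S\<^esub> k) i = fst g (snd k i) \<otimes>\<^bsub>H\<^esub> fst k i"
  "snd \<one>\<^bsub>wr_grp H S\<^esub> = id" "i \<in> S \<Longrightarrow> fst \<one>\<^bsub>wr_grp H S\<^esub> i = \<one>\<^bsub>H\<^esub>"
  by (simp_all add: wr_grp_def)

lemma wr_carrierD:
  assumes "g \<in> carrier (wr_grp H S)"
  shows "\<And>i. i \<in> S \<Longrightarrow> fst g i \<in> carrier H" "snd g permutes S" "\<And>i. snd g i \<in> S \<longleftrightarrow> i \<in> S"
    "\<And>i. i \<notin> S \<Longrightarrow> snd g i = i" "\<And>i. i \<notin> S \<Longrightarrow> fst g i = undefined" "\<And>i j. snd g i = snd g j \<longleftrightarrow> i = j"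
  using assms by (auto simp: wr_carrier_iff permutes_in_image permutes_not_in PiE_def extensional_def
      dest: permutes_inj injD)

lemma wr_eqI:
  assumes g: "g \<in> carrier (wr_grp H S)" "k \<in> carrier (wr_grp H S)"
    and "\<And>i. i \<in> S \<Longrightarrow> snd g i = snd k i" "\<And>i. i \<in> S \<Longrightarrow> fst g i = fst k i"
  shows "g = k"
proof (rule prod_eqI)
  show "fst g = fst k" using assms(4) wr_carrierD(5)[OF g(1)] wr_carrierD(5)[OF g(2)] by (metis ext)
  show "snd g = snd k" using assms(3) wr_carrierD(4)[OF g(1)] wr_carrierD(4)[OF g(2)] by (metis ext)
qed

lemma group_wr_grp:
  assumes "group H"
  shows "group (wr_grp H S)"
proof -
  interpret group H by fact
  have mc: "x \<otimes>\<^bsub>wr_grp H S\<^esub> y \<in> carrier (wr_grp H S)"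
    if "x \<in> carrier (wr_grp H S)" "y \<in> carrier (wr_grp H S)" for x y
    using that by (auto simp: wr_grp_def permutes_compose permutes_in_image intro!: PiE_I m_closed)
  have oc: "\<one>\<^bsub>wr_grp H S\<^esub> \<in> carrier (wr_grp H S)" by (auto simp: wr_grp_def permutes_id)
  show ?thesis
  proof (rule groupI[OF mc oc])
    fix x y z assume x: "x \<in> carrier (wr_grp H S)" and y: "y \<in> carrier (wr_grp H S)" and z: "z \<in> carrier (wr_grp H S)"
    show "x \<otimes>\<^bsub>wr_grp H S\<^esub> y \<otimes>\<^bsub>wr_grp H S\<^esub> z = x \<otimes>\<^bsub>wr_grp H S\<^esub> (y \<otimes>\<^bsub>wr_grp H S\<^esub> z)"
      using x y z by (intro wr_eqI[of _ H S] mc) (auto simp: wr_mult_simps wr_carrierD m_assoc)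
  next
    fix x assume x: "x \<in> carrier (wr_grp H S)"
    show "\<one>\<^bsub>wr_grp H S\<^esub> \<otimes>\<^bsub>wr_grp H S\<^esub> x = x"
      using x by (intro wr_eqI[of _ H S] mc oc) (auto simp: wr_mult_simps wr_carrierD)
    define y where "y = (\<lambda>i\<in>S. inv\<^bsub>H\<^esub> (fst x (inv_into UNIV (snd x) i)), inv_into UNIV (snd x))"
    note p = wr_carrierD(2)[OF x]
    have "y \<in> carrier (wr_grp H S)"
      using wr_carrierD(1)[OF x] permutes_inv[OF p] by (auto simp: y_def wr_carrier_iff permutes_in_image)
    moreover from this have "y \<otimes>\<^bsub>wr_grp H S\<^esub> x = \<one>\<^bsub>wr_grp H S\<^esub>"
      using x p by (intro wr_eqI[of _ H S] mc oc) (auto simp: wr_mult_simps wr_carrierD y_def permutes_inverses[OF p])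
    ultimately show "\<exists>y\<in>carrier (wr_grp H S). y \<otimes>\<^bsub>wr_grp H S\<^esub> x = \<one>\<^bsub>wr_grp H S\<^esub>" by blast
  qed
qed

lemma wr_pow_snd: "snd (g [^]\<^bsub>wr_grp H S\<^esub> (a::nat)) = snd g ^^ a"
  by (induction a) (simp_all add: wr_mult_simps funpow_Suc_right del: funpow.simps)

lemma wr_restrict_simps:
  "i \<in> T \<Longrightarrow> fst (wr_restrict T g) i = fst g i" "i \<in> T \<Longrightarrow> snd (wr_restrict T g) i = snd g i"
  by (simp_all add: wr_restrict_def)

lemma wr_restrict_carrier:
  assumes g: "g \<in> carrier (wr_grp H S)" and T: "T \<subseteq> S" "finite T" "\<And>i. i \<in> T \<Longrightarrow> snd g i \<in> T"
  shows "wr_restrict T g \<in> carrier (wr_grp H T)"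
proof -
  have inj: "inj_on (snd g) T" using wr_carrierD(6)[OF g] by (auto simp: inj_on_def)
  have "snd g ` T = T" by (rule endo_inj_surj[OF T(2) _ inj]) (use T(3) in auto)
  then have "bij_betw (snd g) T T" using inj by (simp add: bij_betw_def)
  then have "snd (wr_restrict T g) permutes T"
    by (intro bij_imp_permutes) (auto simp: wr_restrict_def cong: bij_betw_cong)
  then show ?thesis
    using T(1) wr_carrierD(1)[OF g] by (auto simp: wr_carrier_iff wr_restrict_def)
qed

lemma wr_invariant_complement:
  assumes g: "g \<in> carrier (wr_grp H S)" and T: "T \<subseteq> S" "finite T" "\<And>i. i \<in> T \<Longrightarrow> snd g i \<in> T"
    and i: "i \<in> S - T"
  shows "snd g i \<in> S - T"
proof -
  have inj: "inj_on (snd g) T" using wr_carrierD(6)[OF g] by (auto simp: inj_on_def)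
  have "snd g ` T = T" by (rule endo_inj_surj[OF T(2) _ inj]) (use T(3) in auto)
  then have "snd g i \<notin> T" using i wr_carrierD(6)[OF g] by (metis DiffD2 imageE)
  then show ?thesis using i wr_carrierD(3)[OF g] by auto
qed

lemma wr_restrict_mult:
  assumes H: "group H" and g: "g \<in> carrier (wr_grp H S)" and k: "k \<in> carrier (wr_grp H S)" and T: "T \<subseteq> S" "finite T"
    and gT: "\<And>i. i \<in> T \<Longrightarrow> snd g i \<in> T" and kT: "\<And>i. i \<in> T \<Longrightarrow> snd k i \<in> T"
  shows "wr_restrict T (g \<otimes>\<^bsub>wr_grp H S\<^esub> k) = wr_restrict T g \<otimes>\<^bsub>wr_grp H T\<^esub> wr_restrict T k"
proof (rule wr_eqI[of _ H T])
  interpret S: group "wr_grp H S" by (rule group_wr_grp[OF H])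
  interpret T: group "wr_grp H T" by (rule group_wr_grp[OF H])
  show "wr_restrict T (g \<otimes>\<^bsub>wr_grp H S\<^esub> k) \<in> carrier (wr_grp H T)"
    using g k T gT kT by (intro wr_restrict_carrier[of _ H S]) (auto simp: wr_mult_simps)
  show "wr_restrict T g \<otimes>\<^bsub>wr_grp H T\<^esub> wr_restrict T k \<in> carrier (wr_grp H T)"
    using g k T gT kT by (intro T.m_closed wr_restrict_carrier[of _ H S])
qed (use T gT kT in \<open>auto simp: wr_mult_simps wr_restrict_simps\<close>)

lemma wr_restrict_one: "T \<subseteq> S \<Longrightarrow> wr_restrict T \<one>\<^bsub>wr_grp H S\<^esub> = \<one>\<^bsub>wr_grp H T\<^esub>"
  by (auto simp: wr_restrict_def wr_grp_def fun_eq_iff)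

lemma wr_restrict_aut: "T \<subseteq> S \<Longrightarrow> wr_restrict T (wr_aut \<tau> S g) = wr_aut \<tau> T (wr_restrict T g)"
  by (auto simp: wr_restrict_def wr_aut_def fun_eq_iff)

lemma wr_aut_simps: "snd (wr_aut \<tau> S g) = snd g" "i \<in> S \<Longrightarrow> fst (wr_aut \<tau> S g) i = \<tau> (fst g i)"
  by (simp_all add: wr_aut_def)

lemma wr_aut_involutive:
  assumes H: "group H" and \<tau>: "involutive_automorphism H \<tau>"
  shows "involutive_automorphism (wr_grp H S) (wr_aut \<tau> S)"
proof -
  note t = involutive_automorphismD[OF \<tau> H]
  interpret group "wr_grp H S" by (rule group_wr_grp[OF H])
  have c: "wr_aut \<tau> S g \<in> carrier (wr_grp H S)" if "g \<in> carrier (wr_grp H S)" for g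
    using that t(1) by (auto simp: wr_carrier_iff wr_aut_def dest: PiE_mem)
  have i: "wr_aut \<tau> S (wr_aut \<tau> S g) = g" if "g \<in> carrier (wr_grp H S)" for g
    using that t by (intro wr_eqI[of _ H S] c) (auto simp: wr_aut_simps wr_carrierD)
  have m: "wr_aut \<tau> S (g \<otimes>\<^bsub>wr_grp H S\<^esub> k) = wr_aut \<tau> S g \<otimes>\<^bsub>wr_grp H S\<^esub> wr_aut \<tau> S k"
    if "g \<in> carrier (wr_grp H S)" "k \<in> carrier (wr_grp H S)" for g k
    using that t by (intro wr_eqI[of _ H S] c m_closed) (auto simp: wr_aut_simps wr_mult_simps wr_carrierD)
  have "bij_betw (wr_aut \<tau> S) (carrier (wr_grp H S)) (carrier (wr_grp H S))"
    by (rule bij_betw_byWitness[where f' = "wr_aut \<tau> S"]) (use c i in auto)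
  then show ?thesis using c i m by (simp add: involutive_automorphism_def iso_def hom_def)
qed

definition wr_glue :: "nat set \<Rightarrow> nat set \<Rightarrow> 'a wr \<Rightarrow> 'a wr \<Rightarrow> 'a wr" where
  "wr_glue S T a b = (\<lambda>i\<in>S. if i \<in> T then fst a i else fst b i, \<lambda>i. if i \<in> T then snd a i else snd b i)"

lemma wr_glue_carrier:
  assumes T: "T \<subseteq> S" and a: "a \<in> carrier (wr_grp H T)" and b: "b \<in> carrier (wr_grp H (S - T))"
  shows "wr_glue S T a b \<in> carrier (wr_grp H S)"
proof -
  have "snd (wr_glue S T a b) = snd a \<circ> snd b"
    using wr_carrierD(3,4)[OF a] wr_carrierD(3,4)[OF b] T
    by (auto simp: wr_glue_def fun_eq_iff) (metis DiffD2 DiffI wr_carrierD(4)[OF a] wr_carrierD(4)[OF b] wr_carrierD(3)[OF b])+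
  moreover have "snd a permutes S" "snd b permutes S"
    using wr_carrierD(2)[OF a] wr_carrierD(2)[OF b] T by (auto intro: permutes_subset)
  ultimately have "snd (wr_glue S T a b) permutes S" by (simp add: permutes_compose)
  then show ?thesis using wr_carrierD(1)[OF a] wr_carrierD(1)[OF b]
    by (auto simp: wr_carrier_iff wr_glue_def)
qed

lemma wr_glue_restrict:
  assumes T: "T \<subseteq> S" and a: "a \<in> carrier (wr_grp H T)" and b: "b \<in> carrier (wr_grp H (S - T))"
  shows "wr_restrict T (wr_glue S T a b) = a" "wr_restrict (S - T) (wr_glue S T a b) = b"
proof -
  have "x \<notin> T" if "x \<notin> S" for x using T that by auto
  then show "wr_restrict T (wr_glue S T a b) = a" "wr_restrict (S - T) (wr_glue S T a b) = b"
    using wr_carrierD(4,5)[OF a] wr_carrierD(4,5)[OF b] T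
    by (auto simp: wr_restrict_def wr_glue_def fun_eq_iff intro!: prod_eqI)
qed

lemma wr_restrict_glue:
  assumes T: "T \<subseteq> S" and g: "g \<in> carrier (wr_grp H S)"
  shows "wr_glue S T (wr_restrict T g) (wr_restrict (S - T) g) = g"
  using wr_carrierD(4,5)[OF g] T
  by (auto simp: wr_restrict_def wr_glue_def fun_eq_iff intro!: prod_eqI)

text \<open>An element that preserves a set of positions is a pair of elements on the set and on its complement.\<close>
lemma wr_split_bij:
  assumes "T \<subseteq> S" "finite S"
  shows "bij_betw (\<lambda>y. (wr_restrict T y, wr_restrict (S - T) y))
     {y \<in> carrier (wr_grp H S). \<forall>i\<in>T. snd y i \<in> T}
     (carrier (wr_grp H T) \<times> carrier (wr_grp H (S - T)))"
proof (rule bij_betw_byWitness[where f' = "\<lambda>(a,b). wr_glue S T a b"])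
  have fT: "finite T" using assms finite_subset by auto
  show "\<forall>y\<in>{y \<in> carrier (wr_grp H S). \<forall>i\<in>T. snd y i \<in> T}.
       (case (wr_restrict T y, wr_restrict (S - T) y) of (a, b) \<Rightarrow> wr_glue S T a b) = y"
    using wr_restrict_glue[OF assms(1)] by auto
  show "\<forall>y\<in>carrier (wr_grp H T) \<times> carrier (wr_grp H (S - T)).
       (wr_restrict T (case y of (a, b) \<Rightarrow> wr_glue S T a b), wr_restrict (S - T) (case y of (a, b) \<Rightarrow> wr_glue S T a b)) = y"
    using wr_glue_restrict[OF assms(1)] by auto
  show "(\<lambda>y. (wr_restrict T y, wr_restrict (S - T) y)) ` {y \<in> carrier (wr_grp H S). \<forall>i\<in>T. snd y i \<in> T}
    \<subseteq> carrier (wr_grp H T) \<times> carrier (wr_grp H (S - T))"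
  proof (rule image_subsetI)
    fix y assume "y \<in> {y \<in> carrier (wr_grp H S). \<forall>i\<in>T. snd y i \<in> T}"
    then have y: "y \<in> carrier (wr_grp H S)" "\<And>i. i \<in> T \<Longrightarrow> snd y i \<in> T" by auto
    have "wr_restrict T y \<in> carrier (wr_grp H T)" by (rule wr_restrict_carrier[OF y(1) assms(1) fT y(2)])
    moreover have "wr_restrict (S - T) y \<in> carrier (wr_grp H (S - T))"
      by (rule wr_restrict_carrier[OF y(1)]) (use assms wr_invariant_complement[OF y(1) assms(1) fT y(2)] in auto)
    ultimately show "(wr_restrict T y, wr_restrict (S - T) y) \<in> carrier (wr_grp H T) \<times> carrier (wr_grp H (S - T))" by simp
  qed
  show "(\<lambda>(a, b). wr_glue S T a b) ` (carrier (wr_grp H T) \<times> carrier (wr_grp H (S - T)))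
    \<subseteq> {y \<in> carrier (wr_grp H S). \<forall>i\<in>T. snd y i \<in> T}"
    using wr_glue_carrier[OF assms(1)] wr_carrierD(3) by (fastforce simp: wr_glue_def)
qed

lemma finite_wr_grp:
  assumes "finite (carrier H)" "finite S"
  shows "finite (carrier (wr_grp H S))"
  using assms by (simp add: wr_grp_def finite_PiE finite_permutations)

section \<open>Conjugation along cycles\<close>

locale twisted_group = group H for H (structure) +
  fixes \<tau>
  assumes finite_carrier: "finite (carrier H)" and involutive: "involutive_automorphism H \<tau>"
begin

abbreviation \<Gamma> where "\<Gamma> S \<equiv> wr_grp H S"
abbreviation \<alpha> where "\<alpha> S \<equiv> wr_aut \<tau> S"

sublocale W: group "\<Gamma> S" for S
  by (rule group_wr_grp) (rule is_group)

lemmas \<tau>_closed = involutive_automorphismD(1)[OF involutive is_group]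
  and \<tau>_mult = involutive_automorphismD(2)[OF involutive is_group]
  and \<tau>_\<tau> = involutive_automorphismD(3)[OF involutive is_group]
  and \<tau>_one = involutive_automorphismD(4)[OF involutive is_group]
  and \<tau>_inv = involutive_automorphismD(5)[OF involutive is_group]

lemmas \<alpha>_involutive = wr_aut_involutive[OF is_group involutive]
lemmas \<alpha>_closed = involutive_automorphismD(1)[OF \<alpha>_involutive W.is_group]
  and \<alpha>_mult = involutive_automorphismD(2)[OF \<alpha>_involutive W.is_group]
  and \<alpha>_\<alpha> = involutive_automorphismD(3)[OF \<alpha>_involutive W.is_group]
  and \<alpha>_one = involutive_automorphismD(4)[OF \<alpha>_involutive W.is_group]
  and \<alpha>_inv = involutive_automorphismD(5)[OF \<alpha>_involutive W.is_group]

lemma \<alpha>_pow: "g \<in> carrier (\<Gamma> S) \<Longrightarrow> \<alpha> S (g [^]\<^bsub>\<Gamma> S\<^esub> (a::nat)) = \<alpha> S g [^]\<^bsub>\<Gamma> S\<^esub> a"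
  by (induction a) (simp_all add: \<alpha>_one \<alpha>_mult)

lemma intertwine_pow:
  assumes "gl \<in> carrier (\<Gamma> S)" "gr \<in> carrier (\<Gamma> S)" "u \<in> carrier (\<Gamma> S)"
    and "gl \<otimes>\<^bsub>\<Gamma> S\<^esub> u = u \<otimes>\<^bsub>\<Gamma> S\<^esub> gr"
  shows "gl [^]\<^bsub>\<Gamma> S\<^esub> (a::nat) \<otimes>\<^bsub>\<Gamma> S\<^esub> u = u \<otimes>\<^bsub>\<Gamma> S\<^esub> gr [^]\<^bsub>\<Gamma> S\<^esub> a"
proof (induction a)
  case (Suc a)
  have "gl [^]\<^bsub>\<Gamma> S\<^esub> Suc a \<otimes>\<^bsub>\<Gamma> S\<^esub> u = gl [^]\<^bsub>\<Gamma> S\<^esub> a \<otimes>\<^bsub>\<Gamma> S\<^esub> (gl \<otimes>\<^bsub>\<Gamma> S\<^esub> u)"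
    using assms(1-3) by (simp add: W.m_assoc)
  also have "\<dots> = gl [^]\<^bsub>\<Gamma> S\<^esub> a \<otimes>\<^bsub>\<Gamma> S\<^esub> u \<otimes>\<^bsub>\<Gamma> S\<^esub> gr" unfolding assms(4) using assms(1-3) by (simp add: W.m_assoc)
  also have "\<dots> = u \<otimes>\<^bsub>\<Gamma> S\<^esub> gr [^]\<^bsub>\<Gamma> S\<^esub> Suc a" unfolding Suc using assms(1-3) by (simp add: W.m_assoc)
  finally show ?case .
qed (use assms in simp)

lemma intertwine_at:
  assumes "gl \<otimes>\<^bsub>\<Gamma> S\<^esub> u = u \<otimes>\<^bsub>\<Gamma> S\<^esub> gr"
  shows "snd u (snd gr i) = snd gl (snd u i)"
    and "i \<in> S \<Longrightarrow> fst u (snd gr i) \<otimes> fst gr i = fst gl (snd u i) \<otimes> fst u i"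
proof -
  have "snd (gl \<otimes>\<^bsub>\<Gamma> S\<^esub> u) i = snd (u \<otimes>\<^bsub>\<Gamma> S\<^esub> gr) i" using assms by simp
  then show "snd u (snd gr i) = snd gl (snd u i)" by (simp add: wr_mult_simps)
  assume i: "i \<in> S"
  have "fst (gl \<otimes>\<^bsub>\<Gamma> S\<^esub> u) i = fst (u \<otimes>\<^bsub>\<Gamma> S\<^esub> gr) i" using assms by simp
  then show "fst u (snd gr i) \<otimes> fst gr i = fst gl (snd u i) \<otimes> fst u i" using i by (simp add: wr_mult_simps)
qed

text \<open>An intertwiner is propagated along a cycle, so its value at one position of a transitive set determines it.\<close>
lemma intertwine_eqI:
  assumes g: "gl \<in> carrier (\<Gamma> C)" "gr \<in> carrier (\<Gamma> C)" and u: "u \<in> carrier (\<Gamma> C)" and v: "v \<in> carrier (\<Gamma> C)"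
    and gu: "gl \<otimes>\<^bsub>\<Gamma> C\<^esub> u = u \<otimes>\<^bsub>\<Gamma> C\<^esub> gr" and gv: "gl \<otimes>\<^bsub>\<Gamma> C\<^esub> v = v \<otimes>\<^bsub>\<Gamma> C\<^esub> gr"
    and i0: "i0 \<in> C" and trans: "\<And>i. i \<in> C \<Longrightarrow> \<exists>a. (snd gr ^^ a) i0 = i"
    and eq: "fst u i0 = fst v i0" "snd u i0 = snd v i0"
  shows "u = v"
proof -
  have "(snd gr ^^ a) i0 \<in> C \<and> fst u ((snd gr ^^ a) i0) = fst v ((snd gr ^^ a) i0) \<and> snd u ((snd gr ^^ a) i0) = snd v ((snd gr ^^ a) i0)" for a
  proof (induction a)
    case (Suc a)
    let ?i = "(snd gr ^^ a) i0"
    have i: "?i \<in> C" using Suc by simp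
    have "fst u (snd gr ?i) \<otimes> fst gr ?i = fst v (snd gr ?i) \<otimes> fst gr ?i"
      using intertwine_at(2)[OF gu i] intertwine_at(2)[OF gv i] Suc by simp
    then have "fst u (snd gr ?i) = fst v (snd gr ?i)"
      using i wr_carrierD(1)[OF g(2)] wr_carrierD(1)[OF u] wr_carrierD(1)[OF v] wr_carrierD(3)[OF g(2)] by simp
    then show ?case using Suc intertwine_at(1)[OF gu] intertwine_at(1)[OF gv] i wr_carrierD(3)[OF g(2)] by simp
  qed (use i0 eq in simp)
  then show ?thesis using trans by (intro wr_eqI[OF u v]) metis+
qed

lemma fst_pow_Suc:
  assumes "g \<in> carrier (\<Gamma> S)" "b \<in> S"
  shows "fst (g [^]\<^bsub>\<Gamma> S\<^esub> Suc a) b = fst g ((snd g ^^ a) b) \<otimes> fst (g [^]\<^bsub>\<Gamma> S\<^esub> a) b"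
  using assms by (simp only: W.nat_pow_Suc2 wr_mult_simps(2) wr_pow_snd)

lemma snd_pow_in:
  assumes "g \<in> carrier (\<Gamma> S)"
  shows "(snd g ^^ a) b \<in> S \<longleftrightarrow> b \<in> S"
  using wr_carrierD(3)[OF W.nat_pow_closed[OF assms, of a]] by (simp add: wr_pow_snd)

text \<open>Conversely an intertwiner can be prescribed at one base point \<open>\<beta> i\<close> of each cycle, where it has to fix the position. The only obstruction is that it must
  intertwine the cycle products \<open>fst (gr [^] d) i\<close> and \<open>fst (gl [^] d) i\<close> there.\<close>
lemma intertwiner_exists:
  fixes \<beta> :: "nat \<Rightarrow> nat" and z :: "nat \<Rightarrow> 'a"
  assumes fin: "finite S" and gl: "gl \<in> carrier (\<Gamma> S)" and gr: "gr \<in> carrier (\<Gamma> S)"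
    and \<beta>: "\<And>i. i \<in> S \<Longrightarrow> \<beta> i \<in> S" "\<And>i. i \<in> S \<Longrightarrow> \<beta> (snd gr i) = \<beta> i" "\<And>i. i \<in> S \<Longrightarrow> \<beta> (\<beta> i) = \<beta> i"
    and tr: "\<And>i. i \<in> S \<Longrightarrow> \<exists>a. (snd gr ^^ a) (\<beta> i) = i" and tl: "\<And>i. i \<in> S \<Longrightarrow> \<exists>a. (snd gl ^^ a) (\<beta> i) = i"
    and z: "\<And>i. i \<in> S \<Longrightarrow> z (\<beta> i) \<in> carrier H"
    and zd: "\<And>i d. i \<in> S \<Longrightarrow> \<beta> i = i \<Longrightarrow> d > 0 \<Longrightarrow> (snd gr ^^ d) i = i \<Longrightarrow> (\<And>e. 0 < e \<Longrightarrow> e < d \<Longrightarrow> (snd gr ^^ e) i \<noteq> i) \<Longrightarrow>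
       (snd gl ^^ d) i = i \<and> z i \<otimes> fst (gr [^]\<^bsub>\<Gamma> S\<^esub> d) i = fst (gl [^]\<^bsub>\<Gamma> S\<^esub> d) i \<otimes> z i"
  shows "\<exists>u\<in>carrier (\<Gamma> S). gl \<otimes>\<^bsub>\<Gamma> S\<^esub> u = u \<otimes>\<^bsub>\<Gamma> S\<^esub> gr \<and> (\<forall>i\<in>S. \<beta> i = i \<longrightarrow> snd u i = i \<and> fst u i = z i)"
proof -
  define ix where "ix i = (LEAST a. (snd gr ^^ a) (\<beta> i) = i)" for i
  have ix: "(snd gr ^^ ix i) (\<beta> i) = i" if "i \<in> S" for i
    unfolding ix_def by (rule LeastI_ex[OF tr[OF that]])
  have ix_le: "ix i \<le> a" if "(snd gr ^^ a) (\<beta> i) = i" for i a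
    unfolding ix_def using that by (rule Least_le)
  define \<theta> where "\<theta> i = (if i \<in> S then (snd gl ^^ ix i) (\<beta> i) else i)" for i
  define k where "k = (\<lambda>i\<in>S. fst (gl [^]\<^bsub>\<Gamma> S\<^esub> ix i) (\<beta> i) \<otimes> z (\<beta> i) \<otimes> inv (fst (gr [^]\<^bsub>\<Gamma> S\<^esub> ix i) (\<beta> i)))"
  have pc: "fst (gl [^]\<^bsub>\<Gamma> S\<^esub> (a::nat)) i \<in> carrier H" "fst (gr [^]\<^bsub>\<Gamma> S\<^esub> (a::nat)) i \<in> carrier H" if "i \<in> S" for a i
    using wr_carrierD(1)[OF W.nat_pow_closed[OF gl] that] wr_carrierD(1)[OF W.nat_pow_closed[OF gr] that] by auto
  have step: "\<theta> (snd gr i) = snd gl (\<theta> i) \<and> k (snd gr i) \<otimes> fst gr i = fst gl (\<theta> i) \<otimes> k i" if i: "i \<in> S" for i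
  proof -
    define a where "a = ix i"
    define b where "b = \<beta> i"
    have b: "b \<in> S" "\<beta> b = b" using \<beta> i by (auto simp: b_def)
    have ia: "(snd gr ^^ a) b = i" using ix[OF i] by (simp add: a_def b_def)
    have gi: "snd gr i \<in> S" using wr_carrierD(3)[OF gr] i by simp
    have bi: "\<beta> (snd gr i) = b" using \<beta>(2)[OF i] by (simp add: b_def)
    have \<theta>i: "\<theta> i = (snd gl ^^ a) b" using i by (simp add: \<theta>_def a_def b_def)
    have ki: "k i = fst (gl [^]\<^bsub>\<Gamma> S\<^esub> a) b \<otimes> z b \<otimes> inv (fst (gr [^]\<^bsub>\<Gamma> S\<^esub> a) b)" using i by (simp add: k_def a_def b_def)
    have gri: "fst gr i \<in> carrier H" using wr_carrierD(1)[OF gr] i by simp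
    have zb: "z b \<in> carrier H" using z i by (simp add: b_def)
    have \<theta>S: "\<theta> i \<in> S" unfolding \<theta>i using snd_pow_in[OF gl] b by simp
    have gli: "fst gl (\<theta> i) \<in> carrier H" using wr_carrierD(1)[OF gl] \<theta>S by simp
    have glS: "fst (gl [^]\<^bsub>\<Gamma> S\<^esub> Suc a) b = fst gl (\<theta> i) \<otimes> fst (gl [^]\<^bsub>\<Gamma> S\<^esub> a) b"
      unfolding \<theta>i by (rule fst_pow_Suc[OF gl b(1)])
    have grS: "fst (gr [^]\<^bsub>\<Gamma> S\<^esub> Suc a) b = fst gr i \<otimes> fst (gr [^]\<^bsub>\<Gamma> S\<^esub> a) b"
      using fst_pow_Suc[OF gr b(1)] ia by simp
    have ps: "(snd gr ^^ Suc a) b = snd gr i" using ia by simp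
    consider "ix (snd gr i) = Suc a" | "ix (snd gr i) = 0" "ix (snd gr i) \<noteq> Suc a"
    proof -
      have "ix (snd gr i) = Suc a" if c: "ix (snd gr i) = Suc c" for c
      proof -
        have "snd gr ((snd gr ^^ c) b) = snd gr i" using ix[OF gi] c bi by simp
        then have "(snd gr ^^ c) b = i" using wr_carrierD(6)[OF gr] by simp
        then have "a \<le> c" using ix_le[of c i] by (simp add: a_def b_def)
        moreover have "ix (snd gr i) \<le> Suc a" by (rule ix_le) (use ps bi in simp)
        ultimately show ?thesis using c by simp
      qed
      then show thesis using that by (cases "ix (snd gr i)") auto
    qed
    then show ?thesis
    proof cases
      case 1
      have \<theta>': "\<theta> (snd gr i) = snd gl (\<theta> i)" using 1 gi bi by (simp add: \<theta>_def[of "snd gr i"] \<theta>i)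
      have "k (snd gr i) = fst gl (\<theta> i) \<otimes> fst (gl [^]\<^bsub>\<Gamma> S\<^esub> a) b \<otimes> z b \<otimes> inv (fst gr i \<otimes> fst (gr [^]\<^bsub>\<Gamma> S\<^esub> a) b)"
        using 1 gi bi glS grS by (simp add: k_def del: W.nat_pow_Suc)
      then have "k (snd gr i) \<otimes> fst gr i = fst gl (\<theta> i) \<otimes> k i"
        using gri gli zb pc[OF b(1)] by (simp add: ki inv_mult_group m_assoc)
      then show ?thesis using \<theta>' by simp
    next
      case 2
      have gib: "snd gr i = b" using ix[OF gi] 2 bi by simp
      have d: "(snd gr ^^ Suc a) b = b" using ps gib by simp
      have min: "(snd gr ^^ e) b \<noteq> b" if e: "0 < e" "e < Suc a" for e
      proof
        assume "(snd gr ^^ e) b = b"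
        then have "(snd gr ^^ (a - e)) b = (snd gr ^^ (a - e + e)) b" by (simp add: funpow_add)
        then have "(snd gr ^^ (a - e)) b = i" using e ia by simp
        then have "a \<le> a - e" using ix_le[of "a - e" i] by (simp add: a_def b_def)
        then show False using e by simp
      qed
      have zz: "(snd gl ^^ Suc a) b = b" "z b \<otimes> fst (gr [^]\<^bsub>\<Gamma> S\<^esub> Suc a) b = fst (gl [^]\<^bsub>\<Gamma> S\<^esub> Suc a) b \<otimes> z b"
        using zd[OF b _ d min] by auto
      have "\<theta> (snd gr i) = b" using 2 gi bi gib b by (simp add: \<theta>_def)
      then have \<theta>': "\<theta> (snd gr i) = snd gl (\<theta> i)" using zz(1) by (simp add: \<theta>i)
      have "k (snd gr i) = z b" using 2 gi bi gib b zb by (simp add: k_def wr_mult_simps)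
      moreover have "z b \<otimes> fst gr i \<otimes> fst (gr [^]\<^bsub>\<Gamma> S\<^esub> a) b = fst gl (\<theta> i) \<otimes> fst (gl [^]\<^bsub>\<Gamma> S\<^esub> a) b \<otimes> z b"
        using zz(2) unfolding glS grS using zb gri pc[OF b(1)] by (simp add: m_assoc)
      then have "z b \<otimes> fst gr i \<otimes> fst (gr [^]\<^bsub>\<Gamma> S\<^esub> a) b \<otimes> inv (fst (gr [^]\<^bsub>\<Gamma> S\<^esub> a) b)
          = fst gl (\<theta> i) \<otimes> fst (gl [^]\<^bsub>\<Gamma> S\<^esub> a) b \<otimes> z b \<otimes> inv (fst (gr [^]\<^bsub>\<Gamma> S\<^esub> a) b)" by simp
      then have "z b \<otimes> fst gr i = fst gl (\<theta> i) \<otimes> k i"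
        using zb gri gli pc[OF b(1)] by (simp add: ki m_assoc)
      ultimately show ?thesis using \<theta>' by simp
    qed
  qed
  have base: "\<theta> i = i \<and> k i = z i" if i: "i \<in> S" "\<beta> i = i" for i
  proof -
    have "ix i = 0" using ix_le[of 0 i] i by simp
    then show ?thesis using i z[OF i(1)] by (simp add: \<theta>_def k_def wr_mult_simps)
  qed
  have \<theta>pow: "(snd gr ^^ a) b \<in> S \<and> \<theta> ((snd gr ^^ a) b) = (snd gl ^^ a) b" if "b \<in> S" "\<beta> b = b" for a b
    using base[OF that] that step wr_carrierD(3)[OF gr] by (induction a) auto
  have surj: "\<theta> ` S = S"
  proof
    show "\<theta> ` S \<subseteq> S" using snd_pow_in[OF gl] \<beta>(1) by (auto simp: \<theta>_def)
    show "S \<subseteq> \<theta> ` S"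
    proof
      fix i assume i: "i \<in> S"
      obtain a where a: "(snd gl ^^ a) (\<beta> i) = i" using tl[OF i] by blast
      show "i \<in> \<theta> ` S" using \<theta>pow[OF \<beta>(1)[OF i] \<beta>(3)[OF i], of a] a by (metis imageI)
    qed
  qed
  have "inj_on \<theta> S" by (rule eq_card_imp_inj_on[OF fin]) (simp only: surj)
  then have "\<theta> permutes S" using surj by (intro bij_imp_permutes) (simp_all add: bij_betw_def \<theta>_def)
  then have u: "(k, \<theta>) \<in> carrier (\<Gamma> S)"
    using pc \<beta>(1) z by (auto simp: wr_carrier_iff k_def)
  have "gl \<otimes>\<^bsub>\<Gamma> S\<^esub> (k, \<theta>) = (k, \<theta>) \<otimes>\<^bsub>\<Gamma> S\<^esub> gr"
    by (rule wr_eqI[of _ H S]) (use u gl gr step in \<open>auto simp: wr_mult_simps\<close>)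
  then show ?thesis using u base by (intro bexI[of _ "(k, \<theta>)"]) auto
qed

end

section \<open>Signs on sets of positions and weights\<close>

lemma sign_cycle_of_list:
  "distinct cs \<Longrightarrow> cs \<noteq> [] \<Longrightarrow> sign (cycle_of_list cs) = (-1) ^ (length cs - 1)"
proof (induction cs rule: cycle_of_list.induct)
  case (1 i j cs)
  have "sign (cycle_of_list (i # j # cs)) = sign (transpose i j) * sign (cycle_of_list (j # cs))"
    by (simp add: sign_compose permutation_swap_id permutation_of_cycle)
  then show ?case using 1 by (simp add: sign_swap_id del: cycle_of_list.simps)
qed auto

text \<open>A permutation with a single orbit is a cycle of full length.\<close>
lemma transitive_period:
  assumes \<pi>: "\<pi> permutes C" and fin: "finite C" and i0: "i0 \<in> C" and tr: "\<And>i. i \<in> C \<Longrightarrow> \<exists>a. (\<pi> ^^ a) i0 = i"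
  shows "(\<pi> ^^ a) i0 = i0 \<longleftrightarrow> card C dvd a"
    and "bij_betw (\<lambda>a. (\<pi> ^^ a) i0) {..<card C} C"
    and "sign \<pi> = (-1) ^ (card C - 1)"
proof -
  have perm: "permutation \<pi>" using \<pi> fin unfolding permutation_permutes by blast
  let ?l = "least_power \<pi> i0"
  have l: "(\<pi> ^^ ?l) i0 = i0" "?l > 0" using least_power_of_permutation[OF perm] by auto
  have inC: "(\<pi> ^^ a) i0 \<in> C" for a
    using i0 permutes_in_image[OF \<pi>] by (induction a) auto
  have "C \<subseteq> set (support \<pi> i0)"
  proof
    fix i assume "i \<in> C"
    then obtain a where "(\<pi> ^^ a) i0 = i" using tr by blast
    then have "(\<pi> ^^ (a mod ?l)) i0 = i" using funpow_mod_eq[OF l(1), of a] by simp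
    then show "i \<in> set (support \<pi> i0)" using l(2) by auto
  qed
  then have C: "set (support \<pi> i0) = C" using inC by auto
  have dist: "distinct (support \<pi> i0)" by (rule cycle_of_permutation[OF perm])
  have card: "card C = ?l" using distinct_card[OF dist] C by simp
  show "(\<pi> ^^ a) i0 = i0 \<longleftrightarrow> card C dvd a" unfolding card using least_power_dvd[OF perm] by metis
  show "bij_betw (\<lambda>a. (\<pi> ^^ a) i0) {..<card C} C"
    using dist C unfolding card bij_betw_def by (auto simp: distinct_map lessThan_atLeast0)
  have "\<pi> = cycle_of_list (support \<pi> i0)"
  proof
    fix i
    show "\<pi> i = cycle_of_list (support \<pi> i0) i"
    proof (cases "i \<in> C")
      case True
      then show ?thesis using cycle_restrict[OF perm, of i i0] C by simp
    next
      case False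
      then show ?thesis using id_outside_supp[of i "support \<pi> i0"] C permutes_not_in[OF \<pi>] by simp
    qed
  qed
  then have "sign \<pi> = sign (cycle_of_list (support \<pi> i0))" by (rule arg_cong)
  also have "\<dots> = (-1) ^ (?l - 1)" using sign_cycle_of_list[OF dist] l(2) by simp
  finally show "sign \<pi> = (-1) ^ (card C - 1)" unfolding card .
qed

definition sign_on_set :: "nat set \<Rightarrow> (nat \<Rightarrow> nat) \<Rightarrow> complex" where
  "sign_on_set M \<pi> = of_int (sign (\<lambda>i. if i \<in> M then \<pi> i else i))"

text \<open>The value \<open>L w' h w\<close> belongs to the arrow \<open>h\<close> from \<open>w\<close> to \<open>w'\<close> in the groupoid of the twisted conjugation action;
  arrows are described by \<open>h \<otimes> w = w' \<otimes> \<tau> h\<close>. Restricted to the loops at \<open>w\<close> it is a linear character of the twisted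
  centralizer.\<close>
locale twisted_cocycle = twisted_group +
  fixes L :: "'a \<Rightarrow> 'a \<Rightarrow> 'a \<Rightarrow> complex"
  assumes L_one: "w \<in> twisted_involutions H \<tau> \<Longrightarrow> L w \<one> w = 1"
    and L_mult: "\<lbrakk>w \<in> twisted_involutions H \<tau>; w' \<in> twisted_involutions H \<tau>; w'' \<in> twisted_involutions H \<tau>;
        h \<in> carrier H; h' \<in> carrier H; h \<otimes> w = w' \<otimes> \<tau> h; h' \<otimes> w' = w'' \<otimes> \<tau> h'\<rbrakk>
       \<Longrightarrow> L w'' (h' \<otimes> h) w = L w'' h' w' * L w' h w"

text \<open>The extra assumption is the desired identity for \<open>n = 1\<close>.\<close>
locale twisted_weight = twisted_cocycle +
  assumes L_sum: "c \<in> carrier H \<Longrightarrow>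
      (\<Sum>w | w \<in> twisted_involutions H \<tau> \<and> c \<otimes> w = w \<otimes> \<tau> c. L w c w) = of_nat (card (twisted_square_roots H \<tau> c))"
begin

definition fixing :: "nat set \<Rightarrow> 'a wr \<Rightarrow> 'a wr set" where
  "fixing S g = {\<omega> \<in> twisted_involutions (\<Gamma> S) (\<alpha> S). g \<otimes>\<^bsub>\<Gamma> S\<^esub> \<omega> = \<omega> \<otimes>\<^bsub>\<Gamma> S\<^esub> \<alpha> S g}"

definition roots :: "nat set \<Rightarrow> 'a wr \<Rightarrow> 'a wr set" where
  "roots S g = twisted_square_roots (\<Gamma> S) (\<alpha> S) g"

definition weight :: "nat set \<Rightarrow> 'a wr \<Rightarrow> 'a wr \<Rightarrow> complex" where
  "weight S g \<omega> = sign_on_set {i\<in>S. snd \<omega> i \<noteq> i} (snd g)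
      * (\<Prod>i\<in>{i\<in>S. snd \<omega> i = i}. L (fst \<omega> (snd g i)) (fst g i) (fst \<omega> i))"

lemma fixingD:
  assumes "\<omega> \<in> fixing S g"
  shows "\<omega> \<in> carrier (\<Gamma> S)" "\<omega> \<otimes>\<^bsub>\<Gamma> S\<^esub> \<alpha> S \<omega> = \<one>\<^bsub>\<Gamma> S\<^esub>" "g \<otimes>\<^bsub>\<Gamma> S\<^esub> \<omega> = \<omega> \<otimes>\<^bsub>\<Gamma> S\<^esub> \<alpha> S g"
    "\<And>i. snd \<omega> (snd \<omega> i) = i" "\<And>i. snd \<omega> (snd g i) = snd g (snd \<omega> i)"
proof -
  show c: "\<omega> \<in> carrier (\<Gamma> S)" "\<omega> \<otimes>\<^bsub>\<Gamma> S\<^esub> \<alpha> S \<omega> = \<one>\<^bsub>\<Gamma> S\<^esub>" "g \<otimes>\<^bsub>\<Gamma> S\<^esub> \<omega> = \<omega> \<otimes>\<^bsub>\<Gamma> S\<^esub> \<alpha> S g"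
    using assms by (auto simp: fixing_def twisted_involutions_def)
  have "snd (\<omega> \<otimes>\<^bsub>\<Gamma> S\<^esub> \<alpha> S \<omega>) = id" using c(2) by (simp add: wr_mult_simps)
  then show "snd \<omega> (snd \<omega> i) = i" for i by (simp add: wr_mult_simps wr_aut_simps fun_eq_iff)
  show "snd \<omega> (snd g i) = snd g (snd \<omega> i)" for i using intertwine_at(1)[OF c(3)] by (simp add: wr_aut_simps)
qed

lemma rootsD:
  assumes "y \<in> roots S g"
  shows "y \<in> carrier (\<Gamma> S)" "y \<otimes>\<^bsub>\<Gamma> S\<^esub> \<alpha> S y = g" "g \<otimes>\<^bsub>\<Gamma> S\<^esub> y = y \<otimes>\<^bsub>\<Gamma> S\<^esub> \<alpha> S g"
    "\<And>i. snd y (snd y i) = snd g i" "\<And>i. snd y (snd g i) = snd g (snd y i)"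
proof -
  show c: "y \<in> carrier (\<Gamma> S)" "y \<otimes>\<^bsub>\<Gamma> S\<^esub> \<alpha> S y = g"
    using assms by (auto simp: roots_def twisted_square_roots_def)
  show g: "g \<otimes>\<^bsub>\<Gamma> S\<^esub> y = y \<otimes>\<^bsub>\<Gamma> S\<^esub> \<alpha> S g"
    using c(1) unfolding c(2)[symmetric] by (simp add: \<alpha>_closed \<alpha>_mult \<alpha>_\<alpha> W.m_assoc)
  show "snd y (snd y i) = snd g i" for i unfolding c(2)[symmetric] by (simp add: wr_mult_simps wr_aut_simps)
  show "snd y (snd g i) = snd g (snd y i)" for i using intertwine_at(1)[OF g] by (simp add: wr_aut_simps)
qed

text \<open>For \<open>h\<close> a power of \<open>g\<close>, an element \<open>y\<close> that commutes with \<open>g\<close> up to the twist satisfies \<open>y \<otimes> \<alpha> h = h \<otimes> y\<close>. So multiplication by \<open>h\<close> multiplies \<open>y \<otimes> \<alpha> y\<close> by \<open>h \<otimes> h\<close>. In this way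
  elements that rotate a cycle by a fixed amount become diagonal ones.\<close>
lemma shift_bij:
  fixes b :: nat
  assumes g: "g \<in> carrier (\<Gamma> S)" and z: "z \<in> carrier (\<Gamma> S)"
  defines "h \<equiv> g [^]\<^bsub>\<Gamma> S\<^esub> b"
  shows "bij_betw (\<lambda>y. h \<otimes>\<^bsub>\<Gamma> S\<^esub> y)
    {y \<in> carrier (\<Gamma> S). g \<otimes>\<^bsub>\<Gamma> S\<^esub> y = y \<otimes>\<^bsub>\<Gamma> S\<^esub> \<alpha> S g \<and> y \<otimes>\<^bsub>\<Gamma> S\<^esub> \<alpha> S y = z \<and> snd (h \<otimes>\<^bsub>\<Gamma> S\<^esub> y) = id}
    {Y \<in> carrier (\<Gamma> S). g \<otimes>\<^bsub>\<Gamma> S\<^esub> Y = Y \<otimes>\<^bsub>\<Gamma> S\<^esub> \<alpha> S g \<and> Y \<otimes>\<^bsub>\<Gamma> S\<^esub> \<alpha> S Y = h \<otimes>\<^bsub>\<Gamma> S\<^esub> (h \<otimes>\<^bsub>\<Gamma> S\<^esub> z) \<and> snd Y = id}"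
proof -
  have h: "h \<in> carrier (\<Gamma> S)" using g by (simp add: h_def)
  have gh: "g \<otimes>\<^bsub>\<Gamma> S\<^esub> h = h \<otimes>\<^bsub>\<Gamma> S\<^esub> g" unfolding h_def by (rule W.group_commutes_pow[OF refl g g, symmetric])
  have hy: "h \<otimes>\<^bsub>\<Gamma> S\<^esub> y = y \<otimes>\<^bsub>\<Gamma> S\<^esub> \<alpha> S h" if "y \<in> carrier (\<Gamma> S)" "g \<otimes>\<^bsub>\<Gamma> S\<^esub> y = y \<otimes>\<^bsub>\<Gamma> S\<^esub> \<alpha> S g" for y
    using intertwine_pow[OF g \<alpha>_closed[OF g] that, of b] g by (simp add: h_def \<alpha>_pow)
  have ghy: "g \<otimes>\<^bsub>\<Gamma> S\<^esub> (h \<otimes>\<^bsub>\<Gamma> S\<^esub> y) = h \<otimes>\<^bsub>\<Gamma> S\<^esub> y \<otimes>\<^bsub>\<Gamma> S\<^esub> \<alpha> S g \<longleftrightarrow> g \<otimes>\<^bsub>\<Gamma> S\<^esub> y = y \<otimes>\<^bsub>\<Gamma> S\<^esub> \<alpha> S g" if y: "y \<in> carrier (\<Gamma> S)" for y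
  proof -
    have "g \<otimes>\<^bsub>\<Gamma> S\<^esub> (h \<otimes>\<^bsub>\<Gamma> S\<^esub> y) = h \<otimes>\<^bsub>\<Gamma> S\<^esub> (g \<otimes>\<^bsub>\<Gamma> S\<^esub> y)" using g h y gh by (simp flip: W.m_assoc)
    then show ?thesis using g h y \<alpha>_closed[OF g] by (simp add: W.m_assoc)
  qed
  have sq: "h \<otimes>\<^bsub>\<Gamma> S\<^esub> y \<otimes>\<^bsub>\<Gamma> S\<^esub> \<alpha> S (h \<otimes>\<^bsub>\<Gamma> S\<^esub> y) = h \<otimes>\<^bsub>\<Gamma> S\<^esub> (h \<otimes>\<^bsub>\<Gamma> S\<^esub> (y \<otimes>\<^bsub>\<Gamma> S\<^esub> \<alpha> S y))"
    if y: "y \<in> carrier (\<Gamma> S)" "g \<otimes>\<^bsub>\<Gamma> S\<^esub> y = y \<otimes>\<^bsub>\<Gamma> S\<^esub> \<alpha> S g" for y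
  proof -
    have "h \<otimes>\<^bsub>\<Gamma> S\<^esub> y \<otimes>\<^bsub>\<Gamma> S\<^esub> \<alpha> S (h \<otimes>\<^bsub>\<Gamma> S\<^esub> y) = h \<otimes>\<^bsub>\<Gamma> S\<^esub> (y \<otimes>\<^bsub>\<Gamma> S\<^esub> \<alpha> S h) \<otimes>\<^bsub>\<Gamma> S\<^esub> \<alpha> S y"
      using h y(1) by (simp add: \<alpha>_mult \<alpha>_closed W.m_assoc)
    then show ?thesis using h y(1) by (simp add: hy[OF y, symmetric] \<alpha>_closed W.m_assoc)
  qed
  show ?thesis
  proof (rule bij_betw_byWitness[where f' = "\<lambda>Y. inv\<^bsub>\<Gamma> S\<^esub> h \<otimes>\<^bsub>\<Gamma> S\<^esub> Y"], goal_cases)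
    case 1
    then show ?case using h by (auto simp flip: W.m_assoc)
  next
    case 2
    then show ?case using h by (auto simp flip: W.m_assoc)
  next
    case 3
    then show ?case using h ghy sq by auto
  next
    case 4
    show ?case
    proof (rule image_subsetI)
      fix Y assume "Y \<in> {Y \<in> carrier (\<Gamma> S). g \<otimes>\<^bsub>\<Gamma> S\<^esub> Y = Y \<otimes>\<^bsub>\<Gamma> S\<^esub> \<alpha> S g \<and> Y \<otimes>\<^bsub>\<Gamma> S\<^esub> \<alpha> S Y = h \<otimes>\<^bsub>\<Gamma> S\<^esub> (h \<otimes>\<^bsub>\<Gamma> S\<^esub> z) \<and> snd Y = id}"
      then have Y: "Y \<in> carrier (\<Gamma> S)" and Y2: "g \<otimes>\<^bsub>\<Gamma> S\<^esub> Y = Y \<otimes>\<^bsub>\<Gamma> S\<^esub> \<alpha> S g"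
        "Y \<otimes>\<^bsub>\<Gamma> S\<^esub> \<alpha> S Y = h \<otimes>\<^bsub>\<Gamma> S\<^esub> (h \<otimes>\<^bsub>\<Gamma> S\<^esub> z)" "snd Y = id" by simp_all
      define y where "y = inv\<^bsub>\<Gamma> S\<^esub> h \<otimes>\<^bsub>\<Gamma> S\<^esub> Y"
      have y: "y \<in> carrier (\<Gamma> S)" using Y h by (simp add: y_def)
      have hyY: "h \<otimes>\<^bsub>\<Gamma> S\<^esub> y = Y" using Y h by (simp add: y_def flip: W.m_assoc)
      have gy: "g \<otimes>\<^bsub>\<Gamma> S\<^esub> y = y \<otimes>\<^bsub>\<Gamma> S\<^esub> \<alpha> S g" using ghy[OF y] Y2(1) unfolding hyY by simp
      have "h \<otimes>\<^bsub>\<Gamma> S\<^esub> (h \<otimes>\<^bsub>\<Gamma> S\<^esub> (y \<otimes>\<^bsub>\<Gamma> S\<^esub> \<alpha> S y)) = h \<otimes>\<^bsub>\<Gamma> S\<^esub> (h \<otimes>\<^bsub>\<Gamma> S\<^esub> z)"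
        using sq[OF y gy] Y2(2) unfolding hyY by simp
      then have "y \<otimes>\<^bsub>\<Gamma> S\<^esub> \<alpha> S y = z" using h y z \<alpha>_closed[OF y] by simp
      then show "inv\<^bsub>\<Gamma> S\<^esub> h \<otimes>\<^bsub>\<Gamma> S\<^esub> Y \<in> {y \<in> carrier (\<Gamma> S). g \<otimes>\<^bsub>\<Gamma> S\<^esub> y = y \<otimes>\<^bsub>\<Gamma> S\<^esub> \<alpha> S g \<and> y \<otimes>\<^bsub>\<Gamma> S\<^esub> \<alpha> S y = z \<and> snd (h \<otimes>\<^bsub>\<Gamma> S\<^esub> y) = id}"
        using y gy hyY Y2(3) unfolding y_def by simp
    qed
  qed
qed

end

lemma restrict_perm_permutes:
  assumes "finite M" "inj \<pi>" "\<And>i. i \<in> M \<Longrightarrow> \<pi> i \<in> M"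
  shows "(\<lambda>i. if i \<in> M then \<pi> i else i) permutes M"
proof -
  have inj: "inj_on \<pi> M" using assms(2) by (rule inj_on_subset) simp
  have "\<pi> ` M = M" by (rule endo_inj_surj[OF assms(1) _ inj]) (use assms(3) in auto)
  then show ?thesis using inj by (intro bij_imp_permutes) (auto simp: bij_betw_def inj_on_def)
qed

lemma sign_on_set_cong:
  assumes "\<And>i. i \<in> M \<Longrightarrow> \<pi> i = \<pi>' i"
  shows "sign_on_set M \<pi> = sign_on_set M \<pi>'"
proof -
  have "(\<lambda>i. if i \<in> M then \<pi> i else i) = (\<lambda>i. if i \<in> M then \<pi>' i else i)" using assms by auto
  then show ?thesis by (simp add: sign_on_set_def)
qed

lemma sign_on_set_Un:
  assumes "finite M" "finite N" "M \<inter> N = {}" "inj \<pi>"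
    "\<And>i. i \<in> M \<Longrightarrow> \<pi> i \<in> M" "\<And>i. i \<in> N \<Longrightarrow> \<pi> i \<in> N"
  shows "sign_on_set (M \<union> N) \<pi> = sign_on_set M \<pi> * sign_on_set N \<pi>"
proof -
  let ?f = "\<lambda>M i. if i \<in> M then \<pi> i else i"
  have "permutation (?f M)" "permutation (?f N)"
    using restrict_perm_permutes[OF assms(1,4,5)] restrict_perm_permutes[OF assms(2,4,6)] assms(1,2)
    unfolding permutation_permutes by blast+
  then have "sign (?f M \<circ> ?f N) = sign (?f M) * sign (?f N)" by (rule sign_compose)
  moreover have "?f M \<circ> ?f N = ?f (M \<union> N)" using assms(3,5,6) by (auto simp: fun_eq_iff)
  ultimately show ?thesis by (simp add: sign_on_set_def del: o_apply)
qed

context twisted_weight begin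

section \<open>A single cycle\<close>

lemma commuting_snd_id:
  assumes y: "y \<in> carrier (\<Gamma> C)" and comm: "\<And>i. snd y (snd g i) = snd g (snd y i)"
    and tr: "\<And>i. i \<in> C \<Longrightarrow> \<exists>a. (snd g ^^ a) i0 = i" and y0: "snd y i0 = i0"
  shows "snd y = id"
proof
  have "snd y ((snd g ^^ a) i0) = (snd g ^^ a) i0" for a by (induction a) (simp_all add: comm y0)
  then show "snd y i = id i" for i using tr[of i] wr_carrierD(4)[OF y, of i] by (cases "i \<in> C") auto
qed

text \<open>On one cycle, a diagonal element that commutes with \<open>g\<close> up to the twist is determined by its entry at \<open>i0\<close>, and every entry
  compatible with the cycle product \<open>c\<close> occurs.\<close>
lemma diagonal_bij:
  assumes fin: "finite C" and g: "g \<in> carrier (\<Gamma> C)" and i0: "i0 \<in> C"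
    and tr: "\<And>i. i \<in> C \<Longrightarrow> \<exists>a. (snd g ^^ a) i0 = i"
    and z: "z \<in> carrier (\<Gamma> C)" "g \<otimes>\<^bsub>\<Gamma> C\<^esub> z = z \<otimes>\<^bsub>\<Gamma> C\<^esub> g" "snd z = id"
  defines "c \<equiv> fst (g [^]\<^bsub>\<Gamma> C\<^esub> card C) i0"
  shows "bij_betw (\<lambda>Y. fst Y i0)
    {Y \<in> carrier (\<Gamma> C). g \<otimes>\<^bsub>\<Gamma> C\<^esub> Y = Y \<otimes>\<^bsub>\<Gamma> C\<^esub> \<alpha> C g \<and> Y \<otimes>\<^bsub>\<Gamma> C\<^esub> \<alpha> C Y = z \<and> snd Y = id}
    {y \<in> carrier H. c \<otimes> y = y \<otimes> \<tau> c \<and> y \<otimes> \<tau> y = fst z i0}"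
    (is "bij_betw ?f ?A ?B")
proof -
  let ?k = "card C"
  note period = transitive_period[OF wr_carrierD(2)[OF g] fin i0 tr]
  have per: "(snd g ^^ ?k) i0 = i0" using period(1)[of ?k] by simp
  have k0: "?k > 0" using fin i0 by (metis card_gt_0_iff empty_iff)
  have \<alpha>g: "\<alpha> C g \<in> carrier (\<Gamma> C)" by (rule \<alpha>_closed[OF g])
  have tr\<alpha>: "\<exists>a. (snd (\<alpha> C g) ^^ a) i0 = i" if "i \<in> C" for i using tr[OF that] by (simp add: wr_aut_simps)
  have powc: "fst (\<alpha> C g [^]\<^bsub>\<Gamma> C\<^esub> ?k) i0 = \<tau> c"
    using g i0 by (simp add: \<alpha>_pow[symmetric] wr_aut_simps c_def)
  have "inj_on ?f ?A"
  proof (rule inj_onI)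
    fix Y Z assume "Y \<in> ?A" "Z \<in> ?A" "fst Y i0 = fst Z i0"
    then have YZ: "Y \<in> carrier (\<Gamma> C)" "Z \<in> carrier (\<Gamma> C)" "g \<otimes>\<^bsub>\<Gamma> C\<^esub> Y = Y \<otimes>\<^bsub>\<Gamma> C\<^esub> \<alpha> C g"
      "g \<otimes>\<^bsub>\<Gamma> C\<^esub> Z = Z \<otimes>\<^bsub>\<Gamma> C\<^esub> \<alpha> C g" "fst Y i0 = fst Z i0" "snd Y i0 = snd Z i0" by simp_all
    show "Y = Z" by (rule intertwine_eqI[OF g \<alpha>g YZ(1-4) i0 tr\<alpha> YZ(5,6)])
  qed
  moreover have "?f ` ?A \<subseteq> ?B"
  proof (rule image_subsetI)
    fix Y assume "Y \<in> ?A"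
    then have Y: "Y \<in> carrier (\<Gamma> C)" and gY: "g \<otimes>\<^bsub>\<Gamma> C\<^esub> Y = Y \<otimes>\<^bsub>\<Gamma> C\<^esub> \<alpha> C g"
      and YY: "Y \<otimes>\<^bsub>\<Gamma> C\<^esub> \<alpha> C Y = z" and id: "snd Y = id" by auto
    have "fst (Y \<otimes>\<^bsub>\<Gamma> C\<^esub> \<alpha> C Y) i0 = fst z i0" unfolding YY ..
    then have "fst Y i0 \<otimes> \<tau> (fst Y i0) = fst z i0" using i0 id by (simp add: wr_mult_simps wr_aut_simps)
    moreover have "fst Y i0 \<otimes> \<tau> c = c \<otimes> fst Y i0"
      using intertwine_at(2)[OF intertwine_pow[OF g \<alpha>g Y gY, of ?k] i0] powc id per
      by (simp add: wr_pow_snd wr_aut_simps c_def)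
    ultimately show "fst Y i0 \<in> ?B" using wr_carrierD(1)[OF Y i0] by simp
  qed
  moreover have "?B \<subseteq> ?f ` ?A"
  proof
    fix y assume "y \<in> ?B"
    then have y: "y \<in> carrier H" "c \<otimes> y = y \<otimes> \<tau> c" "y \<otimes> \<tau> y = fst z i0" by auto
    have "\<exists>u\<in>carrier (\<Gamma> C). g \<otimes>\<^bsub>\<Gamma> C\<^esub> u = u \<otimes>\<^bsub>\<Gamma> C\<^esub> \<alpha> C g \<and> (\<forall>i\<in>C. i0 = i \<longrightarrow> snd u i = i \<and> fst u i = y)"
    proof (rule intertwiner_exists[OF fin g \<alpha>g, where z = "\<lambda>_. y" and \<beta> = "\<lambda>_. i0"])
      fix i and d :: nat
      assume i: "i0 = i" and d: "d > 0" "(snd (\<alpha> C g) ^^ d) i = i"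
        and min: "\<And>e. 0 < e \<Longrightarrow> e < d \<Longrightarrow> (snd (\<alpha> C g) ^^ e) i \<noteq> i"
      have "?k dvd d" using period(1)[of d] d i by (simp add: wr_aut_simps)
      moreover have "\<not> ?k < d" using min[of ?k] k0 per i by (auto simp: wr_aut_simps)
      ultimately have "d = ?k" using d(1) dvd_imp_le by force
      then show "(snd g ^^ d) i = i \<and> y \<otimes> fst (\<alpha> C g [^]\<^bsub>\<Gamma> C\<^esub> d) i = fst (g [^]\<^bsub>\<Gamma> C\<^esub> d) i \<otimes> y"
        using per powc y(2) i by (simp add: c_def)
    qed (use i0 tr tr\<alpha> y in auto)
    then obtain u where u: "u \<in> carrier (\<Gamma> C)" "g \<otimes>\<^bsub>\<Gamma> C\<^esub> u = u \<otimes>\<^bsub>\<Gamma> C\<^esub> \<alpha> C g" "snd u i0 = i0" "fst u i0 = y"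
      using i0 by blast
    have id: "snd u = id"
      by (rule commuting_snd_id[OF u(1) _ tr u(3)]) (use intertwine_at(1)[OF u(2)] in \<open>simp_all add: wr_aut_simps\<close>)
    have \<alpha>u: "\<alpha> C u \<in> carrier (\<Gamma> C)" by (rule \<alpha>_closed[OF u(1)])
    have "\<alpha> C (g \<otimes>\<^bsub>\<Gamma> C\<^esub> u) = \<alpha> C (u \<otimes>\<^bsub>\<Gamma> C\<^esub> \<alpha> C g)" unfolding u(2) ..
    then have gu': "\<alpha> C g \<otimes>\<^bsub>\<Gamma> C\<^esub> \<alpha> C u = \<alpha> C u \<otimes>\<^bsub>\<Gamma> C\<^esub> g" using g u(1) \<alpha>g by (simp add: \<alpha>_mult \<alpha>_\<alpha>)
    have "g \<otimes>\<^bsub>\<Gamma> C\<^esub> (u \<otimes>\<^bsub>\<Gamma> C\<^esub> \<alpha> C u) = u \<otimes>\<^bsub>\<Gamma> C\<^esub> (\<alpha> C g \<otimes>\<^bsub>\<Gamma> C\<^esub> \<alpha> C u)"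
      using g u(1) \<alpha>u \<alpha>g u(2) by (simp flip: W.m_assoc)
    then have guu: "g \<otimes>\<^bsub>\<Gamma> C\<^esub> (u \<otimes>\<^bsub>\<Gamma> C\<^esub> \<alpha> C u) = u \<otimes>\<^bsub>\<Gamma> C\<^esub> \<alpha> C u \<otimes>\<^bsub>\<Gamma> C\<^esub> g"
      unfolding gu' using g u(1) \<alpha>u by (simp add: W.m_assoc)
    have "u \<otimes>\<^bsub>\<Gamma> C\<^esub> \<alpha> C u = z"
      by (rule intertwine_eqI[OF g g _ z(1) guu z(2) i0 tr])
        (use u \<alpha>u i0 id z(3) y(3) in \<open>simp_all add: wr_mult_simps wr_aut_simps\<close>)
    then have "u \<in> ?A" using u id by simp
    then show "y \<in> ?f ` ?A" using u(4) by blast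
  qed
  ultimately show ?thesis unfolding bij_betw_def by blast
qed

text \<open>Multiplicativity of \<open>L\<close> makes the product over the positions of a cycle collapse to one value at the cycle product.\<close>
lemma product_along_cycle:
  assumes g: "g \<in> carrier (\<Gamma> C)" and Y: "Y \<in> carrier (\<Gamma> C)" and YY: "Y \<otimes>\<^bsub>\<Gamma> C\<^esub> \<alpha> C Y = \<one>\<^bsub>\<Gamma> C\<^esub>"
    and gY: "g \<otimes>\<^bsub>\<Gamma> C\<^esub> Y = Y \<otimes>\<^bsub>\<Gamma> C\<^esub> \<alpha> C g" and id: "snd Y = id" and i0: "i0 \<in> C"
  shows "(\<Prod>a<n. L (fst Y ((snd g ^^ Suc a) i0)) (fst g ((snd g ^^ a) i0)) (fst Y ((snd g ^^ a) i0)))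
    = L (fst Y ((snd g ^^ n) i0)) (fst (g [^]\<^bsub>\<Gamma> C\<^esub> n) i0) (fst Y i0)"
proof -
  have I: "fst Y i \<in> twisted_involutions H \<tau>" if i: "i \<in> C" for i
  proof -
    have "fst (Y \<otimes>\<^bsub>\<Gamma> C\<^esub> \<alpha> C Y) i = fst \<one>\<^bsub>\<Gamma> C\<^esub> i" unfolding YY ..
    then show ?thesis using i id wr_carrierD(1)[OF Y i] by (simp add: wr_mult_simps wr_aut_simps twisted_involutions_def)
  qed
  have st: "fst g i \<otimes> fst Y i = fst Y (snd g i) \<otimes> \<tau> (fst g i)" if i: "i \<in> C" for i
    using intertwine_at(2)[OF gY i] id i by (simp add: wr_aut_simps)
  have inC: "(snd g ^^ a) i0 \<in> C" for a using snd_pow_in[OF g] i0 by simp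
  have pw: "fst (g [^]\<^bsub>\<Gamma> C\<^esub> a) i0 \<in> carrier H" for a :: nat using wr_carrierD(1)[OF W.nat_pow_closed[OF g] i0] .
  have stn: "fst (g [^]\<^bsub>\<Gamma> C\<^esub> n) i0 \<otimes> fst Y i0 = fst Y ((snd g ^^ n) i0) \<otimes> \<tau> (fst (g [^]\<^bsub>\<Gamma> C\<^esub> n) i0)" for n :: nat
    using intertwine_at(2)[OF intertwine_pow[OF g \<alpha>_closed[OF g] Y gY, of n] i0] id i0
    by (simp add: \<alpha>_pow[OF g, symmetric] wr_pow_snd wr_aut_simps)
  show ?thesis
  proof (induction n)
    case 0
    then show ?case using L_one[OF I[OF i0]] i0 by (simp add: wr_mult_simps)
  next
    case (Suc n)
    let ?i = "(snd g ^^ n) i0"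
    have "L (fst Y (snd g ?i)) (fst g ?i \<otimes> fst (g [^]\<^bsub>\<Gamma> C\<^esub> n) i0) (fst Y i0)
      = L (fst Y (snd g ?i)) (fst g ?i) (fst Y ?i) * L (fst Y ?i) (fst (g [^]\<^bsub>\<Gamma> C\<^esub> n) i0) (fst Y i0)"
      by (rule L_mult[OF I[OF i0] I[OF inC] I pw _ stn st[OF inC]])
        (use inC[of n] inC[of "Suc n"] wr_carrierD(1)[OF g] in simp_all)
    then show ?case using Suc unfolding fst_pow_Suc[OF g i0] by (simp add: mult.commute)
  qed
qed

text \<open>On one cycle everything that commutes with \<open>g\<close> rotates the positions by some \<open>a\<close>. Involutions need \<open>2 * a\<close> to be
  divisible by the length \<open>k\<close>, and square roots need \<open>2 * a - 1\<close> to be. For odd \<open>k\<close> this leaves the diagonal involutions and one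
  rotation for the square roots, and both are counted by the square roots of \<open>c\<close> in \<open>H\<close>. For even \<open>k\<close> there are
  no square roots, and the involutions with \<open>a = 0\<close> and \<open>a = k / 2\<close> cancel: a cycle of even length has sign \<open>-1\<close>.\<close>
lemma single_cycle:
  assumes fin: "finite C" and g: "g \<in> carrier (\<Gamma> C)" and i0: "i0 \<in> C"
    and tr: "\<And>i. i \<in> C \<Longrightarrow> \<exists>a. (snd g ^^ a) i0 = i"
  shows "(\<Sum>\<omega>\<in>fixing C g. weight C g \<omega>) = of_nat (card (roots C g))"
proof -
  let ?k = "card C"
  define c where "c = fst (g [^]\<^bsub>\<Gamma> C\<^esub> ?k) i0"
  define D where "D z = {Y \<in> carrier (\<Gamma> C). g \<otimes>\<^bsub>\<Gamma> C\<^esub> Y = Y \<otimes>\<^bsub>\<Gamma> C\<^esub> \<alpha> C g \<and> Y \<otimes>\<^bsub>\<Gamma> C\<^esub> \<alpha> C Y = z \<and> snd Y = id}" for z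
  note period = transitive_period[OF wr_carrierD(2)[OF g] fin i0 tr]
  have per: "(snd g ^^ ?k) i0 = i0" using period(1)[of ?k] by simp
  have k0: "?k > 0" using fin i0 by (metis card_gt_0_iff empty_iff)
  have c: "c \<in> carrier H" unfolding c_def by (rule wr_carrierD(1)[OF W.nat_pow_closed[OF g] i0])
  have gk: "g [^]\<^bsub>\<Gamma> C\<^esub> ?k \<in> carrier (\<Gamma> C)" using g by simp
  have sndk: "snd (g [^]\<^bsub>\<Gamma> C\<^esub> ?k) = id"
    by (rule commuting_snd_id[OF gk _ tr]) (use per in \<open>simp_all add: wr_pow_snd funpow_swap1\<close>)
  have finfix: "finite (fixing C g)"
    by (rule finite_subset[OF _ finite_wr_grp[OF finite_carrier fin]]) (auto dest: fixingD(1))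
  have D1: "D \<one>\<^bsub>\<Gamma> C\<^esub> = {\<omega> \<in> fixing C g. snd \<omega> = id}"
    by (auto simp: D_def fixing_def twisted_involutions_def)
  \<comment> \<open>Diagonal involutions: the weight depends on the entry at \<open>i0\<close> only, and \<open>L_sum\<close> evaluates the sum.\<close>
  have sum1: "(\<Sum>\<omega>\<in>D \<one>\<^bsub>\<Gamma> C\<^esub>. weight C g \<omega>) = of_nat (card (twisted_square_roots H \<tau> c))"
  proof -
    have "weight C g \<omega> = L (fst \<omega> i0) c (fst \<omega> i0)" if "\<omega> \<in> D \<one>\<^bsub>\<Gamma> C\<^esub>" for \<omega>
    proof -
      have \<omega>: "\<omega> \<in> carrier (\<Gamma> C)" "\<omega> \<otimes>\<^bsub>\<Gamma> C\<^esub> \<alpha> C \<omega> = \<one>\<^bsub>\<Gamma> C\<^esub>" "g \<otimes>\<^bsub>\<Gamma> C\<^esub> \<omega> = \<omega> \<otimes>\<^bsub>\<Gamma> C\<^esub> \<alpha> C g" "snd \<omega> = id"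
        using that by (auto simp: D_def)
      have "weight C g \<omega> = (\<Prod>i\<in>C. L (fst \<omega> (snd g i)) (fst g i) (fst \<omega> i))"
        using \<omega>(4) by (simp add: weight_def sign_on_set_def)
      also have "\<dots> = (\<Prod>a<?k. L (fst \<omega> (snd g ((snd g ^^ a) i0))) (fst g ((snd g ^^ a) i0)) (fst \<omega> ((snd g ^^ a) i0)))"
        by (rule prod.reindex_bij_betw[OF period(2), symmetric])
      also have "\<dots> = L (fst \<omega> i0) c (fst \<omega> i0)"
        using product_along_cycle[OF g \<omega> i0, of ?k] per by (simp add: c_def)
      finally show ?thesis .
    qed
    then have "(\<Sum>\<omega>\<in>D \<one>\<^bsub>\<Gamma> C\<^esub>. weight C g \<omega>) = (\<Sum>\<omega>\<in>D \<one>\<^bsub>\<Gamma> C\<^esub>. L (fst \<omega> i0) c (fst \<omega> i0))" by simp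
    also have "\<dots> = (\<Sum>y\<in>{y \<in> carrier H. c \<otimes> y = y \<otimes> \<tau> c \<and> y \<otimes> \<tau> y = fst \<one>\<^bsub>\<Gamma> C\<^esub> i0}. L y c y)"
      unfolding D_def c_def using g
      by (intro sum.reindex_bij_betw diagonal_bij[OF fin g i0 tr]) (simp_all add: wr_mult_simps)
    also have "{y \<in> carrier H. c \<otimes> y = y \<otimes> \<tau> c \<and> y \<otimes> \<tau> y = fst \<one>\<^bsub>\<Gamma> C\<^esub> i0} = {w. w \<in> twisted_involutions H \<tau> \<and> c \<otimes> w = w \<otimes> \<tau> c}"
      using i0 by (auto simp: wr_mult_simps twisted_involutions_def)
    finally show ?thesis using L_sum[OF c] by simp
  qed
  \<comment> \<open>Diagonal square roots of \<open>g [^] k\<close>: rotating elements are shifted to these, whatever the parity of \<open>k\<close>.\<close>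
  have cardk: "card (D (g [^]\<^bsub>\<Gamma> C\<^esub> ?k)) = card (twisted_square_roots H \<tau> c)"
  proof -
    have "card (D (g [^]\<^bsub>\<Gamma> C\<^esub> ?k)) = card {y \<in> carrier H. c \<otimes> y = y \<otimes> \<tau> c \<and> y \<otimes> \<tau> y = c}"
      unfolding D_def c_def
      by (rule bij_betw_same_card[OF diagonal_bij[OF fin g i0 tr gk _ sndk]]) (simp_all add: W.group_commutes_pow[OF refl g g])
    also have "{y \<in> carrier H. c \<otimes> y = y \<otimes> \<tau> c \<and> y \<otimes> \<tau> y = c} = twisted_square_roots H \<tau> c"
      by (auto simp: twisted_square_roots_def \<tau>_mult \<tau>_\<tau> \<tau>_closed m_assoc)
    finally show ?thesis .
  qed
  have power: "\<exists>a<?k. snd y i0 = (snd g ^^ a) i0 \<and> snd y (snd y i0) = (snd g ^^ (2 * a)) i0"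
    if y: "y \<in> carrier (\<Gamma> C)" and comm: "\<And>i. snd y (snd g i) = snd g (snd y i)" for y
  proof -
    have "snd y i0 \<in> C" using wr_carrierD(3)[OF y] i0 by simp
    then have "snd y i0 \<in> (\<lambda>a. (snd g ^^ a) i0) ` {..<?k}" using bij_betw_imp_surj_on[OF period(2)] by simp
    then obtain a where a: "a < ?k" "snd y i0 = (snd g ^^ a) i0" by (elim imageE) simp
    have "snd y ((snd g ^^ e) i) = (snd g ^^ e) (snd y i)" for e i by (induction e) (simp_all add: comm)
    then have "snd y (snd y i0) = (snd g ^^ a) ((snd g ^^ a) i0)" using a(2) by simp
    then show ?thesis using a by (intro exI[of _ a]) (simp add: mult_2 funpow_add)
  qed
  show ?thesis
  proof (cases "odd ?k")
    case True
    then obtain b where b: "?k = 2 * b + 1" by (elim oddE)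
    have half: "?k dvd a" if "?k dvd 2 * a" for a
      using that True by (metis coprime_dvd_mult_right_iff coprime_left_2_iff_odd coprime_commute)
    have "snd \<omega> = id" if \<omega>: "\<omega> \<in> fixing C g" for \<omega>
    proof -
      obtain a where a: "snd \<omega> i0 = (snd g ^^ a) i0" "snd \<omega> (snd \<omega> i0) = (snd g ^^ (2 * a)) i0"
        using power[OF fixingD(1,5)[OF \<omega>]] by blast
      have "?k dvd 2 * a" using a(2) fixingD(4)[OF \<omega>] period(1)[of "2 * a"] by simp
      then have "?k dvd a" by (rule half)
      then have s: "snd \<omega> i0 = i0" using period(1)[of a] a(1) by simp
      show ?thesis by (rule commuting_snd_id[OF fixingD(1)[OF \<omega>] fixingD(5)[OF \<omega>] tr s])
    qed
    then have "fixing C g = D \<one>\<^bsub>\<Gamma> C\<^esub>" unfolding D1 by blast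
    moreover have "card (roots C g) = card (D (g [^]\<^bsub>\<Gamma> C\<^esub> ?k))"
    proof -
      \<comment> \<open>With \<open>k = 2 * b + 1\<close>, multiplication by \<open>g [^] b\<close> makes a square root of \<open>g\<close> diagonal and turns it into one of \<open>g [^] k\<close>.\<close>
      let ?h = "g [^]\<^bsub>\<Gamma> C\<^esub> b"
      have "roots C g = {y \<in> carrier (\<Gamma> C). g \<otimes>\<^bsub>\<Gamma> C\<^esub> y = y \<otimes>\<^bsub>\<Gamma> C\<^esub> \<alpha> C g \<and> y \<otimes>\<^bsub>\<Gamma> C\<^esub> \<alpha> C y = g \<and> snd (?h \<otimes>\<^bsub>\<Gamma> C\<^esub> y) = id}"
      proof -
        have diag: "snd (?h \<otimes>\<^bsub>\<Gamma> C\<^esub> y) = id" if y: "y \<in> roots C g" for y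
        proof -
          obtain a where a: "snd y i0 = (snd g ^^ a) i0" "snd y (snd y i0) = (snd g ^^ (2 * a)) i0"
            using power[OF rootsD(1,5)[OF y]] by blast
          have "(snd g ^^ (2 * (b + a))) i0 = (snd g ^^ (2 * b)) ((snd g ^^ (2 * a)) i0)"
            by (simp add: funpow_add distrib_left)
          also have "(snd g ^^ (2 * a)) i0 = snd g i0" using a(2) rootsD(4)[OF y] by simp
          also have "(snd g ^^ (2 * b)) (snd g i0) = (snd g ^^ ?k) i0" unfolding b by (simp add: funpow_swap1)
          finally have "?k dvd 2 * (b + a)" using per period(1)[of "2 * (b + a)"] by simp
          then have "?k dvd b + a" by (rule half)
          then have "(snd g ^^ (b + a)) i0 = i0" using period(1)[of "b + a"] by simp
          then have s: "snd (?h \<otimes>\<^bsub>\<Gamma> C\<^esub> y) i0 = i0" by (simp add: wr_mult_simps wr_pow_snd a(1) funpow_add)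
          show ?thesis
            by (rule commuting_snd_id[OF _ _ tr s])
              (use g rootsD(1,5)[OF y] in \<open>simp_all add: wr_mult_simps wr_pow_snd funpow_swap1\<close>)
        qed
        show ?thesis
        proof (intro equalityI subsetI CollectI)
          fix y assume y: "y \<in> roots C g"
          show "y \<in> carrier (\<Gamma> C) \<and> g \<otimes>\<^bsub>\<Gamma> C\<^esub> y = y \<otimes>\<^bsub>\<Gamma> C\<^esub> \<alpha> C g \<and> y \<otimes>\<^bsub>\<Gamma> C\<^esub> \<alpha> C y = g \<and> snd (?h \<otimes>\<^bsub>\<Gamma> C\<^esub> y) = id"
            by (intro conjI rootsD(1-3)[OF y] diag[OF y])
        qed (simp add: roots_def twisted_square_roots_def)
      qed
      then have "card (roots C g) = card (D (?h \<otimes>\<^bsub>\<Gamma> C\<^esub> (?h \<otimes>\<^bsub>\<Gamma> C\<^esub> g)))"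
        unfolding D_def using bij_betw_same_card[OF shift_bij[OF g g, of b]] by simp
      also have "?h \<otimes>\<^bsub>\<Gamma> C\<^esub> (?h \<otimes>\<^bsub>\<Gamma> C\<^esub> g) = g [^]\<^bsub>\<Gamma> C\<^esub> ?k"
        unfolding b using g by (simp add: mult_2 W.m_assoc flip: W.nat_pow_mult)
      finally show ?thesis .
    qed
    ultimately show ?thesis using sum1 cardk by simp
  next
    case False
    then have "even ?k" by simp
    then obtain l where l: "?k = 2 * l" by (rule evenE)
    let ?h = "g [^]\<^bsub>\<Gamma> C\<^esub> l"
    have l0: "l > 0" using l k0 by simp
    have "roots C g = {}"
    proof (rule ccontr)
      assume "roots C g \<noteq> {}"
      then obtain y where y: "y \<in> roots C g" by blast
      obtain a where a: "snd y (snd y i0) = (snd g ^^ (2 * a)) i0" using power[OF rootsD(1,5)[OF y]] by blast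
      have "(snd g ^^ (2 * a + (?k - 1))) i0 = (snd g ^^ (?k - 1)) (snd g i0)"
        using a rootsD(4)[OF y] by (simp add: funpow_add add.commute[of "2 * a"])
      also have "\<dots> = (snd g ^^ ?k) i0" using k0 by (cases ?k) (simp_all add: funpow_swap1)
      finally have "?k dvd 2 * a + (?k - 1)" using per period(1)[of "2 * a + (?k - 1)"] by simp
      then have "even (2 * a + (?k - 1))" using l by (metis dvd_trans dvd_triv_left)
      then show False using False k0 by simp
    qed
    moreover have "(\<Sum>\<omega>\<in>fixing C g. weight C g \<omega>) = 0"
    proof -
      \<comment> \<open>The rotating involutions: with \<open>k = 2 * l\<close>, multiplication by \<open>g [^] l\<close> makes them diagonal square roots of \<open>g [^] k\<close>.\<close>
      define E where "E = {\<omega> \<in> fixing C g. snd \<omega> \<noteq> id}"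
      have "(\<Sum>\<omega>\<in>fixing C g. weight C g \<omega>) = (\<Sum>\<omega>\<in>D \<one>\<^bsub>\<Gamma> C\<^esub>. weight C g \<omega>) + (\<Sum>\<omega>\<in>E. weight C g \<omega>)"
        unfolding D1 E_def using finfix by (subst sum.union_disjoint[symmetric]) (auto intro: sum.cong)
      also have "(\<Sum>\<omega>\<in>E. weight C g \<omega>) = (\<Sum>\<omega>\<in>E. -1)"
      proof (rule sum.cong[OF refl])
        fix \<omega> assume "\<omega> \<in> E"
        then have \<omega>: "\<omega> \<in> fixing C g" "snd \<omega> \<noteq> id" by (auto simp: E_def)
        have nofix: "snd \<omega> i \<noteq> i" if i: "i \<in> C" for i
        proof
          assume fi: "snd \<omega> i = i"
          obtain a where a: "(snd g ^^ a) i0 = i" using tr[OF i] by blast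
          have "snd \<omega> ((snd g ^^ a) i0) = (snd g ^^ a) (snd \<omega> i0)" by (induction a) (simp_all add: fixingD(5)[OF \<omega>(1)])
          then have "(snd g ^^ a) (snd \<omega> i0) = (snd g ^^ a) i0" using fi a by simp
          moreover have "inj (snd g ^^ a)" using wr_carrierD(6)[OF g] by (intro inj_fn injI) simp
          ultimately have s: "snd \<omega> i0 = i0" by (simp add: inj_eq)
          have "snd \<omega> = id" by (rule commuting_snd_id[OF fixingD(1)[OF \<omega>(1)] fixingD(5)[OF \<omega>(1)] tr s])
          then show False using \<omega>(2) by simp
        qed
        have e1: "{i \<in> C. snd \<omega> i \<noteq> i} = C" and e2: "{i \<in> C. snd \<omega> i = i} = {}" using nofix by auto
        have "(\<lambda>i. if i \<in> C then snd g i else i) = snd g" using wr_carrierD(4)[OF g] by auto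
        then show "weight C g \<omega> = -1"
          using period(3) l l0 unfolding weight_def e1 e2 sign_on_set_def by simp
      qed
      also have "\<dots> = - of_nat (card E)" by simp
      also have "card E = card (D (g [^]\<^bsub>\<Gamma> C\<^esub> ?k))"
      proof -
        have "E = {y \<in> carrier (\<Gamma> C). g \<otimes>\<^bsub>\<Gamma> C\<^esub> y = y \<otimes>\<^bsub>\<Gamma> C\<^esub> \<alpha> C g \<and> y \<otimes>\<^bsub>\<Gamma> C\<^esub> \<alpha> C y = \<one>\<^bsub>\<Gamma> C\<^esub> \<and> snd (?h \<otimes>\<^bsub>\<Gamma> C\<^esub> y) = id}"
        proof -
          have diag: "snd \<omega> \<noteq> id \<longleftrightarrow> snd (?h \<otimes>\<^bsub>\<Gamma> C\<^esub> \<omega>) = id" if \<omega>: "\<omega> \<in> fixing C g" for \<omega>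
          proof
            assume ne: "snd \<omega> \<noteq> id"
            obtain a where a: "a < ?k" "snd \<omega> i0 = (snd g ^^ a) i0" "snd \<omega> (snd \<omega> i0) = (snd g ^^ (2 * a)) i0"
              using power[OF fixingD(1,5)[OF \<omega>]] by blast
            have "?k dvd 2 * a" using a(3) fixingD(4)[OF \<omega>] period(1)[of "2 * a"] by simp
            then have "l dvd a" unfolding l by simp
            then obtain q where q: "a = l * q" by blast
            have "a \<noteq> 0"
            proof
              assume "a = 0"
              then have s: "snd \<omega> i0 = i0" using a(2) by simp
              have "snd \<omega> = id" by (rule commuting_snd_id[OF fixingD(1)[OF \<omega>] fixingD(5)[OF \<omega>] tr s])
              then show False using ne by simp
            qed
            then have "q = 1" using a(1) l0 unfolding q l by (cases q) auto
            then have "(snd g ^^ (l + a)) i0 = i0" using per unfolding q l by (simp add: mult_2)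
            then have s: "snd (?h \<otimes>\<^bsub>\<Gamma> C\<^esub> \<omega>) i0 = i0" by (simp add: wr_mult_simps wr_pow_snd a(2) funpow_add)
            show "snd (?h \<otimes>\<^bsub>\<Gamma> C\<^esub> \<omega>) = id"
              by (rule commuting_snd_id[OF _ _ tr s])
                (use g fixingD(1,5)[OF \<omega>] in \<open>simp_all add: wr_mult_simps wr_pow_snd funpow_swap1\<close>)
          next
            assume h: "snd (?h \<otimes>\<^bsub>\<Gamma> C\<^esub> \<omega>) = id"
            show "snd \<omega> \<noteq> id"
            proof
              assume "snd \<omega> = id"
              then have "(snd g ^^ l) i0 = i0" using h by (simp add: wr_mult_simps wr_pow_snd)
              then have "?k dvd l" using period(1)[of l] by simp
              then show False using l l0 by (auto dest: dvd_imp_le)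
            qed
          qed
          have "E = {\<omega> \<in> fixing C g. snd (?h \<otimes>\<^bsub>\<Gamma> C\<^esub> \<omega>) = id}"
            unfolding E_def by (rule Collect_cong, rule conj_cong[OF refl diag])
          also have "\<dots> = {y \<in> carrier (\<Gamma> C). g \<otimes>\<^bsub>\<Gamma> C\<^esub> y = y \<otimes>\<^bsub>\<Gamma> C\<^esub> \<alpha> C g \<and> y \<otimes>\<^bsub>\<Gamma> C\<^esub> \<alpha> C y = \<one>\<^bsub>\<Gamma> C\<^esub> \<and> snd (?h \<otimes>\<^bsub>\<Gamma> C\<^esub> y) = id}"
            unfolding fixing_def twisted_involutions_def by (rule Collect_cong) blast
          finally show ?thesis .
        qed
        then have "card E = card (D (?h \<otimes>\<^bsub>\<Gamma> C\<^esub> (?h \<otimes>\<^bsub>\<Gamma> C\<^esub> \<one>\<^bsub>\<Gamma> C\<^esub>)))"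
          unfolding D_def using bij_betw_same_card[OF shift_bij[OF g W.one_closed, of l]] by simp
        also have "?h \<otimes>\<^bsub>\<Gamma> C\<^esub> (?h \<otimes>\<^bsub>\<Gamma> C\<^esub> \<one>\<^bsub>\<Gamma> C\<^esub>) = g [^]\<^bsub>\<Gamma> C\<^esub> ?k"
          unfolding l using g by (simp add: mult_2 flip: W.nat_pow_mult)
        finally show ?thesis .
      qed
      finally show ?thesis using sum1 cardk by simp
    qed
    ultimately show ?thesis by simp
  qed
qed

end

context twisted_weight begin

section \<open>Two exchanged cycles\<close>

text \<open>The positions \<open>D\<close> are a union of two parts exchanged by \<open>\<omega>\<close> or \<open>y\<close>. Let \<open>e\<close> be the part of \<open>g\<close> on \<open>C\<close> and \<open>e'\<close> the part on \<open>D - C\<close>, so that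
  \<open>g = e \<otimes> e'\<close>. Exchanging elements satisfy \<open>\<omega> \<otimes> \<alpha> e = e' \<otimes> \<omega>\<close>, hence
  \<open>(e \<otimes> \<omega>) \<otimes> \<alpha> (e \<otimes> \<omega>) = e \<otimes> e' \<otimes> \<omega> \<otimes> \<alpha> \<omega> = g\<close>: multiplication by \<open>e\<close> maps involutions to square roots. Their weight is \<open>1\<close>
  since \<open>\<omega>\<close> conjugates the permutation of \<open>e\<close> to that of \<open>e'\<close>, which gives both the same sign.\<close>
lemma swapped_halves:
  assumes fin: "finite D" and g: "g \<in> carrier (\<Gamma> D)" and CD: "C \<subseteq> D" and gC: "\<And>i. i \<in> C \<Longrightarrow> snd g i \<in> C"
    and i0: "i0 \<in> C" and j: "j \<in> D - C"
  defines "sw \<equiv> \<lambda>y :: 'a wr. (\<forall>i\<in>D. snd y i \<in> C \<longleftrightarrow> i \<notin> C) \<and> snd y i0 = j"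
  shows "(\<Sum>\<omega>\<in>{\<omega> \<in> fixing D g. sw \<omega>}. weight D g \<omega>) = of_nat (card {y \<in> roots D g. sw y})"
proof -
  have finC: "finite C" using fin CD finite_subset by blast
  have gC': "snd g i \<in> D - C" if "i \<in> D - C" for i
    by (rule wr_invariant_complement[OF g CD finC gC that])
  define e where "e = wr_glue D C (wr_restrict C g) \<one>\<^bsub>\<Gamma> (D - C)\<^esub>"
  define e' where "e' = wr_glue D C \<one>\<^bsub>\<Gamma> C\<^esub> (wr_restrict (D - C) g)"
  have e: "e \<in> carrier (\<Gamma> D)"
    unfolding e_def by (rule wr_glue_carrier[OF CD wr_restrict_carrier[OF g CD finC gC] W.one_closed])
  have e': "e' \<in> carrier (\<Gamma> D)"
    unfolding e'_def using fin gC' by (intro wr_glue_carrier[OF CD W.one_closed wr_restrict_carrier[OF g]]) auto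
  have fe: "fst e i = (if i \<in> C then fst g i else \<one>)" "fst e' i = (if i \<in> C then \<one> else fst g i)" if "i \<in> D" for i
    using that by (auto simp: e_def e'_def wr_glue_def wr_restrict_def wr_mult_simps)
  have se: "snd e i = (if i \<in> C then snd g i else i)" "snd e' i = (if i \<in> C then i else snd g i)" for i
    using wr_carrierD(4)[OF g, of i] by (auto simp: e_def e'_def wr_glue_def wr_restrict_def wr_mult_simps)
  have gH: "fst g i \<in> carrier H" if "i \<in> D" for i using wr_carrierD(1)[OF g that] .
  have ee': "e \<otimes>\<^bsub>\<Gamma> D\<^esub> e' = g"
    by (rule wr_eqI[of _ H D]) (use e e' g gC gC' gH CD wr_carrierD(3)[OF g] in \<open>auto simp: wr_mult_simps fe se\<close>)
  have e'e: "e' \<otimes>\<^bsub>\<Gamma> D\<^esub> e = g"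
    by (rule wr_eqI[of _ H D]) (use e e' g gC gC' gH CD wr_carrierD(3)[OF g] in \<open>auto simp: wr_mult_simps fe se\<close>)
  have conj: "y \<otimes>\<^bsub>\<Gamma> D\<^esub> \<alpha> D e = e' \<otimes>\<^bsub>\<Gamma> D\<^esub> y"
    if y: "y \<in> carrier (\<Gamma> D)" "g \<otimes>\<^bsub>\<Gamma> D\<^esub> y = y \<otimes>\<^bsub>\<Gamma> D\<^esub> \<alpha> D g" "sw y" for y
  proof (rule wr_eqI[of _ H D])
    show "y \<otimes>\<^bsub>\<Gamma> D\<^esub> \<alpha> D e \<in> carrier (\<Gamma> D)" "e' \<otimes>\<^bsub>\<Gamma> D\<^esub> y \<in> carrier (\<Gamma> D)" using y e e' \<alpha>_closed by auto
    fix i assume i: "i \<in> D"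
    have sw: "snd y i \<in> C \<longleftrightarrow> i \<notin> C" using y(3) i by (simp add: sw_def)
    have yi: "snd y i \<in> D" using wr_carrierD(3)[OF y(1)] i by simp
    show "snd (y \<otimes>\<^bsub>\<Gamma> D\<^esub> \<alpha> D e) i = snd (e' \<otimes>\<^bsub>\<Gamma> D\<^esub> y) i"
      using sw intertwine_at(1)[OF y(2), of i] by (simp add: wr_mult_simps wr_aut_simps se)
    show "fst (y \<otimes>\<^bsub>\<Gamma> D\<^esub> \<alpha> D e) i = fst (e' \<otimes>\<^bsub>\<Gamma> D\<^esub> y) i"
      using sw intertwine_at(2)[OF y(2) i] i yi wr_carrierD(1)[OF y(1) i]
      by (simp add: wr_mult_simps wr_aut_simps se fe \<tau>_one)
  qed
  have ge: "g \<otimes>\<^bsub>\<Gamma> D\<^esub> e = e \<otimes>\<^bsub>\<Gamma> D\<^esub> g" using e e' by (simp add: ee'[symmetric] W.m_assoc) (simp add: e'e ee')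
  have sw_e: "sw (e \<otimes>\<^bsub>\<Gamma> D\<^esub> y) \<longleftrightarrow> sw y" if y: "y \<in> carrier (\<Gamma> D)" for y
  proof -
    have "snd e i \<in> C \<longleftrightarrow> i \<in> C" for i using gC by (simp add: se)
    moreover have "snd e i = j \<longleftrightarrow> i = j" for i using j gC[of i] by (auto simp: se)
    ultimately show ?thesis by (simp add: sw_def wr_mult_simps)
  qed
  have inv_e: "inv\<^bsub>\<Gamma> D\<^esub> e \<in> carrier (\<Gamma> D)" using e by simp
  have "bij_betw (\<lambda>\<omega>. e \<otimes>\<^bsub>\<Gamma> D\<^esub> \<omega>) {\<omega> \<in> fixing D g. sw \<omega>} {y \<in> roots D g. sw y}"
  proof (rule bij_betw_byWitness[where f' = "\<lambda>y. inv\<^bsub>\<Gamma> D\<^esub> e \<otimes>\<^bsub>\<Gamma> D\<^esub> y"])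
    show "\<forall>\<omega>\<in>{\<omega> \<in> fixing D g. sw \<omega>}. inv\<^bsub>\<Gamma> D\<^esub> e \<otimes>\<^bsub>\<Gamma> D\<^esub> (e \<otimes>\<^bsub>\<Gamma> D\<^esub> \<omega>) = \<omega>"
    proof
      fix \<omega> assume "\<omega> \<in> {\<omega> \<in> fixing D g. sw \<omega>}"
      then have "\<omega> \<in> carrier (\<Gamma> D)" using fixingD(1) by blast
      then show "inv\<^bsub>\<Gamma> D\<^esub> e \<otimes>\<^bsub>\<Gamma> D\<^esub> (e \<otimes>\<^bsub>\<Gamma> D\<^esub> \<omega>) = \<omega>" using e by (simp flip: W.m_assoc)
    qed
    show "\<forall>y\<in>{y \<in> roots D g. sw y}. e \<otimes>\<^bsub>\<Gamma> D\<^esub> (inv\<^bsub>\<Gamma> D\<^esub> e \<otimes>\<^bsub>\<Gamma> D\<^esub> y) = y"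
    proof
      fix y assume "y \<in> {y \<in> roots D g. sw y}"
      then have "y \<in> carrier (\<Gamma> D)" using rootsD(1) by blast
      then show "e \<otimes>\<^bsub>\<Gamma> D\<^esub> (inv\<^bsub>\<Gamma> D\<^esub> e \<otimes>\<^bsub>\<Gamma> D\<^esub> y) = y" using e by (simp flip: W.m_assoc)
    qed
    show "(\<lambda>\<omega>. e \<otimes>\<^bsub>\<Gamma> D\<^esub> \<omega>) ` {\<omega> \<in> fixing D g. sw \<omega>} \<subseteq> {y \<in> roots D g. sw y}"
    proof (rule image_subsetI)
      fix \<omega> assume "\<omega> \<in> {\<omega> \<in> fixing D g. sw \<omega>}"
      then have \<omega>: "\<omega> \<in> fixing D g" and sw: "sw \<omega>" by auto
      note w = fixingD(1-3)[OF \<omega>]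
      have \<alpha>w: "\<alpha> D \<omega> \<in> carrier (\<Gamma> D)" by (rule \<alpha>_closed[OF w(1)])
      have \<alpha>e: "\<alpha> D e \<in> carrier (\<Gamma> D)" by (rule \<alpha>_closed[OF e])
      have "e \<otimes>\<^bsub>\<Gamma> D\<^esub> \<omega> \<otimes>\<^bsub>\<Gamma> D\<^esub> \<alpha> D (e \<otimes>\<^bsub>\<Gamma> D\<^esub> \<omega>) = e \<otimes>\<^bsub>\<Gamma> D\<^esub> (\<omega> \<otimes>\<^bsub>\<Gamma> D\<^esub> \<alpha> D e) \<otimes>\<^bsub>\<Gamma> D\<^esub> \<alpha> D \<omega>"
        using e w(1) \<alpha>w \<alpha>e by (simp add: \<alpha>_mult W.m_assoc)
      also have "\<dots> = e \<otimes>\<^bsub>\<Gamma> D\<^esub> e' \<otimes>\<^bsub>\<Gamma> D\<^esub> (\<omega> \<otimes>\<^bsub>\<Gamma> D\<^esub> \<alpha> D \<omega>)"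
        unfolding conj[OF w(1,3) sw] using e e' w(1) \<alpha>w by (simp add: W.m_assoc)
      also have "\<dots> = g" unfolding w(2) ee' using g by simp
      finally show "e \<otimes>\<^bsub>\<Gamma> D\<^esub> \<omega> \<in> {y \<in> roots D g. sw y}"
        using sw_e[OF w(1)] sw e w(1) by (simp add: roots_def twisted_square_roots_def)
    qed
    show "(\<lambda>y. inv\<^bsub>\<Gamma> D\<^esub> e \<otimes>\<^bsub>\<Gamma> D\<^esub> y) ` {y \<in> roots D g. sw y} \<subseteq> {\<omega> \<in> fixing D g. sw \<omega>}"
    proof (rule image_subsetI)
      fix y assume "y \<in> {y \<in> roots D g. sw y}"
      then have yr: "y \<in> roots D g" and sw: "sw y" by auto
      note y = rootsD(1-3)[OF yr]
      have \<alpha>y: "\<alpha> D y \<in> carrier (\<Gamma> D)" by (rule \<alpha>_closed[OF y(1)])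
      have \<alpha>g: "\<alpha> D g \<in> carrier (\<Gamma> D)" by (rule \<alpha>_closed[OF g])
      have \<alpha>e: "\<alpha> D e \<in> carrier (\<Gamma> D)" by (rule \<alpha>_closed[OF e])
      define \<omega> where "\<omega> = inv\<^bsub>\<Gamma> D\<^esub> e \<otimes>\<^bsub>\<Gamma> D\<^esub> y"
      have w: "\<omega> \<in> carrier (\<Gamma> D)" using inv_e y(1) by (simp add: \<omega>_def)
      have ew: "e \<otimes>\<^bsub>\<Gamma> D\<^esub> \<omega> = y" using e y(1) by (simp add: \<omega>_def flip: W.m_assoc)
      have \<alpha>w: "\<alpha> D \<omega> \<in> carrier (\<Gamma> D)" by (rule \<alpha>_closed[OF w])
      have sww: "sw \<omega>" using sw_e[OF w] sw unfolding ew by simp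
      have "e \<otimes>\<^bsub>\<Gamma> D\<^esub> (g \<otimes>\<^bsub>\<Gamma> D\<^esub> \<omega>) = g \<otimes>\<^bsub>\<Gamma> D\<^esub> (e \<otimes>\<^bsub>\<Gamma> D\<^esub> \<omega>)"
        using e g w ge by (simp flip: W.m_assoc)
      also have "\<dots> = e \<otimes>\<^bsub>\<Gamma> D\<^esub> (\<omega> \<otimes>\<^bsub>\<Gamma> D\<^esub> \<alpha> D g)"
        unfolding ew y(3) using e w \<alpha>g by (simp add: ew flip: W.m_assoc)
      finally have gw: "g \<otimes>\<^bsub>\<Gamma> D\<^esub> \<omega> = \<omega> \<otimes>\<^bsub>\<Gamma> D\<^esub> \<alpha> D g" using e g w \<alpha>g by simp
      have "g = e \<otimes>\<^bsub>\<Gamma> D\<^esub> \<omega> \<otimes>\<^bsub>\<Gamma> D\<^esub> \<alpha> D (e \<otimes>\<^bsub>\<Gamma> D\<^esub> \<omega>)" unfolding ew y(2) ..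
      also have "\<dots> = e \<otimes>\<^bsub>\<Gamma> D\<^esub> (\<omega> \<otimes>\<^bsub>\<Gamma> D\<^esub> \<alpha> D e) \<otimes>\<^bsub>\<Gamma> D\<^esub> \<alpha> D \<omega>"
        using e w \<alpha>w \<alpha>e by (simp add: \<alpha>_mult W.m_assoc)
      also have "\<dots> = e \<otimes>\<^bsub>\<Gamma> D\<^esub> e' \<otimes>\<^bsub>\<Gamma> D\<^esub> (\<omega> \<otimes>\<^bsub>\<Gamma> D\<^esub> \<alpha> D \<omega>)"
        unfolding conj[OF w gw sww] using e e' w \<alpha>w by (simp add: W.m_assoc)
      finally have "g = g \<otimes>\<^bsub>\<Gamma> D\<^esub> (\<omega> \<otimes>\<^bsub>\<Gamma> D\<^esub> \<alpha> D \<omega>)" unfolding ee' .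
      then have "\<omega> \<otimes>\<^bsub>\<Gamma> D\<^esub> \<alpha> D \<omega> = \<one>\<^bsub>\<Gamma> D\<^esub>" using W.l_cancel_one'[OF g W.m_closed[OF w \<alpha>w]] by blast
      then show "inv\<^bsub>\<Gamma> D\<^esub> e \<otimes>\<^bsub>\<Gamma> D\<^esub> y \<in> {\<omega> \<in> fixing D g. sw \<omega>}"
        using w gw sww by (simp add: fixing_def twisted_involutions_def flip: \<omega>_def)
    qed
  qed
  then have "card {\<omega> \<in> fixing D g. sw \<omega>} = card {y \<in> roots D g. sw y}" by (rule bij_betw_same_card)
  moreover have "weight D g \<omega> = 1" if \<omega>: "\<omega> \<in> fixing D g" and sw: "sw \<omega>" for \<omega>
  proof -
    note w = fixingD(1,3)[OF \<omega>]
    have nofix: "snd \<omega> i \<noteq> i" if "i \<in> D" for i using sw that unfolding sw_def by metis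
    have e1: "{i \<in> D. snd \<omega> i \<noteq> i} = D" and e2: "{i \<in> D. snd \<omega> i = i} = {}" using nofix by auto
    have p: "permutation (snd \<omega>)" "permutation (snd e)" "permutation (snd e')"
      using wr_carrierD(2)[OF w(1)] wr_carrierD(2)[OF e] wr_carrierD(2)[OF e'] fin unfolding permutation_permutes by blast+
    have "snd (\<omega> \<otimes>\<^bsub>\<Gamma> D\<^esub> \<alpha> D e) = snd (e' \<otimes>\<^bsub>\<Gamma> D\<^esub> \<omega>)" using conj[OF w sw] by simp
    then have "snd \<omega> \<circ> snd e = snd e' \<circ> snd \<omega>" by (simp add: wr_mult_simps wr_aut_simps)
    then have "sign (snd \<omega> \<circ> snd e) = sign (snd e' \<circ> snd \<omega>)" by simp
    then have "sign (snd e) = sign (snd e')" using p by (simp add: sign_compose)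
    moreover have "snd g = snd e \<circ> snd e'" unfolding ee'[symmetric] by (simp add: wr_mult_simps)
    ultimately have "sign (snd g) = 1" using p by (simp add: sign_compose del: o_apply)
    moreover have "(\<lambda>i. if i \<in> D then snd g i else i) = snd g" using wr_carrierD(4)[OF g] by auto
    ultimately show ?thesis unfolding weight_def e1 e2 sign_on_set_def by simp
  qed
  ultimately show ?thesis by simp
qed

section \<open>Weighted involutions count square roots\<close>

lemma restrict_eq_iff:
  assumes T: "T \<subseteq> S" and u: "u \<in> carrier (\<Gamma> S)" and v: "v \<in> carrier (\<Gamma> S)"
  shows "u = v \<longleftrightarrow> wr_restrict T u = wr_restrict T v \<and> wr_restrict (S - T) u = wr_restrict (S - T) v"
  using wr_restrict_glue[OF T u] wr_restrict_glue[OF T v] by metis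

lemma split_membership:
  assumes T: "T \<subseteq> S" and fin: "finite S" and g: "g \<in> carrier (\<Gamma> S)" and gT: "\<And>i. i \<in> T \<Longrightarrow> snd g i \<in> T"
    and y: "y \<in> carrier (\<Gamma> S)" and yT: "\<And>i. i \<in> T \<Longrightarrow> snd y i \<in> T"
  shows "y \<in> fixing S g \<longleftrightarrow> wr_restrict T y \<in> fixing T (wr_restrict T g) \<and> wr_restrict (S - T) y \<in> fixing (S - T) (wr_restrict (S - T) g)"
    and "y \<in> roots S g \<longleftrightarrow> wr_restrict T y \<in> roots T (wr_restrict T g) \<and> wr_restrict (S - T) y \<in> roots (S - T) (wr_restrict (S - T) g)"
proof -
  have fT: "finite T" and fT': "finite (S - T)" and T': "S - T \<subseteq> S" using fin T finite_subset by auto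
  have yT': "snd y i \<in> S - T" if "i \<in> S - T" for i by (rule wr_invariant_complement[OF y T fT yT that])
  have gT': "snd g i \<in> S - T" if "i \<in> S - T" for i by (rule wr_invariant_complement[OF g T fT gT that])
  note \<alpha>y = \<alpha>_closed[OF y] and \<alpha>g = \<alpha>_closed[OF g]
  note c = wr_restrict_carrier[OF y T fT yT] wr_restrict_carrier[OF y T' fT' yT']
  have m1: "wr_restrict T (y \<otimes>\<^bsub>\<Gamma> S\<^esub> \<alpha> S y) = wr_restrict T y \<otimes>\<^bsub>\<Gamma> T\<^esub> \<alpha> T (wr_restrict T y)"
    using wr_restrict_mult[OF is_group y \<alpha>y T fT yT] yT by (simp add: wr_aut_simps wr_restrict_aut[OF T])
  have m2: "wr_restrict (S - T) (y \<otimes>\<^bsub>\<Gamma> S\<^esub> \<alpha> S y) = wr_restrict (S - T) y \<otimes>\<^bsub>\<Gamma> (S - T)\<^esub> \<alpha> (S - T) (wr_restrict (S - T) y)"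
    using wr_restrict_mult[OF is_group y \<alpha>y T' fT' yT'] yT' by (simp add: wr_aut_simps wr_restrict_aut[OF T'])
  have m3: "wr_restrict T (g \<otimes>\<^bsub>\<Gamma> S\<^esub> y) = wr_restrict T g \<otimes>\<^bsub>\<Gamma> T\<^esub> wr_restrict T y"
    by (rule wr_restrict_mult[OF is_group g y T fT gT yT])
  have m4: "wr_restrict (S - T) (g \<otimes>\<^bsub>\<Gamma> S\<^esub> y) = wr_restrict (S - T) g \<otimes>\<^bsub>\<Gamma> (S - T)\<^esub> wr_restrict (S - T) y"
    by (rule wr_restrict_mult[OF is_group g y T' fT' gT' yT'])
  have m5: "wr_restrict T (y \<otimes>\<^bsub>\<Gamma> S\<^esub> \<alpha> S g) = wr_restrict T y \<otimes>\<^bsub>\<Gamma> T\<^esub> \<alpha> T (wr_restrict T g)"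
    using wr_restrict_mult[OF is_group y \<alpha>g T fT yT] gT by (simp add: wr_aut_simps wr_restrict_aut[OF T])
  have m6: "wr_restrict (S - T) (y \<otimes>\<^bsub>\<Gamma> S\<^esub> \<alpha> S g) = wr_restrict (S - T) y \<otimes>\<^bsub>\<Gamma> (S - T)\<^esub> \<alpha> (S - T) (wr_restrict (S - T) g)"
    using wr_restrict_mult[OF is_group y \<alpha>g T' fT' yT'] gT' by (simp add: wr_aut_simps wr_restrict_aut[OF T'])
  have yy: "y \<otimes>\<^bsub>\<Gamma> S\<^esub> \<alpha> S y \<in> carrier (\<Gamma> S)" and gy: "g \<otimes>\<^bsub>\<Gamma> S\<^esub> y \<in> carrier (\<Gamma> S)" and yg: "y \<otimes>\<^bsub>\<Gamma> S\<^esub> \<alpha> S g \<in> carrier (\<Gamma> S)"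
    using y g \<alpha>y \<alpha>g by auto
  show "y \<in> fixing S g \<longleftrightarrow> wr_restrict T y \<in> fixing T (wr_restrict T g) \<and> wr_restrict (S - T) y \<in> fixing (S - T) (wr_restrict (S - T) g)"
    unfolding fixing_def twisted_involutions_def using y c
    by (auto simp: restrict_eq_iff[OF T yy W.one_closed] restrict_eq_iff[OF T gy yg] m1 m2 m3 m4 m5 m6 wr_restrict_one[OF T] wr_restrict_one[OF T'])
  show "y \<in> roots S g \<longleftrightarrow> wr_restrict T y \<in> roots T (wr_restrict T g) \<and> wr_restrict (S - T) y \<in> roots (S - T) (wr_restrict (S - T) g)"
    unfolding roots_def twisted_square_roots_def using y c
    by (auto simp: restrict_eq_iff[OF T yy g] m1 m2)
qed

lemma weight_split:
  assumes T: "T \<subseteq> S" and fin: "finite S" and g: "g \<in> carrier (\<Gamma> S)" and gT: "\<And>i. i \<in> T \<Longrightarrow> snd g i \<in> T"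
    and \<omega>: "\<omega> \<in> fixing S g"
  shows "weight S g \<omega> = weight T (wr_restrict T g) (wr_restrict T \<omega>) * weight (S - T) (wr_restrict (S - T) g) (wr_restrict (S - T) \<omega>)"
proof -
  have fT: "finite T" using fin T finite_subset by auto
  have gT': "snd g i \<in> S - T" if "i \<in> S - T" for i by (rule wr_invariant_complement[OF g T fT gT that])
  note comm = fixingD(5)[OF \<omega>]
  have inj: "inj (snd g)" using wr_carrierD(6)[OF g] by (auto intro: injI)
  let ?M = "\<lambda>T. {i \<in> T. snd \<omega> i \<noteq> i}" and ?N = "\<lambda>T. {i \<in> T. snd \<omega> i = i}"
  have moved: "snd g i \<in> ?M T" if "i \<in> ?M T" "\<And>i. i \<in> T \<Longrightarrow> snd g i \<in> T" for i T
    using that wr_carrierD(6)[OF g] by (auto simp: comm)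
  have fixed: "snd g i \<in> ?N T" if "i \<in> ?N T" "\<And>i. i \<in> T \<Longrightarrow> snd g i \<in> T" for i T
    using that by (auto simp: comm)
  have "sign_on_set (?M S) (snd g) = sign_on_set (?M T \<union> ?M (S - T)) (snd g)"
    using T by (intro arg_cong2[where f = sign_on_set]) auto
  also have "\<dots> = sign_on_set (?M T) (snd g) * sign_on_set (?M (S - T)) (snd g)"
    by (rule sign_on_set_Un[OF _ _ _ inj]) (use fin fT moved[of _ T] moved[of _ "S - T"] gT gT' in auto)
  finally have s: "sign_on_set (?M S) (snd g) = sign_on_set (?M T) (snd g) * sign_on_set (?M (S - T)) (snd g)" .
  let ?P = "\<lambda>i. L (fst \<omega> (snd g i)) (fst g i) (fst \<omega> i)"
  have "(\<Prod>i\<in>?N S. ?P i) = (\<Prod>i\<in>?N T \<union> ?N (S - T). ?P i)" using T by (intro prod.cong) auto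
  also have "\<dots> = (\<Prod>i\<in>?N T. ?P i) * (\<Prod>i\<in>?N (S - T). ?P i)"
    by (rule prod.union_disjoint) (use fin fT in auto)
  finally have p: "(\<Prod>i\<in>?N S. ?P i) = (\<Prod>i\<in>?N T. ?P i) * (\<Prod>i\<in>?N (S - T). ?P i)" .
  have r: "weight T' (wr_restrict T' g) (wr_restrict T' \<omega>) = sign_on_set (?M T') (snd g) * (\<Prod>i\<in>?N T'. ?P i)"
    if "\<And>i. i \<in> T' \<Longrightarrow> snd g i \<in> T'" for T'
  proof -
    have "{i \<in> T'. snd (wr_restrict T' \<omega>) i \<noteq> i} = ?M T'" "{i \<in> T'. snd (wr_restrict T' \<omega>) i = i} = ?N T'"
      by (auto simp: wr_restrict_simps)
    moreover have "sign_on_set (?M T') (snd (wr_restrict T' g)) = sign_on_set (?M T') (snd g)"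
      by (rule sign_on_set_cong) (simp add: wr_restrict_simps)
    moreover have "(\<Prod>i\<in>?N T'. L (fst (wr_restrict T' \<omega>) (snd (wr_restrict T' g) i)) (fst (wr_restrict T' g) i) (fst (wr_restrict T' \<omega>) i))
      = (\<Prod>i\<in>?N T'. ?P i)" using that by (intro prod.cong) (auto simp: wr_restrict_simps)
    ultimately show ?thesis by (simp add: weight_def)
  qed
  have r1: "weight T (wr_restrict T g) (wr_restrict T \<omega>) = sign_on_set (?M T) (snd g) * (\<Prod>i\<in>?N T. ?P i)"
    by (rule r) (rule gT)
  have r2: "weight (S - T) (wr_restrict (S - T) g) (wr_restrict (S - T) \<omega>) = sign_on_set (?M (S - T)) (snd g) * (\<Prod>i\<in>?N (S - T). ?P i)"
    by (rule r) (rule gT')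
  show ?thesis unfolding r1 r2 unfolding weight_def s p by (simp only: mult_ac)
qed

text \<open>The predicate \<open>Q\<close> on the image of one position of \<open>T\<close> lets the same factorization serve for a preserved cycle
  and for a cycle sent to a given other one.\<close>
lemma sum_split:
  assumes T: "T \<subseteq> S" and fin: "finite S" and g: "g \<in> carrier (\<Gamma> S)" and gT: "\<And>i. i \<in> T \<Longrightarrow> snd g i \<in> T" and i0: "i0 \<in> T"
  defines "gT \<equiv> wr_restrict T g" and "gS \<equiv> wr_restrict (S - T) g"
  shows "(\<Sum>\<omega>\<in>{\<omega> \<in> fixing S g. (\<forall>i\<in>T. snd \<omega> i \<in> T) \<and> Q (snd \<omega> i0)}. weight S g \<omega>)
      = (\<Sum>\<omega>\<in>{\<omega> \<in> fixing T gT. Q (snd \<omega> i0)}. weight T gT \<omega>) * (\<Sum>\<omega>\<in>fixing (S - T) gS. weight (S - T) gS \<omega>)"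
    and "card {y \<in> roots S g. (\<forall>i\<in>T. snd y i \<in> T) \<and> Q (snd y i0)}
      = card {y \<in> roots T gT. Q (snd y i0)} * card (roots (S - T) gS)"
proof -
  let ?r = "\<lambda>y. (wr_restrict T y, wr_restrict (S - T) y)"
  have bij: "bij_betw ?r {y \<in> carrier (\<Gamma> S). (\<forall>i\<in>T. snd y i \<in> T) \<and> P y}
      {(a, b). a \<in> carrier (\<Gamma> T) \<and> b \<in> carrier (\<Gamma> (S - T)) \<and> P' a b}"
    if PP: "\<And>y. y \<in> carrier (\<Gamma> S) \<Longrightarrow> (\<forall>i\<in>T. snd y i \<in> T) \<Longrightarrow> P y \<longleftrightarrow> P' (wr_restrict T y) (wr_restrict (S - T) y)"
    for P :: "'a wr \<Rightarrow> bool" and P'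
  proof -
    let ?A = "{y \<in> carrier (\<Gamma> S). \<forall>i\<in>T. snd y i \<in> T}"
    have b: "bij_betw ?r ?A (carrier (\<Gamma> T) \<times> carrier (\<Gamma> (S - T)))" by (rule wr_split_bij[OF T fin])
    have "bij_betw ?r {y \<in> ?A. P y} (?r ` {y \<in> ?A. P y})"
      by (rule inj_on_imp_bij_betw) (rule inj_on_subset[OF bij_betw_imp_inj_on[OF b]], blast)
    moreover have "?r ` {y \<in> ?A. P y} = {x \<in> ?r ` ?A. P' (fst x) (snd x)}" using PP by auto
    moreover have "{y \<in> ?A. P y} = {y \<in> carrier (\<Gamma> S). (\<forall>i\<in>T. snd y i \<in> T) \<and> P y}" by auto
    ultimately show ?thesis using bij_betw_imp_surj_on[OF b] by (simp add: case_prod_unfold mem_Times_iff conj_assoc)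
  qed
  have Q: "Q (snd y i0) \<longleftrightarrow> Q (snd (wr_restrict T y) i0)" for y :: "'a wr" using i0 by (simp add: wr_restrict_simps)
  have "bij_betw ?r {y \<in> carrier (\<Gamma> S). (\<forall>i\<in>T. snd y i \<in> T) \<and> (y \<in> fixing S g \<and> Q (snd y i0))}
      {(a, b). a \<in> carrier (\<Gamma> T) \<and> b \<in> carrier (\<Gamma> (S - T)) \<and> ((a \<in> fixing T gT \<and> Q (snd a i0)) \<and> b \<in> fixing (S - T) gS)}"
    by (rule bij) (auto simp: split_membership(1)[OF T fin g gT] gT_def gS_def simp flip: Q)
  moreover have "{y \<in> carrier (\<Gamma> S). (\<forall>i\<in>T. snd y i \<in> T) \<and> (y \<in> fixing S g \<and> Q (snd y i0))}
     = {\<omega> \<in> fixing S g. (\<forall>i\<in>T. snd \<omega> i \<in> T) \<and> Q (snd \<omega> i0)}" by (auto dest: fixingD(1))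
  moreover have "{(a, b). a \<in> carrier (\<Gamma> T) \<and> b \<in> carrier (\<Gamma> (S - T)) \<and> ((a \<in> fixing T gT \<and> Q (snd a i0)) \<and> b \<in> fixing (S - T) gS)}
     = {\<omega> \<in> fixing T gT. Q (snd \<omega> i0)} \<times> fixing (S - T) gS" by (auto dest: fixingD(1))
  ultimately have b1: "bij_betw ?r {\<omega> \<in> fixing S g. (\<forall>i\<in>T. snd \<omega> i \<in> T) \<and> Q (snd \<omega> i0)}
     ({\<omega> \<in> fixing T gT. Q (snd \<omega> i0)} \<times> fixing (S - T) gS)" by simp
  have "(\<Sum>\<omega>\<in>{\<omega> \<in> fixing S g. (\<forall>i\<in>T. snd \<omega> i \<in> T) \<and> Q (snd \<omega> i0)}. weight S g \<omega>)
     = (\<Sum>\<omega>\<in>{\<omega> \<in> fixing S g. (\<forall>i\<in>T. snd \<omega> i \<in> T) \<and> Q (snd \<omega> i0)}. (\<lambda>(a,b). weight T gT a * weight (S - T) gS b) (?r \<omega>))"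
    by (intro sum.cong refl) (auto simp: gT_def gS_def weight_split[OF T fin g gT])
  also have "\<dots> = (\<Sum>(a,b)\<in>{\<omega> \<in> fixing T gT. Q (snd \<omega> i0)} \<times> fixing (S - T) gS. weight T gT a * weight (S - T) gS b)"
    by (rule sum.reindex_bij_betw[OF b1])
  also have "\<dots> = (\<Sum>\<omega>\<in>{\<omega> \<in> fixing T gT. Q (snd \<omega> i0)}. weight T gT \<omega>) * (\<Sum>\<omega>\<in>fixing (S - T) gS. weight (S - T) gS \<omega>)"
    by (simp add: sum_product sum.cartesian_product)
  finally show "(\<Sum>\<omega>\<in>{\<omega> \<in> fixing S g. (\<forall>i\<in>T. snd \<omega> i \<in> T) \<and> Q (snd \<omega> i0)}. weight S g \<omega>)
      = (\<Sum>\<omega>\<in>{\<omega> \<in> fixing T gT. Q (snd \<omega> i0)}. weight T gT \<omega>) * (\<Sum>\<omega>\<in>fixing (S - T) gS. weight (S - T) gS \<omega>)" .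
  have "bij_betw ?r {y \<in> carrier (\<Gamma> S). (\<forall>i\<in>T. snd y i \<in> T) \<and> (y \<in> roots S g \<and> Q (snd y i0))}
      {(a, b). a \<in> carrier (\<Gamma> T) \<and> b \<in> carrier (\<Gamma> (S - T)) \<and> ((a \<in> roots T gT \<and> Q (snd a i0)) \<and> b \<in> roots (S - T) gS)}"
    by (rule bij) (auto simp: split_membership(2)[OF T fin g gT] gT_def gS_def simp flip: Q)
  moreover have "{y \<in> carrier (\<Gamma> S). (\<forall>i\<in>T. snd y i \<in> T) \<and> (y \<in> roots S g \<and> Q (snd y i0))}
     = {\<omega> \<in> roots S g. (\<forall>i\<in>T. snd \<omega> i \<in> T) \<and> Q (snd \<omega> i0)}" by (auto dest: rootsD(1))
  moreover have "{(a, b). a \<in> carrier (\<Gamma> T) \<and> b \<in> carrier (\<Gamma> (S - T)) \<and> ((a \<in> roots T gT \<and> Q (snd a i0)) \<and> b \<in> roots (S - T) gS)}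
     = {\<omega> \<in> roots T gT. Q (snd \<omega> i0)} \<times> roots (S - T) gS" by (auto dest: rootsD(1))
  ultimately have b2: "bij_betw ?r {\<omega> \<in> roots S g. (\<forall>i\<in>T. snd \<omega> i \<in> T) \<and> Q (snd \<omega> i0)}
     ({\<omega> \<in> roots T gT. Q (snd \<omega> i0)} \<times> roots (S - T) gS)" by simp
  show "card {y \<in> roots S g. (\<forall>i\<in>T. snd y i \<in> T) \<and> Q (snd y i0)}
      = card {y \<in> roots T gT. Q (snd y i0)} * card (roots (S - T) gS)"
    using bij_betw_same_card[OF b2] by (simp add: card_cartesian_product)
qed

text \<open>Induction on the number of positions. Involutions and square roots are sorted by the image of a chosen position \<open>i0\<close>. If it lies in the
  cycle \<open>C\<close> of \<open>i0\<close>, then \<open>C\<close> is preserved and splits off; if it is a position \<open>j\<close> outside, then \<open>C\<close> and the cycle of \<open>j\<close> are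
  exchanged and their union splits off.\<close>
theorem sum_weight_fixing:
  assumes "finite S" "g \<in> carrier (\<Gamma> S)"
  shows "(\<Sum>\<omega>\<in>fixing S g. weight S g \<omega>) = of_nat (card (roots S g))"
  using assms
proof (induction "card S" arbitrary: S g rule: less_induct)
  case less
  note fin = less.prems(1) and g = less.prems(2)
  show ?case
  proof (cases "S = {}")
    case True
    have one: "y = \<one>\<^bsub>\<Gamma> {}\<^esub>" if "y \<in> carrier (\<Gamma> {})" for y :: "'a wr"
      by (rule wr_eqI[OF that W.one_closed]) simp_all
    have oc: "\<one>\<^bsub>\<Gamma> {}\<^esub> \<in> carrier (\<Gamma> {})" by (rule W.one_closed)
    have gg: "g = \<one>\<^bsub>\<Gamma> {}\<^esub>" using one g True by simp
    have "fixing S g = {\<one>\<^bsub>\<Gamma> {}\<^esub>}"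
      unfolding True gg fixing_def twisted_involutions_def using one oc by (auto simp: \<alpha>_one)
    moreover have "roots S g = {\<one>\<^bsub>\<Gamma> {}\<^esub>}"
      unfolding True gg roots_def twisted_square_roots_def using one oc by (auto simp: \<alpha>_one)
    moreover have "weight S g \<one>\<^bsub>\<Gamma> {}\<^esub> = 1" unfolding True weight_def sign_on_set_def by simp
    ultimately show ?thesis by simp
  next
    case False
    then obtain i0 where i0: "i0 \<in> S" by blast
    define orb where "orb i = {(snd g ^^ a) i | a. True}" for i
    have orbS: "orb i \<subseteq> S" if "i \<in> S" for i using snd_pow_in[OF g] that by (auto simp: orb_def)
    have orb_self: "i \<in> orb i" for i unfolding orb_def by (rule CollectI, rule exI[of _ 0]) simp
    have orb_step: "snd g k \<in> orb i" if "k \<in> orb i" for i k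
    proof -
      obtain a where "k = (snd g ^^ a) i" using \<open>k \<in> orb i\<close> unfolding orb_def by auto
      then have "snd g k = (snd g ^^ Suc a) i" by simp
      then show ?thesis unfolding orb_def by blast
    qed
    have orb_image: "snd y ((snd g ^^ a) i) = (snd g ^^ a) (snd y i)"
      if "\<And>i. snd y (snd g i) = snd g (snd y i)" for y :: "'a wr" and a i
      by (induction a) (simp_all add: that)
    have orb_map: "snd y k \<in> orb (snd y i)" if "\<And>i. snd y (snd g i) = snd g (snd y i)" "k \<in> orb i" for y :: "'a wr" and i k
      using that(2) orb_image[OF that(1)] by (auto simp: orb_def)
    have orb_trans: "orb k \<subseteq> orb i" if k: "k \<in> orb i" for i k
    proof
      fix l assume "l \<in> orb k"
      then obtain a b where "k = (snd g ^^ a) i" "l = (snd g ^^ b) k" using k unfolding orb_def by auto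
      then have "l = (snd g ^^ (b + a)) i" by (simp add: funpow_add)
      then show "l \<in> orb i" unfolding orb_def by blast
    qed
    define C where "C = orb i0"
    have CS: "C \<subseteq> S" and C0: "i0 \<in> C" using orbS[OF i0] orb_self by (auto simp: C_def)
    have finC: "finite C" using CS fin finite_subset by blast
    have gC: "snd g i \<in> C" if "i \<in> C" for i using orb_step that by (simp add: C_def)
    have gC': "snd g i \<in> S - C" if "i \<in> S - C" for i by (rule wr_invariant_complement[OF g CS finC gC that])
    have IH: "(\<Sum>\<omega>\<in>fixing (S - T) (wr_restrict (S - T) g). weight (S - T) (wr_restrict (S - T) g) \<omega>)
        = of_nat (card (roots (S - T) (wr_restrict (S - T) g)))"
      if T: "T \<subseteq> S" "\<And>i. i \<in> T \<Longrightarrow> snd g i \<in> T" "i0 \<in> T" for T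
    proof (rule less.hyps)
      have finT: "finite T" using T(1) fin finite_subset by blast
      show "card (S - T) < card S" using T(1,3) i0 fin by (intro psubset_card_mono) auto
      show "finite (S - T)" using fin by simp
      show "wr_restrict (S - T) g \<in> carrier (\<Gamma> (S - T))"
        by (rule wr_restrict_carrier[OF g]) (use fin wr_invariant_complement[OF g T(1) finT T(2)] in auto)
    qed
    have finF: "finite (fixing S g)" "finite (roots S g)"
      by (rule finite_subset[OF _ finite_wr_grp[OF finite_carrier fin]], auto dest: fixingD(1) rootsD(1))+
    have inS: "\<omega> \<in> fixing S g \<Longrightarrow> snd \<omega> i0 \<in> S" "y \<in> roots S g \<Longrightarrow> snd y i0 \<in> S" for \<omega> y
      using wr_carrierD(3)[OF fixingD(1)] wr_carrierD(3)[OF rootsD(1)] i0 by blast+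
    \<comment> \<open>The elements that preserve the cycle of \<open>i0\<close>.\<close>
    have A: "(\<Sum>\<omega>\<in>{\<omega> \<in> fixing S g. snd \<omega> i0 \<in> C}. weight S g \<omega>) = of_nat (card {y \<in> roots S g. snd y i0 \<in> C})"
    proof -
      have pres: "(\<forall>i\<in>C. snd y i \<in> C) \<and> True \<longleftrightarrow> snd y i0 \<in> C" if "\<And>i. snd y (snd g i) = snd g (snd y i)" for y :: "'a wr"
        using orb_map[OF that, of _ i0] orb_trans[of "snd y i0" i0] C0 unfolding C_def by blast
      have "{\<omega> \<in> fixing S g. snd \<omega> i0 \<in> C} = {\<omega> \<in> fixing S g. (\<forall>i\<in>C. snd \<omega> i \<in> C) \<and> True}"
        by (rule Collect_cong, rule conj_cong[OF refl]) (rule pres[symmetric], rule fixingD(5))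
      moreover have "{y \<in> roots S g. snd y i0 \<in> C} = {y \<in> roots S g. (\<forall>i\<in>C. snd y i \<in> C) \<and> True}"
        by (rule Collect_cong, rule conj_cong[OF refl]) (rule pres[symmetric], rule rootsD(5))
      moreover have "(\<Sum>\<omega>\<in>fixing C (wr_restrict C g). weight C (wr_restrict C g) \<omega>) = of_nat (card (roots C (wr_restrict C g)))"
      proof (rule single_cycle[OF finC wr_restrict_carrier[OF g CS finC gC] C0])
        fix i assume "i \<in> C"
        then obtain a where a: "i = (snd g ^^ a) i0" unfolding C_def orb_def by auto
        have "(snd (wr_restrict C g) ^^ a) i0 = (snd g ^^ a) i0 \<and> (snd g ^^ a) i0 \<in> C" for a
          by (induction a) (simp_all add: C0 gC wr_restrict_simps)
        then show "\<exists>a. (snd (wr_restrict C g) ^^ a) i0 = i" using a by (intro exI[of _ a]) simp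
      qed
      ultimately show ?thesis
        using sum_split[OF CS fin g gC C0, of "\<lambda>_. True"] IH[OF CS gC C0] by simp
    qed
    \<comment> \<open>The elements that exchange it with the cycle of \<open>j\<close>: if \<open>i0\<close> goes to \<open>j\<close>, then \<open>j\<close> goes back to the cycle of \<open>i0\<close>, because on positions the square of the element is the identity or \<open>g\<close>.\<close>
    have B: "(\<Sum>\<omega>\<in>{\<omega> \<in> fixing S g. snd \<omega> i0 = j}. weight S g \<omega>) = of_nat (card {y \<in> roots S g. snd y i0 = j})"
      if j: "j \<in> S - C" for j
    proof -
      define D where "D = C \<union> orb j"
      have DS: "D \<subseteq> S" using CS orbS j by (auto simp: D_def)
      have finD: "finite D" using DS fin finite_subset by blast
      have gD: "snd g i \<in> D" if "i \<in> D" for i using that gC orb_step by (auto simp: D_def)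
      have D0: "i0 \<in> D" using C0 by (simp add: D_def)
      have jD: "j \<in> D - C" using j orb_self by (auto simp: D_def)
      have orbj: "k \<in> S - C" if "k \<in> orb j" for k
      proof -
        obtain a where "k = (snd g ^^ a) j" using \<open>k \<in> orb j\<close> unfolding orb_def by auto
        moreover have "(snd g ^^ a) j \<in> S - C" for a by (induction a) (use j gC' in auto)
        ultimately show ?thesis by simp
      qed
      have swap: "(\<forall>i\<in>D. snd y i \<in> D) \<and> snd y i0 = j \<and> (\<forall>i\<in>D. snd y i \<in> C \<longleftrightarrow> i \<notin> C)"
        if comm: "\<And>i. snd y (snd g i) = snd g (snd y i)" and yj: "snd y i0 = j" and yy: "snd y j \<in> C" for y :: "'a wr"
      proof -
        have 1: "snd y i \<in> orb j" if "i \<in> C" for i using orb_map[OF comm, of i i0] that yj by (simp add: C_def)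
        have 2: "snd y i \<in> C" if "i \<in> orb j" for i
          using orb_map[OF comm that] orb_trans[of "snd y j" i0] yy by (auto simp: C_def)
        show ?thesis using 1 2 orbj yj by (auto simp: D_def)
      qed
      define gD' where "gD' = wr_restrict D g"
      have gD': "gD' \<in> carrier (\<Gamma> D)" unfolding gD'_def by (rule wr_restrict_carrier[OF g DS finD gD])
      have commD: "snd y (snd g i) = snd g (snd y i)" if "\<And>i. snd y (snd gD' i) = snd gD' (snd y i)" "i \<in> D" "y \<in> carrier (\<Gamma> D)" for y i
      proof -
        have "snd y i \<in> D" using wr_carrierD(3)[OF that(3)] that(2) by simp
        then show ?thesis using that(1)[of i] that(2) by (simp add: gD'_def wr_restrict_simps)
      qed
      have swapD: "(\<forall>i\<in>D. snd y i \<in> C \<longleftrightarrow> i \<notin> C) \<and> snd y i0 = j \<longleftrightarrow> snd y i0 = j"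
        if y: "y \<in> carrier (\<Gamma> D)" and comm: "\<And>i. snd y (snd gD' i) = snd gD' (snd y i)" and yy: "snd y i0 = j \<Longrightarrow> snd y j \<in> C" for y
      proof -
        have im: "snd y ((snd g ^^ a) i) = (snd g ^^ a) (snd y i) \<and> (snd g ^^ a) i \<in> D" if "i \<in> D" for a i
          by (induction a) (use that gD commD[OF comm _ y] in auto)
        have 1: "snd y i \<in> orb j" if "i \<in> C" "snd y i0 = j" for i
          using that im[OF D0] by (auto simp: C_def orb_def)
        have 2: "snd y i \<in> C" if i: "i \<in> orb j" and "snd y i0 = j" for i
        proof -
          have "snd y j \<in> C" using yy that(2) .
          moreover obtain a where "i = (snd g ^^ a) j" using i unfolding orb_def by auto
          moreover have "(snd g ^^ a) k \<in> C" if "k \<in> C" for a k using that by (induction a) (auto simp: gC)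
          ultimately show ?thesis using im[of j a] jD by auto
        qed
        show ?thesis using 1 2 orbj by (auto simp: D_def)
      qed
      have e1: "{\<omega> \<in> fixing S g. snd \<omega> i0 = j} = {\<omega> \<in> fixing S g. (\<forall>i\<in>D. snd \<omega> i \<in> D) \<and> snd \<omega> i0 = j}"
      proof (rule Collect_cong, rule conj_cong[OF refl])
        fix \<omega> assume \<omega>: "\<omega> \<in> fixing S g"
        have "snd \<omega> j \<in> C" if "snd \<omega> i0 = j" using fixingD(4)[OF \<omega>, of i0] that C0 by simp
        then show "snd \<omega> i0 = j \<longleftrightarrow> (\<forall>i\<in>D. snd \<omega> i \<in> D) \<and> snd \<omega> i0 = j"
          using swap[of \<omega>, OF fixingD(5)[OF \<omega>]] by blast
      qed
      have e2: "{y \<in> roots S g. snd y i0 = j} = {y \<in> roots S g. (\<forall>i\<in>D. snd y i \<in> D) \<and> snd y i0 = j}"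
      proof (rule Collect_cong, rule conj_cong[OF refl])
        fix y assume y: "y \<in> roots S g"
        have "snd y j \<in> C" if "snd y i0 = j" using rootsD(4)[OF y, of i0] that gC[OF C0] by simp
        then show "snd y i0 = j \<longleftrightarrow> (\<forall>i\<in>D. snd y i \<in> D) \<and> snd y i0 = j"
          using swap[of y, OF rootsD(5)[OF y]] by blast
      qed
      have e3: "{\<omega> \<in> fixing D gD'. (\<forall>i\<in>D. snd \<omega> i \<in> C \<longleftrightarrow> i \<notin> C) \<and> snd \<omega> i0 = j} = {\<omega> \<in> fixing D gD'. snd \<omega> i0 = j}"
      proof (rule Collect_cong, rule conj_cong[OF refl])
        fix \<omega> assume \<omega>: "\<omega> \<in> fixing D gD'"
        have yy: "snd \<omega> j \<in> C" if "snd \<omega> i0 = j" using fixingD(4)[OF \<omega>, of i0] that C0 by simp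
        show "(\<forall>i\<in>D. snd \<omega> i \<in> C \<longleftrightarrow> i \<notin> C) \<and> snd \<omega> i0 = j \<longleftrightarrow> snd \<omega> i0 = j"
          by (rule swapD[OF fixingD(1)[OF \<omega>] fixingD(5)[OF \<omega>] yy])
      qed
      have e4: "{y \<in> roots D gD'. (\<forall>i\<in>D. snd y i \<in> C \<longleftrightarrow> i \<notin> C) \<and> snd y i0 = j} = {y \<in> roots D gD'. snd y i0 = j}"
      proof (rule Collect_cong, rule conj_cong[OF refl])
        fix y assume y: "y \<in> roots D gD'"
        have yy: "snd y j \<in> C" if "snd y i0 = j"
          using rootsD(4)[OF y, of i0] that gC[OF C0] D0 by (simp add: gD'_def wr_restrict_simps)
        show "(\<forall>i\<in>D. snd y i \<in> C \<longleftrightarrow> i \<notin> C) \<and> snd y i0 = j \<longleftrightarrow> snd y i0 = j"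
          by (rule swapD[OF rootsD(1)[OF y] rootsD(5)[OF y] yy])
      qed
      have "(\<Sum>\<omega>\<in>{\<omega> \<in> fixing D gD'. snd \<omega> i0 = j}. weight D gD' \<omega>) = of_nat (card {y \<in> roots D gD'. snd y i0 = j})"
        unfolding e3[symmetric] e4[symmetric]
        by (rule swapped_halves[OF finD gD' _ _ C0 jD]) (use gC in \<open>auto simp: gD'_def D_def wr_restrict_simps\<close>)
      then show ?thesis
        unfolding e1 e2 using sum_split[OF DS fin g gD D0, of "\<lambda>k. k = j"] IH[OF DS gD D0] by (simp add: gD'_def)
    qed
    have "(\<Sum>\<omega>\<in>fixing S g. weight S g \<omega>)
      = (\<Sum>\<omega>\<in>{\<omega> \<in> fixing S g. snd \<omega> i0 \<in> C}. weight S g \<omega>) + (\<Sum>\<omega>\<in>{\<omega> \<in> fixing S g. snd \<omega> i0 \<in> S - C}. weight S g \<omega>)"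
      using finF(1) inS(1)
      by (subst sum.union_disjoint[symmetric]) (auto intro!: sum.cong)
    also have "(\<Sum>\<omega>\<in>{\<omega> \<in> fixing S g. snd \<omega> i0 \<in> S - C}. weight S g \<omega>)
      = (\<Sum>j\<in>S - C. \<Sum>\<omega>\<in>{\<omega> \<in> {\<omega> \<in> fixing S g. snd \<omega> i0 \<in> S - C}. snd \<omega> i0 = j}. weight S g \<omega>)"
      using finF(1) fin by (intro sum.group[symmetric]) auto
    also have "\<dots> = (\<Sum>j\<in>S - C. of_nat (card {y \<in> roots S g. snd y i0 = j}))"
    proof (rule sum.cong[OF refl])
      fix j assume j: "j \<in> S - C"
      have "{\<omega> \<in> {\<omega> \<in> fixing S g. snd \<omega> i0 \<in> S - C}. snd \<omega> i0 = j} = {\<omega> \<in> fixing S g. snd \<omega> i0 = j}" using j by auto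
      then show "(\<Sum>\<omega>\<in>{\<omega> \<in> {\<omega> \<in> fixing S g. snd \<omega> i0 \<in> S - C}. snd \<omega> i0 = j}. weight S g \<omega>) = of_nat (card {y \<in> roots S g. snd y i0 = j})"
        using B[OF j] by simp
    qed
    also have "\<dots> = of_nat (\<Sum>j\<in>S - C. card {y \<in> roots S g. snd y i0 = j})" by simp
    also have "(\<Sum>j\<in>S - C. card {y \<in> roots S g. snd y i0 = j}) = card (\<Union>j\<in>S - C. {y \<in> roots S g. snd y i0 = j})"
      using finF(2) fin by (intro card_UN_disjoint[symmetric]) auto
    also have "(\<Union>j\<in>S - C. {y \<in> roots S g. snd y i0 = j}) = {y \<in> roots S g. snd y i0 \<in> S - C}" by auto
    also have "(\<Sum>\<omega>\<in>{\<omega> \<in> fixing S g. snd \<omega> i0 \<in> C}. weight S g \<omega>) + of_nat (card {y \<in> roots S g. snd y i0 \<in> S - C})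
       = of_nat (card {y \<in> roots S g. snd y i0 \<in> C} + card {y \<in> roots S g. snd y i0 \<in> S - C})"
      unfolding A by simp
    also have "card {y \<in> roots S g. snd y i0 \<in> C} + card {y \<in> roots S g. snd y i0 \<in> S - C} = card (roots S g)"
      using finF(2) inS(2)
      by (subst card_Un_disjoint[symmetric]) (auto intro!: arg_cong[where f = card])
    finally show ?thesis .
  qed
qed

end

context twisted_group begin

abbreviation "I \<equiv> twisted_involutions H \<tau>"
abbreviation "act \<equiv> twisted_conj H \<tau>"

section \<open>Orbits under twisted conjugation\<close>

lemma I_carrier: "w \<in> I \<Longrightarrow> w \<in> carrier H"
  by (simp add: twisted_involutions_def)

lemma act_closed: "y \<in> carrier H \<Longrightarrow> w \<in> carrier H \<Longrightarrow> act y w \<in> carrier H"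
  by (simp add: twisted_conj_def \<tau>_closed)

lemma act_eq_iff:
  assumes "y \<in> carrier H" "w \<in> carrier H" "w' \<in> carrier H"
  shows "act y w = w' \<longleftrightarrow> y \<otimes> w = w' \<otimes> \<tau> y"
proof
  assume "act y w = w'"
  then show "y \<otimes> w = w' \<otimes> \<tau> y" using assms by (auto simp: twisted_conj_def m_assoc \<tau>_closed)
next
  assume e: "y \<otimes> w = w' \<otimes> \<tau> y"
  show "act y w = w'" unfolding twisted_conj_def e using assms by (simp add: m_assoc \<tau>_closed)
qed

lemma act_one: "w \<in> carrier H \<Longrightarrow> act \<one> w = w"
  by (simp add: twisted_conj_def \<tau>_one)

lemma act_mult:
  assumes "y \<in> carrier H" "z \<in> carrier H" "w \<in> carrier H"
  shows "act (y \<otimes> z) w = act y (act z w)"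
  using assms by (simp add: twisted_conj_def \<tau>_mult \<tau>_closed inv_mult_group m_assoc)

lemma act_inv:
  assumes "y \<in> carrier H" "w \<in> carrier H"
  shows "act (inv y) (act y w) = w" "act y (act (inv y) w) = w"
  using assms act_mult[of "inv y" y w] act_mult[of y "inv y" w] by (simp_all add: act_one)

lemma act_I:
  assumes "y \<in> carrier H" "w \<in> I"
  shows "act y w \<in> I"
proof -
  have w: "w \<in> carrier H" "w \<otimes> \<tau> w = \<one>" using assms(2) by (auto simp: twisted_involutions_def)
  have "\<tau> (act y w) = \<tau> y \<otimes> (\<tau> w \<otimes> inv y)"
    using assms(1) w(1) by (simp add: twisted_conj_def \<tau>_mult \<tau>_inv \<tau>_\<tau> \<tau>_closed m_assoc)
  then have "act y w \<otimes> \<tau> (act y w) = y \<otimes> w \<otimes> (inv (\<tau> y) \<otimes> (\<tau> y \<otimes> (\<tau> w \<otimes> inv y)))"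
    using assms(1) w(1) by (simp add: twisted_conj_def \<tau>_closed m_assoc)
  also have "inv (\<tau> y) \<otimes> (\<tau> y \<otimes> (\<tau> w \<otimes> inv y)) = \<tau> w \<otimes> inv y"
    using assms(1) w(1) by (simp add: \<tau>_closed flip: m_assoc)
  also have "y \<otimes> w \<otimes> (\<tau> w \<otimes> inv y) = y \<otimes> (w \<otimes> \<tau> w) \<otimes> inv y"
    using assms(1) w(1) by (simp add: \<tau>_closed m_assoc)
  also have "\<dots> = \<one>" unfolding w(2) using assms(1) by simp
  finally show ?thesis using assms(1) w(1) by (simp add: twisted_involutions_def act_closed)
qed

lemma centralizer_iff:
  assumes "w \<in> carrier H"
  shows "g \<in> twisted_centralizer H \<tau> w \<longleftrightarrow> g \<in> carrier H \<and> g \<otimes> w = w \<otimes> \<tau> g"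
  using act_eq_iff[OF _ assms assms] by (auto simp: stabilizer_def)

lemma centralizer_subgroup:
  assumes w: "w \<in> carrier H"
  shows "subgroup (twisted_centralizer H \<tau> w) H"
proof (rule subgroupI)
  show "inv a \<in> twisted_centralizer H \<tau> w" if "a \<in> twisted_centralizer H \<tau> w" for a
    using that act_inv(1)[of a w] w by (auto simp: stabilizer_def)
  show "a \<otimes> b \<in> twisted_centralizer H \<tau> w" if "a \<in> twisted_centralizer H \<tau> w" "b \<in> twisted_centralizer H \<tau> w" for a b
    using that act_mult[of a b w] w by (auto simp: stabilizer_def)
qed (use act_one[OF w] in \<open>auto simp: stabilizer_def\<close>)

lemma sum_over_orbit:
  fixes F :: "'a \<Rightarrow> complex"
  assumes w: "w \<in> I"
  shows "(\<Sum>y\<in>carrier H. F (act y w)) = of_nat (card (twisted_centralizer H \<tau> w)) * (\<Sum>v\<in>orbit H act w. F v)"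
proof -
  have wc: "w \<in> carrier H" by (rule I_carrier[OF w])
  have orb: "orbit H act w = (\<lambda>y. act y w) ` carrier H" by (auto simp: orbit_def)
  have fib: "card {y \<in> carrier H. act y w = v} = card (twisted_centralizer H \<tau> w)" if v: "v \<in> orbit H act w" for v
  proof -
    obtain y0 where y0: "y0 \<in> carrier H" "v = act y0 w" using v by (auto simp: orb)
    have "bij_betw (\<lambda>k. y0 \<otimes> k) (twisted_centralizer H \<tau> w) {y \<in> carrier H. act y w = v}"
    proof (rule bij_betw_byWitness[where f' = "\<lambda>y. inv y0 \<otimes> y"])
      show "\<forall>k\<in>twisted_centralizer H \<tau> w. inv y0 \<otimes> (y0 \<otimes> k) = k"
        using y0 by (auto simp: stabilizer_def simp flip: m_assoc)
      show "\<forall>y\<in>{y \<in> carrier H. act y w = v}. y0 \<otimes> (inv y0 \<otimes> y) = y"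
        using y0 by (auto simp flip: m_assoc)
      show "(\<lambda>k. y0 \<otimes> k) ` twisted_centralizer H \<tau> w \<subseteq> {y \<in> carrier H. act y w = v}"
        using y0 wc by (auto simp: stabilizer_def act_mult)
      show "(\<lambda>y. inv y0 \<otimes> y) ` {y \<in> carrier H. act y w = v} \<subseteq> twisted_centralizer H \<tau> w"
        using y0 wc by (auto simp: stabilizer_def act_mult act_inv)
    qed
    from bij_betw_same_card[OF this] show ?thesis by simp
  qed
  have "(\<Sum>y\<in>carrier H. F (act y w)) = (\<Sum>v\<in>orbit H act w. \<Sum>y\<in>{y \<in> carrier H. act y w = v}. F (act y w))"
    using finite_carrier by (intro sum.group[symmetric]) (auto simp: orb)
  also have "\<dots> = (\<Sum>v\<in>orbit H act w. of_nat (card (twisted_centralizer H \<tau> w)) * F v)"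
    by (intro sum.cong refl) (simp add: fib)
  finally show ?thesis by (simp add: sum_distrib_left)
qed

lemma orbits_partition:
  assumes X: "finite X" and inj: "inj_on \<epsilon> X" and reps: "orbit_representatives H \<tau> (\<epsilon> ` X)"
  shows "(\<Sum>x\<in>X. \<Sum>v\<in>orbit H act (\<epsilon> x). F v) = (\<Sum>v\<in>I. F v)" (is ?sum)
    and "\<And>w. w \<in> I \<Longrightarrow> \<exists>x\<in>X. \<exists>y\<in>carrier H. act y w = \<epsilon> x"
    and "\<And>w x x' y y'. w \<in> I \<Longrightarrow> x \<in> X \<Longrightarrow> x' \<in> X \<Longrightarrow> y \<in> carrier H \<Longrightarrow> y' \<in> carrier H \<Longrightarrow> act y w = \<epsilon> x \<Longrightarrow> act y' w = \<epsilon> x' \<Longrightarrow> x = x'"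
proof -
  have RI: "\<epsilon> x \<in> I" if "x \<in> X" for x using reps that by (auto simp: orbit_representatives_def)
  have ex1: "\<exists>!\<omega>. \<omega> \<in> \<epsilon> ` X \<inter> orbit H act w" if "w \<in> I" for w
  proof -
    have "\<forall>Orb\<in>orbits H I act. \<exists>!\<omega>. \<omega> \<in> \<epsilon> ` X \<inter> Orb" using reps unfolding orbit_representatives_def by (rule conjunct2)
    moreover have "orbit H act w \<in> orbits H I act" unfolding orbits_def using that by blast
    ultimately show ?thesis by (rule bspec)
  qed
  show ex: "\<exists>x\<in>X. \<exists>y\<in>carrier H. act y w = \<epsilon> x" if w: "w \<in> I" for w
  proof -
    obtain \<omega> where "\<omega> \<in> \<epsilon> ` X" "\<omega> \<in> orbit H act w" using ex1[OF w] by blast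
    then obtain x y where "x \<in> X" "\<omega> = \<epsilon> x" "y \<in> carrier H" "\<omega> = act y w" unfolding orbit_def by blast
    then show ?thesis by (intro bexI[of _ x] bexI[of _ y]) simp_all
  qed
  show un: "x = x'" if "w \<in> I" "x \<in> X" "x' \<in> X" "y \<in> carrier H" "y' \<in> carrier H" "act y w = \<epsilon> x" "act y' w = \<epsilon> x'" for w x x' y y'
  proof -
    have "\<epsilon> x \<in> \<epsilon> ` X \<inter> orbit H act w" "\<epsilon> x' \<in> \<epsilon> ` X \<inter> orbit H act w"
      using that by (auto simp: orbit_def) (metis that(6) that(7))+
    then have "\<epsilon> x = \<epsilon> x'" using ex1[OF that(1)] by blast
    then show ?thesis using inj that(2,3) by (simp add: inj_on_def)
  qed
  have fI: "finite I" using finite_carrier by (rule finite_subset[rotated]) (auto dest: I_carrier)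
  have orbI: "orbit H act (\<epsilon> x) \<subseteq> I" if "x \<in> X" for x using act_I RI[OF that] by (auto simp: orbit_def)
  have inorb: "\<exists>y\<in>carrier H. act y v = \<epsilon> x" if "v \<in> orbit H act (\<epsilon> x)" "x \<in> X" for v x
  proof -
    obtain y where y: "y \<in> carrier H" "v = act y (\<epsilon> x)" using \<open>v \<in> orbit H act (\<epsilon> x)\<close> by (auto simp: orbit_def)
    then have "act (inv y) v = \<epsilon> x" using act_inv(1)[OF y(1) I_carrier[OF RI[OF that(2)]]] by simp
    then show ?thesis using y(1) by (intro bexI[of _ "inv y"]) simp_all
  qed
  have "(\<Union>x\<in>X. orbit H act (\<epsilon> x)) = I"
  proof
    show "(\<Union>x\<in>X. orbit H act (\<epsilon> x)) \<subseteq> I" using orbI by blast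
    show "I \<subseteq> (\<Union>x\<in>X. orbit H act (\<epsilon> x))"
    proof
      fix w assume w: "w \<in> I"
      obtain x y where xy: "x \<in> X" "y \<in> carrier H" "act y w = \<epsilon> x" using ex[OF w] by blast
      have "w = act (inv y) (\<epsilon> x)" using act_inv(1)[OF xy(2) I_carrier[OF w]] xy(3) by simp
      moreover have "inv y \<in> carrier H" using xy(2) by simp
      ultimately have "w \<in> orbit H act (\<epsilon> x)" unfolding orbit_def by blast
      then show "w \<in> (\<Union>x\<in>X. orbit H act (\<epsilon> x))" using xy(1) by blast
    qed
  qed
  moreover have "(\<Sum>v\<in>(\<Union>x\<in>X. orbit H act (\<epsilon> x)). F v) = (\<Sum>x\<in>X. \<Sum>v\<in>orbit H act (\<epsilon> x). F v)"
  proof (rule sum.UNION_disjoint[OF X])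
    show "\<forall>x\<in>X. finite (orbit H act (\<epsilon> x))" using fI orbI finite_subset by blast
    show "\<forall>x\<in>X. \<forall>x'\<in>X. x \<noteq> x' \<longrightarrow> orbit H act (\<epsilon> x) \<inter> orbit H act (\<epsilon> x') = {}"
    proof (intro ballI impI, rule ccontr)
      fix x x' assume x: "x \<in> X" "x' \<in> X" "x \<noteq> x'" and "orbit H act (\<epsilon> x) \<inter> orbit H act (\<epsilon> x') \<noteq> {}"
      then obtain v where v: "v \<in> orbit H act (\<epsilon> x)" "v \<in> orbit H act (\<epsilon> x')" by blast
      obtain y y' where "y \<in> carrier H" "act y v = \<epsilon> x" "y' \<in> carrier H" "act y' v = \<epsilon> x'"
        using inorb[OF v(1) x(1)] inorb[OF v(2) x(2)] by blast
      moreover have "v \<in> I" using orbI[OF x(1)] v(1) by blast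
      ultimately show False using un x by blast
    qed
  qed
  ultimately show ?sum by simp
qed

text \<open>By the orbit-stabilizer count, an induced character at \<open>g\<close> is the sum of the transported values of the linear character over the points
  of the orbit that \<open>g\<close> fixes. The function \<open>\<Phi>\<close> is a common extension of the linear characters which is invariant under simultaneous
  conjugation, so it supplies the transported values.\<close>
lemma sum_induced_eq_sum_fixed:
  assumes X: "finite X" and inj: "inj_on \<epsilon> X" and reps: "orbit_representatives H \<tau> (\<epsilon> ` X)"
    and \<Phi>: "\<And>w y g. w \<in> I \<Longrightarrow> y \<in> carrier H \<Longrightarrow> g \<in> carrier H \<Longrightarrow> g \<otimes> w = w \<otimes> \<tau> g \<Longrightarrow> \<Phi> (act y w) (y \<otimes> g \<otimes> inv y) = \<Phi> w g"
    and f: "\<And>x g. x \<in> X \<Longrightarrow> g \<in> twisted_centralizer H \<tau> (\<epsilon> x) \<Longrightarrow> f x g = \<Phi> (\<epsilon> x) g"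
    and g: "g \<in> carrier H"
  shows "(\<Sum>x\<in>X. induced_character H (twisted_centralizer H \<tau> (\<epsilon> x)) (f x) g) = (\<Sum>w | w \<in> I \<and> g \<otimes> w = w \<otimes> \<tau> g. \<Phi> w g)"
proof -
  have RI: "\<epsilon> x \<in> I" if "x \<in> X" for x using reps that by (auto simp: orbit_representatives_def)
  define F where "F w = (if g \<otimes> w = w \<otimes> \<tau> g then \<Phi> w g else 0)" for w
  have fI: "finite I" using finite_carrier by (rule finite_subset[rotated]) (auto dest: I_carrier)
  have "induced_character H (twisted_centralizer H \<tau> (\<epsilon> x)) (f x) g = (\<Sum>v\<in>orbit H act (\<epsilon> x). F v)" if x: "x \<in> X" for x
  proof -
    let ?K = "twisted_centralizer H \<tau> (\<epsilon> x)"
    note eI = RI[OF x] and ec = I_carrier[OF RI[OF x]]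
    have K0: "card ?K \<noteq> 0"
      using subgroup.one_closed[OF centralizer_subgroup[OF ec]] finite_subset[OF subgroup.subset[OF centralizer_subgroup[OF ec]] finite_carrier]
      by (metis card_eq_0_iff empty_iff)
    have summand: "(if y \<otimes> g \<otimes> inv y \<in> ?K then f x (y \<otimes> g \<otimes> inv y) else 0) = F (act (inv y) (\<epsilon> x))" if y: "y \<in> carrier H" for y
    proof -
      define w where "w = act (inv y) (\<epsilon> x)"
      have w: "w \<in> I" unfolding w_def by (rule act_I) (use y eI in auto)
      have wc: "w \<in> carrier H" by (rule I_carrier[OF w])
      have yw: "act y w = \<epsilon> x" unfolding w_def by (rule act_inv(2)[OF y ec])
      have c: "y \<otimes> g \<otimes> inv y \<in> carrier H" using y g by simp
      have "act (y \<otimes> g \<otimes> inv y) (\<epsilon> x) = act y (act g w)"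
        unfolding w_def using y g ec by (simp add: act_mult act_closed m_assoc)
      then have "y \<otimes> g \<otimes> inv y \<in> ?K \<longleftrightarrow> act y (act g w) = act y w"
        using c yw by (simp add: stabilizer_def)
      also have "\<dots> \<longleftrightarrow> act g w = w"
        using act_inv(1)[OF y act_closed[OF g wc]] act_inv(1)[OF y wc] by metis
      also have "\<dots> \<longleftrightarrow> g \<otimes> w = w \<otimes> \<tau> g" by (rule act_eq_iff[OF g wc wc])
      finally have iff: "y \<otimes> g \<otimes> inv y \<in> ?K \<longleftrightarrow> g \<otimes> w = w \<otimes> \<tau> g" .
      show ?thesis
      proof (cases "g \<otimes> w = w \<otimes> \<tau> g")
        case True
        then have "f x (y \<otimes> g \<otimes> inv y) = \<Phi> (act y w) (y \<otimes> g \<otimes> inv y)" using f[OF x] iff yw by simp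
        then show ?thesis using True iff \<Phi>[OF w y g True] by (simp add: F_def flip: w_def)
      next
        case False
        then show ?thesis using iff by (simp add: F_def flip: w_def)
      qed
    qed
    have "(\<Sum>y\<in>carrier H. if y \<otimes> g \<otimes> inv y \<in> ?K then f x (y \<otimes> g \<otimes> inv y) else 0) = (\<Sum>y\<in>carrier H. F (act (inv y) (\<epsilon> x)))"
      by (intro sum.cong refl summand)
    also have "\<dots> = (\<Sum>y\<in>carrier H. F (act y (\<epsilon> x)))" by (rule sum.reindex_bij_betw[OF bij_inv])
    also have "\<dots> = of_nat (card ?K) * (\<Sum>v\<in>orbit H act (\<epsilon> x). F v)" by (rule sum_over_orbit[OF eI])
    finally show ?thesis using g K0 by (simp add: induced_character_def)
  qed
  then have "(\<Sum>x\<in>X. induced_character H (twisted_centralizer H \<tau> (\<epsilon> x)) (f x) g) = (\<Sum>x\<in>X. \<Sum>v\<in>orbit H act (\<epsilon> x). F v)"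
    by simp
  also have "\<dots> = (\<Sum>v\<in>I. F v)" by (rule orbits_partition(1)[OF X inj reps])
  also have "\<dots> = (\<Sum>w | w \<in> I \<and> g \<otimes> w = w \<otimes> \<tau> g. \<Phi> w g)"
    unfolding F_def using fI by (subst sum.inter_filter[symmetric]) auto
  finally show ?thesis .
qed

text \<open>The number of twisted involutions, orbit by orbit.\<close>
lemma sum_indices:
  assumes X: "finite X" and inj: "inj_on \<epsilon> X" and reps: "orbit_representatives H \<tau> (\<epsilon> ` X)"
  shows "(\<Sum>x\<in>X. of_nat (card (carrier H)) / of_nat (card (twisted_centralizer H \<tau> (\<epsilon> x)))) = (of_nat (card I) :: complex)"
proof -
  have RI: "\<epsilon> x \<in> I" if "x \<in> X" for x using reps that by (auto simp: orbit_representatives_def)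
  have "of_nat (card (carrier H)) / of_nat (card (twisted_centralizer H \<tau> (\<epsilon> x))) = (\<Sum>v\<in>orbit H act (\<epsilon> x). (1::complex))" if x: "x \<in> X" for x
  proof -
    let ?K = "twisted_centralizer H \<tau> (\<epsilon> x)"
    note ec = I_carrier[OF RI[OF x]]
    have K0: "card ?K \<noteq> 0"
      using subgroup.one_closed[OF centralizer_subgroup[OF ec]] finite_subset[OF subgroup.subset[OF centralizer_subgroup[OF ec]] finite_carrier]
      by (metis card_eq_0_iff empty_iff)
    have "of_nat (card (carrier H)) = of_nat (card ?K) * (\<Sum>v\<in>orbit H act (\<epsilon> x). (1::complex))"
      using sum_over_orbit[OF RI[OF x], of "\<lambda>_. 1"] by simp
    then show ?thesis using K0 by (simp add: field_simps)
  qed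
  then have "(\<Sum>x\<in>X. of_nat (card (carrier H)) / of_nat (card (twisted_centralizer H \<tau> (\<epsilon> x)))) = (\<Sum>x\<in>X. \<Sum>v\<in>orbit H act (\<epsilon> x). (1::complex))"
    by simp
  also have "\<dots> = (\<Sum>v\<in>I. 1)" by (rule orbits_partition(1)[OF X inj reps])
  finally show ?thesis by simp
qed

text \<open>The inverse of \<open>\<alpha> g\<close> has the same cycles on positions as \<open>g\<close>, run backwards, and its cycle products are the twisted inverses of those
  of \<open>g\<close>. By hypothesis the cycle products are intertwined, and intertwiners extend along cycles.\<close>
lemma twisted_inverse_conjugate:
  assumes fin: "finite S" and g: "g \<in> carrier (\<Gamma> S)"
    and conj: "\<And>c. c \<in> carrier H \<Longrightarrow> \<exists>t\<in>carrier H. t \<otimes> c = inv (\<tau> c) \<otimes> t"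
  shows "\<exists>t\<in>carrier (\<Gamma> S). t \<otimes>\<^bsub>\<Gamma> S\<^esub> g = inv\<^bsub>\<Gamma> S\<^esub> (\<alpha> S g) \<otimes>\<^bsub>\<Gamma> S\<^esub> t"
proof -
  define \<pi> where "\<pi> = snd g"
  have \<pi>: "\<pi> permutes S" and perm: "permutation \<pi>"
    using wr_carrierD(2)[OF g] fin unfolding \<pi>_def permutation_permutes by blast+
  obtain N where N: "\<pi> ^^ N = id" "N > 0" using permutation_is_nilpotent[OF perm] by blast
  let ?gl = "inv\<^bsub>\<Gamma> S\<^esub> (\<alpha> S g)"
  have \<alpha>g: "\<alpha> S g \<in> carrier (\<Gamma> S)" by (rule \<alpha>_closed[OF g])
  have gl: "?gl \<in> carrier (\<Gamma> S)" using \<alpha>g by simp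
  have inv_snd: "snd (inv\<^bsub>\<Gamma> S\<^esub> x) (snd x i) = i" if "x \<in> carrier (\<Gamma> S)" for x i
  proof -
    have "snd (inv\<^bsub>\<Gamma> S\<^esub> x \<otimes>\<^bsub>\<Gamma> S\<^esub> x) i = i" using that by (simp add: wr_mult_simps)
    then show ?thesis by (simp add: wr_mult_simps)
  qed
  have inv_fst: "fst (inv\<^bsub>\<Gamma> S\<^esub> x) (snd x i) \<otimes> fst x i = \<one>" if "x \<in> carrier (\<Gamma> S)" "i \<in> S" for x i
  proof -
    have "fst (inv\<^bsub>\<Gamma> S\<^esub> x \<otimes>\<^bsub>\<Gamma> S\<^esub> x) i = \<one>" using that by (simp add: wr_mult_simps)
    then show ?thesis unfolding wr_mult_simps(2)[OF that(2)] .
  qed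
  have glpow: "?gl [^]\<^bsub>\<Gamma> S\<^esub> (d::nat) = inv\<^bsub>\<Gamma> S\<^esub> (\<alpha> S (g [^]\<^bsub>\<Gamma> S\<^esub> d))" for d
    using \<alpha>g g by (simp add: \<alpha>_pow W.nat_pow_inv)
  have undo: "(snd ?gl ^^ a) ((\<pi> ^^ a) i) = i" for a i
  proof -
    have "snd (?gl [^]\<^bsub>\<Gamma> S\<^esub> a) (snd (\<alpha> S (g [^]\<^bsub>\<Gamma> S\<^esub> a)) i) = i"
      unfolding glpow using g by (intro inv_snd \<alpha>_closed) simp
    then show ?thesis by (simp add: wr_pow_snd wr_aut_simps \<pi>_def)
  qed
  define orb where "orb i = {(\<pi> ^^ a) i | a. True}" for i
  have orb_self: "i \<in> orb i" for i unfolding orb_def by (rule CollectI, rule exI[of _ 0]) simp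
  have orb_step: "orb (\<pi> i) = orb i" for i
  proof
    show "orb (\<pi> i) \<subseteq> orb i"
    proof
      fix k assume "k \<in> orb (\<pi> i)"
      then obtain a where "k = (\<pi> ^^ a) (\<pi> i)" unfolding orb_def by auto
      then have "k = (\<pi> ^^ Suc a) i" by (simp add: funpow_swap1)
      then show "k \<in> orb i" unfolding orb_def by blast
    qed
    show "orb i \<subseteq> orb (\<pi> i)"
    proof
      fix k assume "k \<in> orb i"
      then obtain a where a: "k = (\<pi> ^^ a) i" unfolding orb_def by auto
      have "i = (\<pi> ^^ (N - 1)) (\<pi> i)" using N by (cases N) (auto simp: funpow_swap1 fun_eq_iff)
      then have "k = (\<pi> ^^ a) ((\<pi> ^^ (N - 1)) (\<pi> i))" using a by simp
      then have "k = (\<pi> ^^ (a + (N - 1))) (\<pi> i)" by (simp add: funpow_add)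
      then show "k \<in> orb (\<pi> i)" unfolding orb_def by blast
    qed
  qed
  have orb_pow: "orb ((\<pi> ^^ a) i) = orb i" for a i by (induction a) (simp_all add: orb_step)
  have orbS: "orb i \<subseteq> S" if "i \<in> S" for i using snd_pow_in[OF g] that by (auto simp: orb_def \<pi>_def)
  \<comment> \<open>The least element serves as the base point of a cycle.\<close>
  define \<beta> where "\<beta> i = Min (orb i)" for i
  have \<beta>_in: "\<beta> i \<in> orb i" if "i \<in> S" for i
    unfolding \<beta>_def using finite_subset[OF orbS[OF that] fin] orb_self[of i] by (intro Min_in) blast+
  have \<beta>_pow: "\<exists>b. \<beta> i = (\<pi> ^^ b) i" if "i \<in> S" for i using \<beta>_in[OF that] unfolding orb_def by auto
  define d where "d i = least_power \<pi> i" for i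
  have di: "(\<pi> ^^ d i) i = i" "d i > 0" for i unfolding d_def using least_power_of_permutation[OF perm] by auto
  have "\<forall>i. \<exists>t. i \<in> S \<longrightarrow> t \<in> carrier H \<and> t \<otimes> fst (g [^]\<^bsub>\<Gamma> S\<^esub> d i) i = inv (\<tau> (fst (g [^]\<^bsub>\<Gamma> S\<^esub> d i) i)) \<otimes> t"
    using conj wr_carrierD(1)[OF W.nat_pow_closed[OF g]] by meson
  then obtain z where z: "\<And>i. i \<in> S \<Longrightarrow> z i \<in> carrier H"
    "\<And>i. i \<in> S \<Longrightarrow> z i \<otimes> fst (g [^]\<^bsub>\<Gamma> S\<^esub> d i) i = inv (\<tau> (fst (g [^]\<^bsub>\<Gamma> S\<^esub> d i) i)) \<otimes> z i" by metis
  have "\<exists>u\<in>carrier (\<Gamma> S). ?gl \<otimes>\<^bsub>\<Gamma> S\<^esub> u = u \<otimes>\<^bsub>\<Gamma> S\<^esub> g \<and> (\<forall>i\<in>S. \<beta> i = i \<longrightarrow> snd u i = i \<and> fst u i = z i)"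
  proof (rule intertwiner_exists[OF fin gl g, folded \<pi>_def])
    show \<beta>S: "\<beta> i \<in> S" if "i \<in> S" for i using \<beta>_in[OF that] orbS[OF that] by blast
    show "\<beta> (\<pi> i) = \<beta> i" if "i \<in> S" for i by (simp add: \<beta>_def orb_step)
    show "\<beta> (\<beta> i) = \<beta> i" if i: "i \<in> S" for i
    proof -
      obtain b where "\<beta> i = (\<pi> ^^ b) i" using \<beta>_pow[OF i] by blast
      then have "orb (\<beta> i) = orb i" by (simp add: orb_pow)
      then show ?thesis by (simp add: \<beta>_def)
    qed
    show "\<exists>a. (\<pi> ^^ a) (\<beta> i) = i" if i: "i \<in> S" for i
    proof -
      obtain b where b: "\<beta> i = (\<pi> ^^ b) i" using \<beta>_pow[OF i] by blast
      have "i \<in> orb (\<beta> i)" unfolding b orb_pow by (rule orb_self)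
      then have "\<exists>a. i = (\<pi> ^^ a) (\<beta> i)" unfolding orb_def by simp
      then show ?thesis by (elim exE) (rule exI, erule sym)
    qed
    show "\<exists>a. (snd ?gl ^^ a) (\<beta> i) = i" if i: "i \<in> S" for i
    proof -
      obtain b where b: "\<beta> i = (\<pi> ^^ b) i" using \<beta>_pow[OF i] by blast
      then show ?thesis using undo by (intro exI[of _ b]) simp
    qed
    show "z (\<beta> i) \<in> carrier H" if "i \<in> S" for i using z(1) \<beta>S[OF that] .
    fix i and e :: nat
    assume i: "i \<in> S" and e: "e > 0" "(\<pi> ^^ e) i = i" and min: "\<And>e'. 0 < e' \<Longrightarrow> e' < e \<Longrightarrow> (\<pi> ^^ e') i \<noteq> i"
    have "d i \<le> e" unfolding d_def by (rule least_power_le[OF e(2,1)])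
    moreover have "\<not> d i < e" using min[of "d i"] di(1)[of i] di(2)[of i] by auto
    ultimately have ed: "e = d i" by simp
    let ?X = "\<alpha> S (g [^]\<^bsub>\<Gamma> S\<^esub> d i)"
    have X: "?X \<in> carrier (\<Gamma> S)" using g by (simp add: \<alpha>_closed)
    have Xi: "snd ?X i = i" using di by (simp add: wr_aut_simps wr_pow_snd flip: \<pi>_def)
    have "snd (inv\<^bsub>\<Gamma> S\<^esub> ?X) i = i" using inv_snd[OF X, of i] Xi by simp
    moreover have "fst (inv\<^bsub>\<Gamma> S\<^esub> ?X) i = inv (\<tau> (fst (g [^]\<^bsub>\<Gamma> S\<^esub> d i) i))"
      using inv_fst[OF X i] Xi i wr_carrierD(1)[OF X i] wr_carrierD(1)[OF W.inv_closed[OF X] i]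
      by (intro inv_equality[symmetric]) (simp_all add: wr_aut_simps)
    ultimately show "(snd ?gl ^^ e) i = i \<and> z i \<otimes> fst (g [^]\<^bsub>\<Gamma> S\<^esub> e) i = fst (?gl [^]\<^bsub>\<Gamma> S\<^esub> e) i \<otimes> z i"
      using z(2)[OF i] wr_pow_snd[of H S ?gl e] unfolding ed glpow by simp
  qed
  then show ?thesis by (metis (no_types))
qed

end

section \<open>The weight attached to a model\<close>

lemma linear_character_mult:
  assumes f: "linear_character G f" and G: "group G" and ab: "a \<in> carrier G" "b \<in> carrier G"
  shows "f (a \<otimes>\<^bsub>G\<^esub> b) = f a * f b"
proof -
  interpret group G by fact
  obtain \<rho> where r: "representation G 1 \<rho>" "f = character_of G \<rho>" using f unfolding linear_character_def by blast
  note rr = representationD[OF r(1)]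
  have t: "f g = \<rho> g $$ (0,0)" if "g \<in> carrier G" for g
    using that rr(4)[OF that] by (simp add: r(2) character_of_def mat_trace_def)
  have "\<rho> (a \<otimes>\<^bsub>G\<^esub> b) $$ (0,0) = \<rho> a $$ (0,0) * \<rho> b $$ (0,0)"
    using rep_mult_entry[OF r(1) ab, of 0 0] by simp
  then show ?thesis using ab by (simp add: t)
qed

context twisted_cocycle begin

lemma L_step:
  assumes "w \<in> I" "y \<in> carrier H" "z \<in> carrier H"
  shows "L (act y (act z w)) (y \<otimes> z) w = L (act y (act z w)) y (act z w) * L (act z w) z w"
proof -
  have 1: "act z w \<in> I" "act y (act z w) \<in> I" using assms act_I by auto
  show ?thesis
    by (rule L_mult[OF assms(1) 1 assms(3,2)])
      (use act_eq_iff[OF assms(3) I_carrier[OF assms(1)] I_carrier[OF 1(1)]] act_eq_iff[OF assms(2) I_carrier[OF 1(1)] I_carrier[OF 1(2)]] in simp_all)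
qed

lemma L_nonzero:
  assumes "w \<in> I" "y \<in> carrier H"
  shows "L (act y w) y w \<noteq> 0"
proof -
  have "L w (inv y \<otimes> y) w = L w (inv y) (act y w) * L (act y w) y w"
    using L_step[OF assms(1) inv_closed[OF assms(2)] assms(2)] act_inv(1)[OF assms(2) I_carrier[OF assms(1)]] by simp
  then show ?thesis using L_one[OF assms(1)] assms(2) by auto
qed

text \<open>Transport around a square of arrows in the groupoid.\<close>
lemma L_conj:
  assumes w: "w \<in> I" and y: "y \<in> carrier H" "y' \<in> carrier H" and h: "h \<in> carrier H"
  shows "L (act y' (act h w)) (y' \<otimes> h \<otimes> inv y) (act y w) * L (act y w) y w = L (act y' (act h w)) y' (act h w) * L (act h w) h w"
proof -
  have c: "y' \<otimes> h \<otimes> inv y \<in> carrier H" using y h by simp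
  have wc: "w \<in> carrier H" by (rule I_carrier[OF w])
  have e: "y' \<otimes> h \<otimes> inv y \<otimes> y = y' \<otimes> h" using y h by (simp add: m_assoc)
  have a: "act (y' \<otimes> h \<otimes> inv y) (act y w) = act y' (act h w)"
    using e act_mult[OF c y(1) wc] act_mult[OF y(2) h wc] by simp
  have "L (act y' (act h w)) (y' \<otimes> h) w = L (act y' (act h w)) (y' \<otimes> h \<otimes> inv y) (act y w) * L (act y w) y w"
    using L_step[OF w c y(1)] unfolding a e .
  moreover have "L (act y' (act h w)) (y' \<otimes> h) w = L (act y' (act h w)) y' (act h w) * L (act h w) h w"
    by (rule L_step[OF w y(2) h])
  ultimately show ?thesis by simp
qed

end

context twisted_weight begin

text \<open>Passing from \<open>\<omega>\<close> to a twisted conjugate changes each factor \<open>L\<close> by the values of \<open>L\<close> on the conjugating arrows at two consecutive positions; \<open>g\<close>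
  permutes the positions fixed by \<open>\<omega>\<close>, so these corrections cancel in the product.\<close>
lemma weight_equivariant:
  assumes fin: "finite S" and g: "g \<in> carrier (\<Gamma> S)" and \<omega>: "\<omega> \<in> fixing S g" and y: "y \<in> carrier (\<Gamma> S)"
  shows "weight S (y \<otimes>\<^bsub>\<Gamma> S\<^esub> g \<otimes>\<^bsub>\<Gamma> S\<^esub> inv\<^bsub>\<Gamma> S\<^esub> y) (twisted_conj (\<Gamma> S) (\<alpha> S) y \<omega>) = weight S g \<omega>"
proof -
  define g' where "g' = y \<otimes>\<^bsub>\<Gamma> S\<^esub> g \<otimes>\<^bsub>\<Gamma> S\<^esub> inv\<^bsub>\<Gamma> S\<^esub> y"
  define \<omega>' where "\<omega>' = twisted_conj (\<Gamma> S) (\<alpha> S) y \<omega>"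
  note w = fixingD(1)[OF \<omega>]
  have \<alpha>y: "\<alpha> S y \<in> carrier (\<Gamma> S)" by (rule \<alpha>_closed[OF y])
  have g'c: "g' \<in> carrier (\<Gamma> S)" using g y by (simp add: g'_def)
  have w'c: "\<omega>' \<in> carrier (\<Gamma> S)" using w y \<alpha>y by (simp add: \<omega>'_def twisted_conj_def)
  have g'y: "g' \<otimes>\<^bsub>\<Gamma> S\<^esub> y = y \<otimes>\<^bsub>\<Gamma> S\<^esub> g" using g y by (simp add: g'_def W.m_assoc)
  have w'y: "y \<otimes>\<^bsub>\<Gamma> S\<^esub> \<omega> = \<omega>' \<otimes>\<^bsub>\<Gamma> S\<^esub> \<alpha> S y" using w y \<alpha>y by (simp add: \<omega>'_def twisted_conj_def W.m_assoc)
  let ?\<theta> = "snd y" and ?k = "fst y"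
  have \<theta>S: "?\<theta> i \<in> S \<longleftrightarrow> i \<in> S" for i by (rule wr_carrierD(3)[OF y])
  have \<theta>inj: "inj ?\<theta>" using wr_carrierD(6)[OF y] by (auto intro: injI)
  have kH: "?k i \<in> carrier H" if "i \<in> S" for i by (rule wr_carrierD(1)[OF y that])
  have sg': "snd g' (?\<theta> i) = ?\<theta> (snd g i)" for i using intertwine_at(1)[OF g'y] by simp
  have sw': "snd \<omega>' (?\<theta> i) = ?\<theta> (snd \<omega> i)" for i 
  proof -
    have "snd (y \<otimes>\<^bsub>\<Gamma> S\<^esub> \<omega>) i = snd (\<omega>' \<otimes>\<^bsub>\<Gamma> S\<^esub> \<alpha> S y) i" unfolding w'y ..
    then show ?thesis by (simp add: wr_mult_simps wr_aut_simps)
  qed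
  let ?F = "{i \<in> S. snd \<omega> i = i}" and ?M = "{i \<in> S. snd \<omega> i \<noteq> i}"
  have img: "{j \<in> S. P j} = ?\<theta> ` {i \<in> S. P (?\<theta> i)}" for P
  proof -
    have "S = ?\<theta> ` S" using permutes_image[OF wr_carrierD(2)[OF y]] by simp
    then show ?thesis using \<theta>S by auto
  qed
  have F': "{j \<in> S. snd \<omega>' j = j} = ?\<theta> ` ?F" using img[of "\<lambda>j. snd \<omega>' j = j"] by (simp add: sw' inj_eq[OF \<theta>inj])
  have M': "{j \<in> S. snd \<omega>' j \<noteq> j} = ?\<theta> ` ?M" using img[of "\<lambda>j. snd \<omega>' j \<noteq> j"] by (simp add: sw' inj_eq[OF \<theta>inj])
  have comm: "snd \<omega> (snd g i) = snd g (snd \<omega> i)" for i by (rule fixingD(5)[OF \<omega>])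
  have gF: "snd g i \<in> ?F \<longleftrightarrow> i \<in> ?F" and gM: "snd g i \<in> ?M \<longleftrightarrow> i \<in> ?M" for i
    using wr_carrierD(3,6)[OF g] by (simp_all add: comm)
  have ginj: "inj (snd g)" using wr_carrierD(6)[OF g] by (auto intro: injI)
  have wI: "fst \<omega> i \<in> I" if "i \<in> ?F" for i
  proof -
    have "fst (\<omega> \<otimes>\<^bsub>\<Gamma> S\<^esub> \<alpha> S \<omega>) i = fst \<one>\<^bsub>\<Gamma> S\<^esub> i" unfolding fixingD(2)[OF \<omega>] ..
    then show ?thesis using that wr_carrierD(1)[OF w, of i] by (simp add: wr_mult_simps wr_aut_simps twisted_involutions_def)
  qed
  have hw: "act (fst g i) (fst \<omega> i) = fst \<omega> (snd g i)" if i: "i \<in> ?F" for i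
  proof -
    have "snd g i \<in> ?F" using gF i by blast
    then show ?thesis using intertwine_at(2)[OF fixingD(3)[OF \<omega>], of i] i wI[OF i] wI[of "snd g i"] wr_carrierD(1)[OF g, of i]
      by (subst act_eq_iff) (simp_all add: I_carrier wr_aut_simps)
  qed
  have w'i: "fst \<omega>' (?\<theta> i) = act (?k i) (fst \<omega> i)" if i: "i \<in> ?F" for i
  proof (rule sym, subst act_eq_iff)
    show "?k i \<otimes> fst \<omega> i = fst \<omega>' (?\<theta> i) \<otimes> \<tau> (?k i)" 
    proof -
      have "fst (y \<otimes>\<^bsub>\<Gamma> S\<^esub> \<omega>) i = fst (\<omega>' \<otimes>\<^bsub>\<Gamma> S\<^esub> \<alpha> S y) i" unfolding w'y ..
      then show ?thesis using i by (simp add: wr_mult_simps wr_aut_simps)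
    qed
  qed (use i kH I_carrier[OF wI[OF i]] wr_carrierD(1)[OF w'c] \<theta>S in auto)
  have g'i: "fst g' (?\<theta> i) = ?k (snd g i) \<otimes> fst g i \<otimes> inv (?k i)" if i: "i \<in> S" for i
  proof -
    have c: "fst g' (?\<theta> i) \<in> carrier H" "fst g i \<in> carrier H" "?k (snd g i) \<in> carrier H"
      using i \<theta>S wr_carrierD(1)[OF g'c] wr_carrierD(1)[OF g] kH wr_carrierD(3)[OF g] by auto
    have "?k (snd g i) \<otimes> fst g i \<otimes> inv (?k i) = fst g' (?\<theta> i) \<otimes> ?k i \<otimes> inv (?k i)"
      using intertwine_at(2)[OF g'y i] by simp
    then show ?thesis using c kH[OF i] by (simp add: m_assoc)
  qed
  let ?P = "\<lambda>i. L (fst \<omega> (snd g i)) (fst g i) (fst \<omega> i)"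
  let ?P' = "\<lambda>j. L (fst \<omega>' (snd g' j)) (fst g' j) (fst \<omega>' j)"
  let ?q = "\<lambda>i. L (act (?k i) (fst \<omega> i)) (?k i) (fst \<omega> i)"
  have PP: "?P' (?\<theta> i) * ?q i = ?q (snd g i) * ?P i" if i: "i \<in> ?F" for i
  proof -
    have gi: "snd g i \<in> ?F" using gF i by blast
    have iS: "i \<in> S" "snd g i \<in> S" using i gi by auto
    show ?thesis
      using L_conj[OF wI[OF i] kH[OF iS(1)] kH[OF iS(2)] wr_carrierD(1)[OF g iS(1)]]
      unfolding hw[OF i] sg' w'i[OF i] w'i[OF gi] g'i[OF iS(1)] .
  qed
  have "(\<Prod>i\<in>?F. ?P' (?\<theta> i)) * (\<Prod>i\<in>?F. ?q i) = (\<Prod>i\<in>?F. ?q (snd g i)) * (\<Prod>i\<in>?F. ?P i)"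
    unfolding prod.distrib[symmetric] by (rule prod.cong[OF refl PP])
  also have "(\<Prod>i\<in>?F. ?q (snd g i)) = (\<Prod>i\<in>?F. ?q i)"
  proof (rule prod.reindex_bij_betw)
    have "snd g ` ?F = ?F"
      by (rule endo_inj_surj) (use fin gF ginj in \<open>auto intro: inj_on_subset\<close>)
    then show "bij_betw (snd g) ?F ?F" using ginj by (auto simp: bij_betw_def intro: inj_on_subset)
  qed
  finally have "(\<Prod>i\<in>?F. ?P' (?\<theta> i)) * (\<Prod>i\<in>?F. ?q i) = (\<Prod>i\<in>?F. ?P i) * (\<Prod>i\<in>?F. ?q i)" by (simp only: mult.commute)
  moreover have "(\<Prod>i\<in>?F. ?q i) \<noteq> 0"
    using fin wI kH by (simp add: L_nonzero)
  ultimately have "(\<Prod>i\<in>?F. ?P' (?\<theta> i)) = (\<Prod>i\<in>?F. ?P i)" by simp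
  moreover have "(\<Prod>j\<in>?\<theta> ` ?F. ?P' j) = (\<Prod>i\<in>?F. ?P' (?\<theta> i))"
    using inj_on_subset[OF \<theta>inj subset_UNIV] by (rule prod.reindex_cong) simp_all
  ultimately have prod: "(\<Prod>j\<in>{j \<in> S. snd \<omega>' j = j}. ?P' j) = (\<Prod>i\<in>?F. ?P i)" unfolding F' by simp
  have sign: "sign_on_set {j \<in> S. snd \<omega>' j \<noteq> j} (snd g') = sign_on_set ?M (snd g)"
  proof -
    let ?f = "\<lambda>i. if i \<in> ?M then snd g i else i" and ?f' = "\<lambda>j. if j \<in> ?\<theta> ` ?M then snd g' j else j"
    have fM: "finite ?M" using fin by simp
    have p\<theta>: "permutation ?\<theta>" using wr_carrierD(2)[OF y] fin unfolding permutation_permutes by blast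
    have "?f permutes ?M" by (rule restrict_perm_permutes[OF fM ginj]) (use gM in blast)
    then have pf: "permutation ?f" using fM unfolding permutation_permutes by blast
    have "?f' permutes ?\<theta> ` ?M"
    proof (rule restrict_perm_permutes)
      show "inj (snd g')" using wr_carrierD(6)[OF g'c] by (auto intro: injI)
      show "snd g' j \<in> ?\<theta> ` ?M" if jM: "j \<in> ?\<theta> ` ?M" for j
      proof -
        obtain i where i: "i \<in> ?M" "j = ?\<theta> i" using jM by blast
        then show ?thesis using gM[of i] sg'[of i] by auto
      qed
    qed (use fM in simp)
    then have pf': "permutation ?f'"
      unfolding permutation_permutes
      using finite_imageI[OF fM, of ?\<theta>] by (intro exI[of _ "?\<theta> ` ?M"] conjI)
    have "?f' \<circ> ?\<theta> = ?\<theta> \<circ> ?f" by (auto simp: fun_eq_iff sg' inj_image_mem_iff[OF \<theta>inj])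
    then have "sign (?f' \<circ> ?\<theta>) = sign (?\<theta> \<circ> ?f)" by simp
    then have "sign ?f' = sign ?f" using pf pf' p\<theta> by (simp only: sign_compose) simp
    then show ?thesis unfolding M' sign_on_set_def by simp
  qed
  show ?thesis unfolding g'_def[symmetric] \<omega>'_def[symmetric] weight_def sign prod ..
qed

end

text \<open>A generalized involution model with its representatives numbered by \<open>{1..m}\<close>.\<close>
locale involution_model = twisted_group +
  fixes m :: nat and K :: "nat \<Rightarrow> 'a set" and lam :: "nat \<Rightarrow> 'a \<Rightarrow> complex" and \<epsilon> :: "nat \<Rightarrow> 'a"
  assumes K_eq: "i \<in> {1..m} \<Longrightarrow> K i = twisted_centralizer H \<tau> (\<epsilon> i)"
    and lin: "i \<in> {1..m} \<Longrightarrow> linear_character (H\<lparr>carrier := K i\<rparr>) (lam i)"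
    and inj_\<epsilon>: "inj_on \<epsilon> {1..m}" and reps: "orbit_representatives H \<tau> (\<epsilon> ` {1..m})"
    and model: "g \<in> carrier H \<Longrightarrow> (\<Sum>i\<in>{1..m}. induced_character H (K i) (lam i) g) = (\<Sum>\<chi>\<in>irreducible_characters H. \<chi> g)"
begin

definition cls :: "'a \<Rightarrow> nat" where
  "cls w = (THE i. i \<in> {1..m} \<and> (\<exists>y\<in>carrier H. act y w = \<epsilon> i))"

text \<open>A fixed arrow from each twisted involution to the representative of its orbit.\<close>
definition mover :: "'a \<Rightarrow> 'a" where
  "mover w = (SOME y. y \<in> carrier H \<and> act y w = \<epsilon> (cls w))"

text \<open>The linear character of the representative, transported along the chosen arrows.\<close>
definition L :: "'a \<Rightarrow> 'a \<Rightarrow> 'a \<Rightarrow> complex" where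
  "L w' h w = lam (cls w) (mover w' \<otimes> h \<otimes> inv (mover w))"

lemma \<epsilon>_I: "i \<in> {1..m} \<Longrightarrow> \<epsilon> i \<in> I"
  using reps unfolding orbit_representatives_def by auto

lemma cls_eqI:
  assumes "w \<in> I" "i \<in> {1..m}" "y \<in> carrier H" "act y w = \<epsilon> i"
  shows "cls w = i"
  unfolding cls_def
proof (rule the_equality)
  show "i \<in> {1..m} \<and> (\<exists>y\<in>carrier H. act y w = \<epsilon> i)" using assms by blast
  show "j = i" if "j \<in> {1..m} \<and> (\<exists>y\<in>carrier H. act y w = \<epsilon> j)" for j
    using that assms orbits_partition(3)[OF _ inj_\<epsilon> reps] by (metis finite_atLeastAtMost)
qed

lemma cls_mover:
  assumes "w \<in> I"
  shows "cls w \<in> {1..m}" "mover w \<in> carrier H" "act (mover w) w = \<epsilon> (cls w)"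
proof -
  obtain i y where iy: "i \<in> {1..m}" "y \<in> carrier H" "act y w = \<epsilon> i"
    using orbits_partition(2)[OF _ inj_\<epsilon> reps assms] by blast
  have c: "cls w = i" by (rule cls_eqI[OF assms iy])
  then show "cls w \<in> {1..m}" using iy by simp
  have "mover w \<in> carrier H \<and> act (mover w) w = \<epsilon> (cls w)"
    unfolding mover_def by (rule someI[of _ y]) (use iy c in simp)
  then show "mover w \<in> carrier H" "act (mover w) w = \<epsilon> (cls w)" by auto
qed

lemma cls_act:
  assumes w: "w \<in> I" and y: "y \<in> carrier H"
  shows "cls (act y w) = cls w"
proof (rule sym, rule cls_eqI[OF w])
  have a: "act y w \<in> I" by (rule act_I[OF y w])
  show "cls (act y w) \<in> {1..m}" by (rule cls_mover(1)[OF a])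
  show "mover (act y w) \<otimes> y \<in> carrier H" using cls_mover(2)[OF a] y by simp
  show "act (mover (act y w) \<otimes> y) w = \<epsilon> (cls (act y w))"
    using cls_mover(2,3)[OF a] y I_carrier[OF w] by (simp add: act_mult)
qed

lemma cls_\<epsilon>: "i \<in> {1..m} \<Longrightarrow> cls (\<epsilon> i) = i"
  using cls_eqI[OF \<epsilon>_I _ one_closed] act_one[OF I_carrier[OF \<epsilon>_I]] by blast

lemma K_subgroup: "i \<in> {1..m} \<Longrightarrow> subgroup (K i) H"
  using centralizer_subgroup[OF I_carrier[OF \<epsilon>_I]] K_eq by simp

lemma lam_mult: "i \<in> {1..m} \<Longrightarrow> a \<in> K i \<Longrightarrow> b \<in> K i \<Longrightarrow> lam i (a \<otimes> b) = lam i a * lam i b"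
  using linear_character_mult[OF lin subgroup.subgroup_is_group[OF K_subgroup is_group], of i a b] by simp

lemma lam_one: "i \<in> {1..m} \<Longrightarrow> lam i \<one> = 1"
  using linear_character_one[OF lin subgroup.subgroup_is_group[OF K_subgroup is_group], of i] by simp

lemma transport_in_K:
  assumes w: "w \<in> I" and h: "h \<in> carrier H"
  shows "mover (act h w) \<otimes> h \<otimes> inv (mover w) \<in> K (cls w)"
proof -
  have a: "act h w \<in> I" by (rule act_I[OF h w])
  note m = cls_mover[OF w] and m' = cls_mover[OF a]
  have wc: "w \<in> carrier H" and ec: "\<epsilon> (cls w) \<in> carrier H" using I_carrier[OF w] I_carrier[OF \<epsilon>_I[OF m(1)]] by auto
  have "act (inv (mover w)) (\<epsilon> (cls w)) = w" using act_inv(1)[OF m(2) wc] m(3) by simp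
  then have "act (mover (act h w) \<otimes> h \<otimes> inv (mover w)) (\<epsilon> (cls w)) = \<epsilon> (cls w)"
    using m(2) m'(2,3) h wc ec cls_act[OF w h] by (simp add: act_mult)
  then show ?thesis using K_eq[OF m(1)] m(2) m'(2) h by (simp add: stabilizer_def)
qed

sublocale twisted_cocycle where L = L
proof
  fix w assume w: "w \<in> I"
  show "L w \<one> w = 1" using cls_mover[OF w] lam_one by (simp add: L_def)
next
  fix w w' w'' h h'
  assume w: "w \<in> I" "w' \<in> I" "w'' \<in> I" and h: "h \<in> carrier H" "h' \<in> carrier H"
    and e: "h \<otimes> w = w' \<otimes> \<tau> h" "h' \<otimes> w' = w'' \<otimes> \<tau> h'"
  have a: "w' = act h w" "w'' = act h' w'"
    using act_eq_iff[OF h(1) I_carrier[OF w(1)] I_carrier[OF w(2)]] act_eq_iff[OF h(2) I_carrier[OF w(2)] I_carrier[OF w(3)]] e by auto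
  have c: "cls w' = cls w" using cls_act[OF w(1) h(1)] a(1) by simp
  have k1: "mover w' \<otimes> h \<otimes> inv (mover w) \<in> K (cls w)" using transport_in_K[OF w(1) h(1)] a(1) by simp
  have k2: "mover w'' \<otimes> h' \<otimes> inv (mover w') \<in> K (cls w)" using transport_in_K[OF w(2) h(2)] a(2) c by simp
  note m = cls_mover(2)[OF w(1)] cls_mover(2)[OF w(2)] cls_mover(2)[OF w(3)]
  have "inv (mover w') \<otimes> (mover w' \<otimes> (h \<otimes> inv (mover w))) = h \<otimes> inv (mover w)"
    using m h by (simp flip: m_assoc)
  then have "(mover w'' \<otimes> h' \<otimes> inv (mover w')) \<otimes> (mover w' \<otimes> h \<otimes> inv (mover w)) = mover w'' \<otimes> (h' \<otimes> h) \<otimes> inv (mover w)"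
    using m h by (simp add: m_assoc)
  then show "L w'' (h' \<otimes> h) w = L w'' h' w' * L w' h w"
    using lam_mult[OF cls_mover(1)[OF w(1)] k2 k1] c by (simp add: L_def)
qed

lemma L_base:
  assumes i: "i \<in> {1..m}" and k: "k \<in> K i"
  shows "L (\<epsilon> i) k (\<epsilon> i) = lam i k"
proof -
  note e = \<epsilon>_I[OF i]
  let ?t = "mover (\<epsilon> i)"
  have t: "?t \<in> K i" using cls_mover(2,3)[OF e] cls_\<epsilon>[OF i] K_eq[OF i] by (simp add: stabilizer_def)
  have t': "inv ?t \<in> K i" by (rule subgroup.m_inv_closed[OF K_subgroup[OF i] t])
  have tk: "?t \<otimes> k \<in> K i" by (rule subgroup.m_closed[OF K_subgroup[OF i] t k])
  have "lam i ?t * lam i (inv ?t) = 1" using lam_mult[OF i t t'] cls_mover(2)[OF e] lam_one[OF i] by simp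
  then show ?thesis
    using lam_mult[OF i tk t'] lam_mult[OF i t k] cls_\<epsilon>[OF i] by (simp add: L_def mult_ac)
qed

lemma L_diagonal_invariant:
  assumes w: "w \<in> I" and y: "y \<in> carrier H" and g: "g \<in> carrier H" "g \<otimes> w = w \<otimes> \<tau> g"
  shows "L (act y w) (y \<otimes> g \<otimes> inv y) (act y w) = L w g w"
proof -
  have "act g w = w" using act_eq_iff[OF g(1) I_carrier[OF w] I_carrier[OF w]] g(2) by simp
  then show ?thesis using L_conj[OF w y y g(1)] L_nonzero[OF w y] by simp
qed

text \<open>The indices of the centralizers add up to the number of twisted involutions, that is, of square roots of the identity; so
  \<open>square_roots_if_model\<close> applies.\<close>
lemma model_counts_square_roots:
  assumes g: "g \<in> carrier H"
  shows "(\<Sum>i\<in>{1..m}. induced_character H (K i) (lam i) g) = of_nat (card (twisted_square_roots H \<tau> g))"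
    and "\<exists>t\<in>carrier H. t \<otimes> g = inv (\<tau> g) \<otimes> t"
proof -
  have "twisted_square_roots H \<tau> \<one> = I" by (auto simp: twisted_square_roots_def twisted_involutions_def)
  then have c: "(\<Sum>i\<in>{1..m}. of_nat (card (carrier H)) / of_nat (card (K i))) = (of_nat (card (twisted_square_roots H \<tau> \<one>)) :: complex)"
    using sum_indices[OF _ inj_\<epsilon> reps] K_eq by simp
  show "(\<Sum>i\<in>{1..m}. induced_character H (K i) (lam i) g) = of_nat (card (twisted_square_roots H \<tau> g))"
    by (rule square_roots_if_model(1)[OF is_group finite_carrier involutive K_subgroup lin model c g])
  show "\<exists>t\<in>carrier H. t \<otimes> g = inv (\<tau> g) \<otimes> t"
    by (rule square_roots_if_model(2)[OF is_group finite_carrier involutive K_subgroup lin model c g])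
qed

sublocale twisted_weight where L = L
proof
  fix c assume c: "c \<in> carrier H"
  have "(\<Sum>i\<in>{1..m}. induced_character H (twisted_centralizer H \<tau> (\<epsilon> i)) (lam i) c) = (\<Sum>w | w \<in> I \<and> c \<otimes> w = w \<otimes> \<tau> c. L w c w)"
    by (rule sum_induced_eq_sum_fixed[OF _ inj_\<epsilon> reps, where \<Phi> = "\<lambda>w g. L w g w"])
      (use c L_diagonal_invariant L_base K_eq in auto)
  then show "(\<Sum>w | w \<in> I \<and> c \<otimes> w = w \<otimes> \<tau> c. L w c w) = of_nat (card (twisted_square_roots H \<tau> c))"
    using model_counts_square_roots(1)[OF c] K_eq by simp
qed

end

section \<open>Wreath products on initial segments\<close>

text \<open>The positions start at \<open>1\<close>; the literal stays folded so that intervals keep their form.\<close>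
declare One_nat_def [simp del]

lemma carrier_wreath: "carrier (wreath H n) = carrier (wr_grp H {1..n})"
  by (auto simp: wreath_def wr_grp_def sym_group_def)

lemma one_wreath: "\<one>\<^bsub>wreath H n\<^esub> = \<one>\<^bsub>wr_grp H {1..n}\<^esub>"
  by (simp add: wreath_def wr_grp_def sym_group_def)

lemma mult_wreath:
  assumes "x \<in> carrier (wr_grp H {1..n})" "y \<in> carrier (wr_grp H {1..n})"
  shows "x \<otimes>\<^bsub>wreath H n\<^esub> y = x \<otimes>\<^bsub>wr_grp H {1..n}\<^esub> y"
proof -
  have p: "bij (snd y)" using wr_carrierD(2)[OF assms(2)] by (rule permutes_bij)
  then have "inv_into UNIV (inv_into UNIV (snd y)) = snd y" by (rule inv_inv_eq)
  then show ?thesis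
    by (auto simp: wreath_def wr_grp_def sym_group_def perm_act_def case_prod_unfold fun_eq_iff)
qed

lemma wreath_aut_eq: "wreath_aut \<tau> n g = wr_aut \<tau> {1..n} g"
  by (simp add: wreath_aut_def wr_aut_def case_prod_unfold)

lemma group_wreath:
  assumes "group H"
  shows "group (wreath H n)"
proof -
  interpret G: group "wr_grp H {1..n}" by (rule group_wr_grp[OF assms])
  show ?thesis
    by (rule groupI) (auto simp: carrier_wreath one_wreath mult_wreath G.m_assoc intro: G.inv_closed G.l_inv)
qed

lemma inv_wreath:
  assumes "group H" "x \<in> carrier (wr_grp H {1..n})"
  shows "inv\<^bsub>wreath H n\<^esub> x = inv\<^bsub>wr_grp H {1..n}\<^esub> x"
proof -
  interpret G: group "wr_grp H {1..n}" by (rule group_wr_grp[OF assms(1)])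
  interpret W: group "wreath H n" by (rule group_wreath[OF assms(1)])
  show ?thesis by (rule W.inv_equality) (use assms(2) in \<open>simp_all add: carrier_wreath one_wreath mult_wreath\<close>)
qed

lemma wreath_aut_involutive:
  assumes H: "group H" and \<tau>: "involutive_automorphism H \<tau>"
  shows "involutive_automorphism (wreath H n) (wreath_aut \<tau> n)"
proof -
  note t = involutive_automorphismD[OF wr_aut_involutive[OF H \<tau>] group_wr_grp[OF H]]
  have e: "wreath_aut \<tau> n = wr_aut \<tau> {1..n}" by (rule ext) (rule wreath_aut_eq)
  have "bij_betw (wr_aut \<tau> {1..n}) (carrier (wr_grp H {1..n})) (carrier (wr_grp H {1..n}))"
    using wr_aut_involutive[OF H \<tau>, of "{1..n}"] by (simp add: involutive_automorphism_def iso_def)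
  then show ?thesis
    using t(1-3) unfolding e by (simp add: involutive_automorphism_def iso_def hom_def carrier_wreath mult_wreath)
qed

lemma (in twisted_group) twisted_group_wreath: "twisted_group (wreath H n) (wreath_aut \<tau> n)"
  by (intro twisted_group.intro group_wreath[OF is_group] twisted_group_axioms.intro wreath_aut_involutive[OF is_group involutive])
    (simp add: carrier_wreath finite_wr_grp[OF finite_carrier])

section \<open>Blocks of consecutive positions\<close>

lemma omega_apply: "omega k p = (if 1 \<le> p \<and> p \<le> 2 * k then if odd p then p + 1 else p - 1 else p)"
proof (induction k arbitrary: p)
  case (Suc k)
  consider "p = 2 * k + 1" | "p = 2 * k + 2" | "p \<noteq> 2 * k + 1" "p \<noteq> 2 * k + 2" by blast
  then show ?case
  proof cases
    case 3
    then have "transpose (2 * k + 1) (2 * k + 2) p = p" by (simp add: transpose_def)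
    then have "omega (Suc k) p = omega k p" by simp
    moreover have "1 \<le> p \<and> p \<le> 2 * Suc k \<longleftrightarrow> 1 \<le> p \<and> p \<le> 2 * k" using 3 by auto
    ultimately show ?thesis using Suc by simp
  qed (simp_all add: Suc)
qed simp

lemma omega_omega: "omega k (omega k p) = p"
  unfolding omega_apply by presburger

lemma omega_permutes: "2 * k \<le> n \<Longrightarrow> omega k permutes {1..n}"
proof (induction k)
  case (Suc k)
  have "transpose (2 * k + 1) (2 * k + 2) permutes {1..n}" using Suc.prems by (intro permutes_swap_id) auto
  then show ?case unfolding omega.simps by (rule permutes_compose) (use Suc in simp)
qed (simp add: permutes_id[unfolded id_def] permutes_id)

lemma omega_moves: "p \<in> {1..n} \<Longrightarrow> omega k p \<noteq> p \<longleftrightarrow> p \<le> 2 * k"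
  by (auto simp: omega_apply)

text \<open>Every position of \<open>{1..n}\<close> lies in exactly one block, and block \<open>i\<close> has \<open>a i\<close> positions.\<close>
locale blocks =
  fixes n m :: nat and a :: "nat \<Rightarrow> nat"
  assumes total: "(\<Sum>i\<le>m. a i) = n"
begin

abbreviation "off \<equiv> block_offset a"
abbreviation "bl \<equiv> block_index a"

lemma off_Suc: "off (Suc i) = off i + a i" and off_0: "off 0 = 0"
  by (simp_all add: block_offset_def)

lemma off_mono: "i \<le> j \<Longrightarrow> off i \<le> off j"
  unfolding block_offset_def by (rule sum_mono2) auto

lemma off_top: "off (Suc m) = n"
  using total by (simp add: block_offset_def lessThan_Suc_atMost)

lemma bl_eqI:
  assumes "off i < p" "p \<le> off (Suc i)"
  shows "bl p = i"
  unfolding block_index_def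
proof (rule Least_equality)
  show "p \<le> off (Suc i)" by (rule assms(2))
  show "i \<le> j" if "p \<le> off (Suc j)" for j
  proof (rule ccontr)
    assume "\<not> i \<le> j"
    then have "off (Suc j) \<le> off i" by (intro off_mono) simp
    then show False using that assms by simp
  qed
qed

lemma bl_bounds:
  assumes "p \<in> {1..n}"
  shows "bl p \<le> m" "off (bl p) < p" "p \<le> off (bl p) + a (bl p)"
proof -
  have ex: "p \<le> off (Suc m)" using assms off_top by simp
  show "bl p \<le> m" unfolding block_index_def by (rule Least_le) (rule ex)
  have "p \<le> off (Suc (bl p))" unfolding block_index_def by (rule LeastI) (rule ex)
  then show "p \<le> off (bl p) + a (bl p)" by (simp add: off_Suc)
  show "off (bl p) < p"
  proof (cases "bl p")
    case 0
    then show ?thesis using assms by (simp add: off_0)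
  next
    case (Suc j)
    have "\<not> p \<le> off (Suc j)"
    proof
      assume "p \<le> off (Suc j)"
      then have "bl p \<le> j" unfolding block_index_def by (rule Least_le)
      then show False using Suc by simp
    qed
    then show ?thesis using Suc by simp
  qed
qed

lemma position:
  assumes "i \<le> m" "j \<in> {1..a i}"
  shows "off i + j \<in> {1..n}" "bl (off i + j) = i"
proof -
  have "off (Suc i) \<le> off (Suc m)" by (rule off_mono) (use assms in simp)
  then show "off i + j \<in> {1..n}" using assms off_top by (simp add: off_Suc)
  show "bl (off i + j) = i" by (rule bl_eqI) (use assms in \<open>simp_all add: off_Suc\<close>)
qed

lemma block_bij:
  assumes i: "i \<le> m"
  shows "bij_betw (\<lambda>j. off i + j) {1..a i} {p \<in> {1..n}. bl p = i}"
proof (rule bij_betwI[where g = "\<lambda>p. p - off i"])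
  show "(\<lambda>j. off i + j) \<in> {1..a i} \<rightarrow> {p \<in> {1..n}. bl p = i}"
    using position[OF i] by (intro funcsetI CollectI conjI)
  show "(\<lambda>p. p - off i) \<in> {p \<in> {1..n}. bl p = i} \<rightarrow> {1..a i}"
    using bl_bounds(2,3) by (intro funcsetI) fastforce
  show "off i + j - off i = j" for j by simp
  show "off i + (p - off i) = p" if "p \<in> {p \<in> {1..n}. bl p = i}" for p
    using that bl_bounds(2)[of p] by auto
qed

lemma block_card: "i \<le> m \<Longrightarrow> card {p \<in> {1..n}. bl p = i} = a i"
  using bij_betw_same_card[OF block_bij] by simp

lemma first_block: "p \<in> {1..n} \<Longrightarrow> bl p = 0 \<longleftrightarrow> p \<le> a 0"
  using bl_eqI[of 0 p] bl_bounds[of p] by (auto simp: off_Suc off_0)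

end

lemma blocks_U_set: "x \<in> U_set m n \<Longrightarrow> blocks n m (block_sizes x)"
proof
  assume x: "x \<in> U_set m n"
  have "{..m} = insert 0 {1..m}" by auto
  then have "(\<Sum>i\<le>m. block_sizes x i) = block_sizes x 0 + (\<Sum>i=1..m. block_sizes x i)" by simp
  also have "(\<Sum>i=1..m. block_sizes x i) = (\<Sum>i=1..m. x i)" by (intro sum.cong) (auto simp: block_sizes_def)
  finally show "(\<Sum>i\<le>m. block_sizes x i) = n" using x by (simp add: U_set_def block_sizes_def)
qed

lemma finite_U_set: "finite (U_set m n)"
proof (rule finite_subset)
  show "U_set m n \<subseteq> ({0..m} \<rightarrow>\<^sub>E {..n})"
  proof
    fix x assume x: "x \<in> U_set m n"
    then interpret blocks n m "block_sizes x" by (rule blocks_U_set)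
    have "x i \<le> n" if "i \<le> m" for i
    proof -
      have "block_sizes x i \<le> (\<Sum>i\<le>m. block_sizes x i)" by (rule member_le_sum) (use that in auto)
      then show ?thesis using total by (auto simp: block_sizes_def split: if_splits)
    qed
    then show "x \<in> {0..m} \<rightarrow>\<^sub>E {..n}" using x by (auto simp: U_set_def PiE_iff)
  qed
qed (simp add: finite_PiE)

context twisted_weight begin

text \<open>For a fixed \<open>\<omega>\<close> the weight is multiplicative on the stabilizer: the cocycle identity holds position by position, and the positions moved by \<open>\<omega>\<close> are
  permuted by the stabilizer.\<close>
lemma weight_mult:
  assumes fin: "finite S" and g: "g \<in> carrier (\<Gamma> S)" "g' \<in> carrier (\<Gamma> S)"
    and \<omega>: "\<omega> \<in> fixing S g" "\<omega> \<in> fixing S g'"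
  shows "weight S (g \<otimes>\<^bsub>\<Gamma> S\<^esub> g') \<omega> = weight S g \<omega> * weight S g' \<omega>"
proof -
  let ?F = "{i \<in> S. snd \<omega> i = i}" and ?M = "{i \<in> S. snd \<omega> i \<noteq> i}"
  note w = fixingD(1)[OF \<omega>(1)]
  have F: "snd k i \<in> ?F \<longleftrightarrow> i \<in> ?F" "snd k i \<in> ?M \<longleftrightarrow> i \<in> ?M"
    if "k \<in> carrier (\<Gamma> S)" "\<omega> \<in> fixing S k" for k i
    using wr_carrierD(3,6)[OF that(1)] by (simp_all add: fixingD(5)[OF that(2)])
  have inj: "inj (snd k)" if "k \<in> carrier (\<Gamma> S)" for k using wr_carrierD(6)[OF that] by (auto intro: injI)
  have wI: "fst \<omega> i \<in> I" if "i \<in> ?F" for i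
  proof -
    have "fst (\<omega> \<otimes>\<^bsub>\<Gamma> S\<^esub> \<alpha> S \<omega>) i = fst \<one>\<^bsub>\<Gamma> S\<^esub> i" unfolding fixingD(2)[OF \<omega>(1)] ..
    then show ?thesis using that wr_carrierD(1)[OF w, of i] by (simp add: wr_mult_simps wr_aut_simps twisted_involutions_def)
  qed
  have st: "fst k i \<otimes> fst \<omega> i = fst \<omega> (snd k i) \<otimes> \<tau> (fst k i)"
    if k: "k \<in> carrier (\<Gamma> S)" "\<omega> \<in> fixing S k" and i: "i \<in> ?F" for k i
    using intertwine_at(2)[OF fixingD(3)[OF k(2)], of i] i by (simp add: wr_aut_simps)
  let ?P = "\<lambda>k i. L (fst \<omega> (snd k i)) (fst k i) (fst \<omega> i)"
  have "(\<Prod>i\<in>?F. ?P (g \<otimes>\<^bsub>\<Gamma> S\<^esub> g') i) = (\<Prod>i\<in>?F. ?P g (snd g' i) * ?P g' i)"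
  proof (rule prod.cong[OF refl])
    fix i assume i: "i \<in> ?F"
    have i': "snd g' i \<in> ?F" using F(1)[OF g(2) \<omega>(2)] i by blast
    have i'': "snd g (snd g' i) \<in> ?F" using F(1)[OF g(1) \<omega>(1)] i' by blast
    have "L (fst \<omega> (snd g (snd g' i))) (fst g (snd g' i) \<otimes> fst g' i) (fst \<omega> i) = ?P g (snd g' i) * ?P g' i"
      by (rule L_mult[OF wI[OF i] wI[OF i'] wI[OF i''] _ _ st[OF g(2) \<omega>(2) i] st[OF g(1) \<omega>(1) i']])
        (use i i' wr_carrierD(1)[OF g(1)] wr_carrierD(1)[OF g(2)] in auto)
    then show "?P (g \<otimes>\<^bsub>\<Gamma> S\<^esub> g') i = ?P g (snd g' i) * ?P g' i" using i by (simp add: wr_mult_simps)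
  qed
  also have "\<dots> = (\<Prod>i\<in>?F. ?P g (snd g' i)) * (\<Prod>i\<in>?F. ?P g' i)" by (rule prod.distrib)
  also have "(\<Prod>i\<in>?F. ?P g (snd g' i)) = (\<Prod>i\<in>?F. ?P g i)"
  proof (rule prod.reindex_bij_betw)
    have inj': "inj_on (snd g') ?F" using inj[OF g(2)] by (rule inj_on_subset) simp
    have "snd g' ` ?F = ?F"
      by (rule endo_inj_surj[OF _ _ inj']) (use fin F(1)[OF g(2) \<omega>(2)] in auto)
    then show "bij_betw (snd g') ?F ?F" using inj' by (simp add: bij_betw_def)
  qed
  finally have P: "(\<Prod>i\<in>?F. ?P (g \<otimes>\<^bsub>\<Gamma> S\<^esub> g') i) = (\<Prod>i\<in>?F. ?P g i) * (\<Prod>i\<in>?F. ?P g' i)" .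
  let ?f = "\<lambda>k i. if i \<in> ?M then snd k i else i"
  have perm: "permutation (?f k)" if k: "k \<in> carrier (\<Gamma> S)" "\<omega> \<in> fixing S k" for k
  proof -
    have fM: "finite ?M" using fin by simp
    have "?f k permutes ?M" by (rule restrict_perm_permutes[OF fM inj[OF k(1)]]) (use F(2)[OF k] in blast)
    then show ?thesis unfolding permutation_permutes using fM by (intro exI[of _ ?M] conjI)
  qed
  have "?f (g \<otimes>\<^bsub>\<Gamma> S\<^esub> g') = ?f g \<circ> ?f g'"
  proof
    fix i
    show "?f (g \<otimes>\<^bsub>\<Gamma> S\<^esub> g') i = (?f g \<circ> ?f g') i"
    proof (cases "i \<in> ?M")
      case True
      then have "snd g' i \<in> ?M" using F(2)[OF g(2) \<omega>(2), of i] by blast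
      then show ?thesis using True by (simp only: o_apply if_True wr_mult_simps(1))
    qed (simp only: o_apply if_False)
  qed
  then have "sign_on_set ?M (snd (g \<otimes>\<^bsub>\<Gamma> S\<^esub> g')) = sign_on_set ?M (snd g) * sign_on_set ?M (snd g')"
    unfolding sign_on_set_def using sign_compose[OF perm[OF g(1) \<omega>(1)] perm[OF g(2) \<omega>(2)]] by simp
  then show ?thesis unfolding weight_def P by (simp only: mult_ac)
qed

end

section \<open>The twisted centralizer of a representative\<close>

locale composition = involution_model +
  fixes n :: nat and x :: "nat \<Rightarrow> nat"
  assumes x: "x \<in> U_set m n"
begin

sublocale blocks n m "block_sizes x"
  by (rule blocks_U_set[OF x])

abbreviation "a \<equiv> block_sizes x"
abbreviation "om \<equiv> omega (x 0)"
abbreviation "eps \<equiv> eps_x H n \<epsilon> x"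
abbreviation "e p \<equiv> (if bl p = 0 then \<one> else \<epsilon> (bl p))"

lemma a_0: "a 0 = 2 * x 0" and a_pos: "i \<noteq> 0 \<Longrightarrow> a i = x i"
  by (simp_all add: block_sizes_def)

lemma x0_le: "2 * x 0 \<le> n"
proof -
  have "a 0 \<le> (\<Sum>i\<le>m. a i)" by (rule member_le_sum) auto
  then show ?thesis using total a_0 by simp
qed

lemma om_permutes: "om permutes {1..n}"
  by (rule omega_permutes[OF x0_le])

lemma om_S: "om p \<in> {1..n} \<longleftrightarrow> p \<in> {1..n}"
  by (rule permutes_in_image[OF om_permutes])

lemma om_moves: "p \<in> {1..n} \<Longrightarrow> om p \<noteq> p \<longleftrightarrow> bl p = 0"
  using omega_moves[of p n "x 0"] first_block[of p] a_0 by simp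

lemma om_bl: "p \<in> {1..n} \<Longrightarrow> bl (om p) = bl p"
proof -
  assume p: "p \<in> {1..n}"
  show "bl (om p) = bl p"
  proof (cases "bl p = 0")
    case True
    then have "om p \<noteq> p" using om_moves[OF p] by simp
    then have "om (om p) \<noteq> om p" by (simp add: omega_omega)
    then have "bl (om p) = 0" using om_moves[of "om p"] om_S p by blast
    then show ?thesis using True by simp
  next
    case False
    then have "om p = p" using om_moves[OF p] False by simp
    then show ?thesis by simp
  qed
qed

lemma eps_simps: "snd eps = om" "p \<in> {1..n} \<Longrightarrow> fst eps p = e p"
  by (simp_all add: eps_x_def Let_def)

lemma bl_class: "p \<in> {1..n} \<Longrightarrow> bl p \<noteq> 0 \<Longrightarrow> bl p \<in> {1..m}"
  using bl_bounds(1)[of p] by auto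

lemma e_I:
  assumes p: "p \<in> {1..n}"
  shows "e p \<in> I"
proof (cases "bl p = 0")
  case True
  then show ?thesis by (simp add: twisted_involutions_def \<tau>_one)
next
  case False
  then show ?thesis using \<epsilon>_I[OF bl_class[OF p False]] by simp
qed

lemma eps_carrier: "eps \<in> carrier (\<Gamma> {1..n})"
proof -
  have "fst eps \<in> {1..n} \<rightarrow>\<^sub>E carrier H"
  proof (rule PiE_I)
    show "fst eps p \<in> carrier H" if "p \<in> {1..n}" for p unfolding eps_simps(2)[OF that] by (rule I_carrier[OF e_I[OF that]])
  qed (auto simp: eps_x_def)
  then show ?thesis using om_permutes by (simp only: wr_carrier_iff eps_simps)
qed

lemma eps_I: "eps \<in> twisted_involutions (\<Gamma> {1..n}) (\<alpha> {1..n})"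
proof -
  have "eps \<otimes>\<^bsub>\<Gamma> {1..n}\<^esub> \<alpha> {1..n} eps = \<one>\<^bsub>\<Gamma> {1..n}\<^esub>"
  proof (rule wr_eqI[of _ H "{1..n}"])
    fix p assume p: "p \<in> {1..n}"
    show "snd (eps \<otimes>\<^bsub>\<Gamma> {1..n}\<^esub> \<alpha> {1..n} eps) p = snd \<one>\<^bsub>\<Gamma> {1..n}\<^esub> p"
      by (simp only: wr_mult_simps(1,3) wr_aut_simps(1) eps_simps(1) o_apply omega_omega id_apply)
    have "fst eps (om p) = e p" using eps_simps(2)[of "om p"] om_S[of p] p om_bl[OF p] by simp
    moreover have "e p \<otimes> \<tau> (e p) = \<one>" using e_I[OF p] unfolding twisted_involutions_def by blast
    ultimately show "fst (eps \<otimes>\<^bsub>\<Gamma> {1..n}\<^esub> \<alpha> {1..n} eps) p = fst \<one>\<^bsub>\<Gamma> {1..n}\<^esub> p"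
      using p by (simp only: wr_mult_simps(2,4) wr_aut_simps eps_simps)
  qed (use eps_carrier \<alpha>_closed[OF eps_carrier] in auto)
  then show ?thesis using eps_carrier by (simp add: twisted_involutions_def)
qed

text \<open>The twisted centralizer of \<open>eps\<close>, position by position: it preserves every block, commutes with the matching of block \<open>0\<close>, and has entries in the
  centralizers \<open>K i\<close> on the other blocks.\<close>
definition stab :: "'a wr set" where
  "stab = {g \<in> carrier (\<Gamma> {1..n}). \<forall>p\<in>{1..n}. bl (snd g p) = bl p \<and> snd g (om p) = om (snd g p) \<and>
     (bl p \<noteq> 0 \<longrightarrow> fst g p \<in> K (bl p)) \<and> (bl p = 0 \<longrightarrow> fst g (om p) = \<tau> (fst g p))}"

text \<open>Positions of block \<open>0\<close> are those moved by \<open>om\<close>. Elsewhere the equation says that the entry carries one representative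
  to another one, so the two representatives are the same.\<close>
lemma fixes_eps_iff:
  assumes g: "g \<in> carrier (\<Gamma> {1..n})"
  shows "g \<otimes>\<^bsub>\<Gamma> {1..n}\<^esub> eps = eps \<otimes>\<^bsub>\<Gamma> {1..n}\<^esub> \<alpha> {1..n} g \<longleftrightarrow> g \<in> stab"
proof -
  have gS: "snd g p \<in> {1..n}" if "p \<in> {1..n}" for p using wr_carrierD(3)[OF g] that by blast
  have gH: "fst g p \<in> carrier H" if "p \<in> {1..n}" for p by (rule wr_carrierD(1)[OF g that])
  have "g \<otimes>\<^bsub>\<Gamma> {1..n}\<^esub> eps = eps \<otimes>\<^bsub>\<Gamma> {1..n}\<^esub> \<alpha> {1..n} g \<longleftrightarrow>
     (\<forall>p\<in>{1..n}. snd g (om p) = om (snd g p) \<and> fst g (om p) \<otimes> e p = e (snd g p) \<otimes> \<tau> (fst g p))" (is "?l = ?r")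
  proof
    assume l: ?l
    show ?r
    proof (intro ballI conjI)
      fix p assume p: "p \<in> {1..n}"
      have "snd (g \<otimes>\<^bsub>\<Gamma> {1..n}\<^esub> eps) p = snd (eps \<otimes>\<^bsub>\<Gamma> {1..n}\<^esub> \<alpha> {1..n} g) p" unfolding l ..
      then show "snd g (om p) = om (snd g p)" by (simp only: wr_mult_simps(1) wr_aut_simps(1) eps_simps(1) o_apply)
      have "fst (g \<otimes>\<^bsub>\<Gamma> {1..n}\<^esub> eps) p = fst (eps \<otimes>\<^bsub>\<Gamma> {1..n}\<^esub> \<alpha> {1..n} g) p" unfolding l ..
      then show "fst g (om p) \<otimes> e p = e (snd g p) \<otimes> \<tau> (fst g p)"
        by (simp only: wr_mult_simps(2)[OF p] wr_aut_simps(1) wr_aut_simps(2)[OF p] eps_simps(1) eps_simps(2)[OF p] eps_simps(2)[OF gS[OF p]])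
    qed
  next
    assume r: ?r
    show ?l
    proof (rule wr_eqI[of _ H "{1..n}"])
      fix p assume p: "p \<in> {1..n}"
      show "snd (g \<otimes>\<^bsub>\<Gamma> {1..n}\<^esub> eps) p = snd (eps \<otimes>\<^bsub>\<Gamma> {1..n}\<^esub> \<alpha> {1..n} g) p"
        using r p by (simp only: wr_mult_simps(1) wr_aut_simps(1) eps_simps(1) o_apply)
      show "fst (g \<otimes>\<^bsub>\<Gamma> {1..n}\<^esub> eps) p = fst (eps \<otimes>\<^bsub>\<Gamma> {1..n}\<^esub> \<alpha> {1..n} g) p"
        using bspec[OF r p]
        by (simp only: wr_mult_simps(2)[OF p] wr_aut_simps(1) wr_aut_simps(2)[OF p] eps_simps(1) eps_simps(2)[OF p] eps_simps(2)[OF gS[OF p]])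
    qed (use g eps_carrier \<alpha>_closed in auto)
  qed
  also have "\<dots> \<longleftrightarrow> (\<forall>p\<in>{1..n}. bl (snd g p) = bl p \<and> snd g (om p) = om (snd g p) \<and>
     (bl p \<noteq> 0 \<longrightarrow> fst g p \<in> K (bl p)) \<and> (bl p = 0 \<longrightarrow> fst g (om p) = \<tau> (fst g p)))"
  proof (rule ball_cong[OF refl])
    fix p assume p: "p \<in> {1..n}"
    have gp: "snd g p \<in> {1..n}" and hp: "fst g p \<in> carrier H" using gS gH p by auto
    have hop: "fst g (om p) \<in> carrier H" using gH om_S p by blast
    have zero: "bl (snd g p) = 0 \<longleftrightarrow> bl p = 0" if "snd g (om p) = om (snd g p)"
      using that om_moves[OF p] om_moves[OF gp] wr_carrierD(6)[OF g] by metis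
    show "(snd g (om p) = om (snd g p) \<and> fst g (om p) \<otimes> e p = e (snd g p) \<otimes> \<tau> (fst g p)) \<longleftrightarrow>
      (bl (snd g p) = bl p \<and> snd g (om p) = om (snd g p) \<and>
     (bl p \<noteq> 0 \<longrightarrow> fst g p \<in> K (bl p)) \<and> (bl p = 0 \<longrightarrow> fst g (om p) = \<tau> (fst g p)))"
    proof (cases "snd g (om p) = om (snd g p)")
      case comm: True
      show ?thesis
      proof (cases "bl p = 0")
        case True
        then show ?thesis using comm zero hp hop \<tau>_closed by simp
      next
        case False
        then have omp: "om p = p" using om_moves[OF p] False by simp
        have i: "bl p \<in> {1..m}" by (rule bl_class[OF p False])
        have j: "bl (snd g p) \<in> {1..m}" "bl (snd g p) \<noteq> 0" using zero[OF comm] False bl_class[OF gp] by auto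
        have ec: "\<epsilon> (bl p) \<in> carrier H" "\<epsilon> (bl (snd g p)) \<in> carrier H" using I_carrier \<epsilon>_I i j by auto
        have "fst g (om p) \<otimes> e p = e (snd g p) \<otimes> \<tau> (fst g p) \<longleftrightarrow> act (fst g p) (\<epsilon> (bl p)) = \<epsilon> (bl (snd g p))"
          using act_eq_iff[OF hp ec] False j(2) omp by simp
        also have "\<dots> \<longleftrightarrow> bl (snd g p) = bl p \<and> fst g p \<in> K (bl p)"
        proof
          assume a: "act (fst g p) (\<epsilon> (bl p)) = \<epsilon> (bl (snd g p))"
          have "cls (\<epsilon> (bl p)) = bl (snd g p)" by (rule cls_eqI[OF \<epsilon>_I[OF i] j(1) hp a])
          then have "bl (snd g p) = bl p" using cls_\<epsilon>[OF i] by simp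
          then show "bl (snd g p) = bl p \<and> fst g p \<in> K (bl p)" using a hp K_eq[OF i] by (simp add: stabilizer_def)
        next
          assume "bl (snd g p) = bl p \<and> fst g p \<in> K (bl p)"
          then show "act (fst g p) (\<epsilon> (bl p)) = \<epsilon> (bl (snd g p))" using K_eq[OF i] by (simp add: stabilizer_def)
        qed
        finally show ?thesis using comm False by simp
      qed
    qed simp
  qed
  finally show ?thesis using g unfolding stab_def by blast
qed

lemma stab_fixing: "g \<in> stab \<Longrightarrow> eps \<in> fixing {1..n} g"
  using eps_I fixes_eps_iff[of g] unfolding fixing_def stab_def by blast

abbreviation "tuples \<equiv> G_x_tuples H \<tau> m K x"

text \<open>The tuple of which a given element of \<open>stab\<close> is the block embedding.\<close>
definition unembed :: "'a wr \<Rightarrow> nat \<Rightarrow> 'a wr" where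
  "unembed g = (\<lambda>i\<in>{0..m}. (\<lambda>j\<in>{1..a i}. fst g (off i + j), \<lambda>j. if j \<in> {1..a i} then snd g (off i + j) - off i else j))"

lemma tuplesD:
  assumes u: "u \<in> tuples"
  shows "i \<le> m \<Longrightarrow> u i \<in> carrier (\<Gamma> {1..a i})"
    and "i \<in> {1..m} \<Longrightarrow> j \<in> {1..a i} \<Longrightarrow> fst (u i) j \<in> K i"
    and "u 0 \<in> V_grp H \<tau> (x 0)"
    and "\<not> i \<le> m \<Longrightarrow> u i = undefined"
proof -
  have V: "u 0 \<in> V_grp H \<tau> (x 0)" using u unfolding G_x_tuples_def by (auto dest: PiE_mem)
  have W: "u i \<in> carrier (wreath (H\<lparr>carrier := K i\<rparr>) (x i))" if "i \<in> {1..m}" for i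
    using PiE_mem[OF u[unfolded G_x_tuples_def], of i] that by auto
  have KH: "K i \<subseteq> carrier H" if "i \<in> {1..m}" for i by (rule subgroup.subset[OF K_subgroup[OF that]])
  show "u 0 \<in> V_grp H \<tau> (x 0)" by (rule V)
  show "u i \<in> carrier (\<Gamma> {1..a i})" if i: "i \<le> m"
  proof (cases "i = 0")
    case True
    have "u 0 \<in> carrier (wreath H (2 * x 0))" using V unfolding V_grp_def by auto
    then show ?thesis using True by (simp add: carrier_wreath a_0)
  next
    case False
    then have i: "i \<in> {1..m}" using i by auto
    show ?thesis using W[OF i] KH[OF i] a_pos[OF False] by (auto simp: carrier_wreath wr_carrier_iff PiE_iff)
  qed
  show "fst (u i) j \<in> K i" if i: "i \<in> {1..m}" and j: "j \<in> {1..a i}"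
  proof -
    have "fst (u i) \<in> {1..a i} \<rightarrow>\<^sub>E K i" using W[OF i] a_pos[of i] i by (auto simp: carrier_wreath wr_carrier_iff)
    then show ?thesis using j by (rule PiE_mem)
  qed
  show "\<not> i \<le> m \<Longrightarrow> u i = undefined" using u unfolding G_x_tuples_def by (auto simp: PiE_iff extensional_def)
qed

abbreviation "emb \<equiv> block_embed n a"

lemma emb_at:
  "p \<in> {1..n} \<Longrightarrow> fst (emb u) p = fst (u (bl p)) (p - off (bl p))"
  "p \<in> {1..n} \<Longrightarrow> snd (emb u) p = off (bl p) + snd (u (bl p)) (p - off (bl p))"
  by (simp_all add: block_embed_def)

lemma local_position: "p \<in> {1..n} \<Longrightarrow> p - off (bl p) \<in> {1..a (bl p)}"
  using bl_bounds(2,3)[of p] by auto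

lemma emb_block:
  assumes u: "u \<in> tuples" and p: "p \<in> {1..n}"
  shows "snd (emb u) p \<in> {1..n}" "bl (snd (emb u) p) = bl p"
proof -
  have j: "snd (u (bl p)) (p - off (bl p)) \<in> {1..a (bl p)}"
    using wr_carrierD(3)[OF tuplesD(1)[OF u bl_bounds(1)[OF p]]] local_position[OF p] by blast
  show "snd (emb u) p \<in> {1..n}" "bl (snd (emb u) p) = bl p"
    unfolding emb_at(2)[OF p] by (rule position[OF bl_bounds(1)[OF p] j])+
qed

lemma emb_carrier:
  assumes u: "u \<in> tuples"
  shows "emb u \<in> carrier (\<Gamma> {1..n})"
proof -
  have inj: "inj_on (snd (emb u)) {1..n}"
  proof (rule inj_onI)
    fix p q assume p: "p \<in> {1..n}" and q: "q \<in> {1..n}" and eq: "snd (emb u) p = snd (emb u) q"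
    have b: "bl p = bl q" using emb_block(2)[OF u p] emb_block(2)[OF u q] eq by simp
    then have "snd (u (bl p)) (p - off (bl p)) = snd (u (bl p)) (q - off (bl p))"
      using eq emb_at(2)[OF p, of u] emb_at(2)[OF q, of u] by simp
    then have "p - off (bl p) = q - off (bl p)"
      using wr_carrierD(6)[OF tuplesD(1)[OF u bl_bounds(1)[OF p]]] by simp
    then show "p = q" using bl_bounds(2)[OF p] bl_bounds(2)[OF q] b by simp
  qed
  have "snd (emb u) ` {1..n} = {1..n}"
    by (rule endo_inj_surj[OF _ _ inj]) (use emb_block(1)[OF u] in auto)
  then have "snd (emb u) permutes {1..n}"
    using inj by (intro bij_imp_permutes) (auto simp: bij_betw_def block_embed_def)
  moreover have "fst (emb u) \<in> {1..n} \<rightarrow>\<^sub>E carrier H"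
  proof (rule PiE_I)
    fix p assume p: "p \<in> {1..n}"
    show "fst (emb u) p \<in> carrier H"
      unfolding emb_at(1)[OF p] by (rule wr_carrierD(1)[OF tuplesD(1)[OF u bl_bounds(1)[OF p]] local_position[OF p]])
  qed (auto simp: block_embed_def)
  ultimately show ?thesis by (simp only: wr_carrier_iff)
qed

lemma V_grp_iff:
  "v \<in> V_grp H \<tau> k \<longleftrightarrow> v \<in> carrier (\<Gamma> {1..2*k}) \<and>
     (\<forall>p\<in>{1..2*k}. snd v (omega k p) = omega k (snd v p) \<and> fst v (omega k p) = \<tau> (fst v p))"
proof -
  have "v \<in> V_grp H \<tau> k \<longleftrightarrow> v \<in> carrier (\<Gamma> {1..2*k}) \<and> snd v \<circ> omega k = omega k \<circ> snd v
      \<and> (\<forall>i\<in>{1..k}. fst v (2 * i) = \<tau> (fst v (2 * i - 1)))"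
    by (cases v) (auto simp: V_grp_def W_grp_def sym_group_def carrier_wreath wr_carrier_iff)
  also have "\<dots> \<longleftrightarrow> v \<in> carrier (\<Gamma> {1..2*k}) \<and>
     (\<forall>p\<in>{1..2*k}. snd v (omega k p) = omega k (snd v p) \<and> fst v (omega k p) = \<tau> (fst v p))"
  proof (rule conj_cong[OF refl])
    assume v: "v \<in> carrier (\<Gamma> {1..2*k})"
    have 1: "snd v \<circ> omega k = omega k \<circ> snd v \<longleftrightarrow> (\<forall>p\<in>{1..2*k}. snd v (omega k p) = omega k (snd v p))"
    proof
      assume r: "\<forall>p\<in>{1..2*k}. snd v (omega k p) = omega k (snd v p)"
      have "snd v (omega k p) = omega k (snd v p)" for p
      proof (cases "p \<in> {1..2*k}")
        case False
        then have "omega k p = p" "snd v p = p" using wr_carrierD(4)[OF v] by (auto simp: omega_apply)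
        then show ?thesis by simp
      qed (use r in blast)
      then show "snd v \<circ> omega k = omega k \<circ> snd v" by (simp add: fun_eq_iff)
    qed (simp add: fun_eq_iff)
    have 2: "(\<forall>i\<in>{1..k}. fst v (2 * i) = \<tau> (fst v (2 * i - 1))) \<longleftrightarrow> (\<forall>p\<in>{1..2*k}. fst v (omega k p) = \<tau> (fst v p))"
    proof
      assume l: "\<forall>i\<in>{1..k}. fst v (2 * i) = \<tau> (fst v (2 * i - 1))"
      show "\<forall>p\<in>{1..2*k}. fst v (omega k p) = \<tau> (fst v p)"
      proof
        fix p assume p: "p \<in> {1..2*k}"
        show "fst v (omega k p) = \<tau> (fst v p)"
        proof (cases "odd p")
          case True
          then obtain b where b: "p = 2 * b + 1" by (rule oddE)
          then have "b + 1 \<in> {1..k}" using p by auto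
          then have "fst v (2 * (b + 1)) = \<tau> (fst v (2 * (b + 1) - 1))" using l by blast
          moreover have "omega k p = 2 * (b + 1)" using b p by (simp add: omega_apply)
          moreover have "2 * (b + 1) - 1 = p" using b by simp
          ultimately show ?thesis by (simp only:)
        next
          case False
          then have "even p" by simp
          then obtain b where b: "p = 2 * b" by (rule evenE)
          then have bk: "b \<in> {1..k}" using p by auto
          have "omega k p = 2 * b - 1" using b p by (simp add: omega_apply)
          moreover have "fst v (2 * b) = \<tau> (fst v (2 * b - 1))" using l bk by blast
          moreover have "fst v (2 * b - 1) \<in> carrier H" using bk by (intro wr_carrierD(1)[OF v]) auto
          ultimately show ?thesis using b \<tau>_\<tau> by simp
        qed
      qed
    next
      assume r: "\<forall>p\<in>{1..2*k}. fst v (omega k p) = \<tau> (fst v p)"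
      show "\<forall>i\<in>{1..k}. fst v (2 * i) = \<tau> (fst v (2 * i - 1))"
      proof
        fix i assume i: "i \<in> {1..k}"
        then have "2 * i - 1 \<in> {1..2*k}" by auto
        moreover have "omega k (2 * i - 1) = 2 * i" using i by (auto simp: omega_apply)
        ultimately show "fst v (2 * i) = \<tau> (fst v (2 * i - 1))" using r by metis
      qed
    qed
    show "snd v \<circ> omega k = omega k \<circ> snd v \<and> (\<forall>i\<in>{1..k}. fst v (2 * i) = \<tau> (fst v (2 * i - 1))) \<longleftrightarrow>
      (\<forall>p\<in>{1..2*k}. snd v (omega k p) = omega k (snd v p) \<and> fst v (omega k p) = \<tau> (fst v p))"
      unfolding 1 2 by blast
  qed
  finally show ?thesis .
qed

lemma emb_stab:
  assumes u: "u \<in> tuples"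
  shows "emb u \<in> stab"
  unfolding stab_def
proof (intro CollectI conjI ballI emb_carrier[OF u])
  fix p assume p: "p \<in> {1..n}"
  show "bl (snd (emb u) p) = bl p" by (rule emb_block(2)[OF u p])
  have V: "snd (u 0) (om q) = om (snd (u 0) q)" "fst (u 0) (om q) = \<tau> (fst (u 0) q)" if "q \<in> {1..2 * x 0}" for q
    using tuplesD(3)[OF u] that unfolding V_grp_iff by blast+
  have zero: "snd (emb u) q = snd (u 0) q" "fst (emb u) q = fst (u 0) q" "q \<in> {1..2 * x 0}" if "q \<in> {1..n}" "bl q = 0" for q
    using emb_at[OF that(1), of u] that first_block[OF that(1)] a_0 by (auto simp: off_0)
  show "snd (emb u) (om p) = om (snd (emb u) p)"
  proof (cases "bl p = 0")
    case True
    then show ?thesis using zero[OF p] zero[of "om p"] om_S[of p] om_bl[OF p] p V by auto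
  next
    case False
    then have "om p = p" using om_moves[OF p] False by simp
    moreover have "om (snd (emb u) p) = snd (emb u) p"
      using om_moves[OF emb_block(1)[OF u p]] emb_block(2)[OF u p] False by simp
    ultimately show ?thesis by simp
  qed
  show "bl p \<noteq> 0 \<longrightarrow> fst (emb u) p \<in> K (bl p)"
    using tuplesD(2)[OF u bl_class[OF p] local_position[OF p]] emb_at(1)[OF p, of u] by simp
  show "bl p = 0 \<longrightarrow> fst (emb u) (om p) = \<tau> (fst (emb u) p)"
    using zero[OF p] zero[of "om p"] om_S[of p] om_bl[OF p] p V by auto
qed

lemma unembed_at:
  "i \<le> m \<Longrightarrow> j \<in> {1..a i} \<Longrightarrow> fst (unembed g i) j = fst g (off i + j)"
  "i \<le> m \<Longrightarrow> j \<in> {1..a i} \<Longrightarrow> snd (unembed g i) j = snd g (off i + j) - off i"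
  by (simp_all add: unembed_def)

lemma unembed_tuples:
  assumes g: "g \<in> stab"
  shows "unembed g \<in> tuples"
proof -
  have gc: "g \<in> carrier (\<Gamma> {1..n})" using g unfolding stab_def by blast
  have gs: "bl (snd g p) = bl p" "snd g (om p) = om (snd g p)" "bl p \<noteq> 0 \<Longrightarrow> fst g p \<in> K (bl p)"
    "bl p = 0 \<Longrightarrow> fst g (om p) = \<tau> (fst g p)" if "p \<in> {1..n}" for p
    using g that unfolding stab_def by blast+
  have gS: "snd g p \<in> {1..n}" if "p \<in> {1..n}" for p using wr_carrierD(3)[OF gc] that by blast
  have loc: "snd g (off i + j) - off i \<in> {1..a i}" "off i < snd g (off i + j)" if "i \<le> m" "j \<in> {1..a i}" for i j
  proof -
    note p = position[OF that]
    have "bl (snd g (off i + j)) = i" using gs(1)[OF p(1)] p(2) by simp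
    then show "snd g (off i + j) - off i \<in> {1..a i}" "off i < snd g (off i + j)"
      using local_position[OF gS[OF p(1)]] bl_bounds(2)[OF gS[OF p(1)]] by auto
  qed
  have perm: "snd (unembed g i) permutes {1..a i}" if i: "i \<le> m" for i
  proof -
    have inj: "inj_on (snd (unembed g i)) {1..a i}"
    proof (rule inj_onI)
      fix j k assume jk: "j \<in> {1..a i}" "k \<in> {1..a i}" "snd (unembed g i) j = snd (unembed g i) k"
      then have "snd g (off i + j) = snd g (off i + k)"
        using unembed_at(2)[OF i] loc(2)[OF i jk(1)] loc(2)[OF i jk(2)] by simp
      then show "j = k" using wr_carrierD(6)[OF gc] by simp
    qed
    have "snd (unembed g i) ` {1..a i} = {1..a i}"
      by (rule endo_inj_surj[OF _ _ inj]) (use unembed_at(2)[OF i] loc(1)[OF i] in auto)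
    then show ?thesis using inj i by (intro bij_imp_permutes) (auto simp: bij_betw_def unembed_def)
  qed
  show ?thesis
    unfolding G_x_tuples_def
  proof (rule PiE_I)
    fix i assume "i \<in> {0..m}"
    then have i: "i \<le> m" by simp
    show "unembed g i \<in> (if i = 0 then V_grp H \<tau> (x 0) else carrier (wreath (H\<lparr>carrier := K i\<rparr>) (x i)))"
    proof (cases "i = 0")
      case True
      have at: "fst (unembed g 0) q = fst g q" "snd (unembed g 0) q = snd g q" "q \<in> {1..n}" "bl q = 0" "om q \<in> {1..2 * x 0}"
        if q: "q \<in> {1..2 * x 0}" for q
      proof -
        show "fst (unembed g 0) q = fst g q" "snd (unembed g 0) q = snd g q"
          using unembed_at[of 0 q] q by (simp_all add: off_0 a_0)
        show qn: "q \<in> {1..n}" using q x0_le by auto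
        show b: "bl q = 0" using first_block[OF qn] q by (simp add: a_0)
        have oq: "om q \<in> {1..n}" using om_S qn by blast
        have "bl (om q) = 0" using om_bl[OF qn] b by simp
        then have "om q \<le> 2 * x 0" using first_block[OF oq] by (simp add: a_0)
        then show "om q \<in> {1..2 * x 0}" using oq by simp
      qed
      have "unembed g 0 \<in> carrier (\<Gamma> {1..2 * x 0})"
      proof -
        have "fst (unembed g 0) \<in> {1..2 * x 0} \<rightarrow>\<^sub>E carrier H"
        proof (rule PiE_I)
          fix q assume q: "q \<in> {1..2 * x 0}"
          show "fst (unembed g 0) q \<in> carrier H" unfolding at(1)[OF q] by (rule wr_carrierD(1)[OF gc at(3)[OF q]])
        qed (auto simp: unembed_def a_0)
        then show ?thesis using perm[of 0] by (simp only: wr_carrier_iff a_0)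
      qed
      moreover have "snd (unembed g 0) (om q) = om (snd (unembed g 0) q) \<and> fst (unembed g 0) (om q) = \<tau> (fst (unembed g 0) q)"
        if q: "q \<in> {1..2 * x 0}" for q
        using at(1,2)[OF q] at(1,2)[OF at(5)[OF q]] gs(2,4)[OF at(3)[OF q]] at(4)[OF q] by simp
      ultimately have "unembed g 0 \<in> V_grp H \<tau> (x 0)" unfolding V_grp_iff by blast
      then show ?thesis using True by simp
    next
      case False
      have "fst (unembed g i) \<in> {1..x i} \<rightarrow>\<^sub>E K i"
      proof (rule PiE_I)
        fix j assume "j \<in> {1..x i}"
        then have j: "j \<in> {1..a i}" using a_pos[OF False] by simp
        show "fst (unembed g i) j \<in> K i"
          using gs(3)[OF position(1)[OF i j]] position(2)[OF i j] False unembed_at(1)[OF i j] by simp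
      qed (use i in \<open>auto simp: unembed_def a_pos[OF False]\<close>)
      then show ?thesis using False perm[OF i] by (simp add: carrier_wreath wr_carrier_iff a_pos)
    qed
  qed (auto simp: unembed_def)
qed

lemma emb_unembed:
  assumes g: "g \<in> stab"
  shows "emb (unembed g) = g"
proof (rule wr_eqI[of _ H "{1..n}"])
  show gc: "g \<in> carrier (\<Gamma> {1..n})" using g unfolding stab_def by blast
  show "emb (unembed g) \<in> carrier (\<Gamma> {1..n})" by (rule emb_carrier[OF unembed_tuples[OF g]])
  fix p assume p: "p \<in> {1..n}"
  note b = bl_bounds[OF p] and l = local_position[OF p]
  have o: "off (bl p) + (p - off (bl p)) = p" using b(2) by simp
  have gp: "snd g p \<in> {1..n}" using wr_carrierD(3)[OF gc] p by blast
  have "bl (snd g p) = bl p" using g p unfolding stab_def by blast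
  then have o': "off (bl p) < snd g p" using bl_bounds(2)[OF gp] by simp
  show "snd (emb (unembed g)) p = snd g p"
    using o o' by (simp add: emb_at(2)[OF p] unembed_at(2)[OF b(1) l])
  show "fst (emb (unembed g)) p = fst g p"
    using o by (simp add: emb_at(1)[OF p] unembed_at(1)[OF b(1) l])
qed

lemma unembed_emb:
  assumes u: "u \<in> tuples"
  shows "unembed (emb u) = u"
proof
  fix i
  have u': "unembed (emb u) \<in> tuples" by (rule unembed_tuples[OF emb_stab[OF u]])
  show "unembed (emb u) i = u i"
  proof (cases "i \<le> m")
    case i: True
    show ?thesis
    proof (rule wr_eqI[OF tuplesD(1)[OF u' i] tuplesD(1)[OF u i]])
      fix j assume j: "j \<in> {1..a i}"
      note p = position[OF i j]
      show "snd (unembed (emb u) i) j = snd (u i) j" by (simp add: unembed_at(2)[OF i j] emb_at(2)[OF p(1)] p(2))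
      show "fst (unembed (emb u) i) j = fst (u i) j" by (simp add: unembed_at(1)[OF i j] emb_at(1)[OF p(1)] p(2))
    qed
  next
    case False
    then show ?thesis using tuplesD(4)[OF u] tuplesD(4)[OF u'] by simp
  qed
qed

lemma G_x_eq: "G_x H \<tau> n m K x = stab"
proof
  show "G_x H \<tau> n m K x \<subseteq> stab" unfolding G_x_def using emb_stab by blast
  show "stab \<subseteq> G_x H \<tau> n m K x"
  proof
    fix g assume g: "g \<in> stab"
    have "g = emb (unembed g)" using emb_unembed[OF g] by simp
    then show "g \<in> G_x H \<tau> n m K x" unfolding G_x_def using unembed_tuples[OF g] by blast
  qed
qed

text \<open>Block \<open>0\<close> consists of the moved positions and gives the sign; on block \<open>i\<close> the factor \<open>L\<close> at the representative is the linear character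
  \<open>lam i\<close>.\<close>
lemma phi_x_eq:
  assumes g: "g \<in> stab"
  shows "phi_x H \<tau> n m K lam x g = weight {1..n} g eps"
proof -
  have inj: "inj_on emb tuples" by (rule inj_on_inverseI[where g = unembed]) (rule unembed_emb)
  have u: "inv_into tuples emb g = unembed g"
    using inv_into_f_f[OF inj unembed_tuples[OF g]] emb_unembed[OF g] by simp
  have gc: "g \<in> carrier (\<Gamma> {1..n})" using g unfolding stab_def by blast
  have gs: "bl (snd g p) = bl p" "bl p \<noteq> 0 \<Longrightarrow> fst g p \<in> K (bl p)" if "p \<in> {1..n}" for p
    using g that unfolding stab_def by blast+
  have M: "{p \<in> {1..n}. snd eps p \<noteq> p} = {1..2 * x 0}"
  proof (rule Set.set_eqI)
    show "p \<in> {p \<in> {1..n}. snd eps p \<noteq> p} \<longleftrightarrow> p \<in> {1..2 * x 0}" for p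
      unfolding eps_simps using omega_moves[of p n "x 0"] x0_le by auto
  qed
  have F: "{p \<in> {1..n}. snd eps p = p} = (\<Union>i\<in>{1..m}. {p \<in> {1..n}. bl p = i})"
    using om_moves bl_class unfolding eps_simps by fastforce
  have "snd (unembed g 0) = (\<lambda>j. if j \<in> {1..2 * x 0} then snd g j else j)"
    by (simp add: unembed_def off_0 a_0 cong: if_cong)
  then have s: "sigma_char (unembed g 0) = sign_on_set {1..2 * x 0} (snd g)"
    by (simp add: sigma_char_def case_prod_unfold sign_on_set_def)
  have "(\<Prod>p\<in>{p \<in> {1..n}. snd eps p = p}. L (fst eps (snd g p)) (fst g p) (fst eps p))
     = (\<Prod>i\<in>{1..m}. \<Prod>p\<in>{p \<in> {1..n}. bl p = i}. L (fst eps (snd g p)) (fst g p) (fst eps p))"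
    unfolding F by (rule prod.UNION_disjoint) auto
  also have "\<dots> = (\<Prod>i\<in>{1..m}. wreath_char (x i) (lam i) (unembed g i))"
  proof (rule prod.cong[OF refl])
    fix i assume i: "i \<in> {1..m}"
    then have im: "i \<le> m" and i0: "i \<noteq> 0" by auto
    have "(\<Prod>p\<in>{p \<in> {1..n}. bl p = i}. L (fst eps (snd g p)) (fst g p) (fst eps p)) = (\<Prod>p\<in>{p \<in> {1..n}. bl p = i}. lam i (fst g p))"
    proof (rule prod.cong[OF refl])
      fix p assume "p \<in> {p \<in> {1..n}. bl p = i}"
      then have p: "p \<in> {1..n}" and b: "bl p = i" by auto
      have gp: "snd g p \<in> {1..n}" using wr_carrierD(3)[OF gc] p by blast
      show "L (fst eps (snd g p)) (fst g p) (fst eps p) = lam i (fst g p)"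
        using L_base[OF i, of "fst g p"] gs[OF p] b i0 by (simp add: eps_simps(2)[OF p] eps_simps(2)[OF gp])
    qed
    also have "\<dots> = (\<Prod>j\<in>{1..a i}. lam i (fst g (off i + j)))"
      by (rule prod.reindex_bij_betw[OF block_bij[OF im], symmetric])
    also have "\<dots> = (\<Prod>j\<in>{1..a i}. lam i (fst (unembed g i) j))"
      by (intro prod.cong refl) (simp add: unembed_at(1)[OF im])
    finally show "(\<Prod>p\<in>{p \<in> {1..n}. bl p = i}. L (fst eps (snd g p)) (fst g p) (fst eps p)) = wreath_char (x i) (lam i) (unembed g i)"
      by (simp add: wreath_char_def case_prod_unfold a_pos[OF i0])
  qed
  finally have "weight {1..n} g eps = sigma_char (unembed g 0) * (\<Prod>i=1..m. wreath_char (x i) (lam i) (unembed g i))"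
    unfolding weight_def M s by simp
  then show ?thesis using g unfolding phi_x_def by (simp add: G_x_eq u Let_def)
qed

end

section \<open>Representatives of the twisted orbits\<close>

lemma (in twisted_group) orbit_representativesI:
  assumes mem: "\<And>x. x \<in> X \<Longrightarrow> \<epsilon> x \<in> I"
    and ex: "\<And>w. w \<in> I \<Longrightarrow> \<exists>x\<in>X. \<exists>y\<in>carrier H. y \<otimes> w = \<epsilon> x \<otimes> \<tau> y"
    and uniq: "\<And>x x' y. x \<in> X \<Longrightarrow> x' \<in> X \<Longrightarrow> y \<in> carrier H \<Longrightarrow> y \<otimes> \<epsilon> x = \<epsilon> x' \<otimes> \<tau> y \<Longrightarrow> x = x'"
  shows "inj_on \<epsilon> X" "orbit_representatives H \<tau> (\<epsilon> ` X)"
proof -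
  have c: "\<epsilon> x \<in> carrier H" if "x \<in> X" for x by (rule I_carrier[OF mem[OF that]])
  show "inj_on \<epsilon> X"
  proof (rule inj_onI)
    fix x x' assume x: "x \<in> X" "x' \<in> X" and eq: "\<epsilon> x = \<epsilon> x'"
    have "\<one> \<otimes> \<epsilon> x = \<epsilon> x' \<otimes> \<tau> \<one>" using c[OF x(1)] by (simp add: \<tau>_one eq[symmetric])
    then show "x = x'" by (rule uniq[OF x one_closed])
  qed
  have "\<exists>!\<omega>. \<omega> \<in> \<epsilon> ` X \<inter> orbit H act w" if w: "w \<in> I" for w
  proof -
    note wc = I_carrier[OF w]
    obtain x y where x: "x \<in> X" and y: "y \<in> carrier H" "y \<otimes> w = \<epsilon> x \<otimes> \<tau> y" using ex[OF w] by blast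
    have e: "act y w = \<epsilon> x" using act_eq_iff[OF y(1) wc c[OF x]] y(2) by blast
    show ?thesis
    proof (rule ex1I[of _ "\<epsilon> x"])
      show "\<epsilon> x \<in> \<epsilon> ` X \<inter> orbit H act w" using x y(1) e[symmetric] unfolding orbit_def by blast
      fix v assume "v \<in> \<epsilon> ` X \<inter> orbit H act w"
      then obtain x' y' where x': "x' \<in> X" "v = \<epsilon> x'" and y': "y' \<in> carrier H" "v = act y' w" unfolding orbit_def by blast
      let ?z = "y \<otimes> inv y'"
      have z: "?z \<in> carrier H" using y(1) y'(1) by simp
      have "act ?z (\<epsilon> x') = act y (act (inv y') (\<epsilon> x'))" by (rule act_mult) (use y(1) y'(1) c[OF x'(1)] in auto)
      also have "act (inv y') (\<epsilon> x') = w" using act_inv(1)[OF y'(1) wc] x'(2) y'(2) by simp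
      finally have "act ?z (\<epsilon> x') = \<epsilon> x" using e by simp
      then have "?z \<otimes> \<epsilon> x' = \<epsilon> x \<otimes> \<tau> ?z" using act_eq_iff[OF z c[OF x'(1)] c[OF x]] by blast
      then have "x' = x" by (rule uniq[OF x'(1) x z])
      then show "v = \<epsilon> x" using x'(2) by simp
    qed
  qed
  then show "orbit_representatives H \<tau> (\<epsilon> ` X)"
    using mem unfolding orbit_representatives_def orbits_def by blast
qed

context twisted_group begin

lemma twisted_involutions_wreath:
  "twisted_involutions (wreath H n) (wreath_aut \<tau> n) = twisted_involutions (\<Gamma> {1..n}) (\<alpha> {1..n})"
  unfolding twisted_involutions_def carrier_wreath wreath_aut_eq one_wreath
  by (rule Collect_cong) (metis mult_wreath \<alpha>_closed)

lemma twisted_square_roots_wreath: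
  "twisted_square_roots (wreath H n) (wreath_aut \<tau> n) g = twisted_square_roots (\<Gamma> {1..n}) (\<alpha> {1..n}) g"
  unfolding twisted_square_roots_def carrier_wreath wreath_aut_eq
  by (rule Collect_cong) (metis mult_wreath \<alpha>_closed)

lemma commutation_wreath:
  assumes "y \<in> carrier (\<Gamma> {1..n})" "w \<in> carrier (\<Gamma> {1..n})" "w' \<in> carrier (\<Gamma> {1..n})"
  shows "y \<otimes>\<^bsub>wreath H n\<^esub> w = w' \<otimes>\<^bsub>wreath H n\<^esub> wreath_aut \<tau> n y \<longleftrightarrow> y \<otimes>\<^bsub>\<Gamma> {1..n}\<^esub> w = w' \<otimes>\<^bsub>\<Gamma> {1..n}\<^esub> \<alpha> {1..n} y"
  unfolding wreath_aut_eq mult_wreath[OF assms(1,2)] mult_wreath[OF assms(3) \<alpha>_closed[OF assms(1)]] ..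

lemma twisted_conj_wreath:
  assumes y: "y \<in> carrier (\<Gamma> {1..n})" and w: "w \<in> carrier (\<Gamma> {1..n})"
  shows "twisted_conj (wreath H n) (wreath_aut \<tau> n) y w = twisted_conj (\<Gamma> {1..n}) (\<alpha> {1..n}) y w"
proof -
  note a = \<alpha>_closed[OF y]
  show ?thesis unfolding twisted_conj_def wreath_aut_eq inv_wreath[OF is_group a] mult_wreath[OF y w]
    by (rule mult_wreath[OF W.m_closed[OF y w] W.inv_closed[OF a]])
qed

lemma conj_wreath:
  assumes y: "y \<in> carrier (\<Gamma> {1..n})" and g: "g \<in> carrier (\<Gamma> {1..n})"
  shows "y \<otimes>\<^bsub>wreath H n\<^esub> g \<otimes>\<^bsub>wreath H n\<^esub> inv\<^bsub>wreath H n\<^esub> y = y \<otimes>\<^bsub>\<Gamma> {1..n}\<^esub> g \<otimes>\<^bsub>\<Gamma> {1..n}\<^esub> inv\<^bsub>\<Gamma> {1..n}\<^esub> y"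
  unfolding inv_wreath[OF is_group y] mult_wreath[OF y g]
  by (rule mult_wreath[OF W.m_closed[OF y g] W.inv_closed[OF y]])

end

context composition begin

lemma centralizer_eps: "twisted_centralizer (wreath H n) (wreath_aut \<tau> n) eps = stab"
proof -
  interpret T: twisted_group "wreath H n" "wreath_aut \<tau> n" by (rule twisted_group_wreath)
  have ec: "eps \<in> carrier (wreath H n)" using eps_carrier by (simp only: carrier_wreath)
  show ?thesis
  proof (rule Set.set_eqI)
    fix g
    show "g \<in> twisted_centralizer (wreath H n) (wreath_aut \<tau> n) eps \<longleftrightarrow> g \<in> stab"
    proof (cases "g \<in> carrier (\<Gamma> {1..n})")
      case True
      then show ?thesis
        unfolding T.centralizer_iff[OF ec] carrier_wreath commutation_wreath[OF True eps_carrier eps_carrier] fixes_eps_iff[OF True]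
        by blast
    next
      case False
      then show ?thesis unfolding T.centralizer_iff[OF ec] carrier_wreath stab_def by blast
    qed
  qed
qed

lemma stab_subgroup: "subgroup stab (wreath H n)"
proof -
  interpret T: twisted_group "wreath H n" "wreath_aut \<tau> n" by (rule twisted_group_wreath)
  have ec: "eps \<in> carrier (wreath H n)" using eps_carrier by (simp only: carrier_wreath)
  show ?thesis using T.centralizer_subgroup[OF ec] unfolding centralizer_eps .
qed

lemma phi_x_linear: "linear_character (wreath H n\<lparr>carrier := stab\<rparr>) (phi_x H \<tau> n m K lam x)"
proof -
  let ?f = "phi_x H \<tau> n m K lam x" and ?G = "wreath H n\<lparr>carrier := stab\<rparr>"
  have sc: "g \<in> carrier (\<Gamma> {1..n})" if "g \<in> stab" for g using that unfolding stab_def by blast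
  have one: "\<one>\<^bsub>wreath H n\<^esub> \<in> stab" by (rule subgroup.one_closed[OF stab_subgroup])
  have mult: "?f (g \<otimes>\<^bsub>wreath H n\<^esub> h) = ?f g * ?f h" if g: "g \<in> stab" and h: "h \<in> stab" for g h
  proof -
    have "g \<otimes>\<^bsub>wreath H n\<^esub> h \<in> stab" by (rule subgroup.m_closed[OF stab_subgroup g h])
    then show ?thesis
      using weight_mult[OF _ sc[OF g] sc[OF h] stab_fixing[OF g] stab_fixing[OF h]]
      by (simp add: phi_x_eq g h mult_wreath[OF sc[OF g] sc[OF h]])
  qed
  have f1: "?f \<one>\<^bsub>wreath H n\<^esub> = 1"
  proof -
    have "(\<Prod>p\<in>{p \<in> {1..n}. snd eps p = p}. L (fst eps (snd \<one>\<^bsub>\<Gamma> {1..n}\<^esub> p)) (fst \<one>\<^bsub>\<Gamma> {1..n}\<^esub> p) (fst eps p)) = 1"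
    proof (rule prod.neutral, rule ballI)
      fix p assume "p \<in> {p \<in> {1..n}. snd eps p = p}"
      then have p: "p \<in> {1..n}" by blast
      show "L (fst eps (snd \<one>\<^bsub>\<Gamma> {1..n}\<^esub> p)) (fst \<one>\<^bsub>\<Gamma> {1..n}\<^esub> p) (fst eps p) = 1"
        unfolding wr_mult_simps(3) wr_mult_simps(4)[OF p] id_apply eps_simps(2)[OF p] by (rule L_one[OF e_I[OF p]])
    qed
    moreover have "sign_on_set M id = 1" for M
    proof -
      have "(\<lambda>i. if i \<in> M then id i else i) = id" by auto
      then show ?thesis unfolding sign_on_set_def by (simp add: sign_id)
    qed
    ultimately have "weight {1..n} \<one>\<^bsub>\<Gamma> {1..n}\<^esub> eps = 1" unfolding weight_def wr_mult_simps(3) by simp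
    then show ?thesis using phi_x_eq[OF one] unfolding one_wreath by simp
  qed
  have "representation ?G 1 (\<lambda>g. mat 1 1 (\<lambda>_. ?f g))"
    unfolding representation_def
  proof (intro conjI ballI)
    show "mat 1 1 (\<lambda>_. ?f \<one>\<^bsub>?G\<^esub>) = 1\<^sub>m 1" using f1 by (intro eq_matI) auto
    fix g h assume gh: "g \<in> carrier ?G" "h \<in> carrier ?G"
    then show "mat 1 1 (\<lambda>_. ?f (g \<otimes>\<^bsub>?G\<^esub> h)) = mat 1 1 (\<lambda>_. ?f g) * mat 1 1 (\<lambda>_. ?f h)"
      using mult[of g h] by (intro eq_matI) (auto simp: scalar_prod_def)
  qed auto
  moreover have "?f = character_of ?G (\<lambda>g. mat 1 1 (\<lambda>_. ?f g))"
  proof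
    show "?f g = character_of ?G (\<lambda>g. mat 1 1 (\<lambda>_. ?f g)) g" for g
      by (cases "g \<in> stab") (simp_all add: character_of_def mat_trace_def, simp add: phi_x_def G_x_eq)
  qed
  ultimately show ?thesis unfolding linear_character_def by blast
qed

end

context involution_model begin

lemma composition: "x \<in> U_set m n \<Longrightarrow> composition H \<tau> m K lam \<epsilon> n x"
  by unfold_locales

text \<open>An arrow between two representatives permutes the positions and preserves their kind: moved or not, and the orbit of the entry if not. So it
  maps blocks to blocks, and the block sizes agree.\<close>
lemma eps_x_unique:
  assumes x: "x \<in> U_set m n" and x': "x' \<in> U_set m n" and y: "y \<in> carrier (\<Gamma> {1..n})"
    and eq: "y \<otimes>\<^bsub>\<Gamma> {1..n}\<^esub> eps_x H n \<epsilon> x = eps_x H n \<epsilon> x' \<otimes>\<^bsub>\<Gamma> {1..n}\<^esub> \<alpha> {1..n} y"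
  shows "x = x'"
proof -
  interpret A: composition H \<tau> m K lam \<epsilon> n x by (rule composition[OF x])
  interpret B: composition H \<tau> m K lam \<epsilon> n x' by (rule composition[OF x'])
  have bl: "B.bl (snd y p) = A.bl p" if p: "p \<in> {1..n}" for p
  proof -
    have q: "snd y p \<in> {1..n}" using wr_carrierD(3)[OF y] p by blast
    have "snd (y \<otimes>\<^bsub>\<Gamma> {1..n}\<^esub> A.eps) p = snd (B.eps \<otimes>\<^bsub>\<Gamma> {1..n}\<^esub> \<alpha> {1..n} y) p" unfolding eq ..
    then have comm: "snd y (A.om p) = B.om (snd y p)"
      by (simp only: wr_mult_simps(1) wr_aut_simps(1) A.eps_simps(1) B.eps_simps(1) o_apply)
    have "fst (y \<otimes>\<^bsub>\<Gamma> {1..n}\<^esub> A.eps) p = fst (B.eps \<otimes>\<^bsub>\<Gamma> {1..n}\<^esub> \<alpha> {1..n} y) p" unfolding eq ..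
    then have f: "fst y (A.om p) \<otimes> A.e p = B.e (snd y p) \<otimes> \<tau> (fst y p)"
      by (simp only: wr_mult_simps(2)[OF p] wr_aut_simps(1) wr_aut_simps(2)[OF p] A.eps_simps(1) A.eps_simps(2)[OF p] B.eps_simps(2)[OF q])
    have zero: "B.bl (snd y p) = 0 \<longleftrightarrow> A.bl p = 0"
      unfolding A.om_moves[OF p, symmetric] B.om_moves[OF q, symmetric] comm[symmetric] wr_carrierD(6)[OF y] ..
    show ?thesis
    proof (cases "A.bl p = 0")
      case True
      then show ?thesis using zero by simp
    next
      case False
      then have nz: "B.bl (snd y p) \<noteq> 0" using zero by simp
      note i = A.bl_class[OF p False] and j = B.bl_class[OF q nz]
      have "A.om p = p" using A.om_moves[OF p] False by simp
      then have "act (fst y p) (\<epsilon> (A.bl p)) = \<epsilon> (B.bl (snd y p))"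
        using f False nz act_eq_iff[OF wr_carrierD(1)[OF y p] I_carrier[OF \<epsilon>_I[OF i]] I_carrier[OF \<epsilon>_I[OF j]]] by simp
      then have "cls (\<epsilon> (A.bl p)) = B.bl (snd y p)" by (rule cls_eqI[OF \<epsilon>_I[OF i] j wr_carrierD(1)[OF y p]])
      then show ?thesis using cls_\<epsilon>[OF i] by simp
    qed
  qed
  have sizes: "A.a i = B.a i" if i: "i \<le> m" for i
  proof -
    have im: "snd y ` {p \<in> {1..n}. A.bl p = i} = {p \<in> {1..n}. B.bl p = i}"
    proof
      show "snd y ` {p \<in> {1..n}. A.bl p = i} \<subseteq> {p \<in> {1..n}. B.bl p = i}"
      proof (rule image_subsetI)
        fix p assume "p \<in> {p \<in> {1..n}. A.bl p = i}"
        then have p: "p \<in> {1..n}" "A.bl p = i" by auto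
        have "snd y p \<in> {1..n}" using wr_carrierD(3)[OF y] p(1) by blast
        then show "snd y p \<in> {p \<in> {1..n}. B.bl p = i}" using bl[OF p(1)] p(2) by simp
      qed
      show "{p \<in> {1..n}. B.bl p = i} \<subseteq> snd y ` {p \<in> {1..n}. A.bl p = i}"
      proof
        fix q assume q: "q \<in> {p \<in> {1..n}. B.bl p = i}"
        have "q \<in> snd y ` {1..n}" using q permutes_image[OF wr_carrierD(2)[OF y]] by blast
        then obtain p where p: "p \<in> {1..n}" "q = snd y p" by blast
        have "A.bl p = i" using bl[OF p(1)] q p(2) by simp
        then show "q \<in> snd y ` {p \<in> {1..n}. A.bl p = i}" using p by blast
      qed
    qed
    have "inj_on (snd y) {p \<in> {1..n}. A.bl p = i}" using wr_carrierD(6)[OF y] by (auto intro: inj_onI)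
    then have "card (snd y ` {p \<in> {1..n}. A.bl p = i}) = card {p \<in> {1..n}. A.bl p = i}" by (rule card_image)
    then show ?thesis unfolding im A.block_card[OF i] B.block_card[OF i] by (rule sym)
  qed
  show ?thesis
  proof (rule PiE_ext)
    show "x \<in> {0..m} \<rightarrow>\<^sub>E UNIV" "x' \<in> {0..m} \<rightarrow>\<^sub>E UNIV" using x x' by (simp_all add: U_set_def)
    show "x i = x' i" if "i \<in> {0..m}" for i
      using sizes[of i] that by (cases "i = 0") (simp_all add: block_sizes_def)
  qed
qed

end

context involution_model begin

text \<open>Every twisted involution is brought into standard form: the transposed pairs of positions are moved to block \<open>0\<close> and
  the fixed positions to the block of the orbit of their entry, while the entries are normalized by \<open>mover\<close> at fixed positions and to \<open>\<one>\<close> on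
  transposed pairs.\<close>
lemma eps_x_exists:
  assumes \<omega>: "\<omega> \<in> twisted_involutions (\<Gamma> {1..n}) (\<alpha> {1..n})"
  shows "\<exists>x\<in>U_set m n. \<exists>y\<in>carrier (\<Gamma> {1..n}). y \<otimes>\<^bsub>\<Gamma> {1..n}\<^esub> \<omega> = eps_x H n \<epsilon> x \<otimes>\<^bsub>\<Gamma> {1..n}\<^esub> \<alpha> {1..n} y"
proof -
  let ?S = "{1..n}" and ?\<sigma> = "snd \<omega>" and ?w = "fst \<omega>"
  have \<omega>c: "\<omega> \<in> carrier (\<Gamma> ?S)" and \<omega>1: "\<omega> \<otimes>\<^bsub>\<Gamma> ?S\<^esub> \<alpha> ?S \<omega> = \<one>\<^bsub>\<Gamma> ?S\<^esub>" using \<omega> unfolding twisted_involutions_def by auto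
  have \<sigma>\<sigma>: "?\<sigma> (?\<sigma> p) = p" for p
  proof -
    have "snd (\<omega> \<otimes>\<^bsub>\<Gamma> ?S\<^esub> \<alpha> ?S \<omega>) p = snd \<one>\<^bsub>\<Gamma> ?S\<^esub> p" unfolding \<omega>1 ..
    then show ?thesis by (simp add: wr_mult_simps wr_aut_simps)
  qed
  have \<sigma>S: "?\<sigma> p \<in> ?S \<longleftrightarrow> p \<in> ?S" for p by (rule wr_carrierD(3)[OF \<omega>c])
  have wH: "?w p \<in> carrier H" if "p \<in> ?S" for p by (rule wr_carrierD(1)[OF \<omega>c that])
  have ww: "?w (?\<sigma> p) \<otimes> \<tau> (?w p) = \<one>" if p: "p \<in> ?S" for p
  proof -
    have "fst (\<omega> \<otimes>\<^bsub>\<Gamma> ?S\<^esub> \<alpha> ?S \<omega>) p = fst \<one>\<^bsub>\<Gamma> ?S\<^esub> p" unfolding \<omega>1 ..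
    then show ?thesis using p by (simp only: wr_mult_simps wr_aut_simps)
  qed
  have wI: "?w p \<in> I" if "p \<in> ?S" "?\<sigma> p = p" for p
    using ww[OF that(1)] wH[OF that(1)] that(2) unfolding twisted_involutions_def by simp
  \<comment> \<open>The block to which a position has to go.\<close>
  define cl where "cl p = (if ?\<sigma> p \<noteq> p then 0 else cls (?w p))" for p
  \<comment> \<open>The smaller element of each transposed pair.\<close>
  define T where "T = {p \<in> ?S. p < ?\<sigma> p}"
  define x where "x = (\<lambda>i\<in>{0..m}. if i = 0 then card T else card {p \<in> ?S. cl p = i})"
  have TS: "T \<subseteq> ?S" and finT: "finite T" unfolding T_def by auto
  have cl_le: "cl p \<le> m" if "p \<in> ?S" for p
    using cls_mover(1)[OF wI[OF that]] unfolding cl_def by auto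
  have cl_0: "cl p = 0 \<longleftrightarrow> ?\<sigma> p \<noteq> p" if "p \<in> ?S" for p
    using cls_mover(1)[OF wI[OF that]] unfolding cl_def by auto
  have \<sigma>T: "?\<sigma> p \<in> T \<longleftrightarrow> p \<in> ?S \<and> ?\<sigma> p < p" for p unfolding T_def using \<sigma>S \<sigma>\<sigma> by auto
  have moved: "{p \<in> ?S. cl p = 0} = T \<union> ?\<sigma> ` T"
  proof (rule Set.set_eqI)
    fix p
    have "p \<in> ?\<sigma> ` T \<longleftrightarrow> ?\<sigma> p \<in> T"
    proof
      assume "p \<in> ?\<sigma> ` T"
      then show "?\<sigma> p \<in> T" using \<sigma>\<sigma> by auto
    next
      assume "?\<sigma> p \<in> T"
      then have "?\<sigma> (?\<sigma> p) \<in> ?\<sigma> ` T" by (rule imageI)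
      then show "p \<in> ?\<sigma> ` T" unfolding \<sigma>\<sigma> .
    qed
    then show "p \<in> {p \<in> ?S. cl p = 0} \<longleftrightarrow> p \<in> T \<union> ?\<sigma> ` T" using cl_0[of p] \<sigma>T[of p] unfolding T_def by auto
  qed
  have card0: "card {p \<in> ?S. cl p = 0} = 2 * card T"
  proof -
    have disj: "T \<inter> ?\<sigma> ` T = {}"
    proof (rule equals0I)
      fix p assume "p \<in> T \<inter> ?\<sigma> ` T"
      then obtain q where "q \<in> T" "p = ?\<sigma> q" "p \<in> T" by blast
      then show False using \<sigma>\<sigma>[of q] unfolding T_def by simp
    qed
    have inj: "inj_on ?\<sigma> T" using wr_carrierD(6)[OF \<omega>c] by (auto intro: inj_onI)
    show ?thesis unfolding moved using card_Un_disjoint[OF finT finite_imageI[OF finT] disj] card_image[OF inj] by simp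
  qed
  have xU: "x \<in> U_set m n"
  proof -
    have "2 * x 0 + (\<Sum>i=1..m. x i) = card {p \<in> ?S. cl p = 0} + (\<Sum>i=1..m. card {p \<in> ?S. cl p = i})"
      unfolding card0 by (simp add: x_def)
    also have "\<dots> = (\<Sum>i\<in>insert 0 {1..m}. card {p \<in> ?S. cl p = i})" by simp
    also have "insert 0 {1..m} = {..m}" by auto
    also have "(\<Sum>i\<le>m. card {p \<in> ?S. cl p = i}) = card (\<Union>i\<in>{..m}. {p \<in> ?S. cl p = i})"
      by (rule card_UN_disjoint[symmetric]) auto
    also have "(\<Union>i\<in>{..m}. {p \<in> ?S. cl p = i}) = ?S" using cl_le by auto
    finally show ?thesis unfolding U_set_def by (auto simp: x_def)
  qed
  interpret A: composition H \<tau> m K lam \<epsilon> n x by (rule composition[OF xU])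
  obtain h where h: "bij_betw h T {0..<card T}" using ex_bij_betw_finite_nat[OF finT] by blast
  have hlt: "h p < card T" if "p \<in> T" for p using bij_betwE[OF h] that by auto
  have hinj: "h p = h q \<longleftrightarrow> p = q" if "p \<in> T" "q \<in> T" for p q using bij_betw_imp_inj_on[OF h] that by (meson inj_on_eq_iff)
  have "\<forall>i\<in>{1..m}. \<exists>f. bij_betw f {p \<in> ?S. cl p = i} {q \<in> ?S. A.bl q = i}"
  proof
    fix i assume i: "i \<in> {1..m}"
    then have "card {q \<in> ?S. A.bl q = i} = card {p \<in> ?S. cl p = i}"
      using A.block_card[of i] A.a_pos[of i] by (simp add: x_def)
    then show "\<exists>f. bij_betw f {p \<in> ?S. cl p = i} {q \<in> ?S. A.bl q = i}" by (intro finite_same_card_bij) auto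
  qed
  from bchoice[OF this] obtain f where f': "\<forall>i\<in>{1..m}. bij_betw (f i) {p \<in> ?S. cl p = i} {q \<in> ?S. A.bl q = i}" by (rule exE)
  note f = bspec[OF f']
  \<comment> \<open>The pairs are numbered by \<open>h\<close>; pair number \<open>b\<close> goes to the positions \<open>2 * b + 1\<close> and \<open>2 * b + 2\<close> that are matched by \<open>omega\<close>.\<close>
  define \<theta> where "\<theta> p = (if p \<in> T then 2 * h p + 1 else if ?\<sigma> p \<in> T then 2 * h (?\<sigma> p) + 2 else if p \<in> ?S then f (cl p) p else p)" for p
  have cases_S: "p \<in> T \<or> ?\<sigma> p \<in> T \<or> (?\<sigma> p = p \<and> cl p \<in> {1..m} \<and> p \<notin> T \<and> ?\<sigma> p \<notin> T)" if p: "p \<in> ?S" for p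
    using cl_0[OF p] cl_le[OF p] \<sigma>T[of p] p unfolding T_def by fastforce
  have notT: "?\<sigma> p \<notin> T" "?\<sigma> (?\<sigma> p) \<in> T" if "p \<in> T" for p using that \<sigma>T[of p] \<sigma>\<sigma> unfolding T_def by auto
  have notT': "p \<notin> T" if "?\<sigma> p \<in> T" for p using notT(1)[of p] that by blast
  have \<theta>1: "\<theta> p = 2 * h p + 1" if "p \<in> T" for p using that by (simp add: \<theta>_def)
  have \<theta>2: "\<theta> p = 2 * h (?\<sigma> p) + 2" if "?\<sigma> p \<in> T" for p using that notT'[OF that] by (simp add: \<theta>_def)
  have \<theta>3: "\<theta> p = f (cl p) p" if "p \<in> ?S" "p \<notin> T" "?\<sigma> p \<notin> T" for p using that by (simp add: \<theta>_def)
  have low: "q \<in> ?S \<and> A.bl q = 0" if q: "1 \<le> q" "q \<le> 2 * card T" for q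
  proof -
    have "x 0 = card T" by (simp add: x_def)
    then have "A.a 0 = 2 * card T" unfolding A.a_0 by simp
    moreover have "2 * card T \<le> n" using A.x0_le by (simp add: x_def)
    ultimately show ?thesis using A.first_block[of q] q by simp
  qed
  have \<theta>S: "\<theta> p \<in> ?S \<and> A.bl (\<theta> p) = cl p" if p: "p \<in> ?S" for p
    using cases_S[OF p]
  proof (elim disjE conjE)
    assume t: "p \<in> T"
    then have "cl p = 0" using moved by blast
    then show ?thesis using low[of "\<theta> p"] hlt[OF t] \<theta>1[OF t] by simp
  next
    assume t: "?\<sigma> p \<in> T"
    then have "cl p = 0" using cl_0[OF p] \<sigma>T[of p] by simp
    then show ?thesis using low[of "\<theta> p"] hlt[OF t] \<theta>2[OF t] by simp
  next
    assume c: "?\<sigma> p = p" "cl p \<in> {1..m}" "p \<notin> T" "?\<sigma> p \<notin> T"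
    have "f (cl p) p \<in> {q \<in> ?S. A.bl q = cl p}" using bij_betwE[OF f[OF c(2)]] p by blast
    then show ?thesis unfolding \<theta>3[OF p c(3,4)] by blast
  qed
  have \<theta>inj: "inj_on \<theta> ?S"
  proof (rule inj_onI)
    fix p q assume p: "p \<in> ?S" and q: "q \<in> ?S" and eq: "\<theta> p = \<theta> q"
    then have c: "cl p = cl q" using \<theta>S by metis
    show "p = q"
    proof (cases "cl p = 0")
      case True
      have par: "r \<in> T \<and> \<theta> r = 2 * h r + 1 \<or> ?\<sigma> r \<in> T \<and> \<theta> r = 2 * h (?\<sigma> r) + 2" if "r \<in> ?S" "cl r = 0" for r
        using cases_S[OF that(1)] that(2) \<theta>1 \<theta>2 by fastforce
      have no: "2 * a + 1 \<noteq> 2 * b + 2" for a b :: nat by presburger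
      have "p \<in> T \<and> q \<in> T \<and> h p = h q \<or> ?\<sigma> p \<in> T \<and> ?\<sigma> q \<in> T \<and> h (?\<sigma> p) = h (?\<sigma> q)"
        using par[OF p True] par[OF q] c True eq no no[symmetric] by auto
      then have "p = q \<or> ?\<sigma> p = ?\<sigma> q" using hinj by blast
      then show ?thesis using wr_carrierD(6)[OF \<omega>c] by blast
    next
      case False
      have pt: "p \<notin> T" "?\<sigma> p \<notin> T" using False moved p cl_0[OF p] \<sigma>T[of p] by auto
      have qt: "q \<notin> T" "?\<sigma> q \<notin> T" using False c moved q cl_0[OF q] \<sigma>T[of q] by auto
      have i: "cl p \<in> {1..m}" using False cl_le[OF p] by simp
      have "f (cl p) p = f (cl p) q" using eq \<theta>3[OF p pt] \<theta>3[OF q qt] c by simp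
      moreover have "p \<in> {r \<in> ?S. cl r = cl p}" "q \<in> {r \<in> ?S. cl r = cl p}" using p q c by auto
      ultimately show ?thesis using bij_betw_imp_inj_on[OF f[OF i]] by (rule inj_onD[rotated])
    qed
  qed
  have \<theta>perm: "\<theta> permutes ?S"
  proof (rule bij_imp_permutes)
    have "\<theta> ` ?S = ?S" by (rule endo_inj_surj[OF _ _ \<theta>inj]) (use \<theta>S in auto)
    then show "bij_betw \<theta> ?S ?S" using \<theta>inj by (simp add: bij_betw_def)
    show "\<theta> p = p" if "p \<notin> ?S" for p using that TS \<sigma>S[of p] by (auto simp: \<theta>_def)
  qed
  have \<theta>om: "\<theta> (?\<sigma> p) = A.om (\<theta> p)" for p
  proof (cases "p \<in> ?S")
    case p: True
    have om12: "A.om (2 * h r + 1) = 2 * h r + 2" "A.om (2 * h r + 2) = 2 * h r + 1" if "r \<in> T" for r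
    proof -
      have "x 0 = card T" by (simp add: x_def)
      then show "A.om (2 * h r + 1) = 2 * h r + 2" "A.om (2 * h r + 2) = 2 * h r + 1"
        using hlt[OF that] by (auto simp: omega_apply)
    qed
    show ?thesis using cases_S[OF p]
    proof (elim disjE conjE)
      assume t: "p \<in> T"
      show ?thesis unfolding \<theta>1[OF t] \<theta>2[OF notT(2)[OF t]] om12[OF t] \<sigma>\<sigma> ..
    next
      assume t: "?\<sigma> p \<in> T"
      show ?thesis unfolding \<theta>1[OF t] \<theta>2[OF t] om12[OF t] ..
    next
      assume c: "?\<sigma> p = p" "cl p \<in> {1..m}"
      have "A.om (\<theta> p) = \<theta> p" using A.om_moves[of "\<theta> p"] \<theta>S[OF p] c by simp
      then show ?thesis using c by simp
    qed
  next
    case False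
    then have "?\<sigma> p = p" "\<theta> p = p" "A.om p = p"
      using wr_carrierD(4)[OF \<omega>c] permutes_not_in[OF \<theta>perm] permutes_not_in[OF A.om_permutes] by auto
    then show ?thesis by simp
  qed
  \<comment> \<open>The two entries of a pair are twisted inverses of each other, so a correction at one end makes both trivial.\<close>
  define k where "k p = (if p \<in> T then \<one> else if ?\<sigma> p \<in> T then inv (?w (?\<sigma> p)) else mover (?w p))" for p
  have kH: "k p \<in> carrier H" if p: "p \<in> ?S" for p
    using cases_S[OF p] wH[of "?\<sigma> p"] \<sigma>S[of p] p cls_mover(2)[OF wI[OF p]] by (auto simp: k_def)
  have key: "k (?\<sigma> p) \<otimes> ?w p = A.e (\<theta> p) \<otimes> \<tau> (k p)" if p: "p \<in> ?S" for p
    using cases_S[OF p]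
  proof (elim disjE conjE)
    assume t: "p \<in> T"
    then have "A.bl (\<theta> p) = 0" using \<theta>S[OF p] moved by auto
    then show ?thesis using t notT[OF t] \<sigma>\<sigma>[of p] wH[OF p] by (simp add: k_def \<tau>_one)
  next
    assume t: "?\<sigma> p \<in> T"
    have sp: "?\<sigma> p \<in> ?S" using t TS by blast
    have "A.bl (\<theta> p) = 0" using \<theta>S[OF p] cl_0[OF p] \<sigma>T[of p] t by simp
    moreover have "?w p = inv (\<tau> (?w (?\<sigma> p)))"
      using ww[OF sp] \<sigma>\<sigma>[of p] wH[OF p] \<tau>_closed[OF wH[OF sp]] inv_equality by simp
    ultimately show ?thesis using t notT'[OF t] \<tau>_inv[OF wH[OF sp]] \<tau>_closed[OF wH[OF sp]] by (simp add: k_def)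
  next
    assume c: "?\<sigma> p = p" "cl p \<in> {1..m}" "p \<notin> T" "?\<sigma> p \<notin> T"
    note w = wI[OF p c(1)] and mv = cls_mover[OF wI[OF p c(1)]]
    have "A.bl (\<theta> p) = cls (?w p)" using \<theta>S[OF p] c(1) unfolding cl_def by simp
    moreover have "mover (?w p) \<otimes> ?w p = \<epsilon> (cls (?w p)) \<otimes> \<tau> (mover (?w p))"
      using mv(3) act_eq_iff[OF mv(2) I_carrier[OF w] I_carrier[OF \<epsilon>_I[OF mv(1)]]] by blast
    ultimately show ?thesis using c mv(1) by (simp add: k_def)
  qed
  let ?y = "(restrict k ?S, \<theta>)"
  have y: "?y \<in> carrier (\<Gamma> ?S)" unfolding wr_carrier_iff using kH \<theta>perm by auto
  have "?y \<otimes>\<^bsub>\<Gamma> ?S\<^esub> \<omega> = A.eps \<otimes>\<^bsub>\<Gamma> ?S\<^esub> \<alpha> ?S ?y"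
  proof (rule wr_eqI[of _ H ?S])
    fix p assume p: "p \<in> ?S"
    show "snd (?y \<otimes>\<^bsub>\<Gamma> ?S\<^esub> \<omega>) p = snd (A.eps \<otimes>\<^bsub>\<Gamma> ?S\<^esub> \<alpha> ?S ?y) p"
      by (simp only: wr_mult_simps(1) wr_aut_simps(1) A.eps_simps(1) snd_conv o_apply \<theta>om)
    have \<theta>p: "\<theta> p \<in> ?S" and \<sigma>p: "?\<sigma> p \<in> ?S" using \<theta>S[OF p] \<sigma>S[of p] p by auto
    show "fst (?y \<otimes>\<^bsub>\<Gamma> ?S\<^esub> \<omega>) p = fst (A.eps \<otimes>\<^bsub>\<Gamma> ?S\<^esub> \<alpha> ?S ?y) p"
      unfolding wr_mult_simps(2)[OF p] wr_aut_simps(1) wr_aut_simps(2)[OF p] snd_conv fst_conv A.eps_simps(2)[OF \<theta>p]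
        restrict_apply'[OF p] restrict_apply'[OF \<sigma>p] by (rule key[OF p])
  qed (use y \<omega>c A.eps_carrier \<alpha>_closed in auto)
  then show ?thesis using xU y by blast
qed

lemma wreath_orbit_representatives:
  shows "inj_on (eps_x H n \<epsilon>) (U_set m n)"
    and "orbit_representatives (wreath H n) (wreath_aut \<tau> n) (eps_x H n \<epsilon> ` U_set m n)"
proof -
  interpret T: twisted_group "wreath H n" "wreath_aut \<tau> n" by (rule twisted_group_wreath)
  have c: "eps_x H n \<epsilon> x \<in> carrier (\<Gamma> {1..n})" if "x \<in> U_set m n" for x
    by (rule composition.eps_carrier[OF composition[OF that]])
  have 1: "eps_x H n \<epsilon> x \<in> twisted_involutions (wreath H n) (wreath_aut \<tau> n)" if "x \<in> U_set m n" for x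
    unfolding twisted_involutions_wreath by (rule composition.eps_I[OF composition[OF that]])
  have 2: "\<exists>x\<in>U_set m n. \<exists>y\<in>carrier (wreath H n). y \<otimes>\<^bsub>wreath H n\<^esub> w = eps_x H n \<epsilon> x \<otimes>\<^bsub>wreath H n\<^esub> wreath_aut \<tau> n y"
    if w: "w \<in> twisted_involutions (wreath H n) (wreath_aut \<tau> n)" for w
  proof -
    have w': "w \<in> twisted_involutions (\<Gamma> {1..n}) (\<alpha> {1..n})" using w unfolding twisted_involutions_wreath .
    then have wc: "w \<in> carrier (\<Gamma> {1..n})" unfolding twisted_involutions_def by blast
    obtain x y where "x \<in> U_set m n" "y \<in> carrier (\<Gamma> {1..n})"
      "y \<otimes>\<^bsub>\<Gamma> {1..n}\<^esub> w = eps_x H n \<epsilon> x \<otimes>\<^bsub>\<Gamma> {1..n}\<^esub> \<alpha> {1..n} y"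
      using eps_x_exists[OF w'] by blast
    then show ?thesis unfolding carrier_wreath using commutation_wreath[OF _ wc c] by blast
  qed
  have 3: "x = x'" if xx: "x \<in> U_set m n" "x' \<in> U_set m n" and y: "y \<in> carrier (wreath H n)"
    and eq: "y \<otimes>\<^bsub>wreath H n\<^esub> eps_x H n \<epsilon> x = eps_x H n \<epsilon> x' \<otimes>\<^bsub>wreath H n\<^esub> wreath_aut \<tau> n y" for x x' y
  proof -
    have y': "y \<in> carrier (\<Gamma> {1..n})" using y unfolding carrier_wreath .
    show ?thesis by (rule eps_x_unique[OF xx y' eq[unfolded commutation_wreath[OF y' c[OF xx(1)] c[OF xx(2)]]]])
  qed
  show "inj_on (eps_x H n \<epsilon>) (U_set m n)" by (rule T.orbit_representativesI(1)[OF 1 2 3])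
  show "orbit_representatives (wreath H n) (wreath_aut \<tau> n) (eps_x H n \<epsilon> ` U_set m n)"
    by (rule T.orbit_representativesI(2)[OF 1 2 3])
qed

section \<open>The model of the wreath product\<close>

text \<open>The orbit sum for the wreath product, followed by the count of \<open>sum_weight_fixing\<close>.\<close>
lemma wreath_induced_sum:
  assumes g: "g \<in> carrier (wreath H n)"
  shows "(\<Sum>x\<in>U_set m n. induced_character (wreath H n) (G_x H \<tau> n m K x) (phi_x H \<tau> n m K lam x) g)
    = of_nat (card (twisted_square_roots (wreath H n) (wreath_aut \<tau> n) g))"
proof -
  interpret T: twisted_group "wreath H n" "wreath_aut \<tau> n" by (rule twisted_group_wreath)
  have g': "g \<in> carrier (\<Gamma> {1..n})" using g unfolding carrier_wreath .
  have Ic: "w \<in> carrier (\<Gamma> {1..n})" if "w \<in> T.I" for w using T.I_carrier[OF that] unfolding carrier_wreath .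
  have fix_iff: "w \<in> fixing {1..n} h \<longleftrightarrow> w \<in> T.I \<and> h \<otimes>\<^bsub>wreath H n\<^esub> w = w \<otimes>\<^bsub>wreath H n\<^esub> wreath_aut \<tau> n h"
    if h: "h \<in> carrier (\<Gamma> {1..n})" for w h
  proof (cases "w \<in> T.I")
    case True
    show ?thesis using True unfolding commutation_wreath[OF h Ic[OF True] Ic[OF True]] fixing_def twisted_involutions_wreath by blast
  next
    case False
    then show ?thesis unfolding fixing_def twisted_involutions_wreath by blast
  qed
  have cen: "G_x H \<tau> n m K x = twisted_centralizer (wreath H n) (wreath_aut \<tau> n) (eps_x H n \<epsilon> x)" if "x \<in> U_set m n" for x
    using composition.G_x_eq[OF composition[OF that]] composition.centralizer_eps[OF composition[OF that]] by simp
  have "(\<Sum>x\<in>U_set m n. induced_character (wreath H n) (G_x H \<tau> n m K x) (phi_x H \<tau> n m K lam x) g)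
    = (\<Sum>x\<in>U_set m n. induced_character (wreath H n) (twisted_centralizer (wreath H n) (wreath_aut \<tau> n) (eps_x H n \<epsilon> x)) (phi_x H \<tau> n m K lam x) g)"
    by (rule sum.cong[OF refl]) (simp only: cen)
  also have "\<dots> = (\<Sum>w | w \<in> T.I \<and> g \<otimes>\<^bsub>wreath H n\<^esub> w = w \<otimes>\<^bsub>wreath H n\<^esub> wreath_aut \<tau> n g. weight {1..n} g w)"
  proof (rule T.sum_induced_eq_sum_fixed[OF finite_U_set wreath_orbit_representatives, where \<Phi> = "\<lambda>w g. weight {1..n} g w"])
    fix w y h assume w: "w \<in> T.I" and y: "y \<in> carrier (wreath H n)" and h: "h \<in> carrier (wreath H n)"
      and hw: "h \<otimes>\<^bsub>wreath H n\<^esub> w = w \<otimes>\<^bsub>wreath H n\<^esub> wreath_aut \<tau> n h"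
    have y': "y \<in> carrier (\<Gamma> {1..n})" and h': "h \<in> carrier (\<Gamma> {1..n})" using y h unfolding carrier_wreath by auto
    have "w \<in> fixing {1..n} h" using fix_iff[OF h'] w hw by blast
    then show "weight {1..n} (y \<otimes>\<^bsub>wreath H n\<^esub> h \<otimes>\<^bsub>wreath H n\<^esub> inv\<^bsub>wreath H n\<^esub> y) (T.act y w) = weight {1..n} h w"
      unfolding conj_wreath[OF y' h'] twisted_conj_wreath[OF y' Ic[OF w]] by (intro weight_equivariant h' y') simp
  next
    fix x h assume x: "x \<in> U_set m n" and h: "h \<in> twisted_centralizer (wreath H n) (wreath_aut \<tau> n) (eps_x H n \<epsilon> x)"
    show "phi_x H \<tau> n m K lam x h = weight {1..n} h (eps_x H n \<epsilon> x)"
      by (rule composition.phi_x_eq[OF composition[OF x]]) (use h composition.centralizer_eps[OF composition[OF x]] in simp)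
  qed (rule g)
  also have "\<dots> = (\<Sum>w\<in>fixing {1..n} g. weight {1..n} g w)" by (rule sum.cong) (auto simp: fix_iff[OF g'])
  also have "\<dots> = of_nat (card (roots {1..n} g))" by (rule sum_weight_fixing[OF _ g']) simp
  finally show ?thesis unfolding roots_def twisted_square_roots_wreath .
qed

theorem generalized_involution_model_wreath:
  shows "generalized_involution_model (wreath H n) (wreath_aut \<tau> n)
      ((\<lambda>x. (G_x H \<tau> n m K x, phi_x H \<tau> n m K lam x)) ` U_set m n)"
    and "inj_on (\<lambda>x. (G_x H \<tau> n m K x, phi_x H \<tau> n m K lam x)) (U_set m n)"
    and "\<And>x. x \<in> U_set m n \<Longrightarrow> G_x H \<tau> n m K x = twisted_centralizer (wreath H n) (wreath_aut \<tau> n) (eps_x H n \<epsilon> x)"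
proof -
  let ?G = "wreath H n" and ?U = "U_set m n" and ?M = "\<lambda>x. (G_x H \<tau> n m K x, phi_x H \<tau> n m K lam x)"
  interpret T: twisted_group ?G "wreath_aut \<tau> n" by (rule twisted_group_wreath)
  have sub: "subgroup (G_x H \<tau> n m K x) ?G" and lin: "linear_character (?G\<lparr>carrier := G_x H \<tau> n m K x\<rparr>) (phi_x H \<tau> n m K lam x)"
    and cen: "G_x H \<tau> n m K x = twisted_centralizer ?G (wreath_aut \<tau> n) (eps_x H n \<epsilon> x)" if "x \<in> ?U" for x
  proof -
    interpret composition H \<tau> m K lam \<epsilon> n x by (rule composition[OF that])
    show "subgroup (G_x H \<tau> n m K x) ?G" "linear_character (?G\<lparr>carrier := G_x H \<tau> n m K x\<rparr>) (phi_x H \<tau> n m K lam x)"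
      "G_x H \<tau> n m K x = twisted_centralizer ?G (wreath_aut \<tau> n) (eps_x H n \<epsilon> x)"
      unfolding G_x_eq by (rule stab_subgroup phi_x_linear centralizer_eps[symmetric])+
  qed
  then show "\<And>x. x \<in> ?U \<Longrightarrow> G_x H \<tau> n m K x = twisted_centralizer ?G (wreath_aut \<tau> n) (eps_x H n \<epsilon> x)" by blast
  have real: "\<exists>t\<in>carrier ?G. t \<otimes>\<^bsub>?G\<^esub> g = inv\<^bsub>?G\<^esub> (wreath_aut \<tau> n g) \<otimes>\<^bsub>?G\<^esub> t" if "g \<in> carrier ?G" for g
  proof -
    have g: "g \<in> carrier (\<Gamma> {1..n})" using that unfolding carrier_wreath .
    note a = \<alpha>_closed[OF g]
    obtain t where t: "t \<in> carrier (\<Gamma> {1..n})" "t \<otimes>\<^bsub>\<Gamma> {1..n}\<^esub> g = inv\<^bsub>\<Gamma> {1..n}\<^esub> (\<alpha> {1..n} g) \<otimes>\<^bsub>\<Gamma> {1..n}\<^esub> t"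
      using twisted_inverse_conjugate[OF finite_atLeastAtMost g model_counts_square_roots(2)] by blast
    have "t \<otimes>\<^bsub>?G\<^esub> g = inv\<^bsub>?G\<^esub> (wreath_aut \<tau> n g) \<otimes>\<^bsub>?G\<^esub> t"
      unfolding wreath_aut_eq inv_wreath[OF is_group a] mult_wreath[OF t(1) g] mult_wreath[OF W.inv_closed[OF a] t(1)] by (rule t(2))
    then show ?thesis using t(1) unfolding carrier_wreath by blast
  qed
  note main = model_if_induced_sum_counts_square_roots[OF T.is_group T.finite_carrier T.involutive real finite_U_set sub lin wreath_induced_sum]
  have sum: "(\<Sum>x\<in>?U. induced_character ?G (G_x H \<tau> n m K x) (phi_x H \<tau> n m K lam x) g) = (\<Sum>\<chi>\<in>irreducible_characters ?G. \<chi> g)"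
    if "g \<in> carrier ?G" for g
    by (rule main(1)) (rule that | assumption)+
  show inj: "inj_on ?M ?U" by (rule main(2)) assumption+
  have "model ?G (?M ` ?U)"
    unfolding model_def
  proof (intro conjI ballI)
    show "finite (?M ` ?U)" by (rule finite_imageI[OF finite_U_set])
    show "case p of (K, lam) \<Rightarrow> subgroup K ?G \<and> linear_character (?G\<lparr>carrier := K\<rparr>) lam" if "p \<in> ?M ` ?U" for p
      using that sub lin by auto
    show "(\<Sum>(K, lam)\<in>?M ` ?U. induced_character ?G K lam g) = (\<Sum>\<chi>\<in>irreducible_characters ?G. \<chi> g)" if "g \<in> carrier ?G" for g
      unfolding sum.reindex[OF inj] o_def case_prod_conv by (rule sum[OF that])
  qed
  moreover have "\<exists>\<iota>. inj_on \<iota> (?M ` ?U) \<and> (\<forall>(K, lam)\<in>?M ` ?U. K = twisted_centralizer ?G (wreath_aut \<tau> n) (\<iota> (K, lam))) \<and>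
      orbit_representatives ?G (wreath_aut \<tau> n) (\<iota> ` ?M ` ?U)"
  proof (intro exI conjI)
    let ?\<iota> = "eps_x H n \<epsilon> \<circ> the_inv_into ?U ?M"
    have \<iota>: "?\<iota> (?M x) = eps_x H n \<epsilon> x" if "x \<in> ?U" for x using the_inv_into_f_f[OF inj that] by simp
    have im: "?\<iota> ` ?M ` ?U = eps_x H n \<epsilon> ` ?U" unfolding image_image by (rule image_cong[OF refl]) (rule \<iota>)
    show "orbit_representatives ?G (wreath_aut \<tau> n) (?\<iota> ` ?M ` ?U)" unfolding im by (rule wreath_orbit_representatives(2))
    show "inj_on ?\<iota> (?M ` ?U)"
    proof (rule inj_onI)
      fix p q assume "p \<in> ?M ` ?U" "q \<in> ?M ` ?U" and eq: "?\<iota> p = ?\<iota> q"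
      then obtain x y where x: "x \<in> ?U" "p = ?M x" and y: "y \<in> ?U" "q = ?M y" by blast
      have "eps_x H n \<epsilon> x = eps_x H n \<epsilon> y" using eq unfolding x(2) y(2) \<iota>[OF x(1)] \<iota>[OF y(1)] .
      then have "x = y" using wreath_orbit_representatives(1)[of n] x(1) y(1) by (meson inj_onD)
      then show "p = q" using x y by simp
    qed
    show "\<forall>(K, lam)\<in>?M ` ?U. K = twisted_centralizer ?G (wreath_aut \<tau> n) (?\<iota> (K, lam))"
    proof (rule ballI)
      fix p assume "p \<in> ?M ` ?U"
      then obtain x where x: "x \<in> ?U" "p = ?M x" by blast
      show "case p of (K, lam) \<Rightarrow> K = twisted_centralizer ?G (wreath_aut \<tau> n) (?\<iota> (K, lam))"
        unfolding x(2) case_prod_conv \<iota>[OF x(1)] by (rule cen[OF x(1)])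
    qed
  qed
  ultimately show "generalized_involution_model ?G (wreath_aut \<tau> n) (?M ` ?U)"
    unfolding generalized_involution_model_def using T.involutive by blast
qed

end

lemma involution_modelI:
  assumes H: "group H" "finite (carrier H)" "involutive_automorphism H \<tau>"
    and inj: "inj_on (\<lambda>i. (K i, lam i)) {1..m}" and M: "model H ((\<lambda>i. (K i, lam i)) ` {1..m})"
    and \<epsilon>: "inj_on \<epsilon> {1..m}" "orbit_representatives H \<tau> (\<epsilon> ` {1..m})"
    and K: "\<And>i. i \<in> {1..m} \<Longrightarrow> K i = twisted_centralizer H \<tau> (\<epsilon> i)"
  shows "involution_model H \<tau> m K lam \<epsilon>"
proof -
  have lin: "linear_character (H\<lparr>carrier := K i\<rparr>) (lam i)" if "i \<in> {1..m}" for i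
    using M that unfolding model_def by blast
  have "(\<Sum>i\<in>{1..m}. induced_character H (K i) (lam i) g) = (\<Sum>\<chi>\<in>irreducible_characters H. \<chi> g)" if "g \<in> carrier H" for g
  proof -
    have "(\<Sum>(K, lam)\<in>(\<lambda>i. (K i, lam i)) ` {1..m}. induced_character H K lam g) = (\<Sum>i\<in>{1..m}. induced_character H (K i) (lam i) g)"
      unfolding sum.reindex[OF inj] o_def case_prod_conv ..
    then show ?thesis using M that unfolding model_def by simp
  qed
  then show ?thesis
    using H K lin \<epsilon> by (intro involution_model.intro twisted_group.intro twisted_group_axioms.intro involution_model_axioms.intro)
qed

theorem theorem4p3:
  fixes H :: "('a, 'b) monoid_scheme"
  assumes "group H" and "finite (carrier H)"
  shows
    "(\<forall>(\<tau> :: 'a \<Rightarrow> 'a) (n :: nat) (m :: nat) (K :: nat \<Rightarrow> 'a set)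
        (lam :: nat \<Rightarrow> 'a \<Rightarrow> complex) (\<epsilon> :: nat \<Rightarrow> 'a).
        involutive_automorphism H \<tau> \<longrightarrow>
        n \<ge> 1 \<longrightarrow>
        inj_on (\<lambda>i. (K i, lam i)) {1..m} \<longrightarrow>
        generalized_involution_model H \<tau> ((\<lambda>i. (K i, lam i)) ` {1..m}) \<longrightarrow>
        inj_on \<epsilon> {1..m} \<longrightarrow>
        orbit_representatives H \<tau> (\<epsilon> ` {1..m}) \<longrightarrow>
        (\<forall>i\<in>{1..m}. K i = twisted_centralizer H \<tau> (\<epsilon> i)) \<longrightarrow>
          generalized_involution_model (wreath H n) (wreath_aut \<tau> n)
            ((\<lambda>x. (G_x H \<tau> n m K x, phi_x H \<tau> n m K lam x)) ` U_set m n) \<and>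
          inj_on (\<lambda>x. (G_x H \<tau> n m K x, phi_x H \<tau> n m K lam x)) (U_set m n) \<and>
          inj_on (eps_x H n \<epsilon>) (U_set m n) \<and>
          orbit_representatives (wreath H n) (wreath_aut \<tau> n) (eps_x H n \<epsilon> ` U_set m n) \<and>
          (\<forall>x\<in>U_set m n.
             G_x H \<tau> n m K x = twisted_centralizer (wreath H n) (wreath_aut \<tau> n) (eps_x H n \<epsilon> x)))
     \<and> (has_generalized_involution_model H \<longrightarrow>
          (\<forall>n\<ge>1. has_generalized_involution_model (wreath H n)))"
proof (intro conjI allI impI)
  fix \<tau> :: "'a \<Rightarrow> 'a" and n m :: nat and K :: "nat \<Rightarrow> 'a set" and lam :: "nat \<Rightarrow> 'a \<Rightarrow> complex" and \<epsilon> :: "nat \<Rightarrow> 'a"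
  assume \<tau>: "involutive_automorphism H \<tau>" and inj: "inj_on (\<lambda>i. (K i, lam i)) {1..m}"
    and M: "generalized_involution_model H \<tau> ((\<lambda>i. (K i, lam i)) ` {1..m})"
    and \<epsilon>: "inj_on \<epsilon> {1..m}" "orbit_representatives H \<tau> (\<epsilon> ` {1..m})"
    and K: "\<forall>i\<in>{1..m}. K i = twisted_centralizer H \<tau> (\<epsilon> i)"
  have "model H ((\<lambda>i. (K i, lam i)) ` {1..m})" using M unfolding generalized_involution_model_def by blast
  then interpret involution_model H \<tau> m K lam \<epsilon>
    by (rule involution_modelI[OF assms \<tau> inj _ \<epsilon> bspec[OF K]])
  show "generalized_involution_model (wreath H n) (wreath_aut \<tau> n)
      ((\<lambda>x. (G_x H \<tau> n m K x, phi_x H \<tau> n m K lam x)) ` U_set m n)"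
    by (rule generalized_involution_model_wreath(1))
  show "inj_on (\<lambda>x. (G_x H \<tau> n m K x, phi_x H \<tau> n m K lam x)) (U_set m n)"
    by (rule generalized_involution_model_wreath(2))
  show "inj_on (eps_x H n \<epsilon>) (U_set m n)" by (rule wreath_orbit_representatives(1))
  show "orbit_representatives (wreath H n) (wreath_aut \<tau> n) (eps_x H n \<epsilon> ` U_set m n)"
    by (rule wreath_orbit_representatives(2))
  show "\<forall>x\<in>U_set m n. G_x H \<tau> n m K x = twisted_centralizer (wreath H n) (wreath_aut \<tau> n) (eps_x H n \<epsilon> x)"
    using generalized_involution_model_wreath(3) by blast
next
  fix n :: nat
  assume "has_generalized_involution_model H"
  then obtain \<tau> M where gim: "generalized_involution_model H \<tau> M"
    unfolding has_generalized_involution_model_def by (elim exE)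
  from gim have \<tau>: "involutive_automorphism H \<tau>" unfolding generalized_involution_model_def by (elim conjE)
  from gim have M: "model H M" unfolding generalized_involution_model_def by (elim conjE)
  from gim have "\<exists>\<iota>. inj_on \<iota> M \<and> (\<forall>(K, lam)\<in>M. K = twisted_centralizer H \<tau> (\<iota> (K, lam))) \<and> orbit_representatives H \<tau> (\<iota> ` M)"
    unfolding generalized_involution_model_def by (elim conjE)
  then obtain \<iota> where \<iota>: "inj_on \<iota> M" "\<forall>(K, lam)\<in>M. K = twisted_centralizer H \<tau> (\<iota> (K, lam))" "orbit_representatives H \<tau> (\<iota> ` M)"
    by (elim exE conjE)
  have fin: "finite M" using M unfolding model_def by blast
  obtain e where e: "bij_betw e {1..card M} M" using ex_bij_betw_nat_finite_1[OF fin] by blast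
  have einj: "inj_on e {1..card M}" and eM: "e ` {1..card M} = M" using e by (auto simp: bij_betw_def)
  have "involution_model H \<tau> (card M) (\<lambda>i. fst (e i)) (\<lambda>i. snd (e i)) (\<lambda>i. \<iota> (e i))"
  proof (rule involution_modelI[OF assms \<tau>])
    show "inj_on (\<lambda>i. (fst (e i), snd (e i))) {1..card M}" "model H ((\<lambda>i. (fst (e i), snd (e i))) ` {1..card M})"
      using einj M eM by (simp_all only: prod.collapse)
    have im: "\<iota> ` M = (\<lambda>i. \<iota> (e i)) ` {1..card M}" using image_image[of \<iota> e "{1..card M}"] unfolding eM .
    show "orbit_representatives H \<tau> ((\<lambda>i. \<iota> (e i)) ` {1..card M})" using \<iota>(3) unfolding im .
    show "inj_on (\<lambda>i. \<iota> (e i)) {1..card M}" using comp_inj_on[OF einj] \<iota>(1) eM by (simp add: o_def)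
    show "fst (e i) = twisted_centralizer H \<tau> (\<iota> (e i))" if "i \<in> {1..card M}" for i
    proof -
      have "e i \<in> M" using imageI[OF that, of e] unfolding eM .
      then have "case e i of (K, lam) \<Rightarrow> K = twisted_centralizer H \<tau> (\<iota> (K, lam))" by (rule bspec[OF \<iota>(2)])
      then show ?thesis unfolding case_prod_unfold prod.collapse .
    qed
  qed
  then show "has_generalized_involution_model (wreath H n)"
    using involution_model.generalized_involution_model_wreath(1) unfolding has_generalized_involution_model_def by blast
qed

end
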